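(* Let $d\ge3$ and assume: (k) $\beta\in C^2(\mathbb{R})$, $\beta(0)=0$ and $\beta'(r)\ge a|r|^{\alpha-1}$ for all $r\in\mathbb{R}$, where $\alpha\ge1$ and $a>0$; (kk) $D\in L^\infty(\mathbb{R}^d;\mathbb{R}^d)$, $\mathrm{div}\,D\in L^2(\mathbb{R}^d)+L^\infty(\mathbb{R}^d)$, $\mathrm{div}\,D\ge0$ a.e.; (kkk) $b\in C_b(\mathbb{R})\cap C^1(\mathbb{R})$, $b\ge0$. For $u_0\in L^1$ let $u$ be the generalized solution (constructed in the context) to $u_t-\Delta(\beta(u))+\mathrm{div}(Db(u)u)=0$ on $[0,\infty)\times\mathbb{R}^d$ with $u(0)=u_0$. Then $u(t)\in L^\infty$ for all $t>0$, and there is a constant $C$ independent of $u_0$ (and $t$) such that $$|u(t)|_\infty\le C\,t^{-\frac{d}{2+(\alpha-1)d}}\,|u_0|_1^{\frac{2}{2+d(\alpha-1)}},\qquad\forall t\in(0,\infty),\ u_0\in L^1 .$$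
   Context: $L^p=L^p(\mathbb{R}^d)$ with norm $|\cdot|_p$; $H^1=W^{1,2}(\mathbb{R}^d)$; $C_b$ = continuous bounded functions. Let $A_0y=-\Delta\beta(y)+\mathrm{div}(Db(y)y)$ (in $\mathcal{D}'(\mathbb{R}^d)$) with $D(A_0)=\{y\in L^1:\ \beta(y)\in L^1_{\rm loc},\ A_0y\in L^1\}$. Approximations. For $\varepsilon\in(0,1)$ put $\beta_\varepsilon(r)=\beta((I+\varepsilon\beta)^{-1}r)$, $\widetilde\beta_\varepsilon(r)=\beta_\varepsilon(r)+\varepsilon r$; $D_\varepsilon=D$ if $|D|\in L^2$ and $\mathrm{div}\,D\in L^2+L^\infty$, and otherwise $D_\varepsilon=\eta_\varepsilon D$ with $\eta_\varepsilon\in C_0^1(\mathbb{R}^d)$, $0\le\eta_\varepsilon\le1$, $|\nabla\eta_\varepsilon|\le1$, $\eta_\varepsilon(x)=1$ for $|x|\le1/\varepsilon$; $b_\varepsilon=b$ if $b$ is constant and otherwise $b_\varepsilon(r)=\frac{(b*\rho_\varepsilon)(r)}{1+\varepsilon|r|}$ with $\rho_\varepsilon(r)=\frac1\varepsilon\rho(r/\varepsilon)$ a standard mollifier on $\mathbb{R}$. For $f\in L^1\cap L^2$ and $0<\lambda<\lambda_\varepsilon$ ($\lambda_\varepsilon>0$ small), $u_\varepsilon(\lambda,f)$ is the unique $u\in L^2$ with $\widetilde\beta_\varepsilon(u)\in H^1$ solving $u-\lambda\Delta\widetilde\beta_\varepsilon(u)+\lambda\varepsilon\widetilde\beta_\varepsilon(u)+\lambda\,\mathrm{div}(D_\varepsilon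 b_\varepsilon(u)u)=f$. The map $f\mapsto u_\varepsilon(\lambda,f)$ is an $L^1$-contraction; it is extended to all $f\in L^1$ by continuity and to all $\lambda>0$ by the resolvent identity $u_\varepsilon(\lambda_2,f)=u_\varepsilon\big(\lambda_1,\frac{\lambda_1}{\lambda_2}f+(1-\frac{\lambda_1}{\lambda_2})u_\varepsilon(\lambda_2,f)\big)$. The operators $J_\lambda$ and $A$. For $f\in L^1\cap L^\infty$ and $\lambda>0$, $J_\lambda f$ is the limit of $u_\varepsilon(\lambda,f)$ weak-star in $L^\infty$ along a fixed sequence $\varepsilon\to0$ (chosen independently of $f,\lambda$); $J_\lambda$ is a contraction for $|\cdot|_1$ and is extended by continuity to $L^1$. One has $J_\lambda f\in D(A_0)$, $J_\lambda f+\lambda A_0J_\lambda f=f$, and the range of $J_\lambda$ is independent of $\lambda$. Set $D(A)=J_\lambda(L^1)$, $Au=A_0u$ for $u\in D(A)$, so that $J_\lambda=(I+\lambda A)^{-1}$; $A$ is $m$-accretive and densely defined in $L^1$. The generalized solution with initial datum $u_0\in L^1$ is the function $u\in C([0,\infty);L^1)$ given by $u(t)=S(t)u_0=\lim_{n\to\infty}(I+\frac tnA)^{-n}u_0$ in $L^1$, uniformly for $t$ in compact intervals; equivalently it is the locally uniform $L^1$-limit as $h\to0$ of the step functions of the implicit scheme $u_h^{i+1}+hAu_h^{i+1}=u_h^i$, $u_h^0=u_0$. *)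

theory Defs
  imports "HOL-Probability.Essential_Supremum"
begin

text \<open>
  Elements of $L^p(\mathbb{R}^d)$ are represented by Borel functions, identified almost everywhere
  with respect to \<^const>\<open>lborel\<close>; every Lebesgue class has a Borel representative.
  Operators on $L^1$ act on representatives, and all equations between them are a.e. equations.
\<close>

definition L1 :: "('a::euclidean_space \<Rightarrow> real) set" where
  "L1 = {f. integrable lborel f}"

definition L1_norm :: "('a::euclidean_space \<Rightarrow> real) \<Rightarrow> real" where
  "L1_norm f = (\<integral>x. \<bar>f x\<bar> \<partial>lborel)"

definition L2 :: "('a::euclidean_space \<Rightarrow> real) set" where
  "L2 = {f \<in> borel_measurable lborel. integrable lborel (\<lambda>x. (f x)\<^sup>2)}"

definition Linf_norm :: "('a::euclidean_space \<Rightarrow> real) \<Rightarrow> ereal" where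
  "Linf_norm f = esssup lborel (\<lambda>x. ereal \<bar>f x\<bar>)"

definition Linf :: "('a::euclidean_space \<Rightarrow> real) set" where
  "Linf = {f \<in> borel_measurable lborel. Linf_norm f < \<infinity>}"

definition L2_plus_Linf :: "('a::euclidean_space \<Rightarrow> real) set" where
  "L2_plus_Linf = {\<lambda>x. g x + h x | g h. g \<in> L2 \<and> h \<in> Linf}"

definition L1_loc :: "('a::euclidean_space \<Rightarrow> real) set" where
  "L1_loc = {f \<in> borel_measurable lborel. \<forall>K. compact K \<longrightarrow> set_integrable lborel K f}"

definition L1_lim :: "(nat \<Rightarrow> 'a::euclidean_space \<Rightarrow> real) \<Rightarrow> ('a \<Rightarrow> real) \<Rightarrow> bool" where
  "L1_lim g f \<longleftrightarrow> (\<lambda>n. L1_norm (\<lambda>x. g n x - f x)) \<longlonglongrightarrow> 0"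

definition weak_star_lim :: "(nat \<Rightarrow> 'a::euclidean_space \<Rightarrow> real) \<Rightarrow> ('a \<Rightarrow> real) \<Rightarrow> bool" where
  "weak_star_lim g f \<longleftrightarrow> (\<forall>\<^sub>F n in sequentially. g n \<in> Linf) \<and> f \<in> Linf \<and>
     (\<forall>\<phi>\<in>L1. (\<lambda>n. \<integral>x. g n x * \<phi> x \<partial>lborel) \<longlonglongrightarrow> (\<integral>x. f x * \<phi> x \<partial>lborel))"

text \<open>
  \<open>T\<close> is the extension by continuity to $L^1$ of its own restriction to the subset \<open>X\<close>
  (which is dense in the uses below).
\<close>

definition L1_extension_from ::
  "('a::euclidean_space \<Rightarrow> real) set \<Rightarrow> (('a \<Rightarrow> real) \<Rightarrow> ('a \<Rightarrow> real)) \<Rightarrow> bool" where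
  "L1_extension_from X T \<longleftrightarrow>
     (\<forall>f\<in>L1. T f \<in> L1 \<and> (\<forall>g. (\<forall>n. g n \<in> X) \<and> L1_lim g f \<longrightarrow> L1_lim (\<lambda>n. T (g n)) (T f)))"


subsection \<open>Classical and weak derivatives\<close>

definition part_deriv :: "'a::euclidean_space \<Rightarrow> ('a \<Rightarrow> real) \<Rightarrow> 'a \<Rightarrow> real" where
  "part_deriv i f x = frechet_derivative f (at x) i"

definition grad :: "('a::euclidean_space \<Rightarrow> real) \<Rightarrow> 'a \<Rightarrow> 'a" where
  "grad f x = (\<Sum>i\<in>Basis. part_deriv i f x *\<^sub>R i)"

definition laplacian :: "('a::euclidean_space \<Rightarrow> real) \<Rightarrow> 'a \<Rightarrow> real" where
  "laplacian f x = (\<Sum>i\<in>Basis. part_deriv i (part_deriv i f) x)"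

primrec C_k :: "nat \<Rightarrow> ('a::euclidean_space \<Rightarrow> real) \<Rightarrow> bool" where
  "C_k 0 f \<longleftrightarrow> continuous_on UNIV f"
| "C_k (Suc k) f \<longleftrightarrow> f differentiable_on UNIV \<and> (\<forall>i\<in>Basis. C_k k (part_deriv i f))"

definition compactly_supported :: "('a::euclidean_space \<Rightarrow> real) \<Rightarrow> bool" where
  "compactly_supported f \<longleftrightarrow> compact (closure {x. f x \<noteq> 0})"

definition test_functions :: "('a::euclidean_space \<Rightarrow> real) set" where
  "test_functions = {\<phi>. (\<forall>k. C_k k \<phi>) \<and> compactly_supported \<phi>}"

definition has_weak_div :: "('a::euclidean_space \<Rightarrow> 'a) \<Rightarrow> ('a \<Rightarrow> real) \<Rightarrow> bool" where
  "has_weak_div F v \<longleftrightarrow> (\<forall>i\<in>Basis. (\<lambda>x. F x \<bullet> i) \<in> L1_loc) \<and> v \<in> L1_loc \<and>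
     (\<forall>\<phi>\<in>test_functions.
        (\<integral>x. F x \<bullet> grad \<phi> x \<partial>lborel) = - (\<integral>x. v x * \<phi> x \<partial>lborel))"

definition H1 :: "('a::euclidean_space \<Rightarrow> real) set" where
  "H1 = {w \<in> L2. \<forall>i\<in>Basis. \<exists>g\<in>L2. \<forall>\<phi>\<in>test_functions.
           (\<integral>x. w x * part_deriv i \<phi> x \<partial>lborel) = - (\<integral>x. g x * \<phi> x \<partial>lborel)}"


subsection \<open>The approximating problems\<close>

definition beta_eps :: "(real \<Rightarrow> real) \<Rightarrow> real \<Rightarrow> real \<Rightarrow> real" where
  "beta_eps \<beta> \<epsilon> r = \<beta> (inv (\<lambda>s. s + \<epsilon> * \<beta> s) r)"

definition beta_tilde :: "(real \<Rightarrow> real) \<Rightarrow> real \<Rightarrow> real \<Rightarrow> real" where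
  "beta_tilde \<beta> \<epsilon> r = beta_eps \<beta> \<epsilon> r + \<epsilon> * r"

definition cutoff_family :: "(real \<Rightarrow> 'a::euclidean_space \<Rightarrow> real) \<Rightarrow> bool" where
  "cutoff_family \<eta> \<longleftrightarrow> (\<forall>\<epsilon>\<in>{0<..<1}. C_k 1 (\<eta> \<epsilon>) \<and> compactly_supported (\<eta> \<epsilon>) \<and>
     (\<forall>x. 0 \<le> \<eta> \<epsilon> x \<and> \<eta> \<epsilon> x \<le> 1 \<and> norm (grad (\<eta> \<epsilon>) x) \<le> 1) \<and>
     (\<forall>x. norm x \<le> 1 / \<epsilon> \<longrightarrow> \<eta> \<epsilon> x = 1))"

definition D_eps ::
  "('a::euclidean_space \<Rightarrow> 'a) \<Rightarrow> (real \<Rightarrow> 'a \<Rightarrow> real) \<Rightarrow> real \<Rightarrow> 'a \<Rightarrow> 'a" where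
  "D_eps D \<eta> \<epsilon> =
     (if (\<lambda>x. norm (D x)) \<in> L2 \<and> (\<exists>v\<in>L2_plus_Linf. has_weak_div D v) then D
      else (\<lambda>x. \<eta> \<epsilon> x *\<^sub>R D x))"

definition standard_mollifier :: "(real \<Rightarrow> real) \<Rightarrow> bool" where
  "standard_mollifier \<rho> \<longleftrightarrow> (\<forall>k. C_k k \<rho>) \<and> (\<forall>r. 0 \<le> \<rho> r) \<and> (\<forall>r. 1 < \<bar>r\<bar> \<longrightarrow> \<rho> r = 0) \<and>
     (\<integral>r. \<rho> r \<partial>lborel) = 1"

definition b_eps :: "(real \<Rightarrow> real) \<Rightarrow> (real \<Rightarrow> real) \<Rightarrow> real \<Rightarrow> real \<Rightarrow> real" where
  "b_eps b \<rho> \<epsilon> =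
     (if b constant_on UNIV then b
      else (\<lambda>r. (\<integral>s. b (r - s) * (1 / \<epsilon> * \<rho> (s / \<epsilon>)) \<partial>lborel) / (1 + \<epsilon> * \<bar>r\<bar>)))"

text \<open>
  The equation
  $u-\lambda\Delta\tilde\beta_\varepsilon(u)+\lambda\varepsilon\tilde\beta_\varepsilon(u)
   +\lambda\,\mathrm{div}(D_\varepsilon b_\varepsilon(u)u)=f$
  is understood in the sense of distributions.
\<close>

definition approx_solution ::
  "(real \<Rightarrow> real) \<Rightarrow> ('a::euclidean_space \<Rightarrow> 'a) \<Rightarrow> (real \<Rightarrow> real) \<Rightarrow> (real \<Rightarrow> 'a \<Rightarrow> real) \<Rightarrow>
   (real \<Rightarrow> real) \<Rightarrow> real \<Rightarrow> real \<Rightarrow> ('a \<Rightarrow> real) \<Rightarrow> ('a \<Rightarrow> real) \<Rightarrow> bool" where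
  "approx_solution \<beta> D b \<eta> \<rho> \<epsilon> lam f u \<longleftrightarrow>
     u \<in> L2 \<and> (\<lambda>x. beta_tilde \<beta> \<epsilon> (u x)) \<in> H1 \<and>
     (\<forall>\<phi>\<in>test_functions.
        (\<integral>x. u x * \<phi> x \<partial>lborel)
        - lam * (\<integral>x. beta_tilde \<beta> \<epsilon> (u x) * laplacian \<phi> x \<partial>lborel)
        + lam * \<epsilon> * (\<integral>x. beta_tilde \<beta> \<epsilon> (u x) * \<phi> x \<partial>lborel)
        - lam * (\<integral>x. b_eps b \<rho> \<epsilon> (u x) * u x * (D_eps D \<eta> \<epsilon> x \<bullet> grad \<phi> x) \<partial>lborel)
        = (\<integral>x. f x * \<phi> x \<partial>lborel))"

text \<open>
  \<open>U \<epsilon> lam f\<close> is $u_\varepsilon(\lambda,f)$: the unique solution for $f\in L^1\cap L^2$ and small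
  $\lambda$, extended by continuity to $f\in L^1$ and by the resolvent identity to all
  $\lambda>0$.  Here \<open>lam0\<close> is $\lambda_\varepsilon$.
\<close>

definition approx_resolvents ::
  "(real \<Rightarrow> real) \<Rightarrow> ('a::euclidean_space \<Rightarrow> 'a) \<Rightarrow> (real \<Rightarrow> real) \<Rightarrow> (real \<Rightarrow> 'a \<Rightarrow> real) \<Rightarrow>
   (real \<Rightarrow> real) \<Rightarrow> (real \<Rightarrow> real \<Rightarrow> ('a \<Rightarrow> real) \<Rightarrow> 'a \<Rightarrow> real) \<Rightarrow> bool" where
  "approx_resolvents \<beta> D b \<eta> \<rho> U \<longleftrightarrow> (\<forall>\<epsilon>\<in>{0<..<1}. \<exists>lam0>0.
     (\<forall>lam\<in>{0<..<lam0}.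
        (\<forall>f \<in> L1 \<inter> L2. approx_solution \<beta> D b \<eta> \<rho> \<epsilon> lam f (U \<epsilon> lam f) \<and>
           (\<forall>v. approx_solution \<beta> D b \<eta> \<rho> \<epsilon> lam f v \<longrightarrow> (AE x in lborel. v x = U \<epsilon> lam f x))) \<and>
        L1_extension_from (L1 \<inter> L2) (U \<epsilon> lam)) \<and>
     (\<forall>lam1\<in>{0<..<lam0}. \<forall>lam2>0. \<forall>f\<in>L1. U \<epsilon> lam2 f \<in> L1 \<and>
        (AE x in lborel. U \<epsilon> lam2 f x =
           U \<epsilon> lam1 (\<lambda>y. lam1 / lam2 * f y + (1 - lam1 / lam2) * U \<epsilon> lam2 f y) x)))"


subsection \<open>The resolvents, the operator and the generalized solution\<close>

definition limit_resolvents ::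
  "(real \<Rightarrow> real \<Rightarrow> ('a::euclidean_space \<Rightarrow> real) \<Rightarrow> 'a \<Rightarrow> real) \<Rightarrow> (nat \<Rightarrow> real) \<Rightarrow>
   (real \<Rightarrow> ('a \<Rightarrow> real) \<Rightarrow> 'a \<Rightarrow> real) \<Rightarrow> bool" where
  "limit_resolvents U e J \<longleftrightarrow> (\<forall>n. e n \<in> {0<..<1}) \<and> e \<longlonglongrightarrow> 0 \<and>
     (\<forall>lam>0. (\<forall>f \<in> L1 \<inter> Linf. weak_star_lim (\<lambda>n. U (e n) lam f) (J lam f)) \<and>
            L1_extension_from (L1 \<inter> Linf) (J lam))"

text \<open>\<open>A0_graph\<close> is the graph of $A_0y=-\Delta\beta(y)+\mathrm{div}(Db(y)y)$.\<close>

definition A0_graph ::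
  "(real \<Rightarrow> real) \<Rightarrow> ('a::euclidean_space \<Rightarrow> 'a) \<Rightarrow> (real \<Rightarrow> real) \<Rightarrow>
   (('a \<Rightarrow> real) \<times> ('a \<Rightarrow> real)) set" where
  "A0_graph \<beta> D b = {(y, w). y \<in> L1 \<and> (\<lambda>x. \<beta> (y x)) \<in> L1_loc \<and> w \<in> L1 \<and>
     (\<forall>\<phi>\<in>test_functions.
        - (\<integral>x. \<beta> (y x) * laplacian \<phi> x \<partial>lborel)
        - (\<integral>x. b (y x) * y x * (D x \<bullet> grad \<phi> x) \<partial>lborel)
        = (\<integral>x. w x * \<phi> x \<partial>lborel))}"

text \<open>
  The range $J_\lambda(L^1)$ does not depend on $\lambda$, so $D(A)=J_\lambda(L^1)$ may be
  required for every $\lambda>0$.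
\<close>

definition dom_A :: "(real \<Rightarrow> ('a::euclidean_space \<Rightarrow> real) \<Rightarrow> 'a \<Rightarrow> real) \<Rightarrow> ('a \<Rightarrow> real) set" where
  "dom_A J = {y. \<forall>lam>0. \<exists>f\<in>L1. AE x in lborel. y x = J lam f x}"

definition A_graph ::
  "(real \<Rightarrow> real) \<Rightarrow> ('a::euclidean_space \<Rightarrow> 'a) \<Rightarrow> (real \<Rightarrow> real) \<Rightarrow>
   (real \<Rightarrow> ('a \<Rightarrow> real) \<Rightarrow> 'a \<Rightarrow> real) \<Rightarrow> (('a \<Rightarrow> real) \<times> ('a \<Rightarrow> real)) set" where
  "A_graph \<beta> D b J = {(y, w) \<in> A0_graph \<beta> D b. y \<in> dom_A J}"

text \<open>The graph of $(I+\lambda A)^{-1}$, for an operator on $L^1$ given by its graph \<open>G\<close>.\<close>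

definition resolvent_graph ::
  "(('a::euclidean_space \<Rightarrow> real) \<times> ('a \<Rightarrow> real)) set \<Rightarrow> real \<Rightarrow>
   (('a \<Rightarrow> real) \<times> ('a \<Rightarrow> real)) set" where
  "resolvent_graph G lam =
     {(f, v). f \<in> L1 \<and> (\<exists>w. (v, w) \<in> G \<and> (AE x in lborel. v x + lam * w x = f x))}"

text \<open>
  \<open>v n t\<close> is $(I+\frac tnA)^{-n}u_0$.  At $t=0$ this is $u_0$ by convention (the domain of $A$
  is only dense), so the exponential formula is stated for $t>0$ together with $u(0)=u_0$.
\<close>

definition generalized_solution ::
  "(real \<Rightarrow> real) \<Rightarrow> ('a::euclidean_space \<Rightarrow> 'a) \<Rightarrow> (real \<Rightarrow> real) \<Rightarrow>
   (real \<Rightarrow> ('a \<Rightarrow> real) \<Rightarrow> 'a \<Rightarrow> real) \<Rightarrow> ('a \<Rightarrow> real) \<Rightarrow> (real \<Rightarrow> 'a \<Rightarrow> real) \<Rightarrow> bool" where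
  "generalized_solution \<beta> D b J u0 u \<longleftrightarrow>
     (\<forall>t\<ge>0. u t \<in> L1) \<and>
     (\<forall>s\<ge>0. ((\<lambda>t. L1_norm (\<lambda>x. u t x - u s x)) \<longlongrightarrow> 0) (at s within {0..})) \<and>
     (AE x in lborel. u 0 x = u0 x) \<and>
     (\<exists>v. (\<forall>n\<ge>1. \<forall>t>0.
             (u0, v n t) \<in> resolvent_graph (A_graph \<beta> D b J) (t / real n) ^^ n) \<and>
          (\<forall>T>0. uniform_limit {0<..T} (\<lambda>n t. L1_norm (\<lambda>x. v n t x - u t x)) (\<lambda>_. 0)
             sequentially))"

end

(* The mollified weak equation, tested with functions of the solution, bounds translates of the part of
   the solution above a level; this gives compactness of the approximations, and for the limit an energy
   estimate above every positive level. Testing differences of solutions with a superharmonic weight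
   (d >= 3) yields the L1 contraction and passes the equation to the limit, so the graph of A is that of the
   resolvents J. A Nash inequality, proved through translates, turns the energy estimate into the decay of
   the L2 norm of (u - k)^+ along the implicit scheme, and a De Giorgi iteration over levels and times
   gives the bound on the maximum. *)
theory Submission
  imports Defs "HOL-Analysis.Radon_Nikodym" "HOL-Analysis.Ball_Volume"
begin

text \<open>The slope of \<beta> may vanish at 0, so u itself has no gradient bound. The energy
  estimates therefore test with functions that vanish below a level \<kappa> > 0, where the slope is
  at least a \<kappa>^(\<alpha>-1). After the chain rule the drift is then an integral of D . grad
  H(v) with H >= 0, and div D >= 0 gives it a sign. Gradients are kept as bounds |s(u(. + w)) -
  s(u)|_2 <= C |w|, which avoid Sobolev calculus and survive limits. J is given only as a weak-star
  limit, which does not pass through \<beta> and b; hence the compactness argument. The generalized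
  solution is defined through A, and for data that are only integrable \<beta>(J g) has no pointwise
  bound; hence the weight. The exponents come from one balance. Above \<kappa> the diffusion acts at
  least like a \<kappa>^(\<alpha>-1) times the Laplacian, so in time t mass A spreads to height A (a
  \<kappa>^(\<alpha>-1) t)^(-d/2); equating this with \<kappa> gives \<kappa>^(1 + (\<alpha>-1) d/2)
  ~ A t^(-d/2).\<close>

abbreviation (input) lborel_integral (binder "\<integral>" 10) where "lborel_integral f \<equiv> integral\<^sup>L lborel f"
abbreviation (input) lborel_nn_integral (binder "\<integral>\<^sup>+" 10) where "lborel_nn_integral f \<equiv> integral\<^sup>N lborel f"
abbreviation (input) lborel_AE (binder "AE " 10) where "lborel_AE P \<equiv> AE x in lborel. P x"
abbreviation (input) lborel_integrable ("\<L>") where "\<L> f \<equiv> integrable lborel f"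
abbreviation (input) borel_functions ("\<M>") where "\<M> \<equiv> borel_measurable borel"
abbreviation (input) seq_tendsto ("(_/ ----> _)" [60, 60] 60) where "X ----> L \<equiv> X \<longlonglongrightarrow> L"


section \<open>Test functions\<close>


lemma part_deriv_eq: "(f has_derivative f') (at x) ==> part_deriv i f x = f' i"
 unfolding part_deriv_def using frechet_derivative_at by metis

lemma C_k_Suc_imp: "C_k (Suc k) f ==> C_k k f"
proof (induction k arbitrary: f)
 case 0
 then show ?case by (auto intro: differentiable_imp_continuous_on)
next
 case (Suc k)
 then show ?case by auto
qed

lemma C_k_le: "C_k m f ==> k \<le> m ==> C_k k f"
proof (induction m)
 case (Suc m)
 then show ?case using C_k_Suc_imp by (metis le_Suc_eq)
qed auto

lemma C_k_const: "C_k k (%x::'a::euclidean_space. c)"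
proof (induction k arbitrary: c)
 case (Suc k)
 have "part_deriv i (%x::'a. c) = (%x. 0)" for i
  by (rule ext, rule part_deriv_eq) (auto intro: derivative_eq_intros)
 then show ?case using Suc by simp
qed simp

lemma C_k_add: "C_k k f ==> C_k k g ==> C_k k (%x::'a::euclidean_space. f x + g x)"
proof (induction k arbitrary: f g)
 case 0
 then show ?case by (auto intro: continuous_intros)
next
 case (Suc k)
 have d: "(f has_derivative frechet_derivative f (at x)) (at x)"
   "(g has_derivative frechet_derivative g (at x)) (at x)" for x
  using Suc.prems by (auto simp: differentiable_on_eq_differentiable_at frechet_derivative_works)
 have "part_deriv i (%x. f x + g x) = (%x. part_deriv i f x + part_deriv i g x)" for i
  by (rule ext, rule part_deriv_eq[OF has_derivative_add[OF d], THEN trans])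
    (simp add: part_deriv_def)
 then show ?case using Suc by (auto intro!: Suc.IH differentiable_on_add)
qed

lemma C_k_mult: "C_k k f ==> C_k k g ==> C_k k (%x::'a::euclidean_space. f x * g x)"
proof (induction k arbitrary: f g)
 case 0
 then show ?case by (auto intro: continuous_intros)
next
 case (Suc k)
 have d: "(f has_derivative frechet_derivative f (at x)) (at x)"
   "(g has_derivative frechet_derivative g (at x)) (at x)" for x
  using Suc.prems by (auto simp: differentiable_on_eq_differentiable_at frechet_derivative_works)
 have "part_deriv i (%x. f x * g x) = (%x. f x * part_deriv i g x + part_deriv i f x * g x)" for i
  by (rule ext, rule part_deriv_eq[OF has_derivative_mult[OF d], THEN trans])
    (simp add: part_deriv_def)
 moreover have "C_k k f" "C_k k g" using Suc.prems C_k_Suc_imp by blast+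
 ultimately show ?case using Suc.prems
  by (auto intro!: C_k_add Suc.IH differentiable_on_mult)
qed

lemma C_k_prod: "finite I ==> (!!i. i \<in> I ==> C_k k (f i)) ==>
  C_k k (%x::'a::euclidean_space. \<Prod>i\<in>I. f i x)"
 by (induction I rule: finite_induct) (auto intro: C_k_const C_k_mult)

text \<open>Ridge functions are the factors of the product kernel \<open>kern\<close>. An arbitrary
  direction \<open>w\<close> lets the scaling by 1/\<delta> be absorbed into the direction.\<close>

lemma C_k_ridge:
 fixes g :: "real => real" and w :: "'a::euclidean_space"
 shows "C_k k g ==> C_k k (%x. g (x \<bullet> w))"
proof (induction k arbitrary: g)
 case 0
 then show ?case by (auto intro!: continuous_intros continuous_on_compose2[of UNIV g])
next
 case (Suc k)
 have d: "(g has_derivative frechet_derivative g (at x)) (at x)" for x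
  using Suc.prems by (auto simp: differentiable_on_eq_differentiable_at frechet_derivative_works)
 have d2: "((%x. g (x \<bullet> w)) has_derivative (%h. frechet_derivative g (at (x \<bullet> w)) (h \<bullet> w))) (at x)" for x
  by (rule has_derivative_compose[OF _ d]) (auto intro!: derivative_eq_intros)
 have l: "frechet_derivative g (at y) h = h * part_deriv 1 g y" for y h
  unfolding part_deriv_def
  using linear_frechet_derivative[of g "at y"] d[of y]
  by (metis differentiableI linear_cmul mult.right_neutral real_scaleR_def)
 have "part_deriv i (%x. g (x \<bullet> w)) = (%x. (i \<bullet> w) * part_deriv 1 g (x \<bullet> w))" for i
  by (rule ext, rule part_deriv_eq[OF d2, THEN trans]) (simp add: l)
 moreover have "(%x. g (x \<bullet> w)) differentiable_on UNIV"
  using d2 by (auto simp: differentiable_on_eq_differentiable_at intro: differentiableI)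
 moreover have "C_k k (part_deriv 1 g)" using Suc.prems by auto
 ultimately show ?case using Suc.IH by (auto intro!: C_k_mult C_k_const)
qed

lemma C_k_reflect:
 fixes f :: "'a::euclidean_space => real"
 assumes "C_k k f" shows "C_k k (%z. f (x - z))"
 using assms
proof (induction k arbitrary: f)
 case 0
 then show ?case by (auto intro!: continuous_intros continuous_on_compose2[of UNIV f])
next
 case (Suc k)
 have d: "(f has_derivative frechet_derivative f (at y)) (at y)" for y
  using Suc.prems by (auto simp: differentiable_on_eq_differentiable_at frechet_derivative_works)
 have d2: "((%z. f (x - z)) has_derivative (%h. frechet_derivative f (at (x - z)) (- h))) (at z)" for z
  by (rule has_derivative_compose[OF _ d]) (auto intro!: derivative_eq_intros)
 have l: "frechet_derivative f (at y) (- i) = (-1) * part_deriv i f y" for y i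
  unfolding part_deriv_def
  using linear_frechet_derivative[of f "at y"] d[of y]
  by (metis differentiableI linear_neg mult_minus1)
 have "part_deriv i (%z. f (x - z)) = (%z. (-1) * part_deriv i f (x - z))" for i
  by (rule ext, rule part_deriv_eq[OF d2, THEN trans]) (rule l)
 moreover have "(%z. f (x - z)) differentiable_on UNIV"
  using d2 by (auto simp: differentiable_on_eq_differentiable_at intro: differentiableI)
 moreover have "C_k k (%z. (-1) * part_deriv i f (x - z))" if "i \<in> Basis" for i
  by (rule C_k_mult) (use Suc that in \<open>auto intro: C_k_const\<close>)
 ultimately show ?case by simp
qed

lemma compactly_supported_iff: "compactly_supported f \<longleftrightarrow> bounded {x. f x \<noteq> 0}"
 by (simp add: compactly_supported_def compact_closure)

context
 fixes \<phi> :: "'a::euclidean_space => real"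
 assumes test: "\<phi> \<in> test_functions"
begin

lemma test_C_k: "C_k k \<phi>"
 using test by (simp add: test_functions_def)

lemma test_has_derivative: "(\<phi> has_derivative frechet_derivative \<phi> (at x)) (at x)"
 using test_C_k[of 1] by (simp add: differentiable_on_eq_differentiable_at frechet_derivative_works)

lemma test_supp: "bounded {x. \<phi> x \<noteq> 0}"
 using test by (simp add: test_functions_def compactly_supported_iff)

lemma test_part_deriv: assumes "i \<in> Basis" shows "part_deriv i \<phi> \<in> test_functions"
proof -
 have "{x. part_deriv i \<phi> x \<noteq> 0} \<subseteq> closure {x. \<phi> x \<noteq> 0}"
 proof (rule ccontr)
  assume "\<not> ?thesis"
  then obtain x where x: "part_deriv i \<phi> x \<noteq> 0" "x \<in> - closure {x. \<phi> x \<noteq> 0}" by auto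
  have "(\<phi> has_derivative (%h. 0)) (at x)"
   by (rule has_derivative_transform_within_open[of "%x. 0" _ _ _ "- closure {x. \<phi> x \<noteq> 0}"])
     (use x closure_subset[of "{x. \<phi> x \<noteq> 0}"] in \<open>auto\<close>)
  from part_deriv_eq[OF this] x show False by auto
 qed
 then have "bounded {x. part_deriv i \<phi> x \<noteq> 0}"
  using test_supp bounded_closure bounded_subset by blast
 moreover have "C_k k (part_deriv i \<phi>)" for k
  using test_C_k[of "Suc k"] assms by auto
 ultimately show ?thesis by (simp add: test_functions_def compactly_supported_iff)
qed

text \<open>Testing a distributional identity with this reflected function turns it into a pointwise
  identity between convolutions; this is how weak equations are mollified below.\<close>

lemma test_reflect: "(%z. \<phi> (x - z)) \<in> test_functions"
proof -
 have "{z. \<phi> (x - z) \<noteq> 0} = (%y. x - y) ` {y. \<phi> y \<noteq> 0}"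
  by (auto intro!: image_eqI[of _ _ "x - _"])
 then have "bounded {z. \<phi> (x - z) \<noteq> 0}"
  using bounded_translation[OF bounded_uminus[THEN iffD2, OF test_supp], of x]
  by (simp add: image_image)
 then show ?thesis
  using test_C_k by (auto simp: test_functions_def compactly_supported_iff intro: C_k_reflect)
qed

lemma test_continuous: "continuous_on UNIV \<phi>"
 using test_C_k[of 0] by simp

lemma test_measurable[measurable]: "\<phi> \<in> \<M>"
 using test_continuous by (simp add: borel_measurable_continuous_onI)

lemma test_compact_support: "\<exists>K. compact K \<and> (\<forall>x. x \<notin> K \<longrightarrow> \<phi> x = 0)"
proof (intro exI conjI allI impI)
 show "compact (closure {x. \<phi> x \<noteq> 0})" using test_supp by simp
 show "\<phi> x = 0" if "x \<notin> closure {x. \<phi> x \<noteq> 0}" for x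
  using that closure_subset[of "{x. \<phi> x \<noteq> 0}"] by auto
qed

lemma test_bounded: "\<exists>B\<ge>0. \<forall>x. \<bar>\<phi> x\<bar> \<le> B"
proof -
 obtain K where K: "compact K" "!!x. x \<notin> K ==> \<phi> x = 0" using test_compact_support by blast
 have "bounded (\<phi> ` K)"
  using K(1) test_continuous by (meson compact_continuous_image compact_imp_bounded continuous_on_subset subset_UNIV)
 then obtain B where B: "B > 0" "!!x. x \<in> K ==> \<bar>\<phi> x\<bar> \<le> B"
  unfolding bounded_pos by auto
 show ?thesis
  by (intro exI[of _ B] conjI allI) (use B K in \<open>auto, metis abs_zero less_imp_le\<close>)
qed

lemma test_integrable_mult:
 assumes "h \<in> L1_loc" shows "\<L> (%x. h x * \<phi> x)"
proof -
 obtain K where K: "compact K" "!!x. x \<notin> K ==> \<phi> x = 0" using test_compact_support by blast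
 obtain B where B: "!!x. \<bar>\<phi> x\<bar> \<le> B" using test_bounded by blast
 have m: "h \<in> \<M>" using assms by (simp add: L1_loc_def)
 have i: "\<L> (%x. B * (indicator K x *\<^sub>R h x))"
  using assms K(1) by (auto simp: L1_loc_def set_integrable_def)
 show ?thesis
 proof (rule Bochner_Integration.integrable_bound[OF i])
  show "(%x. h x * \<phi> x) \<in> borel_measurable lborel" using m by measurable
  show "AE x. norm (h x * \<phi> x) \<le> norm (B * (indicator K x *\<^sub>R h x))"
  proof (intro AE_I2)
   fix x
   have "\<bar>\<phi> x\<bar> \<le> \<bar>B\<bar>" using B[of x] by simp
   then show "norm (h x * \<phi> x) \<le> norm (B * (indicator K x *\<^sub>R h x))"
    using K(2)[of x] by (cases "x \<in> K") (auto simp: abs_mult mult.commute[of "\<bar>h x\<bar>"] mult_right_mono)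
  qed
 qed
qed

end

section \<open>Integrals and translations\<close>


lemma lborel_distr_shift: "distr lborel borel (%x. x + h) = (lborel :: 'a::euclidean_space measure)"
 using lborel_distr_plus[of h] by (simp add: add.commute[of _ h] cong: distr_cong)

lemma lborel_distr_reflect: "distr lborel borel (%z. h - z) = (lborel :: 'a::euclidean_space measure)"
 using lborel_affine[of "-1" h] by (simp add: density_1)

lemma nn_integral_shift:
 fixes f :: "'a::euclidean_space => ennreal"
 assumes [measurable]: "f \<in> \<M>"
 shows "(\<integral>\<^sup>+x. f (x + h)) = (\<integral>\<^sup>+x. f x)"
 by (subst (2) lborel_distr_shift[of h, symmetric]) (simp add: nn_integral_distr)

lemma integral_shift:
 fixes f :: "'a::euclidean_space => real"
 assumes [measurable]: "f \<in> \<M>"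
 shows "(\<integral>x. f (x + h)) = (\<integral>x. f x)"
 by (subst (2) lborel_distr_shift[of h, symmetric]) (simp add: integral_distr)

lemma integral_reflect_shift:
 fixes f :: "'a::euclidean_space => real"
 assumes [measurable]: "f \<in> \<M>"
 shows "(\<integral>x. f (h - x)) = (\<integral>x. f x)"
 by (subst (2) lborel_distr_reflect[of h, symmetric]) (simp add: integral_distr)

lemma integrable_shift:
 fixes f :: "'a::euclidean_space => real"
 assumes "\<L> f"
 shows "\<L> (%x. f (x + h))"
proof -
 have [measurable]: "f \<in> \<M>" using assms by auto
 from assms show ?thesis
  by (subst (asm) lborel_distr_shift[of h, symmetric]) (simp add: integrable_distr_eq)
qed

lemma integrable_reflect_shift:
 fixes f :: "'a::euclidean_space => real"
 assumes "\<L> f"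
 shows "\<L> (%x. f (h - x))"
proof -
 have [measurable]: "f \<in> \<M>" using assms by auto
 from assms show ?thesis
  by (subst (asm) lborel_distr_reflect[of h, symmetric]) (simp add: integrable_distr_eq)
qed

lemma AE_shift:
 assumes "AE x. P (x::'a::euclidean_space)"
 shows "AE x. P (x + h)"
proof -
 have "(%x. x + h) \<in> lborel \<rightarrow>\<^sub>M borel" by measurable
 then show ?thesis by (rule AE_distrD) (simp only: lborel_distr_shift assms)
qed

lemma integrable_squeeze:
 fixes f g :: "'a::euclidean_space => real"
 assumes "\<L> g" "f \<in> \<M>" "AE x. \<bar>f x\<bar> \<le> g x"
 shows "\<L> f"
 by (rule Bochner_Integration.integrable_bound[OF assms(1)]) (use assms in auto)

lemma integral_mono_abs:
 fixes f g :: "'a::euclidean_space => real"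
 assumes "\<L> g" "f \<in> \<M>" "AE x. \<bar>f x\<bar> \<le> g x"
 shows "(\<integral>x. \<bar>f x\<bar>) \<le> (\<integral>x. g x)"
 by (rule integral_mono_AE) (use assms integrable_squeeze[OF assms] in auto)

section \<open>The spaces L^2 and L^\<infinity>, Cauchy-Schwarz and Jensen\<close>

lemma L2_measurable[measurable_dest]: "f \<in> L2 ==> f \<in> \<M>"
 by (simp add: L2_def)

lemma L2_integrable: "f \<in> L2 ==> \<L> (%x. (f x)^2)"
 by (simp add: L2_def)

lemma L2_I: "f \<in> \<M> ==> \<L> (%x. (f x)^2) ==> f \<in> L2"
 by (simp add: L2_def)

lemma abs_mult_le_squares: "\<bar>x * y\<bar> \<le> (x^2 + y^2) / 2" for x y :: real
 using sum_squares_bound[of "\<bar>x\<bar>" "\<bar>y\<bar>"] by (simp add: abs_mult)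

lemma power2_add_le: "(x + y)^2 \<le> 2 * x^2 + 2 * y^2" for x y :: real
 using sum_squares_bound[of x y] by (simp add: power2_sum)

lemma L2_mult: assumes "f \<in> L2" "g \<in> L2" shows "\<L> (%x. f x * g x)"
proof (rule integrable_squeeze)
 show "\<L> (%x. ((f x)^2 + (g x)^2) / 2)"
  using L2_integrable[OF assms(1)] L2_integrable[OF assms(2)] by auto
 show "(%x. f x * g x) \<in> \<M>" using assms by measurable
 show "AE x. \<bar>f x * g x\<bar> \<le> ((f x)^2 + (g x)^2) / 2"
  by (intro AE_I2 abs_mult_le_squares)
qed

lemma L2_dominated:
 assumes "g \<in> L2" "f \<in> \<M>" "AE x. \<bar>f x\<bar> \<le> C * \<bar>g x\<bar>"
 shows "f \<in> L2"
proof (rule L2_I[OF assms(2)], rule integrable_squeeze)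
 show "\<L> (%x. C^2 * (g x)^2)" using L2_integrable[OF assms(1)] by simp
 show "(%x. (f x)^2) \<in> \<M>" using assms by measurable
 show "AE x. \<bar>(f x)\<^sup>2\<bar> \<le> C^2 * (g x)^2"
  using assms(3) by eventually_elim
   (metis abs_ge_zero abs_power2 power2_abs power_mono power_mult_distrib)
qed

lemma L2_add: assumes "f \<in> L2" "g \<in> L2" shows "(%x. f x + g x) \<in> L2"
proof (rule L2_I, use assms in measurable, rule integrable_squeeze)
 show "\<L> (%x. 2 * (f x)^2 + 2 * (g x)^2)" using L2_integrable[OF assms(1)] L2_integrable[OF assms(2)] by auto
 show "(%x. (f x + g x)^2) \<in> \<M>" using assms by measurable
 show "AE x. \<bar>(f x + g x)\<^sup>2\<bar> \<le> 2 * (f x)^2 + 2 * (g x)^2"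
  by (intro AE_I2) (simp add: power2_add_le)
qed

lemma L2_cmult: assumes "f \<in> L2" shows "(%x. c * f x) \<in> L2"
 by (rule L2_dominated[OF assms, of _ "\<bar>c\<bar>"]) (use assms in \<open>auto simp: abs_mult\<close>)

lemma L2_diff: assumes "f \<in> L2" "g \<in> L2" shows "(%x. f x - g x) \<in> L2"
 using L2_add[OF assms(1) L2_cmult[OF assms(2), of "-1"]] by simp

lemma L2_uminus: assumes "f \<in> L2" shows "(%x. - f x) \<in> L2"
 using L2_cmult[OF assms(1), of "-1"] by simp

lemma L2_shift: assumes "f \<in> L2" shows "(%x. f (x + h)) \<in> L2"
proof (rule L2_I)
 have [measurable]: "f \<in> \<M>" using assms by (rule L2_measurable)
 show "(%x. f (x + h)) \<in> \<M>" by measurable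
qed (rule integrable_shift[OF L2_integrable[OF assms]])

lemma L2_bounded_mult:
 assumes "f \<in> L2" "g \<in> \<M>" "!!x. \<bar>g x\<bar> \<le> C" shows "(%x. g x * f x) \<in> L2"
 by (rule L2_dominated[OF assms(1), of _ C])
   (use assms in \<open>auto simp: abs_mult mult_right_mono\<close>)

lemma Linf_iff: "f \<in> Linf \<longleftrightarrow> f \<in> \<M> \<and> (\<exists>M. AE x. \<bar>f x\<bar> \<le> M)"
proof -
 have "\<exists>M. AE x. \<bar>f x\<bar> \<le> M" if "Linf_norm f < \<infinity>" "f \<in> \<M>"
 proof -
  obtain M where M: "Linf_norm f \<le> ereal M"
   using \<open>Linf_norm f < \<infinity>\<close> by (cases "Linf_norm f") auto
  have "AE x. ereal \<bar>f x\<bar> \<le> Linf_norm f" unfolding Linf_norm_def by (rule esssup_AE)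
  then have "AE x. \<bar>f x\<bar> \<le> M" using M by (auto elim!: eventually_mono dest: order_trans)
  then show ?thesis by blast
 qed
 moreover have "Linf_norm f < \<infinity>" if "AE x. \<bar>f x\<bar> \<le> M" "f \<in> \<M>" for M
 proof -
  have "Linf_norm f \<le> ereal M" unfolding Linf_norm_def
   using that by (intro esssup_I) (auto intro: borel_measurable_ereal)
  then show ?thesis by (auto simp: less_top[symmetric] top_ereal_def)
 qed
 ultimately show ?thesis by (auto simp: Linf_def)
qed

lemma Linf_norm_le:
 assumes "f \<in> \<M>" "AE x. \<bar>f x\<bar> \<le> M"
 shows "Linf_norm f \<le> ereal M"
 unfolding Linf_norm_def using assms by (intro esssup_I) auto

lemma L1_Linf_L2: assumes "f \<in> L1" "f \<in> Linf" shows "f \<in> L2"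
proof -
 obtain M where M: "AE x. \<bar>f x\<bar> \<le> M" using assms Linf_iff by blast
 have i: "\<L> f" using assms by (simp add: L1_def)
 then have [measurable]: "f \<in> \<M>" by auto
 have "\<L> (%x. (f x)^2)"
 proof (rule integrable_squeeze)
  show "\<L> (%x. M * \<bar>f x\<bar>)" using i by auto
  show "AE x. \<bar>(f x)\<^sup>2\<bar> \<le> M * \<bar>f x\<bar>"
   using M by eventually_elim (metis abs_ge_zero abs_mult mult_right_mono power2_eq_square)
 qed simp
 then show ?thesis by (intro L2_I) auto
qed

lemma cauchy_schwarz_L2:
 fixes f g :: "'a::euclidean_space => real"
 assumes "f \<in> L2" "g \<in> L2"
 shows "\<bar>\<integral>x. f x * g x\<bar> \<le> sqrt (\<integral>x. (f x)^2) * sqrt (\<integral>x. (g x)^2)"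
proof -
 have [measurable]: "f \<in> \<M>" "g \<in> \<M>" using assms by (auto dest: L2_measurable)
 note i = L2_integrable[OF assms(1)] L2_integrable[OF assms(2)] L2_mult[OF assms]
 let ?I = "\<integral>x. \<bar>f x * g x\<bar>"
 have e: "(\<integral>\<^sup>+x. ennreal \<bar>f x\<bar> * ennreal \<bar>g x\<bar>) = ennreal ?I"
  using integrable_abs[OF i(3)] by (simp add: nn_integral_eq_integral abs_mult flip: ennreal_mult)
 have "ennreal (?I\<^sup>2) \<le> ennreal ((\<integral>x. (f x)^2) * (\<integral>x. (g x)^2))"
  using Cauchy_Schwarz_nn_integral[of "%x. ennreal \<bar>f x\<bar>" lborel "%x. ennreal \<bar>g x\<bar>"] i
  by (simp add: e ennreal_power nn_integral_eq_integral ennreal_mult)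
 then have "?I\<^sup>2 \<le> (\<integral>x. (f x)^2) * (\<integral>x. (g x)^2)" by (subst (asm) ennreal_le_iff) auto
 then have "?I \<le> sqrt ((\<integral>x. (f x)^2) * (\<integral>x. (g x)^2))" by (rule real_le_rsqrt)
 then show ?thesis unfolding real_sqrt_mult by (rule order_trans[OF integral_abs_bound])
qed

text \<open>Cauchy-Schwarz for the splitting f k = (f sqrt k) (sqrt k). The right side is a
  nonnegative integral so that it makes sense, possibly as infinity, for any measurable
  \<open>f\<close>; if the Bochner integral on the left does not exist, its value 0 makes the claim
  trivial.\<close>

lemma jensen_square:
 fixes f k :: "'a::euclidean_space => real"
 assumes [measurable]: "f \<in> \<M>" and k: "\<L> k" "!!x. k x \<ge> 0"
 shows "ennreal ((\<integral>x. f x * k x)^2) \<le>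
     ennreal (\<integral>x. k x) * (\<integral>\<^sup>+x. ennreal ((f x)^2 * k x))"
proof -
 have [measurable]: "k \<in> \<M>" using k by auto
 have "ennreal \<bar>\<integral>x. f x * k x\<bar> \<le> (\<integral>\<^sup>+x. ennreal (\<bar>f x\<bar> * sqrt (k x)) * ennreal (sqrt (k x)))"
 proof (cases "\<L> (%x. f x * k x)")
  case True
  have "\<bar>f x\<bar> * sqrt (k x) * sqrt (k x) = norm (f x * k x)" for x using k(2)[of x] by (simp add: abs_mult mult.assoc)
  with integral_norm_bound_ennreal[OF True] show ?thesis using k(2) by (simp flip: ennreal_mult)
 qed (simp add: not_integrable_integral_eq)
 then have "(ennreal \<bar>\<integral>x. f x * k x\<bar>)^2 \<le> (\<integral>\<^sup>+x. ennreal (\<bar>f x\<bar> * sqrt (k x)) * ennreal (sqrt (k x)))^2"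
  by (rule power_mono) simp
 also have "\<dots> \<le> (\<integral>\<^sup>+x. (ennreal (\<bar>f x\<bar> * sqrt (k x)))^2) * (\<integral>\<^sup>+x. (ennreal (sqrt (k x)))^2)"
  by (rule Cauchy_Schwarz_nn_integral) measurable
 also have "\<dots> = ennreal (\<integral>x. k x) * (\<integral>\<^sup>+x. ennreal ((f x)^2 * k x))"
  using k by (simp add: ennreal_power power_mult_distrib nn_integral_eq_integral mult.commute)
 finally show ?thesis by (simp add: ennreal_power)
qed

lemma L1_tendsto_integral:
 fixes a :: "nat => 'a::euclidean_space => real"
 assumes "!!n. \<L> (a n)" "\<L> a'" "(%n. \<integral>x. \<bar>a n x - a' x\<bar>) ----> 0"
 shows "(%n. \<integral>x. a n x) ----> (\<integral>x. a' x)" "(%n. \<integral>x. \<bar>a n x\<bar>) ----> (\<integral>x. \<bar>a' x\<bar>)"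
proof -
 have "norm ((\<integral>x. a n x) - (\<integral>x. a' x)) \<le> (\<integral>x. \<bar>a n x - a' x\<bar>)"
  "norm ((\<integral>x. \<bar>a n x\<bar>) - (\<integral>x. \<bar>a' x\<bar>)) \<le> (\<integral>x. \<bar>a n x - a' x\<bar>)" for n
 proof -
  show "norm ((\<integral>x. a n x) - (\<integral>x. a' x)) \<le> (\<integral>x. \<bar>a n x - a' x\<bar>)"
   using assms(1)[of n] assms(2) integral_abs_bound[of lborel "%x. a n x - a' x"] by simp
  have "\<bar>\<integral>x. \<bar>a n x\<bar> - \<bar>a' x\<bar>\<bar> \<le> (\<integral>x. \<bar>a n x - a' x\<bar>)"
   by (rule order_trans[OF integral_abs_bound integral_mono]) (use assms(1)[of n] assms(2) in auto)
  then show "norm ((\<integral>x. \<bar>a n x\<bar>) - (\<integral>x. \<bar>a' x\<bar>)) \<le> (\<integral>x. \<bar>a n x - a' x\<bar>)"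
   using assms(1)[of n] assms(2) by simp
 qed
 from this[THEN allI, THEN always_eventually, THEN Lim_null_comparison, OF assms(3)]
 show "(%n. \<integral>x. a n x) ----> (\<integral>x. a' x)" "(%n. \<integral>x. \<bar>a n x\<bar>) ----> (\<integral>x. \<bar>a' x\<bar>)"
  by (simp_all add: LIM_zero_iff)
qed

lemma L1_tendsto_lincomb:
 fixes a b :: "nat => 'a::euclidean_space => real"
 assumes i: "!!n. \<L> (a n)" "!!n. \<L> (b n)" "\<L> a'" "\<L> b'"
  and lim: "(%n. \<integral>x. \<bar>a n x - a' x\<bar>) ----> 0" "(%n. \<integral>x. \<bar>b n x - b' x\<bar>) ----> 0"
 shows "(%n. \<integral>x. \<bar>(c * a n x + d * b n x) - (c * a' x + d * b' x)\<bar>) ----> 0"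
proof (rule Lim_null_comparison[OF always_eventually[OF allI]])
 show "(%n. \<bar>c\<bar> * (\<integral>x. \<bar>a n x - a' x\<bar>) + \<bar>d\<bar> * (\<integral>x. \<bar>b n x - b' x\<bar>)) ----> 0"
  using tendsto_add[OF tendsto_mult_right_zero[OF lim(1)] tendsto_mult_right_zero[OF lim(2)]] by simp
 have "\<bar>(c * a n x + d * b n x) - (c * a' x + d * b' x)\<bar> \<le> \<bar>c\<bar> * \<bar>a n x - a' x\<bar> + \<bar>d\<bar> * \<bar>b n x - b' x\<bar>" for n x
  using abs_triangle_ineq[of "c * (a n x - a' x)" "d * (b n x - b' x)"] unfolding abs_mult by (simp add: algebra_simps)
 then have le: "(\<integral>x. \<bar>(c * a n x + d * b n x) - (c * a' x + d * b' x)\<bar>)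
   \<le> (\<integral>x. \<bar>c\<bar> * \<bar>a n x - a' x\<bar> + \<bar>d\<bar> * \<bar>b n x - b' x\<bar>)" for n
  using i(1,2)[of n] i(3,4) by (intro integral_mono) auto
 then show "norm (\<integral>x. \<bar>(c * a n x + d * b n x) - (c * a' x + d * b' x)\<bar>) \<le>
   \<bar>c\<bar> * (\<integral>x. \<bar>a n x - a' x\<bar>) + \<bar>d\<bar> * (\<integral>x. \<bar>b n x - b' x\<bar>)" for n
  using le[of n] i(1,2)[of n] i(3,4) by simp
qed

lemma L1_lim_AE_subseq:
 fixes f :: "nat => 'a::euclidean_space => real"
 assumes "!!n. \<L> (f n)" "\<L> f'" "(%n. \<integral>x. \<bar>f n x - f' x\<bar>) ----> 0"
 obtains r where "strict_mono r" "AE x. (%n. f (r n) x) ----> f' x"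
proof -
 have "\<exists>r. strict_mono r \<and> (AE x. (%n. f (r n) x - f' x) ----> 0)"
  by (rule tendsto_L1_AE_subseq) (use assms in auto)
 then obtain r where r: "strict_mono r" "AE x. (%n. f (r n) x - f' x) ----> 0" by blast
 have "AE x. (%n. f (r n) x) ----> f' x"
  using r(2) by eventually_elim (simp add: LIM_zero_iff)
 with r(1) that show thesis by blast
qed

section \<open>Continuity of translations in L^1 and L^2\<close>

definition L1_translation_cont :: "('a::euclidean_space => real) => bool" where
 "L1_translation_cont f \<longleftrightarrow>
   (\<forall>h. h ----> 0 \<longrightarrow> (%n. \<integral>x. \<bar>f (x + h n) - f x\<bar>) ----> 0)"

text \<open>The property is closed under L^1 approximation because translation is an L^1 isometry:
  three terms, each below r/3.\<close>

lemma L1_translation_cont_approx: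
 assumes f: "\<L> f"
  and approx: "!!e. e > 0 ==> \<exists>g. \<L> g \<and> L1_translation_cont g \<and> (\<integral>x. \<bar>f x - g x\<bar>) < e"
 shows "L1_translation_cont f"
 unfolding L1_translation_cont_def
proof (intro allI impI LIMSEQ_I)
 fix h :: "nat => 'a" and r :: real assume h: "h ----> 0" and r: "r > 0"
 obtain g where g: "\<L> g" "L1_translation_cont g" "(\<integral>x. \<bar>f x - g x\<bar>) < r / 3"
  using approx[of "r / 3"] r by auto
 have [measurable]: "f \<in> \<M>" "g \<in> \<M>" using f g by auto
 from g(2) h have "(%n. \<integral>x. \<bar>g (x + h n) - g x\<bar>) ----> 0"
  by (simp add: L1_translation_cont_def)
 from LIMSEQ_D[OF this, of "r / 3"] r
 obtain N where N: "!!n. n \<ge> N ==> \<bar>\<integral>x. \<bar>g (x + h n) - g x\<bar>\<bar> < r / 3" by auto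
 show "\<exists>no. \<forall>n\<ge>no. norm ((\<integral>x. \<bar>f (x + h n) - f x\<bar>) - 0) < r"
 proof (intro exI allI impI)
  fix n assume "n \<ge> N"
  have i: "\<L> (%x. \<bar>f x - g x\<bar>)" "\<L> (%x. \<bar>f (x + h n) - g (x + h n)\<bar>)"
   "\<L> (%x. \<bar>g (x + h n) - g x\<bar>)" "\<L> (%x. \<bar>f (x + h n) - f x\<bar>)"
   using f g integrable_shift[OF f, of "h n"] integrable_shift[OF g(1), of "h n"] by auto
  have "(\<integral>x. \<bar>f (x + h n) - f x\<bar>) \<le>
    (\<integral>x. \<bar>f (x + h n) - g (x + h n)\<bar> + \<bar>g (x + h n) - g x\<bar> + \<bar>f x - g x\<bar>)"
   using i by (intro integral_mono) auto
  also have "\<dots> = (\<integral>x. \<bar>f (x + h n) - g (x + h n)\<bar>) + (\<integral>x. \<bar>g (x + h n) - g x\<bar>) + (\<integral>x. \<bar>f x - g x\<bar>)"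
   using i by simp
  also have "(\<integral>x. \<bar>f (x + h n) - g (x + h n)\<bar>) = (\<integral>x. \<bar>f x - g x\<bar>)"
   using integral_shift[of "%x. \<bar>f x - g x\<bar>" "h n"] by simp
  finally show "norm ((\<integral>x. \<bar>f (x + h n) - f x\<bar>) - 0) < r"
   using g(3) N[OF \<open>n \<ge> N\<close>] by simp
 qed
qed

text \<open>At a point of T the translated indicator is eventually 1, since T is open, so the
  positive part of 1_T(x) - 1_T(x + h) tends to 0 under the majorant 1_T. The negative part has the
  same integral because translation preserves the measure.\<close>

lemma L1_translation_cont_open:
 fixes T :: "'a::euclidean_space set"
 assumes "open T" "emeasure lborel T < \<infinity>"
 shows "L1_translation_cont (indicator T)"
 unfolding L1_translation_cont_def
proof (intro allI impI)
 fix h :: "nat => 'a" assume h: "h ----> 0"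
 let ?I = "indicator T :: 'a => real"
 have [measurable]: "T \<in> sets borel" using assms by auto
 have i: "\<L> ?I" using assms by (simp add: integrable_indicator_iff)
 have "(%n. \<integral>x. max 0 (?I x - ?I (x + h n))) ----> (\<integral>x. 0 \<partial>(lborel :: 'a measure))"
 proof (rule integral_dominated_convergence[where w="?I"])
  show "AE x. (%n. max 0 (?I x - ?I (x + h n))) ----> 0"
  proof (intro AE_I2)
   fix x :: 'a
   show "(%n. max 0 (?I x - ?I (x + h n))) ----> 0"
   proof (cases "x \<in> T")
    case True
    have "(%n. x + h n) ----> x" using tendsto_add[OF tendsto_const h, of x] by simp
    then have "\<forall>\<^sub>F n in sequentially. x + h n \<in> T" using topological_tendstoD assms(1) True by blast
    then have "\<forall>\<^sub>F n in sequentially. max 0 (?I x - ?I (x + h n)) = 0"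
     by eventually_elim (use True in auto)
    then show ?thesis by (rule tendsto_eventually)
   qed auto
  qed
 qed (use i in \<open>auto simp: indicator_def\<close>)
 then have "(%n. 2 * (\<integral>x. max 0 (?I x - ?I (x + h n)))) ----> 0"
  using tendsto_mult_right_zero by fastforce
 moreover have "(\<integral>x. \<bar>?I (x + h n) - ?I x\<bar>) = 2 * (\<integral>x. max 0 (?I x - ?I (x + h n)))" for n
 proof -
  have j: "\<L> (%x. ?I (x + h n))" by (rule integrable_shift[OF i])
  have m: "\<L> (%x. max 0 (?I x - ?I (x + h n)))"
   using i j by (intro integrable_max) auto
  have "(\<integral>x. \<bar>?I (x + h n) - ?I x\<bar>) =
   (\<integral>x. 2 * max 0 (?I x - ?I (x + h n)) + (?I (x + h n) - ?I x))"
   by (intro Bochner_Integration.integral_cong) (auto simp: max_def)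
  also have "\<dots> = 2 * (\<integral>x. max 0 (?I x - ?I (x + h n))) + ((\<integral>x. ?I (x + h n)) - (\<integral>x. ?I x))"
   using i j m by simp
  also have "(\<integral>x. ?I (x + h n)) = (\<integral>x. ?I x)" by (rule integral_shift) simp
  finally show ?thesis by simp
 qed
 ultimately show "(%n. \<integral>x. \<bar>?I (x + h n) - ?I x\<bar>) ----> 0" by simp
qed

text \<open>Measurable induction: outer regularity reduces the indicator of a set of finite measure
  to that of an open set, and the limit step is dominated convergence of the simple
  functions.\<close>

lemma L1_translation_cont_integrable:
 fixes f :: "'a::euclidean_space => real"
 shows "\<L> f ==> L1_translation_cont f"
proof (induction f rule: integrable_induct)
 case (base A c)
 have [measurable]: "A \<in> sets borel" using base by simp
 have ind: "L1_translation_cont (indicator A :: 'a => real)"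
 proof (rule L1_translation_cont_approx)
  show "\<L> (indicator A :: 'a => real)" using base by (simp add: integrable_indicator_iff)
  fix e :: real assume e: "e > 0"
  have "A \<in> sets lebesgue" using base by auto
  then obtain T where T: "open T" "A \<subseteq> T" "T - A \<in> lmeasurable" "emeasure lebesgue (T - A) < ennreal e"
   using sets_lebesgue_outer_open[of A e] e by blast
  have [measurable]: "T \<in> sets borel" using T by auto
  have d: "emeasure lborel (T - A) < ennreal e" using T by simp
  have "emeasure lborel T \<le> emeasure lborel (T - A) + emeasure lborel A"
   using emeasure_subadditive[of "T - A" lborel A] T(2) by (simp add: Un_absorb1 Un_commute)
  also have "\<dots> < \<infinity>" using d base by (auto simp: less_top[symmetric] top_unique)
  finally have fin: "emeasure lborel T < \<infinity>" .
  have "(\<integral>x. \<bar>indicator A x - indicator T x :: real\<bar>) = (\<integral>x. indicator (T - A) x)"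
   using T(2) by (intro Bochner_Integration.integral_cong) (auto simp: indicator_def)
  also have "\<dots> = measure lborel (T - A)" by simp
  also have "\<dots> < e"
  proof -
   have "emeasure lborel (T - A) \<noteq> top" using d by auto
   then have "emeasure lborel (T - A) = ennreal (measure lborel (T - A))"
    by (rule emeasure_eq_ennreal_measure)
   with d show ?thesis by (simp add: ennreal_less_iff)
  qed
  finally show "\<exists>g. \<L> g \<and> L1_translation_cont g \<and> (\<integral>x. \<bar>indicator A x - g x\<bar>) < e"
   using fin T(1) by (intro exI[of _ "indicator T"]) (simp add: L1_translation_cont_open integrable_indicator_iff)
 qed
 show ?case unfolding L1_translation_cont_def
 proof (intro allI impI)
  fix h :: "nat => 'a" assume "h ----> 0"
  with ind have "(%n. \<bar>c\<bar> * (\<integral>x. \<bar>indicator A (x + h n) - indicator A x\<bar>)) ----> \<bar>c\<bar> * 0"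
   unfolding L1_translation_cont_def by (intro tendsto_mult_left) auto
  moreover have "\<bar>indicator A (x + h n) *\<^sub>R c - indicator A x *\<^sub>R c\<bar> = \<bar>c\<bar> * \<bar>indicator A (x + h n) - indicator A x\<bar>" for x n
   by (auto simp: indicator_def)
  ultimately show "(%n. \<integral>x. \<bar>indicator A (x + h n) *\<^sub>R c - indicator A x *\<^sub>R c\<bar>) ----> 0"
   by simp
 qed
next
 case (add f g)
 note i = \<open>\<L> f\<close> \<open>\<L> g\<close>
 show ?case unfolding L1_translation_cont_def
 proof (intro allI impI)
  fix h :: "nat => 'a" assume "h ----> 0"
  with add have "(%n. \<integral>x. \<bar>f (x + h n) - f x\<bar>) ----> 0" "(%n. \<integral>x. \<bar>g (x + h n) - g x\<bar>) ----> 0"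
   unfolding L1_translation_cont_def by auto
  from L1_tendsto_lincomb[of "%n x. f (x + h n) - f x" "%n x. g (x + h n) - g x" "%_. 0" "%_. 0" 1 1] this i
   integrable_shift[OF i(1)] integrable_shift[OF i(2)]
  show "(%n. \<integral>x. \<bar>f (x + h n) + g (x + h n) - (f x + g x)\<bar>) ----> 0"
   by (simp add: add_diff_add)
 qed
next
 case (lim f s)
 show ?case
 proof (rule L1_translation_cont_approx[OF \<open>\<L> f\<close>])
  fix e :: real assume "e > 0"
  have "(%n. \<integral>x. \<bar>f x - s n x\<bar>) ----> (\<integral>x. 0 \<partial>(lborel :: 'a measure))"
  proof (rule integral_dominated_convergence[where w="%x. 3 * \<bar>f x\<bar>"])
   have "\<bar>f x - s n x\<bar> \<le> 3 * \<bar>f x\<bar>" for n x using lim.hyps(3)[of x n] by simp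
   then show "AE x. norm \<bar>f x - s n x\<bar> \<le> 3 * \<bar>f x\<bar>" for n by simp
   have "(%n. \<bar>f x - s n x\<bar>) ----> 0" for x
    using tendsto_rabs[OF tendsto_diff[OF tendsto_const[of "f x"] lim.hyps(2)[of x]]] by simp
   then show "AE x. (%n. \<bar>f x - s n x\<bar>) ----> 0" by simp
  qed (use lim.hyps(1,4) in auto)
  then have "(%n. \<integral>x. \<bar>f x - s n x\<bar>) ----> 0" by simp
  from order_tendstoD(2)[OF this \<open>e > 0\<close>] obtain n where "(\<integral>x. \<bar>f x - s n x\<bar>) < e"
   using eventually_happens'[OF sequentially_bot] by blast
  then show "\<exists>g. \<L> g \<and> L1_translation_cont g \<and> (\<integral>x. \<bar>f x - g x\<bar>) < e"
   using lim.hyps(1) lim.IH by blast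
 qed
qed

lemma L1_translation_continuous:
 fixes f :: "'a::euclidean_space => real"
 assumes "\<L> f" "h ----> 0"
 shows "(%n. \<integral>x. \<bar>f (x + h n) - f x\<bar>) ----> 0"
 using L1_translation_cont_integrable[OF assms(1)] assms(2) by (simp add: L1_translation_cont_def)

text \<open>Reduces the L^2 continuity of translations of f to the L^1 statement for the integrable
  function f |f|.\<close>

lemma square_diff_le_signed_square: "(x - y)^2 \<le> 2 * \<bar>x * \<bar>x\<bar> - y * \<bar>y\<bar>\<bar>" for x y :: real
proof -
 have *: "(x - y)^2 \<le> 2 * \<bar>x * \<bar>x\<bar> - y * \<bar>y\<bar>\<bar>" if "\<bar>y\<bar> \<le> x" for x y :: real
 proof (cases "y \<ge> 0")
  case True
  then have "y * y \<le> x * y" "x * y \<le> x * x" using that by (auto intro: mult_mono)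
  then show ?thesis using True that by (simp add: power2_eq_square algebra_simps)
 next
  case False
  then show ?thesis using that zero_le_power2[of "x + y"] by (simp add: power2_eq_square algebra_simps abs_of_nonneg)
 qed
 consider "\<bar>y\<bar> \<le> x" | "\<bar>x\<bar> \<le> y" | "\<bar>y\<bar> \<le> - x" | "\<bar>x\<bar> \<le> - y" by linarith
 then show ?thesis
  using *[of y x] *[of x y] *[of "- y" "- x"] *[of "- x" "- y"] by cases (simp_all add: power2_commute abs_minus_commute add.commute)
qed

lemma L2_translation_continuous:
 fixes f :: "'a::euclidean_space => real"
 assumes f: "f \<in> L2" and h: "h ----> 0"
 shows "(%n. \<integral>x. (f (x + h n) - f x)^2) ----> 0"
proof (rule Lim_null_comparison)
 note [measurable] = L2_measurable[OF f]
 define g where "g x = f x * \<bar>f x\<bar>" for x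
 have g: "\<L> g" unfolding g_def[abs_def]
  by (rule integrable_squeeze[OF L2_integrable[OF f]]) (auto simp: abs_mult power2_eq_square)
 show "(%n. 2 * (\<integral>x. \<bar>g (x + h n) - g x\<bar>)) ----> 0"
  by (rule tendsto_mult_right_zero[OF L1_translation_continuous[OF g h]])
 have "(\<integral>x. (f (x + h n) - f x)^2) \<le> (\<integral>x. 2 * \<bar>g (x + h n) - g x\<bar>)" for n
  using g integrable_shift[OF g, of "h n"] square_diff_le_signed_square
  by (intro integral_mono L2_integrable L2_diff L2_shift f) (auto simp: g_def[abs_def])
 then show "\<forall>\<^sub>F n in sequentially. norm (\<integral>x. (f (x + h n) - f x)^2) \<le> 2 * (\<integral>x. \<bar>g (x + h n) - g x\<bar>)"
  by simp
qed

section \<open>Mollification\<close>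


text \<open>A product of one-dimensional bumps, because \<open>standard_mollifier\<close> lives on
  the real line; in dimension one it is the kernel occurring in \<open>b_eps\<close>, so that one
  theory of convolution covers both.\<close>

definition kern :: "(real => real) => real => 'a::euclidean_space => real" where
 "kern \<rho> \<delta> x = (\<Prod>i\<in>Basis. \<rho> (x \<bullet> i / \<delta>) / \<delta>)"

context
 fixes \<rho> :: "real => real" and \<delta> :: real
 assumes \<rho>: "standard_mollifier \<rho>" and \<delta>: "\<delta> > 0"
begin

lemma mollifier_measurable[measurable]: "\<rho> \<in> \<M>"
 using \<rho> by (auto simp: standard_mollifier_def dest!: spec[of _ 0] intro: borel_measurable_continuous_onI)

lemma mollifier_nonneg: "\<rho> r \<ge> 0"
 using \<rho> by (simp add: standard_mollifier_def)

lemma mollifier_integrable: "\<L> \<rho>"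
 using \<rho> not_integrable_integral_eq by (fastforce simp: standard_mollifier_def)

lemma mollifier_nn_integral: "(\<integral>\<^sup>+s. ennreal (\<rho> s)) = 1"
 using \<rho> by (subst nn_integral_eq_integral[OF mollifier_integrable])
  (simp_all add: standard_mollifier_def)

lemma kern_nonneg: "kern \<rho> \<delta> x \<ge> 0"
 unfolding kern_def using mollifier_nonneg \<delta> by (intro prod_nonneg) auto

lemma kern_support: assumes "kern \<rho> \<delta> (x::'a::euclidean_space) \<noteq> 0" shows "norm x \<le> real DIM('a) * \<delta>"
proof -
 have "\<bar>x \<bullet> i\<bar> \<le> \<delta>" if "i \<in> Basis" for i
 proof -
  have "\<rho> (x \<bullet> i / \<delta>) \<noteq> 0" using assms that by (auto simp: kern_def)
  then have "\<not> \<bar>x \<bullet> i / \<delta>\<bar> > 1" using \<rho> by (auto simp: standard_mollifier_def)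
  then show ?thesis using \<delta> by (simp add: abs_divide divide_le_eq)
 qed
 then have "(\<Sum>i\<in>Basis. \<bar>x \<bullet> i\<bar>) \<le> real DIM('a) * \<delta>"
  using sum_bounded_above[of Basis "%i. \<bar>x \<bullet> i\<bar>" \<delta>] by simp
 then show ?thesis using norm_le_l1[of x] by linarith
qed

lemma kern_test: "kern \<rho> \<delta> \<in> (test_functions :: ('a::euclidean_space => real) set)"
proof -
 have "C_k k (kern \<rho> \<delta> :: 'a => real)" for k
 proof -
  have "C_k k (%x::'a. \<rho> (x \<bullet> (inverse \<delta> *\<^sub>R i)) * inverse \<delta>)" for i
   by (rule C_k_mult[OF C_k_ridge[of k \<rho> "inverse \<delta> *\<^sub>R i"] C_k_const])
    (use \<rho> in \<open>simp add: standard_mollifier_def\<close>)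
  then have "C_k k (%x::'a. \<Prod>i\<in>Basis. \<rho> (x \<bullet> (inverse \<delta> *\<^sub>R i)) * inverse \<delta>)"
   by (rule C_k_prod[OF finite_Basis])
  moreover have "(%x::'a. \<Prod>i\<in>Basis. \<rho> (x \<bullet> (inverse \<delta> *\<^sub>R i)) * inverse \<delta>) = kern \<rho> \<delta>"
   unfolding kern_def by (intro ext prod.cong refl) (simp only: divide_inverse inner_scaleR_right mult.commute[of "inverse \<delta>"])
  ultimately show ?thesis by simp
 qed
 moreover have "bounded {x::'a. kern \<rho> \<delta> x \<noteq> 0}"
  using kern_support by (auto simp: bounded_iff)
 ultimately show ?thesis by (simp add: test_functions_def compactly_supported_iff)
qed

lemma kern_measurable[measurable]: "kern \<rho> \<delta> \<in> borel_measurable (borel :: 'a::euclidean_space measure)"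
 by (rule test_measurable[OF kern_test])

lemma kern_nn_integral: "(\<integral>\<^sup>+x. ennreal (kern \<rho> \<delta> (x::'a::euclidean_space))) = 1"
proof -
 have "(\<integral>\<^sup>+x. ennreal (kern \<rho> \<delta> (x::'a))) = (\<integral>\<^sup>+x. (\<Prod>i\<in>Basis. ennreal (\<rho> (x \<bullet> i / \<delta>) / \<delta>)) \<partial>(lborel::'a measure))"
  unfolding kern_def using mollifier_nonneg \<delta> by (subst prod_ennreal) auto
 also have "\<dots> = (\<Prod>i\<in>(Basis::'a set). (\<integral>\<^sup>+s. ennreal (\<rho> (s / \<delta>) / \<delta>)))"
  by (rule nn_integral_lborel_prod[where f="%i s. ennreal (\<rho> (s / \<delta>) / \<delta>)"]) auto
 also have "(\<integral>\<^sup>+s. ennreal (\<rho> (s / \<delta>) / \<delta>)) = 1"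
 proof -
  have "(\<integral>\<^sup>+s. ennreal (\<rho> (s / \<delta>) / \<delta>)) = ennreal \<delta> * (\<integral>\<^sup>+s. ennreal (\<rho> ((0 + \<delta> * s) / \<delta>) / \<delta>))"
   using \<delta> by (subst nn_integral_real_affine[of _ \<delta> 0]) auto
  also have "\<dots> = (\<integral>\<^sup>+s. ennreal (\<rho> s))"
   using \<delta> by (subst nn_integral_cmult[symmetric]) (auto simp: ennreal_mult'[symmetric])
  finally show ?thesis using mollifier_nn_integral by simp
 qed
 finally show ?thesis by simp
qed

lemma kern_integrable: "\<L> (kern \<rho> \<delta> :: 'a::euclidean_space => real)"
 by (rule integrableI_nonneg) (use kern_nonneg kern_nn_integral[where 'a='a] in auto)

lemma kern_integral: "(\<integral>x. kern \<rho> \<delta> (x::'a::euclidean_space)) = 1"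
 using kern_nn_integral kern_nonneg
 by (subst integral_eq_nn_integral) auto

end

section \<open>Convolution with test functions and the limit of shrinking kernels\<close>

definition conv :: "('a::euclidean_space => real) => ('a => real) => 'a => real" where
 "conv h \<phi> x = (\<integral>z. h z * \<phi> (x - z))"

lemma conv_measurable[measurable (raw)]:
 fixes h \<phi> :: "'a::euclidean_space => real"
 assumes [measurable]: "h \<in> \<M>" "\<phi> \<in> \<M>"
 shows "conv h \<phi> \<in> \<M>"
 unfolding conv_def[abs_def] by measurable

lemma conv_alt:
 fixes h \<phi> :: "'a::euclidean_space => real"
 assumes [measurable]: "h \<in> \<M>" "\<phi> \<in> \<M>"
 shows "conv h \<phi> x = (\<integral>k. h (x - k) * \<phi> k)"
 unfolding conv_def using integral_reflect_shift[of "%z. h z * \<phi> (x - z)" x] by simp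

lemma L1_loc_measurable[measurable_dest]: "h \<in> L1_loc ==> h \<in> \<M>"
 by (simp add: L1_loc_def)

lemma emeasure_compact_finite: "compact K ==> emeasure lborel K < \<infinity>"
 using emeasure_bounded_finite[of K] compact_imp_bounded by blast

lemma L2_L1_loc: assumes "f \<in> L2" shows "f \<in> L1_loc"
proof -
 have "set_integrable lborel K f" if "compact K" for K
 proof -
  have [measurable]: "K \<in> sets borel" using that by (simp add: borel_compact)
  have e: "(%x. (indicator K x :: real)^2) = indicator K" by (auto simp: indicator_def)
  have "(indicator K :: 'a => real) \<in> L2"
   using emeasure_compact_finite[OF that] by (intro L2_I) (simp_all add: integrable_indicator_iff e)
  from L2_mult[OF this assms] show ?thesis by (simp add: set_integrable_def)
 qed
 then show ?thesis using assms by (simp add: L1_loc_def L2_measurable)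
qed

lemma L1_L1_loc: assumes "\<L> f" shows "f \<in> L1_loc"
proof -
 have "set_integrable lborel K f" if "compact K" for K
  using set_integrable_subset[of lborel UNIV f K] assms that by (simp add: set_integrable_def borel_compact)
 then show ?thesis using assms by (auto simp: L1_loc_def)
qed

lemma Linf_L1_loc: assumes [measurable]: "f \<in> \<M>" and "AE x. \<bar>f x\<bar> \<le> M" shows "f \<in> L1_loc"
proof -
 have "set_integrable lborel K f" if "compact K" for K
  unfolding set_integrable_def
 proof (rule integrable_squeeze)
  have [measurable]: "K \<in> sets borel" using that by (simp add: borel_compact)
  show "\<L> (%x. M * indicator K x)"
   using emeasure_compact_finite[OF that] by (simp add: integrable_indicator_iff)
  show "(%x. indicator K x *\<^sub>R f x) \<in> \<M>" by measurable
  show "AE x. \<bar>indicator K x *\<^sub>R f x\<bar> \<le> M * indicator K x"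
   using assms(2) by eventually_elim (simp add: indicator_def)
 qed
 then show ?thesis by (simp add: L1_loc_def)
qed

lemma conv_integrable:
 assumes "h \<in> L1_loc" "\<phi> \<in> test_functions"
 shows "\<L> (%z. h z * \<phi> (x - z))"
 by (rule test_integrable_mult[OF test_reflect[OF assms(2)] assms(1)])

lemma conv_integrable':
 assumes "h \<in> L1_loc" "\<phi> \<in> test_functions"
 shows "\<L> (%k. h (x - k) * \<phi> k)"
 using integrable_reflect_shift[OF conv_integrable[OF assms, of x], of x] by simp

lemma test_integrable: assumes "\<phi> \<in> test_functions" shows "\<L> \<phi>"
 using test_integrable_mult[OF assms, of "%_. 1"] Linf_L1_loc[of "%_. 1" 1] by simp

text \<open>Young's inequality for L^2 and L^1, via Jensen with weight |\<phi>| and Tonelli. It is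
  stated for general test functions since it is also applied to derivatives of the kernel.\<close>

lemma conv_L2:
 assumes h: "h \<in> L2" and \<phi>: "\<phi> \<in> test_functions"
 shows "conv h \<phi> \<in> L2"
proof -
 note [measurable] = L2_measurable[OF h] test_measurable[OF \<phi>]
 define c where "c = (\<integral>x. \<bar>\<phi> x\<bar>)"
 let ?I = "%x. \<integral>\<^sup>+k. ennreal ((h (x - k))^2 * \<bar>\<phi> k\<bar>)"
 let ?N = "\<integral>\<^sup>+x. ennreal ((h x)^2)"
 have ia: "\<L> (%x. \<bar>\<phi> x\<bar>)" using test_integrable[OF \<phi>] by auto
 have 1: "ennreal ((conv h \<phi> x)^2) \<le> ennreal c * ?I x" for x
 proof -
  \<comment> \<open>\<phi> may change sign, whereas Jensen needs a nonnegative weight; the sign is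
    moved to the other factor and disappears when squared.\<close>
  have e: "h (x - k) * \<phi> k = h (x - k) * sgn (\<phi> k) * \<bar>\<phi> k\<bar>" for k by (simp add: sgn_real_def abs_if)
  have "ennreal ((conv h \<phi> x)^2) \<le> ennreal c * (\<integral>\<^sup>+k. ennreal ((h (x - k) * sgn (\<phi> k))^2 * \<bar>\<phi> k\<bar>))"
   unfolding conv_alt[OF L2_measurable[OF h] test_measurable[OF \<phi>]] c_def e
   using ia by (intro jensen_square) auto
  also have "\<dots> = ennreal c * ?I x"
   by (intro arg_cong2[where f="(*)"] refl nn_integral_cong) (auto simp: sgn_real_def power_mult_distrib)
  finally show ?thesis .
 qed
 have hn: "?N < \<infinity>"
  using L2_integrable[OF h] by (simp add: integrable_iff_bounded)
 have "(\<integral>\<^sup>+x. ennreal ((conv h \<phi> x)^2)) \<le>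
   (\<integral>\<^sup>+x. ennreal c * ?I x)"
  by (intro nn_integral_mono 1)
 also have "\<dots> = ennreal c * (\<integral>\<^sup>+x. ?I x)"
  by (rule nn_integral_cmult) measurable
 also have "(\<integral>\<^sup>+x. ?I x) =
  (\<integral>\<^sup>+k. (\<integral>\<^sup>+x. ennreal ((h (x - k))^2 * \<bar>\<phi> k\<bar>)))"
  by (rule lborel_pair.Fubini') measurable
 also have "\<dots> = (\<integral>\<^sup>+k. ?N * ennreal \<bar>\<phi> k\<bar>)"
 proof (rule nn_integral_cong)
  fix k
  have "(\<integral>\<^sup>+x. ennreal ((h (x - k))^2 * \<bar>\<phi> k\<bar>)) = (\<integral>\<^sup>+x. ennreal ((h (x - k))^2)) * ennreal \<bar>\<phi> k\<bar>"
   by (simp add: ennreal_mult nn_integral_multc)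
  also have "(\<integral>\<^sup>+x. ennreal ((h (x - k))^2)) = ?N"
   using nn_integral_shift[of "%x. ennreal ((h x)^2)" "- k"] by simp
  finally show "(\<integral>\<^sup>+x. ennreal ((h (x - k))^2 * \<bar>\<phi> k\<bar>)) =
   ?N * ennreal \<bar>\<phi> k\<bar>" .
 qed
 also have "\<dots> = ?N * ennreal c"
  unfolding c_def using ia by (simp add: nn_integral_cmult nn_integral_eq_integral)
 also have "ennreal c * \<dots> < \<infinity>" using hn by (simp add: ennreal_mult_less_top)
 finally have "\<L> (%x. (conv h \<phi> x)^2)" by (intro integrableI_nonneg) auto
 then show ?thesis by (intro L2_I) auto
qed

lemma conv_bounded:
 assumes h[measurable]: "h \<in> \<M>" "AE z in lborel. \<bar>h z\<bar> \<le> M" and \<phi>: "\<phi> \<in> test_functions"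
 shows "\<bar>conv h \<phi> x\<bar> \<le> M * (\<integral>z. \<bar>\<phi> z\<bar>)"
proof -
 have i: "\<L> (%z. \<bar>\<phi> (x - z)\<bar>)"
  using integrable_reflect_shift[OF test_integrable[OF \<phi>]] by auto
 have "\<bar>conv h \<phi> x\<bar> \<le> (\<integral>z. \<bar>h z * \<phi> (x - z)\<bar>)"
  unfolding conv_def by (rule integral_abs_bound)
 also have "\<dots> \<le> (\<integral>z. M * \<bar>\<phi> (x - z)\<bar>)"
  by (rule integral_mono_abs) (use i \<phi>[THEN test_measurable] h in \<open>auto simp: abs_mult elim!: eventually_mono intro: mult_right_mono\<close>)
 also have "\<dots> = M * (\<integral>z. \<bar>\<phi> z\<bar>)"
  using integral_reflect_shift[of "%z. \<bar>\<phi> z\<bar>" x] test_measurable[OF \<phi>] by simp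
 finally show ?thesis .
qed

lemma conv_diff_kern:
 fixes h :: "'a::euclidean_space => real"
 assumes "standard_mollifier \<rho>" "\<delta> > 0" and h: "h \<in> L1_loc"
 shows "conv h (kern \<rho> \<delta>) x - h x = (\<integral>k. (h (x - k) - h x) * kern \<rho> \<delta> k)"
proof -
 have 1: "(\<integral>k. kern \<rho> \<delta> (k::'a)) = 1" by (rule kern_integral[OF assms(1,2)])
 have 2: "kern \<rho> \<delta> \<in> borel_measurable (borel :: 'a measure)" by (rule kern_measurable[OF assms(1,2)])
 have "conv h (kern \<rho> \<delta>) x - h x = (\<integral>k. h (x - k) * kern \<rho> \<delta> k) - (\<integral>k. h x * kern \<rho> \<delta> (k::'a))"
  by (simp add: conv_alt[OF L1_loc_measurable[OF h] 2] 1)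
 also have "\<dots> = (\<integral>k. h (x - k) * kern \<rho> \<delta> k - h x * kern \<rho> \<delta> k)"
  using conv_integrable'[OF h kern_test[OF assms(1,2)], of x] kern_integrable[OF assms(1,2)]
  by (intro Bochner_Integration.integral_diff[symmetric]) auto
 finally show ?thesis by (simp add: left_diff_distrib)
qed

text \<open>Tonelli and the unit mass of the kernel: an average over shifts in the support of the
  kernel inherits any bound that is uniform over these shifts. It serves both the L^2 and the
  weighted L^1 estimate.\<close>

lemma kern_average_le:
 fixes \<Psi> :: "'a::euclidean_space => 'a => real"
 assumes \<rho>: "standard_mollifier \<rho>" "\<delta> > 0" and e: "e \<ge> 0"
  and \<Psi>[measurable]: "case_prod \<Psi> \<in> borel_measurable (borel \<Otimes>\<^sub>M borel)" "!!k. \<L> (%x. \<Psi> x k)" "!!x k. 0 \<le> \<Psi> x k"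
  and le: "!!k. norm k \<le> real DIM('a) * \<delta> ==> (\<integral>x. \<Psi> x k) \<le> e"
  and g: "!!x. 0 \<le> g x" "!!x. ennreal (g x) \<le> (\<integral>\<^sup>+k. ennreal (\<Psi> x k * kern \<rho> \<delta> k))"
 shows "(\<integral>x. g x) \<le> e"
proof -
 let ?K = "kern \<rho> \<delta> :: 'a => real"
 have [measurable]: "?K \<in> \<M>" by (rule kern_measurable[OF \<rho>])
 have "(\<integral>\<^sup>+x. ennreal (g x)) \<le> (\<integral>\<^sup>+x. (\<integral>\<^sup>+k. ennreal (\<Psi> x k * ?K k)))"
  by (intro nn_integral_mono g)
 also have "\<dots> = (\<integral>\<^sup>+k. (\<integral>\<^sup>+x. ennreal (\<Psi> x k * ?K k)))"
  by (rule lborel_pair.Fubini') measurable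
 also have "\<dots> \<le> (\<integral>\<^sup>+k. ennreal e * ennreal (?K k))"
 proof (rule nn_integral_mono)
  fix k
  have "(\<integral>\<^sup>+x. ennreal (\<Psi> x k * ?K k)) = ennreal (\<integral>x. \<Psi> x k) * ennreal (?K k)"
   using kern_nonneg[OF \<rho>, of k] \<Psi>(2,3) borel_measurable_integrable[OF \<Psi>(2)[of k]]
   by (simp add: ennreal_mult nn_integral_multc nn_integral_eq_integral)
  also have "\<dots> \<le> ennreal e * ennreal (?K k)"
  proof (cases "?K k = 0")
   case False
   from le[OF kern_support[OF \<rho> this]] show ?thesis by (intro mult_right_mono ennreal_leI) auto
  qed simp
  finally show "(\<integral>\<^sup>+x. ennreal (\<Psi> x k * ?K k)) \<le> ennreal e * ennreal (?K k)" .
 qed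
 also have "\<dots> = ennreal e" using kern_nn_integral[OF \<rho>, where 'a='a] by (simp add: nn_integral_cmult)
 finally show ?thesis using e g(1) by (intro integral_real_bounded) auto
qed

lemma conv_kern_L2_le:
 assumes \<rho>: "standard_mollifier \<rho>" "\<delta> > 0" and h: "h \<in> L2" and e: "e \<ge> 0"
  and le: "!!k. norm k \<le> real DIM('a) * \<delta> ==> (\<integral>x. (h (x - k) - h (x::'a::euclidean_space))^2) \<le> e"
 shows "(\<integral>x. (conv h (kern \<rho> \<delta>) x - h x)^2) \<le> e"
proof (rule kern_average_le[OF \<rho> e _ _ _ le])
 note [measurable] = L2_measurable[OF h]
 show "(%(x, k). (h (x - k) - h x)^2) \<in> borel_measurable (borel \<Otimes>\<^sub>M borel)" by measurable
 show "\<L> (%x. (h (x - k) - h x)^2)" for k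
  using L2_integrable[OF L2_diff[OF L2_shift[OF h, of "- k"] h]] by simp
 show "ennreal ((conv h (kern \<rho> \<delta>) x - h x)^2) \<le> (\<integral>\<^sup>+k. ennreal ((h (x - k) - h x)^2 * kern \<rho> \<delta> k))" for x
  unfolding conv_diff_kern[OF \<rho> L2_L1_loc[OF h]]
  using jensen_square[of "%k. h (x - k) - h x" "kern \<rho> \<delta>"] kern_integrable[OF \<rho>, where 'a='a] kern_nonneg[OF \<rho>, where 'a='a] kern_integral[OF \<rho>, where 'a='a] by simp
qed auto

text \<open>The weight makes room for an \<open>h\<close> that is bounded without being integrable:
  \<open>divergence_sign\<close> applies it to the components of \<open>D\<close>, weighted by the
  absolute value of \<open>q' i\<close>.\<close>

lemma conv_kern_weighted_le:
 fixes h p :: "'a::euclidean_space => real"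
 assumes \<rho>: "standard_mollifier \<rho>" "\<delta> > 0" and h: "h \<in> L1_loc" and e: "e \<ge> 0"
  and p[measurable]: "p \<in> \<M>" "!!x. 0 \<le> p x" and i: "!!k. \<L> (%x. p x * \<bar>h (x - k) - h x\<bar>)"
  and le: "!!k. norm k \<le> real DIM('a) * \<delta> ==> (\<integral>x. p x * \<bar>h (x - k) - h x\<bar>) \<le> e"
 shows "(\<integral>x. p x * \<bar>conv h (kern \<rho> \<delta>) x - h x\<bar>) \<le> e"
proof (rule kern_average_le[OF \<rho> e _ i _ le])
 note [measurable] = L1_loc_measurable[OF h]
 show "(%(x, k). p x * \<bar>h (x - k) - h x\<bar>) \<in> borel_measurable (borel \<Otimes>\<^sub>M borel)" by measurable
 fix x
 have "\<L> (%k. p x * ((h (x - k) - h x) * kern \<rho> \<delta> k))"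
  using conv_integrable'[OF h kern_test[OF \<rho>], of x] kern_integrable[OF \<rho>, where 'a='a] by (simp add: left_diff_distrib)
 from integral_norm_bound_ennreal[OF this] kern_nonneg[OF \<rho>, where 'a='a] p(2)[of x]
 show "ennreal (p x * \<bar>conv h (kern \<rho> \<delta>) x - h x\<bar>) \<le> (\<integral>\<^sup>+k. ennreal (p x * \<bar>h (x - k) - h x\<bar> * kern \<rho> \<delta> k))"
  unfolding conv_diff_kern[OF \<rho> h] by (simp add: abs_mult mult.assoc)
qed (use p(2) in auto)

lemma small_translation_bound:
 fixes F :: "'a::euclidean_space => real"
 assumes "!!h. h ----> 0 ==> (%n. F (h n)) ----> 0" and "e > 0"
 obtains d where "d > 0" "!!k. norm k < d ==> F k \<le> e"
proof -
 have "\<exists>d>0. \<forall>k. norm k < d \<longrightarrow> F k \<le> e"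
 proof (rule ccontr)
  assume "\<not> ?thesis"
  then have "\<forall>n::nat. \<exists>k. norm k < inverse (real (Suc n)) \<and> F k > e"
   by (metis inverse_positive_iff_positive not_le of_nat_0_less_iff zero_less_Suc)
  then obtain h where h: "!!n. norm (h n) < inverse (real (Suc n))" "!!n. F (h n) > e" by metis
  have "h ----> 0"
   by (rule Lim_null_comparison[OF always_eventually LIMSEQ_inverse_real_of_nat])
    (use h(1) less_imp_le in blast)
  from assms(1)[OF this] have "0 \<ge> e"
   by (rule LIMSEQ_le_const) (use h(2) in \<open>auto intro: less_imp_le\<close>)
  with \<open>e > 0\<close> show False by simp
 qed
 then show thesis using that by blast
qed

text \<open>The common last step of all mollification limits: whatever bounds F on the shrinking
  support of the kernel bounds T n. The argument \<open>- k\<close> occurs because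
  \<open>conv_alt\<close> averages h (x - k).\<close>

lemma kern_scale_tendsto:
 fixes F :: "'a::euclidean_space => real"
 assumes T: "!!n e. e \<ge> 0 ==> (!!k. norm k \<le> real DIM('a) * \<delta> n ==> F (- k) \<le> e) ==> T n \<le> e" "!!n. 0 \<le> T n"
  and F: "!!h. h ----> 0 ==> (%n. F (h n)) ----> 0" and \<delta>: "\<delta> ----> 0"
 shows "T ----> 0"
proof (rule LIMSEQ_I)
 fix r :: real assume r: "r > 0"
 obtain d where d: "d > 0" "!!k. norm k < d ==> F k \<le> r / 2" using small_translation_bound[of F "r / 2", OF F] r by auto
 have "(%n. real DIM('a) * \<delta> n) ----> 0" using tendsto_mult_right_zero[OF \<delta>] by simp
 from order_tendstoD(2)[OF this d(1)]
 obtain N where N: "!!n. n \<ge> N ==> real DIM('a) * \<delta> n < d" by (auto simp: eventually_sequentially)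
 have "T n \<le> r / 2" if "n \<ge> N" for n
 proof (rule T(1))
  show "F (- k) \<le> r / 2" if "norm k \<le> real DIM('a) * \<delta> n" for k
   using d(2)[of "- k"] that N[OF \<open>n \<ge> N\<close>] by simp
 qed (use r in simp)
 then show "\<exists>no. \<forall>n\<ge>no. norm (T n - 0) < r" using r T(2) by (intro exI[of _ N]) force
qed

lemma conv_kern_L2_tendsto:
 fixes h :: "'a::euclidean_space => real"
 assumes \<rho>: "standard_mollifier \<rho>" and h: "h \<in> L2" and \<delta>: "!!n. \<delta> n > 0" "\<delta> ----> 0"
 shows "(%n. \<integral>x. (conv h (kern \<rho> (\<delta> n)) x - h x)^2) ----> 0"
 by (rule kern_scale_tendsto[OF conv_kern_L2_le[OF \<rho> \<delta>(1) h] _ L2_translation_continuous[OF h] \<delta>(2)]) auto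

lemma conv_kern_L1_tendsto:
 fixes h :: "'a::euclidean_space => real"
 assumes \<rho>: "standard_mollifier \<rho>" and h: "\<L> h" and \<delta>: "!!n. \<delta> n > 0" "\<delta> ----> 0"
 shows "(%n. \<integral>x. \<bar>conv h (kern \<rho> (\<delta> n)) x - h x\<bar>) ----> 0"
proof (rule kern_scale_tendsto[OF _ _ _ \<delta>(2), where F="%k. \<integral>x. \<bar>h (x + k) - h x\<bar>"])
 show "(\<integral>x. \<bar>conv h (kern \<rho> (\<delta> n)) x - h x\<bar>) \<le> e"
  if "e \<ge> 0" "!!k. norm k \<le> real DIM('a) * \<delta> n ==> (\<integral>x. \<bar>h (x + - k) - h x\<bar>) \<le> e" for n e
 proof -
  have "\<L> (%x. h (x - k))" for k using integrable_shift[OF h, of "- k"] by simp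
  then show ?thesis using conv_kern_weighted_le[OF \<rho> \<delta>(1) L1_L1_loc[OF h] that(1), of "%_. 1" n] that(2) h by simp
 qed
 show "(%n. \<integral>x. \<bar>h (x + k n) - h x\<bar>) ----> 0" if "k ----> 0" for k
  by (rule L1_translation_continuous[OF h that])
qed auto

section \<open>Directional derivatives\<close>


text \<open>Differentiability along one line direction at every point. Products, compositions and
  integration by parts along coordinate lines can all be done at this level, without Frechet
  derivatives of the factors.\<close>

definition has_dderiv :: "('a::euclidean_space => real) => 'a => ('a => real) => bool" where
 "has_dderiv p w p' \<longleftrightarrow> (\<forall>x. ((%r. p (x + r *\<^sub>R w)) has_real_derivative p' x) (at 0))"

lemma has_dderiv_at:
 assumes "has_dderiv p w p'"
 shows "((%r. p (x + r *\<^sub>R w)) has_real_derivative p' (x + r *\<^sub>R w)) (at r within S)"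
proof -
 have "((%t. p ((x + r *\<^sub>R w) + t *\<^sub>R w)) has_real_derivative p' (x + r *\<^sub>R w)) (at 0)"
  using assms by (simp add: has_dderiv_def)
 then have "((%t. p (x + (t + r) *\<^sub>R w)) has_real_derivative p' (x + r *\<^sub>R w)) (at 0)"
  by (simp add: algebra_simps)
 then have "((%t. p (x + t *\<^sub>R w)) has_real_derivative p' (x + r *\<^sub>R w)) (at (0 + r))"
  by (subst DERIV_shift)
 then show ?thesis by (simp add: has_field_derivative_at_within)
qed

lemma has_dderiv_mult:
 assumes "has_dderiv p w p'" "has_dderiv q w q'"
 shows "has_dderiv (%x. p x * q x) w (%x. p x * q' x + p' x * q x)"
 unfolding has_dderiv_def
proof
 fix x
 have "((%r. p (x + r *\<^sub>R w)) has_real_derivative p' x) (at 0)" "((%r. q (x + r *\<^sub>R w)) has_real_derivative q' x) (at 0)"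
  using assms by (auto simp: has_dderiv_def)
 from DERIV_mult[OF this] show "((%r. p (x + r *\<^sub>R w) * q (x + r *\<^sub>R w)) has_real_derivative p x * q' x + p' x * q x) (at 0)"
  by (simp add: algebra_simps)
qed

lemma has_dderiv_diff:
 assumes "has_dderiv p w p'" "has_dderiv q w q'"
 shows "has_dderiv (%x. p x - q x) w (%x. p' x - q' x)"
 using assms unfolding has_dderiv_def by (auto intro!: derivative_eq_intros)

lemma has_dderiv_chain:
 assumes "has_dderiv p w p'" "!!r. (S has_real_derivative T r) (at r)"
 shows "has_dderiv (%x. S (p x)) w (%x. T (p x) * p' x)"
 unfolding has_dderiv_def
proof
 fix x
 have 1: "((%r. p (x + r *\<^sub>R w)) has_real_derivative p' x) (at 0)"
  using assms by (auto simp: has_dderiv_def)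
 show "((%r. S (p (x + r *\<^sub>R w))) has_real_derivative T (p x) * p' x) (at 0)"
  by (rule DERIV_chain2[OF _ 1]) (use assms(2)[of "p x"] in simp)
qed

lemma has_dderiv_frechet:
 assumes "!!x. (f has_derivative f' x) (at x)"
 shows "has_dderiv f w (%x. f' x w)"
 unfolding has_dderiv_def
proof
 fix x
 have 1: "((%r::real. x + r *\<^sub>R w) has_derivative (%r. r *\<^sub>R w)) (at 0)"
  by (auto intro!: derivative_eq_intros)
 have 2: "(f has_derivative f' x) (at (x + 0 *\<^sub>R w))" using assms by simp
 have "linear (f' x)" using assms has_derivative_linear by blast
 then have "(%r. f' x (r *\<^sub>R w)) = (%r. f' x w * r)" by (auto simp: linear_cmul)
 with has_derivative_compose[OF 1 2]
 show "((%r. f (x + r *\<^sub>R w)) has_real_derivative f' x w) (at 0)"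
  by (simp add: has_field_derivative_def)
qed

lemma frechet_derivative_sum_Basis:
 fixes f :: "'a::euclidean_space => real"
 assumes "(f has_derivative frechet_derivative f (at x)) (at x)"
 shows "frechet_derivative f (at x) w = (\<Sum>i\<in>Basis. (w \<bullet> i) * part_deriv i f x)"
proof -
 interpret l: linear "frechet_derivative f (at x)" using assms has_derivative_linear by blast
 have "frechet_derivative f (at x) w = frechet_derivative f (at x) (\<Sum>i\<in>Basis. (w \<bullet> i) *\<^sub>R i)"
  by (simp add: euclidean_representation)
 then show ?thesis by (simp add: l.sum l.scale part_deriv_def)
qed

lemma C_1_has_dderiv:
 fixes f :: "'a::euclidean_space => real"
 assumes "C_k 1 f"
 shows "has_dderiv f w (%x. \<Sum>i\<in>Basis. (w \<bullet> i) * part_deriv i f x)"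
proof -
 have d: "(f has_derivative frechet_derivative f (at x)) (at x)" for x
  using assms by (simp add: differentiable_on_eq_differentiable_at frechet_derivative_works)
 from has_dderiv_frechet[OF d, of w] show ?thesis
  using frechet_derivative_sum_Basis[OF d] by simp
qed

lemma C_1_has_dderiv_Basis:
 fixes f :: "'a::euclidean_space => real"
 assumes "C_k 1 f" "i \<in> Basis"
 shows "has_dderiv f i (part_deriv i f)"
proof -
 have "(\<Sum>j\<in>Basis. (i \<bullet> j) * part_deriv j f x) = part_deriv i f x" for x
  using assms(2) by (simp add: inner_Basis if_distrib[of "%a. a * _"] cong: if_cong)
 then show ?thesis using C_1_has_dderiv[OF assms(1), of i] by simp
qed

lemma conv_sum_kernel:
 assumes "h \<in> L1_loc" "!!i. i \<in> I ==> \<phi> i \<in> test_functions" "finite I"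
 shows "conv h (%y. \<Sum>i\<in>I. c i * \<phi> i y) x = (\<Sum>i\<in>I. c i * conv h (\<phi> i) x)"
proof -
 have "conv h (%y. \<Sum>i\<in>I. c i * \<phi> i y) x = (\<integral>z. (\<Sum>i\<in>I. c i * (h z * \<phi> i (x - z))))"
  unfolding conv_def by (simp add: sum_distrib_left mult.left_commute)
 also have "\<dots> = (\<Sum>i\<in>I. c i * conv h (\<phi> i) x)"
  unfolding conv_def using conv_integrable[OF assms(1,2)] by (subst Bochner_Integration.integral_sum) auto
 finally show ?thesis .
qed

text \<open>Differentiation under the integral for a factor \<open>h\<close> that is only locally
  integrable: the difference quotients of \<phi> are bounded by its Lipschitz constant and supported
  in one compact set.\<close>

lemma conv_has_dderiv:
 fixes h :: "'a::euclidean_space => real"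
 assumes h: "h \<in> L1_loc" and \<phi>: "\<phi> \<in> test_functions"
 shows "has_dderiv (conv h \<phi>) w (%x. \<Sum>i\<in>Basis. (w \<bullet> i) * conv h (part_deriv i \<phi>) x)"
proof -
 define \<phi>' where "\<phi>' y = (\<Sum>i\<in>Basis. (w \<bullet> i) * part_deriv i \<phi> y)" for y
 have dd: "has_dderiv \<phi> w \<phi>'"
  unfolding \<phi>'_def using C_1_has_dderiv test_C_k[OF \<phi>] by blast
 have pd: "part_deriv i \<phi> \<in> test_functions" if "i \<in> Basis" for i
  by (rule test_part_deriv[OF \<phi> that])
 note [measurable] = L1_loc_measurable[OF h] test_measurable[OF \<phi>]
 have [measurable]: "\<phi>' \<in> \<M>"
  unfolding \<phi>'_def using test_measurable[OF pd] by (intro borel_measurable_sum) auto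
 have "\<forall>i\<in>Basis. \<exists>B. \<forall>y. \<bar>part_deriv i \<phi> y\<bar> \<le> B" using test_bounded[OF pd] by blast
 then obtain Bi where Bi: "!!i y. i \<in> Basis ==> \<bar>part_deriv i \<phi> y\<bar> \<le> Bi i" by metis
 define B where "B = (\<Sum>i\<in>Basis. \<bar>w \<bullet> i\<bar> * Bi i)"
 have B: "\<bar>\<phi>' y\<bar> \<le> B" for y
  unfolding \<phi>'_def B_def
  by (intro order_trans[OF sum_abs] sum_mono) (simp add: abs_mult mult_left_mono Bi)
 obtain R where R: "!!y. \<phi> y \<noteq> 0 ==> norm y \<le> R"
  using test_supp[OF \<phi>] by (auto simp: bounded_iff)
 have lip: "\<bar>\<phi> (y + r *\<^sub>R w) - \<phi> y\<bar> \<le> B * \<bar>r\<bar>" for y r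
  using field_differentiable_bound[of UNIV "%r. \<phi> (y + r *\<^sub>R w)" "%r. \<phi>' (y + r *\<^sub>R w)" B r 0]
   has_dderiv_at[OF dd] B by simp
 have "((%r. conv h \<phi> (x + r *\<^sub>R w)) has_real_derivative conv h \<phi>' x) (at 0)" for x
  unfolding has_field_derivative_iff tendsto_at_iff_sequentially
 proof (intro allI impI)
  fix s :: "nat => real" assume s: "\<forall>i. s i \<in> UNIV - {0}" "s ----> 0"
  obtain C where C: "!!n. \<bar>s n\<bar> \<le> C"
   using s(2) by (metis Bseq_def convergentI convergent_imp_Bseq real_norm_def)
  \<comment> \<open>Large enough to contain the supports of z -> \<phi>(x - z + s n w) for all n at
    once, since |s n| <= C.\<close>
  define K where "K = cball x (R + C * norm w)"
  let ?q = "%n z. (\<phi> (x - z + s n *\<^sub>R w) - \<phi> (x - z)) / s n"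
  have Kc: "compact K" unfolding K_def by simp
  have [measurable]: "K \<in> sets borel" unfolding K_def by simp
  have "(%n. \<integral>z. h z * ?q n z) ----> (\<integral>z. h z * \<phi>' (x - z))"
  proof (rule integral_dominated_convergence[where w="%z. B * \<bar>indicator K z *\<^sub>R h z\<bar>"])
   show "\<L> (%z. B * \<bar>indicator K z *\<^sub>R h z\<bar>)"
    using h Kc by (auto simp: L1_loc_def set_integrable_def simp del: real_scaleR_def)
   show "AE z in lborel. (%n. h z * ?q n z) ----> h z * \<phi>' (x - z)"
   proof (intro AE_I2 tendsto_mult_left)
    fix z
    have "((%r. \<phi> (x - z + r *\<^sub>R w)) has_real_derivative \<phi>' (x - z)) (at 0)"
     using dd by (simp add: has_dderiv_def)
    then show "(%n. ?q n z) ----> \<phi>' (x - z)"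
     unfolding has_field_derivative_iff tendsto_at_iff_sequentially using s by (force simp: o_def)
   qed
   show "AE z in lborel. norm (h z * ?q n z) \<le> B * \<bar>indicator K z *\<^sub>R h z\<bar>" for n
   proof (intro AE_I2)
    fix z
    have sn: "s n \<noteq> 0" using s(1) by auto
    show "norm (h z * ?q n z) \<le> B * \<bar>indicator K z *\<^sub>R h z\<bar>"
    proof (cases "z \<in> K")
     case True
     have "\<bar>(?q n z)\<bar> \<le> B"
      using lip[of "x - z" "s n"] sn by (simp add: abs_divide divide_le_eq)
     from mult_left_mono[OF this, of "\<bar>h z\<bar>"] True show ?thesis by (simp add: abs_mult mult.commute)
    next
     case False
     have far: "norm (x - z) > R + C * norm w" using False by (simp add: K_def dist_norm)
     have "norm (s n *\<^sub>R w) \<le> C * norm w" using C[of n] by (simp add: mult_right_mono)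
     then have "norm (x - z + s n *\<^sub>R w) > R"
      using far norm_triangle_ineq2[of "x - z" "- (s n *\<^sub>R w)"] by simp
     moreover have "norm (x - z) > R" using far C[of n]
      by (smt (verit) mult_nonneg_nonneg norm_ge_zero)
     ultimately have "\<phi> (x - z + s n *\<^sub>R w) = 0" "\<phi> (x - z) = 0" using R by force+
     then show ?thesis using False by simp
    qed
   qed
  qed measurable
  moreover have "(conv h \<phi> (x + s n *\<^sub>R w) - conv h \<phi> x) / s n =
   (\<integral>z. h z * ?q n z)" for n
  proof -
   have e: "x + s n *\<^sub>R w - z = x - z + s n *\<^sub>R w" for z by simp
   have "conv h \<phi> (x + s n *\<^sub>R w) - conv h \<phi> x = (\<integral>z. h z * \<phi> (x - z + s n *\<^sub>R w) - h z * \<phi> (x - z))"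
    unfolding conv_def using conv_integrable[OF h \<phi>, of x] conv_integrable[OF h \<phi>, of "x + s n *\<^sub>R w"]
    by (simp add: e)
   also have "\<dots> / s n = (\<integral>z. (h z * \<phi> (x - z + s n *\<^sub>R w) - h z * \<phi> (x - z)) / s n)"
    by simp
   finally show ?thesis by (simp add: right_diff_distrib diff_divide_distrib)
  qed
  ultimately show "((%y. (conv h \<phi> (x + y *\<^sub>R w) - conv h \<phi> (x + 0 *\<^sub>R w)) / (y - 0)) \<circ> s) ----> conv h \<phi>' x"
   by (simp only: o_def conv_def[of h \<phi>'] scaleR_zero_left add_0_right diff_zero)
 qed
 moreover have "conv h \<phi>' x = (\<Sum>i\<in>Basis. (w \<bullet> i) * conv h (part_deriv i \<phi>) x)" for x
  unfolding \<phi>'_def by (rule conv_sum_kernel[OF h pd]) auto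
 ultimately show ?thesis by (simp add: has_dderiv_def)
qed

lemma conv_has_dderiv_Basis:
 fixes h :: "'a::euclidean_space => real"
 assumes "h \<in> L1_loc" "\<phi> \<in> test_functions" "i \<in> Basis"
 shows "has_dderiv (conv h \<phi>) i (conv h (part_deriv i \<phi>))"
proof -
 have "(\<Sum>j\<in>Basis. (i \<bullet> j) * conv h (part_deriv j \<phi>) x) = conv h (part_deriv i \<phi>) x" for x
  using assms(3) by (simp add: inner_Basis if_distrib[of "%a. a * _"] cong: if_cong)
 then show ?thesis using conv_has_dderiv[OF assms(1,2), of i] by simp
qed

text \<open>The fundamental theorem along a segment for a derivative that may be discontinuous: it
  has a gauge integral in any case, and the assumed Lebesgue integrability identifies the two
  integrals.\<close>

lemma has_dderiv_increment:
 assumes dd: "has_dderiv p w p'" and i: "\<L> (%r. indicator {0..1} r * p' (x + r *\<^sub>R w))"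
 shows "(\<integral>r. indicator {0..1} r * p' (x + r *\<^sub>R w)) = p (x + w) - p x"
proof -
 have s: "set_integrable lborel {0..1} (%r. p' (x + r *\<^sub>R w))"
  using i by (simp add: set_integrable_def)
 have "((%r. p' (x + r *\<^sub>R w)) has_integral (p (x + 1 *\<^sub>R w) - p (x + 0 *\<^sub>R w))) {0..1}"
  by (rule fundamental_theorem_of_calculus)
   (use has_dderiv_at[OF dd] in \<open>auto simp: has_real_derivative_iff_has_vector_derivative\<close>)
 then have "integral {0..1} (%r. p' (x + r *\<^sub>R w)) = p (x + w) - p x" by (simp add: integral_unique)
 then show ?thesis using set_borel_integral_eq_integral(2)[OF s] by (simp add: set_lebesgue_integral_def)
qed

text \<open>By translation invariance the integral of p' equals its average over the shifts r w with
  r in [0,1]; Fubini turns this into the integral of p(x + w) - p(x), which is 0. Integrability of p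
  and p' thus replaces a cutoff at infinity.\<close>

lemma integral_dderiv_zero:
 fixes p p' :: "'a::euclidean_space => real"
 assumes dd: "has_dderiv p w p'" and p: "\<L> p" and p': "\<L> p'"
 shows "(\<integral>x. p' x) = 0"
proof -
 have [measurable]: "p \<in> \<M>" "p' \<in> \<M>" using p p' by auto
 define f where "f r x = indicator {0..1::real} r * p' (x + r *\<^sub>R w)" for r x
 have f: "integrable (lborel \<Otimes>\<^sub>M lborel) (case_prod f)"
 proof (rule lborel_pair.Fubini_integrable)
  show "case_prod f \<in> borel_measurable (lborel \<Otimes>\<^sub>M lborel)"
   unfolding f_def[abs_def] by measurable
  have "(\<integral>y. norm (f r y)) = indicator {0..1} r * (\<integral>x. \<bar>p' x\<bar>)" for r
   using integral_shift[of "%x. \<bar>p' x\<bar>" "r *\<^sub>R w"] by (simp add: f_def abs_mult)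
  then show "\<L> (%x. \<integral>y. norm (case (x, y) of (r, x) => f r x))"
   by (simp add: integrable_indicator_iff)
  show "AE x. \<L> (%y. case (x, y) of (r, x) => f r x)"
   using integrable_shift[OF p'] by (auto simp: f_def)
 qed
 have "(\<integral>x. p' x) = (\<integral>r. indicator {0..1::real} r * (\<integral>x. p' x))" by simp
 also have "\<dots> = (\<integral>r. (\<integral>x. f r x))"
  using integral_shift[of p'] by (simp add: f_def)
 also have "\<dots> = (\<integral>x. (\<integral>r. f r x))"
  by (rule lborel_pair.Fubini_integral[OF f, symmetric])
 also have "\<dots> = (\<integral>x. p (x + w) - p x)"
 proof (rule integral_cong_AE)
  have "AE x. \<L> (%r. f r x)"
   using lborel_pair.AE_integrable_snd[OF f] by simp
  then show "AE x. (\<integral>r. f r x) = p (x + w) - p x"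
   unfolding f_def by eventually_elim (rule has_dderiv_increment[OF dd])
 qed (simp_all add: f_def)
 also have "\<dots> = 0" using p integrable_shift[OF p, of w] integral_shift[of p w] by simp
 finally show ?thesis .
qed

text \<open>Jensen on the segment from x to x + w, then Tonelli. Here derivatives are traded for
  translation differences, the form in which gradient bounds are kept afterwards.\<close>

lemma translation_le_dderiv:
 fixes p p' :: "'a::euclidean_space => real"
 assumes dd: "has_dderiv p w p'" and [measurable]: "p \<in> \<M>" "p' \<in> \<M>"
 shows "(\<integral>\<^sup>+x. ennreal ((p (x + w) - p x)^2)) \<le> (\<integral>\<^sup>+x. ennreal ((p' x)^2))"
proof -
 let ?P = "\<integral>\<^sup>+x. ennreal ((p' x)^2)"
 let ?I = "%x. \<integral>\<^sup>+r. ennreal ((p' (x + r *\<^sub>R w))^2 * indicator {0..1} r)"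
 have 1: "ennreal ((p (x + w) - p x)^2) \<le> ?I x" for x
 proof (cases "?I x < \<infinity>")
  case True
  have "\<L> (%r. (p' (x + r *\<^sub>R w))^2 * indicator {0..1} r)"
   using True by (intro integrableI_nonneg) auto
  then have i: "\<L> (%r. ((p' (x + r *\<^sub>R w))^2 + 1) * indicator {0..1::real} r)"
   by (simp add: distrib_right integrable_indicator_iff)
  have "\<L> (%r. indicator {0..1} r * p' (x + r *\<^sub>R w))"
  proof (rule integrable_squeeze[OF i])
   have "\<bar>y\<bar> \<le> y^2 + 1" for y :: real using abs_mult_le_squares[of y 1] by (simp add: field_simps)
   then show "AE r in lborel. \<bar>indicator {0..1} r * p' (x + r *\<^sub>R w)\<bar> \<le> ((p' (x + r *\<^sub>R w))^2 + 1) * indicator {0..1} r"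
    by (auto simp: indicator_def)
  qed simp
  from has_dderiv_increment[OF dd this]
  have e: "p (x + w) - p x = (\<integral>r. p' (x + r *\<^sub>R w) * indicator {0..1} r)" by (simp add: mult.commute)
  show ?thesis unfolding e
   using jensen_square[of "%r. p' (x + r *\<^sub>R w)" "indicator {0..1::real}"]
   by (simp add: integrable_indicator_iff)
 \<comment> \<open>If the inner integral is infinite there is nothing to prove; finiteness was what
   made the derivative integrable on the segment.\<close>
 qed (simp add: not_less top_unique)
 have "(\<integral>\<^sup>+x. ennreal ((p (x + w) - p x)^2)) \<le>
  (\<integral>\<^sup>+x. ?I x)"
  by (intro nn_integral_mono 1)
 also have "\<dots> = (\<integral>\<^sup>+r. (\<integral>\<^sup>+x. ennreal ((p' (x + r *\<^sub>R w))^2 * indicator {0..1::real} r)))"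
  by (rule lborel_pair.Fubini') measurable
 also have "\<dots> = (\<integral>\<^sup>+r. ?P * indicator {0..1::real} r)"
 proof (rule nn_integral_cong)
  fix r :: real
  have "(\<integral>\<^sup>+x. ennreal ((p' (x + r *\<^sub>R w))^2)) = ?P"
   using nn_integral_shift[of "%x. ennreal ((p' x)^2)" "r *\<^sub>R w"] by simp
  then show "(\<integral>\<^sup>+x. ennreal ((p' (x + r *\<^sub>R w))^2 * indicator {0..1} r)) =
    ?P * indicator {0..1} r"
   by (auto simp: indicator_def)
 qed
 also have "\<dots> = ?P" by (simp add: nn_integral_cmult)
 finally show ?thesis .
qed

section \<open>Convergence in L^2 and almost everywhere\<close>

definition L2_tendsto :: "(nat => 'a::euclidean_space => real) => ('a => real) => bool" where
 "L2_tendsto f g \<longleftrightarrow> (\<forall>n. f n \<in> L2) \<and> g \<in> L2 \<and> (%n. \<integral>x. (f n x - g x)^2) ----> 0"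

lemma L2_tendsto_mult:
 assumes "L2_tendsto f g" "L2_tendsto p q"
 shows "(%n. \<integral>x. f n x * p n x) ----> (\<integral>x. g x * q x)"
proof -
 have L: "f n \<in> L2" "g \<in> L2" "p n \<in> L2" "q \<in> L2" for n using assms by (auto simp: L2_tendsto_def)
 define a b where "a n = sqrt (\<integral>x. (f n x - g x)^2)" and "b n = sqrt (\<integral>x. (p n x - q x)^2)" for n
 define G Q where "G = sqrt (\<integral>x. (g x)^2)" and "Q = sqrt (\<integral>x. (q x)^2)"
 have ab: "a ----> 0" "b ----> 0"
  using assms tendsto_real_sqrt[of _ 0] unfolding a_def[abs_def] b_def[abs_def] L2_tendsto_def by fastforce+
 have "(%n. a n * b n + a n * Q + G * b n) ----> 0 * 0 + 0 * Q + G * 0"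
  by (intro tendsto_intros ab)
 then have lim: "(%n. a n * b n + a n * Q + G * b n) ----> 0" by simp
 have "\<bar>(\<integral>x. f n x * p n x) - (\<integral>x. g x * q x)\<bar> \<le> a n * b n + a n * Q + G * b n" for n
 proof -
  note d = L2_diff[OF L(1)[of n] L(2)] L2_diff[OF L(3)[of n] L(4)]
  have "(\<integral>x. f n x * p n x) - (\<integral>x. g x * q x) = (\<integral>x. f n x * p n x - g x * q x)"
   using L2_mult[OF L(1)[of n] L(3)[of n]] L2_mult[OF L(2) L(4)] by simp
  also have "\<dots> = (\<integral>x. (f n x - g x) * (p n x - q x) + (f n x - g x) * q x + g x * (p n x - q x))"
   by (intro Bochner_Integration.integral_cong) (auto simp: algebra_simps)
  also have "\<dots> = (\<integral>x. (f n x - g x) * (p n x - q x)) + (\<integral>x. (f n x - g x) * q x) + (\<integral>x. g x * (p n x - q x))"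
   using L2_mult[OF d] L2_mult[OF d(1) L(4)] L2_mult[OF L(2) d(2)] by simp
  finally show ?thesis
   using cauchy_schwarz_L2[OF d] cauchy_schwarz_L2[OF d(1) L(4)] cauchy_schwarz_L2[OF L(2) d(2)]
   unfolding a_def b_def G_def Q_def by linarith
 qed
 then have "(%n. (\<integral>x. f n x * p n x) - (\<integral>x. g x * q x)) ----> 0"
  by (intro Lim_null_comparison[OF _ lim] always_eventually) auto
 then show ?thesis by (simp add: LIM_zero_iff)
qed

lemma L2_tendsto_square:
 assumes "L2_tendsto f g"
 shows "(%n. \<integral>x. (f n x)^2) ----> (\<integral>x. (g x)^2)"
 using L2_tendsto_mult[OF assms assms] by (simp add: power2_eq_square)

lemma L2_tendsto_subseq:
 assumes "L2_tendsto f g" "strict_mono r"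
 shows "L2_tendsto (%n. f (r n)) g"
 using assms LIMSEQ_subseq_LIMSEQ[of "%n. \<integral>x. (f n x - g x)^2" 0 r]
 by (auto simp: L2_tendsto_def o_def)

lemma L2_tendsto_diff:
 assumes "L2_tendsto f g" "L2_tendsto p q"
 shows "L2_tendsto (%n x. f n x - p n x) (%x. g x - q x)"
proof -
 have L: "f n \<in> L2" "g \<in> L2" "p n \<in> L2" "q \<in> L2" for n using assms by (auto simp: L2_tendsto_def)
 have "(%n. 2 * (\<integral>x. (f n x - g x)^2) + 2 * (\<integral>x. (p n x - q x)^2)) ----> 2 * 0 + 2 * 0"
  using assms by (intro tendsto_intros) (auto simp: L2_tendsto_def)
 then have lim: "(%n. 2 * (\<integral>x. (f n x - g x)^2) + 2 * (\<integral>x. (p n x - q x)^2)) ----> 0" by simp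
 have "(\<integral>x. (f n x - p n x - (g x - q x))^2) \<le> 2 * (\<integral>x. (f n x - g x)^2) + 2 * (\<integral>x. (p n x - q x)^2)" for n
 proof -
  note i = L2_integrable[OF L2_diff[OF L(1)[of n] L(2)]] L2_integrable[OF L2_diff[OF L(3)[of n] L(4)]]
   L2_integrable[OF L2_diff[OF L2_diff[OF L(1)[of n] L(3)[of n]] L2_diff[OF L(2) L(4)]]]
  have "(\<integral>x. (f n x - p n x - (g x - q x))^2) \<le> (\<integral>x. 2 * (f n x - g x)^2 + 2 * (p n x - q x)^2)"
  proof (rule integral_mono[OF i(3)])
   show "\<L> (%x. 2 * (f n x - g x)^2 + 2 * (p n x - q x)^2)" using i by auto
   show "(f n x - p n x - (g x - q x))^2 \<le> 2 * (f n x - g x)^2 + 2 * (p n x - q x)^2" for x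
    using power2_add_le[of "f n x - g x" "- (p n x - q x)"] by (simp add: algebra_simps power2_commute)
  qed
  then show ?thesis using i by simp
 qed
 then have "(%n. \<integral>x. (f n x - p n x - (g x - q x))^2) ----> 0"
  by (intro Lim_null_comparison[OF _ lim] always_eventually) auto
 then show ?thesis using L L2_diff by (auto simp: L2_tendsto_def)
qed

lemma L2_tendsto_shift:
 assumes "L2_tendsto f g"
 shows "L2_tendsto (%n x. f n (x + h)) (%x. g (x + h))"
proof -
 have L: "f n \<in> L2" "g \<in> L2" for n using assms by (auto simp: L2_tendsto_def)
 note [measurable] = L[THEN L2_measurable]
 have "(\<integral>x. (f n (x + h) - g (x + h))^2) = (\<integral>x. (f n x - g x)^2)" for n
  using integral_shift[of "%x. (f n x - g x)^2" h] by simp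
 then show ?thesis using assms L2_shift by (auto simp: L2_tendsto_def)
qed

lemma lipschitz_of_deriv:
 fixes S T :: "real => real"
 assumes "!!r. (S has_real_derivative T r) (at r)" "!!r. \<bar>T r\<bar> \<le> C"
 shows "\<bar>S x - S y\<bar> \<le> C * \<bar>x - y\<bar>"
 using field_differentiable_bound[of UNIV S T C x y] assms by simp

lemma square_le_of_abs: "\<bar>x\<bar> \<le> c * \<bar>y\<bar> ==> x\<^sup>2 \<le> c^2 * y^2" for x y c :: real
 using power_mono[of "\<bar>x\<bar>" "c * \<bar>y\<bar>" 2] by (simp add: power_mult_distrib)

text \<open>The common core of the next two lemmas: pointwise linear domination transfers both
  membership in L^2 and convergence.\<close>

lemma L2_tendsto_dominated:
 assumes fg: "L2_tendsto f g" and [measurable]: "!!n. p n \<in> \<M>" "q \<in> \<M>"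
  and le: "!!n x. \<bar>p n x\<bar> \<le> C * \<bar>f n x\<bar>" "!!x. \<bar>q x\<bar> \<le> C * \<bar>g x\<bar>" "!!n x. \<bar>p n x - q x\<bar> \<le> C * \<bar>f n x - g x\<bar>"
 shows "L2_tendsto p q"
proof -
 have L: "f n \<in> L2" "g \<in> L2" for n using fg by (auto simp: L2_tendsto_def)
 have pq: "p n \<in> L2" "q \<in> L2" for n using L2_dominated[OF L(1)[of n], of "p n" C] L2_dominated[OF L(2), of q C] le by simp_all
 have lim: "(%n. C^2 * (\<integral>x. (f n x - g x)^2)) ----> 0"
  using fg by (intro tendsto_mult_right_zero) (simp add: L2_tendsto_def)
 have "(\<integral>x. (p n x - q x)^2) \<le> (\<integral>x. C^2 * (f n x - g x)^2)" for n
  by (rule integral_mono[OF L2_integrable[OF L2_diff[OF pq]] _ square_le_of_abs[OF le(3)]]) (use L2_integrable[OF L2_diff[OF L]] in simp)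
 then have "(%n. \<integral>x. (p n x - q x)^2) ----> 0"
  by (intro Lim_null_comparison[OF _ lim] always_eventually) auto
 then show ?thesis using pq by (auto simp: L2_tendsto_def)
qed

lemma L2_tendsto_lipschitz:
 fixes S :: "real => real"
 assumes fg: "L2_tendsto f g" and lip: "!!x y. \<bar>S x - S y\<bar> \<le> C * \<bar>x - y\<bar>" and "S 0 = 0"
  and [measurable]: "S \<in> \<M>"
 shows "L2_tendsto (%n x. S (f n x)) (%x. S (g x))"
proof (rule L2_tendsto_dominated[OF fg _ _ _ _ lip])
 have L: "f n \<in> L2" "g \<in> L2" for n using fg by (auto simp: L2_tendsto_def)
 note [measurable] = L[THEN L2_measurable]
 show "(%x. S (f n x)) \<in> \<M>" "(%x. S (g x)) \<in> \<M>" for n by measurable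
 show "\<bar>S (f n x)\<bar> \<le> C * \<bar>f n x\<bar>" "\<bar>S (g x)\<bar> \<le> C * \<bar>g x\<bar>" for n x using lip[of _ 0] \<open>S 0 = 0\<close> by simp_all
qed

lemma L2_tendsto_bounded_mult:
 assumes fg: "L2_tendsto f g" and [measurable]: "\<psi> \<in> \<M>" and b: "!!x. \<bar>\<psi> x\<bar> \<le> P"
 shows "L2_tendsto (%n x. \<psi> x * f n x) (%x. \<psi> x * g x)"
proof (rule L2_tendsto_dominated[OF fg, where C=P])
 have L: "f n \<in> L2" "g \<in> L2" for n using fg by (auto simp: L2_tendsto_def)
 note [measurable] = L[THEN L2_measurable]
 show "(%x. \<psi> x * f n x) \<in> \<M>" "(%x. \<psi> x * g x) \<in> \<M>" for n by measurable
qed (auto simp: abs_mult mult_right_mono b simp flip: right_diff_distrib)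

text \<open>One subsequence for the whole finite family, because the sum of the squared errors tends
  to 0 in L^1.\<close>

lemma L2_tendsto_AE_subseq:
 fixes f :: "'i => nat => 'a::euclidean_space => real"
 assumes "finite I" "!!i. i \<in> I ==> L2_tendsto (f i) (g i)"
 obtains r where "strict_mono r" "AE x. \<forall>i\<in>I. (%n. f i (r n) x) ----> g i x"
proof -
 define u where "u n x = (\<Sum>i\<in>I. (f i n x - g i x)^2)" for n x
 have int: "\<L> (%x. (f i n x - g i x)^2)" if "i \<in> I" for i n
  using assms(2)[OF that] L2_integrable[OF L2_diff] by (auto simp: L2_tendsto_def)
 have "(%n. \<Sum>i\<in>I. \<integral>x. (f i n x - g i x)^2) ----> (\<Sum>i\<in>I. 0)"
  using assms(2) by (intro tendsto_sum) (auto simp: L2_tendsto_def)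
 moreover have "(\<integral>x. norm (u n x)) = (\<Sum>i\<in>I. \<integral>x. (f i n x - g i x)^2)" for n
 proof -
  have "norm (u n x) = (\<Sum>i\<in>I. (f i n x - g i x)^2)" for x by (simp add: u_def sum_nonneg)
  then show ?thesis using int by (simp add: Bochner_Integration.integral_sum)
 qed
 ultimately have "(%n. \<integral>x. norm (u n x)) ----> 0" by simp
 from tendsto_L1_AE_subseq[OF _ this]
 obtain r where r: "strict_mono r" "AE x. (%n. u (r n) x) ----> 0"
  using int by (auto simp: u_def)
 have "AE x. \<forall>i\<in>I. (%n. f i (r n) x) ----> g i x"
  using r(2)
 proof eventually_elim
  case (elim x)
  show ?case
  proof
   fix i assume "i \<in> I"
   have "(%n. (f i (r n) x - g i x)^2) ----> 0"
   proof (rule Lim_null_comparison[OF _ elim], intro always_eventually allI)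
    fix n show "norm ((f i (r n) x - g i x)^2) \<le> u (r n) x"
     unfolding u_def using member_le_sum[OF \<open>i \<in> I\<close>, of "%i. (f i (r n) x - g i x)^2"] assms(1) by simp
   qed
   then have "(%n. f i (r n) x - g i x) ----> 0"
    using tendsto_real_sqrt[of _ 0] by (fastforce simp: tendsto_rabs_zero_iff)
   then show "(%n. f i (r n) x) ----> g i x" by (simp add: LIM_zero_iff)
  qed
 qed
 with r(1) that show thesis by blast
qed

text \<open>Dominated convergence with a convergent sequence of majorants: the excess of
 \<open>\<bar>h n - h\<bar>\<close> over \<open>2 k\<close> is at most \<open>(k n - k)\<^sup>+\<close>.\<close>

lemma dominated_convergence_L1:
 fixes h :: "nat => 'a::euclidean_space => real"
 assumes [measurable]: "!!n. h n \<in> \<M>" "h' \<in> \<M>"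
  and k: "!!n. \<L> (k n)" "\<L> k'"
  and le: "!!n. AE x. \<bar>h n x\<bar> \<le> k n x"
  and lim: "AE x. (%n. h n x) ----> h' x" "AE x. (%n. k n x) ----> k' x"
  and k_lim: "(%n. \<integral>x. k n x) ----> (\<integral>x. k' x)"
 shows "\<L> h'" "(%n. \<integral>x. \<bar>h n x - h' x\<bar>) ----> 0"
  "(%n. \<integral>x. h n x) ----> (\<integral>x. h' x)"
proof -
 have [measurable]: "k n \<in> \<M>" "k' \<in> \<M>" for n using k by auto
 have le': "AE x. \<bar>h' x\<bar> \<le> k' x"
 proof -
  have "AE x. \<forall>n. \<bar>h n x\<bar> \<le> k n x" using le by (simp add: AE_all_countable)
  then show ?thesis using lim
  proof eventually_elim
   case (elim x)
   then show ?case by (intro LIMSEQ_le[OF tendsto_rabs[OF elim(2)] elim(3)]) auto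
  qed
 qed
 show ih: "\<L> h'" by (rule integrable_squeeze[OF k(2) _ le']) measurable
 have ihn: "\<L> (h n)" for n by (rule integrable_squeeze[OF k(1) _ le]) measurable
 \<comment> \<open>m n is dominated by the fixed function 3 k', so the ordinary theorem applies to
   it, and what is left over, k n - k', has integrals tending to 0.\<close>
 define m where "m n x = max 0 (k' x - k n x) + min \<bar>h n x - h' x\<bar> (2 * k' x)" for n x
 have m: "AE x. \<bar>m n x\<bar> \<le> 3 * k' x \<and> \<bar>h n x - h' x\<bar> \<le> (k n x - k' x) + m n x" for n
  using le[of n] le' by eventually_elim (auto simp: m_def max_def min_def)
 have mm[measurable]: "m n \<in> \<M>" for n unfolding m_def by measurable
 have mi: "\<L> (m n)" for n
 proof (rule integrable_squeeze[OF _ mm])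
  show "AE x. \<bar>m n x\<bar> \<le> 3 * k' x" using m[of n] by eventually_elim simp
 qed (use k in simp)
 have "(%n. \<integral>x. m n x) ----> (\<integral>x. 0 \<partial>(lborel :: 'a measure))"
 proof (rule integral_dominated_convergence[where w="%x. 3 * k' x"])
  show "AE x. (%n. m n x) ----> 0"
   using lim le'
  proof eventually_elim
   case (elim x)
   have "(%n. m n x) ----> max 0 (k' x - k' x) + min \<bar>h' x - h' x\<bar> (2 * k' x)"
    unfolding m_def by (intro tendsto_intros elim)
   then show ?case using elim by simp
  qed
  show "AE x. norm (m n x) \<le> 3 * k' x" for n using m[of n] by eventually_elim simp
 qed (use k in auto)
 then have lim0: "(%n. (\<integral>x. k n x) - (\<integral>x. k' x) + (\<integral>x. m n x)) ----> 0"
  using tendsto_add[OF tendsto_diff[OF k_lim tendsto_const[of "\<integral>x. k' x"]]] by fastforce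
 have "(\<integral>x. \<bar>h n x - h' x\<bar>) \<le> (\<integral>x. k n x - k' x + m n x)" for n
 proof (rule integral_mono_abs)
  show "AE x. \<bar>h n x - h' x\<bar> \<le> k n x - k' x + m n x" using m[of n] by eventually_elim simp
 qed (use k mi in auto)
 then have "\<forall>\<^sub>F n in sequentially. norm (\<integral>x. \<bar>h n x - h' x\<bar>) \<le> (\<integral>x. k n x) - (\<integral>x. k' x) + (\<integral>x. m n x)"
  using k mi by simp
 from Lim_null_comparison[OF this lim0] show L: "(%n. \<integral>x. \<bar>h n x - h' x\<bar>) ----> 0" .
 show "(%n. \<integral>x. h n x) ----> (\<integral>x. h' x)" by (rule L1_tendsto_integral(1)[OF ihn ih L])
qed

lemma L2_tendsto_conv_kern:
 assumes "standard_mollifier \<rho>" "h \<in> L2"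
 shows "L2_tendsto (%n. conv h (kern \<rho> (inverse (real (Suc n))))) h"
 unfolding L2_tendsto_def
proof (intro conjI allI)
 show "conv h (kern \<rho> (inverse (real (Suc n)))) \<in> L2" for n
  by (rule conv_L2[OF assms(2) kern_test[OF assms(1)]]) simp
 show "(%n. \<integral>x. (conv h (kern \<rho> (inverse (real (Suc n)))) x - h x)^2) ----> 0"
  by (rule conv_kern_L2_tendsto[OF assms _ LIMSEQ_inverse_real_of_nat]) simp
qed (rule assms(2))

text \<open>A single sequence of kernels has to serve the unknown, the right side and all components
  of the flux, since the mollified equation contains them together; nonlinear functions of
  \<open>v\<close> need convergence a.e. as well.\<close>

lemma mollifying_sequence:
 fixes v g :: "'a::euclidean_space => real" and F :: "'a => 'a => real"
 assumes \<rho>: "standard_mollifier \<rho>" and L: "v \<in> L2" "g \<in> L2" "!!i. i \<in> Basis ==> F i \<in> L2"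
 obtains k where "!!n. k n \<in> test_functions" "L2_tendsto (%n. conv v (k n)) v" "L2_tendsto (%n. conv g (k n)) g"
  "!!i. i \<in> Basis ==> L2_tendsto (%n. conv (F i) (k n)) (F i)"
  "AE x. (%n. conv v (k n) x) ----> v x \<and> (\<forall>i\<in>Basis. (%n. conv (F i) (k n) x) ----> F i x)"
proof -
 define k where "k n = (kern \<rho> (inverse (real (Suc n))) :: 'a => real)" for n
 \<comment> \<open>The index \<open>None\<close> stands for \<open>v\<close> and
   \<open>Some i\<close> for \<open>F i\<close>, so that one extraction handles all of them.\<close>
 define f where "f = case_option v F"
 have "f j \<in> L2" if "j \<in> insert None (Some ` Basis)" for j using that L by (auto simp: f_def)
 then have "L2_tendsto (%n. conv (f j) (k n)) (f j)" if "j \<in> insert None (Some ` Basis)" for j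
  unfolding k_def using that by (intro L2_tendsto_conv_kern[OF \<rho>])
 then obtain r where r: "strict_mono r" "AE x. \<forall>j\<in>insert None (Some ` Basis). (%n. conv (f j) (k (r n)) x) ----> f j x"
  using L2_tendsto_AE_subseq[of "insert None (Some ` Basis)" "%j n. conv (f j) (k n)" f] by auto
 have K: "L2_tendsto (%n. conv h (k (r n))) h" if "h \<in> L2" for h
  using L2_tendsto_subseq[OF L2_tendsto_conv_kern[OF \<rho> that] r(1)] by (simp add: k_def)
 have "k (r n) \<in> test_functions" for n unfolding k_def by (rule kern_test[OF \<rho>]) simp
 then show thesis using that[of "%n. k (r n)"] r(2) K L by (simp add: f_def)
qed

section \<open>Weak equations\<close>


text \<open>The distributional form of -\<Delta>v + div F = g.\<close>

definition weak_eq :: "('a::euclidean_space => real) => ('a => 'a) => ('a => real) => bool" where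
 "weak_eq v F g \<longleftrightarrow> (\<forall>\<phi>\<in>test_functions.
   - (\<integral>x. v x * laplacian \<phi> x) - (\<integral>x. F x \<bullet> grad \<phi> x) = (\<integral>x. g x * \<phi> x))"

lemma part_deriv_reflect:
 assumes "\<phi> \<in> test_functions"
 shows "part_deriv i (%z. \<phi> (x - z)) = (%z. - part_deriv i \<phi> (x - z))"
proof
 fix z
 have "((%z. \<phi> (x - z)) has_derivative (%h. frechet_derivative \<phi> (at (x - z)) (- h))) (at z)"
  by (rule has_derivative_compose[OF _ test_has_derivative[OF assms]]) (auto intro!: derivative_eq_intros)
 from part_deriv_eq[OF this, of i]
 have "part_deriv i (%z. \<phi> (x - z)) z = frechet_derivative \<phi> (at (x - z)) (- i)" .
 also have "\<dots> = - part_deriv i \<phi> (x - z)"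
  unfolding part_deriv_def
  using test_has_derivative[OF assms] linear_neg has_derivative_linear by blast
 finally show "part_deriv i (%z. \<phi> (x - z)) z = - part_deriv i \<phi> (x - z)" .
qed

lemma part_deriv_uminus:
 assumes "\<phi> \<in> test_functions"
 shows "part_deriv i (%z. - \<phi> z) = (%z. - part_deriv i \<phi> z)"
proof
 fix z
 have "((%z. - \<phi> z) has_derivative (%h. - frechet_derivative \<phi> (at z) h)) (at z)"
  by (rule has_derivative_minus[OF test_has_derivative[OF assms]])
 from part_deriv_eq[OF this, of i] show "part_deriv i (%z. - \<phi> z) z = - part_deriv i \<phi> z"
  by (simp add: part_deriv_def)
qed

lemma laplacian_reflect:
 assumes "\<phi> \<in> test_functions"
 shows "laplacian (%z. \<phi> (x - z)) z = (\<Sum>i\<in>Basis. part_deriv i (part_deriv i \<phi>) (x - z))"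
 unfolding laplacian_def
proof (rule sum.cong[OF refl])
 fix i :: 'a assume i: "i \<in> Basis"
 have 1: "(%z. part_deriv i \<phi> (x - z)) \<in> test_functions"
  by (rule test_reflect[OF test_part_deriv[OF assms i]])
 show "part_deriv i (part_deriv i (%z. \<phi> (x - z))) z = part_deriv i (part_deriv i \<phi>) (x - z)"
  unfolding part_deriv_reflect[OF assms] part_deriv_uminus[OF 1] part_deriv_reflect[OF test_part_deriv[OF assms i]] by simp
qed

lemma grad_reflect:
 assumes "\<phi> \<in> test_functions"
 shows "grad (%z. \<phi> (x - z)) z = (\<Sum>i\<in>Basis. (- part_deriv i \<phi> (x - z)) *\<^sub>R i)"
 unfolding grad_def part_deriv_reflect[OF assms] ..

lemma integral_inner_grad_reflect:
 fixes F :: "'a::euclidean_space => 'a"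
 assumes \<phi>: "\<phi> \<in> test_functions" and F: "!!i. i \<in> Basis ==> (%x. F x \<bullet> i) \<in> L1_loc"
 shows "(\<integral>z. F z \<bullet> grad (%z. \<phi> (x - z)) z) =
  - (\<Sum>i\<in>Basis. conv (%z. F z \<bullet> i) (part_deriv i \<phi>) x)"
proof -
 have "(\<integral>z. F z \<bullet> grad (%z. \<phi> (x - z)) z) = (\<integral>z. (\<Sum>i\<in>Basis. - ((F z \<bullet> i) * part_deriv i \<phi> (x - z))))"
  unfolding grad_reflect[OF \<phi>] by (simp add: inner_sum_right mult.commute)
 also have "\<dots> = (\<Sum>i\<in>Basis. - conv (%z. F z \<bullet> i) (part_deriv i \<phi>) x)"
  unfolding conv_def using conv_integrable[OF F test_part_deriv[OF \<phi>]]
  by (subst Bochner_Integration.integral_sum) auto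
 finally show ?thesis by (simp add: sum_negf)
qed

text \<open>The equation holds pointwise for the mollified functions, with all derivatives carried
  by \<phi>.\<close>

lemma weak_eq_conv:
 fixes F :: "'a::euclidean_space => 'a"
 assumes eq: "weak_eq v F g" and \<phi>: "\<phi> \<in> test_functions"
  and v: "v \<in> L1_loc" and F: "!!i. i \<in> Basis ==> (%x. F x \<bullet> i) \<in> L1_loc"
 shows "(\<Sum>i\<in>Basis. conv (%z. F z \<bullet> i) (part_deriv i \<phi>) x - conv v (part_deriv i (part_deriv i \<phi>)) x) = conv g \<phi> x"
proof -
 have pp: "part_deriv i (part_deriv i \<phi>) \<in> test_functions" if "i \<in> Basis" for i
  using that \<phi> test_part_deriv by blast
 have "(\<integral>z. v z * laplacian (%z. \<phi> (x - z)) z) = (\<Sum>i\<in>Basis. conv v (part_deriv i (part_deriv i \<phi>)) x)"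
  unfolding laplacian_reflect[OF \<phi>] conv_def sum_distrib_left
  using conv_integrable[OF v pp] by (subst Bochner_Integration.integral_sum) auto
 moreover note integral_inner_grad_reflect[OF \<phi> F]
 moreover have "- (\<integral>z. v z * laplacian (%z. \<phi> (x - z)) z) - (\<integral>z. F z \<bullet> grad (%z. \<phi> (x - z)) z) = conv g \<phi> x"
  using eq test_reflect[OF \<phi>] unfolding weak_eq_def conv_def by blast
 ultimately show ?thesis by (simp add: sum_subtractf)
qed

lemma has_dderiv_const: "has_dderiv (%_. c) w (%_. 0)"
 by (simp add: has_dderiv_def)

text \<open>The mollified equation is multiplied by S(v_n) \<psi> and integrated by parts in each
  coordinate. Since v_n is smooth, the classical chain rule applies to S(v_n); S is Lipschitz with S
  0 = 0, so S(v_n) lies in L^2.\<close>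

lemma mollified_identity:
 fixes F :: "'a::euclidean_space => 'a" and S T :: "real => real"
 assumes eq: "weak_eq v F g" and \<phi>: "\<phi> \<in> test_functions"
  and v: "v \<in> L2" and F: "!!i. i \<in> Basis ==> (%x. F x \<bullet> i) \<in> L2" and g: "g \<in> L2"
  and S: "!!r. (S has_real_derivative T r) (at r)" "!!r. \<bar>T r\<bar> \<le> C" "S 0 = 0"
  and T[measurable]: "T \<in> \<M>"
  and \<psi>: "!!i. i \<in> Basis ==> has_dderiv \<psi> i (\<psi>' i)" "!!x. \<bar>\<psi> x\<bar> \<le> P" "!!i x. i \<in> Basis ==> \<bar>\<psi>' i x\<bar> \<le> P"
  and \<psi>m[measurable]: "\<psi> \<in> \<M>" "!!i. i \<in> Basis ==> \<psi>' i \<in> \<M>"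
 defines "vn \<equiv> conv v \<phi>" and "dv \<equiv> %i. conv v (part_deriv i \<phi>)"
  and "Fn \<equiv> %i. conv (%x. F x \<bullet> i) \<phi>"
 shows "(\<Sum>i\<in>Basis. \<integral>x. (T (vn x) * dv i x * \<psi> x + S (vn x) * \<psi>' i x) * (dv i x - Fn i x)) =
  (\<integral>x. conv g \<phi> x * (S (vn x) * \<psi> x))"
proof -
 define ddv where "ddv i = conv v (part_deriv i (part_deriv i \<phi>))" for i
 define dF where "dF i = conv (%x. F x \<bullet> i) (part_deriv i \<phi>)" for i
 have pd: "part_deriv i \<phi> \<in> test_functions" if "i \<in> Basis" for i
  by (rule test_part_deriv[OF \<phi> that])
 have L: "vn \<in> L2" "i \<in> Basis ==> dv i \<in> L2" "i \<in> Basis ==> ddv i \<in> L2" "i \<in> Basis ==> Fn i \<in> L2" "i \<in> Basis ==> dF i \<in> L2" for i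
  unfolding vn_def dv_def ddv_def Fn_def dF_def using v F \<phi> pd test_part_deriv[OF pd]
  by (auto intro: conv_L2)
 note [measurable] = L[THEN L2_measurable]
 have S_cont: "continuous_on UNIV S"
  using S(1) by (meson DERIV_isCont continuous_at_imp_continuous_on)
 then have [measurable]: "S \<in> \<M>" by (rule borel_measurable_continuous_onI)
 have S_le: "\<bar>S x\<bar> \<le> C * \<bar>x\<bar>" for x using lipschitz_of_deriv[OF S(1,2), of x 0] S(3) by simp
 have SL: "(%x. S (vn x)) \<in> L2"
  by (rule L2_dominated[OF L(1), of _ C]) (use S_le in auto)
 have S\<psi>: "(%x. \<psi> x * S (vn x)) \<in> L2" "i \<in> Basis ==> (%x. \<psi>' i x * S (vn x)) \<in> L2" for i
  using SL \<psi> \<psi>m by (auto intro!: L2_bounded_mult)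
 have Tv: "(%x. \<psi> x * (T (vn x) * dv i x)) \<in> L2" if "i \<in> Basis" for i
  by (intro L2_bounded_mult[OF L2_bounded_mult[OF L(2)[OF that], of "%x. T (vn x)" C]])
    (use S(2) \<psi>(2) in \<open>auto\<close>)
 have dvd: "has_dderiv vn i (dv i)" "has_dderiv (dv i) i (ddv i)" "has_dderiv (Fn i) i (dF i)" if "i \<in> Basis" for i
  unfolding vn_def dv_def ddv_def Fn_def dF_def
  using conv_has_dderiv_Basis L2_L1_loc v F that \<phi> pd by blast+
 have zero: "(\<integral>x. (T (vn x) * dv i x * \<psi> x + S (vn x) * \<psi>' i x) * (dv i x - Fn i x)) =
   (\<integral>x. (dF i x - ddv i x) * (S (vn x) * \<psi> x))" if i: "i \<in> Basis" for i
 proof -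
  note di = dvd[OF i]
  let ?A = "%x. (T (vn x) * dv i x * \<psi> x + S (vn x) * \<psi>' i x) * (dv i x - Fn i x)"
  let ?B = "%x. (S (vn x) * \<psi> x) * (ddv i x - dF i x)"
  \<comment> \<open>The integral of the i-th derivative of S(v_n) \<psi> (d_i v_n - F_n i) vanishes;
    its two product-rule parts are \<open>?B\<close> and \<open>?A\<close>.\<close>
  have dd: "has_dderiv (%x. (S (vn x) * \<psi> x) * (dv i x - Fn i x)) i (%x. ?B x + (S (vn x) * \<psi>' i x + T (vn x) * dv i x * \<psi> x) * (dv i x - Fn i x))"
   by (intro has_dderiv_mult has_dderiv_diff has_dderiv_chain[OF di(1) S(1)] \<psi>(1)[OF i] di)
  have iA: "\<L> ?A"
   using L2_mult[OF L2_add[OF Tv[OF i] S\<psi>(2)[OF i]] L2_diff[OF L(2)[OF i] L(4)[OF i]]]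
   by (simp add: mult.commute mult.left_commute)
  have iB: "\<L> ?B"
   using L2_mult[OF S\<psi>(1) L2_diff[OF L(3)[OF i] L(5)[OF i]]] by (simp add: mult.commute)
  have ip: "\<L> (%x. (S (vn x) * \<psi> x) * (dv i x - Fn i x))"
   using L2_mult[OF S\<psi>(1) L2_diff[OF L(2)[OF i] L(4)[OF i]]] by (simp add: mult.commute)
  have "(%x. ?B x + (S (vn x) * \<psi>' i x + T (vn x) * dv i x * \<psi> x) * (dv i x - Fn i x)) = (%x. ?B x + ?A x)"
   by (simp add: add.commute)
  with integral_dderiv_zero[OF dd ip] iA iB
  have "(\<integral>x. ?B x) + (\<integral>x. ?A x) = 0" by simp
  moreover have "(\<integral>x. ?B x) = - (\<integral>x. (dF i x - ddv i x) * (S (vn x) * \<psi> x))"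
   by (subst Bochner_Integration.integral_minus[symmetric]) (simp add: algebra_simps)
  ultimately show ?thesis by simp
 qed
 have "(\<Sum>i\<in>Basis. \<integral>x. (dF i x - ddv i x) * (S (vn x) * \<psi> x)) =
   (\<integral>x. (\<Sum>i\<in>Basis. (dF i x - ddv i x) * (S (vn x) * \<psi> x)))"
 proof (rule Bochner_Integration.integral_sum[symmetric])
  fix i :: 'a assume i: "i \<in> Basis"
  show "\<L> (%x. (dF i x - ddv i x) * (S (vn x) * \<psi> x))"
   using L2_mult[OF L2_diff[OF L(5)[OF i] L(3)[OF i]] S\<psi>(1)] by (simp add: mult.commute)
 qed
 also have "\<dots> = (\<integral>x. conv g \<phi> x * (S (vn x) * \<psi> x))"
  using weak_eq_conv[OF eq \<phi> L2_L1_loc[OF v] L2_L1_loc[OF F]]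
  by (simp add: dF_def ddv_def flip: sum_distrib_right)
 finally show ?thesis using zero by simp
qed

text \<open>Lebesgue measure is not zero, so an a.e. statement without a variable is true; this is
  how an a.e. upper bound of a norm is seen to be nonnegative.\<close>

lemma AE_lborel_const:
 assumes "AE x in (lborel :: 'a::euclidean_space measure). P" shows P
 using assms by (auto simp: eventually_const_iff ae_filter_eq_bot_iff)

text \<open>Formally the sum is minus the integral of q div D. As q is neither smooth nor compactly
  supported, the field is mollified instead of q: the divergence of the mollified field is
  \<open>conv divD ?K\<close>, still nonnegative, and integration by parts against q is
  legitimate.\<close>

lemma divergence_sign:
 fixes D :: "'a::euclidean_space => 'a"
 assumes \<rho>: "standard_mollifier \<rho>" and D[measurable]: "D \<in> \<M>"
  and bound: "AE x. norm (D x) \<le> m0"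
  and div: "has_weak_div D divD" "AE x. divD x \<ge> 0"
  and q: "!!x. q x \<ge> 0" "\<L> q"
  and q': "!!i. i \<in> Basis ==> has_dderiv q i (q' i)" "!!i. i \<in> Basis ==> \<L> (q' i)"
 shows "(\<Sum>i\<in>Basis. \<integral>x. (D x \<bullet> i) * q' i x) \<le> 0"
proof -
 let ?D = "%i. %x. D x \<bullet> i"
 have m0: "m0 \<ge> 0"
  by (rule AE_lborel_const, use bound in eventually_elim) (use norm_ge_zero order_trans in blast)
 have Di: "?D i \<in> L1_loc" "AE x. \<bar>D x \<bullet> i\<bar> \<le> m0" if "i \<in> Basis" for i
 proof -
  show "AE x. \<bar>D x \<bullet> i\<bar> \<le> m0" using bound
   by eventually_elim (use Basis_le_norm[OF that] order_trans in blast)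
  then show "?D i \<in> L1_loc" by (intro Linf_L1_loc) auto
 qed
 have int0: "\<L> (%x. conv (?D i) (kern \<rho> \<delta>) x * q' i x)"
  "\<L> (%x. conv (?D i) (part_deriv i (kern \<rho> \<delta>)) x * q x)"
  "\<L> (%x. conv (?D i) (kern \<rho> \<delta>) x * q x)" if \<delta>: "\<delta> > 0" and i: "i \<in> Basis" for \<delta> i
 proof -
  have bm: "\<L> (%x. conv (?D i) \<phi> x * h x)" if \<phi>: "\<phi> \<in> test_functions" and h: "\<L> h" for \<phi> h :: "'a => real"
  proof (rule integrable_squeeze)
   show "\<L> (%x. (m0 * (\<integral>z. \<bar>\<phi> z\<bar>)) * \<bar>h x\<bar>)" using h by auto
   have "conv (?D i) \<phi> \<in> \<M>"
    by (intro conv_measurable test_measurable[OF \<phi>] L1_loc_measurable[OF Di(1)[OF i]])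
   then show "(%x. conv (?D i) \<phi> x * h x) \<in> \<M>" using h by auto
   show "AE x. \<bar>conv (?D i) \<phi> x * h x\<bar> \<le> (m0 * (\<integral>z. \<bar>\<phi> z\<bar>)) * \<bar>h x\<bar>"
    using conv_bounded[OF L1_loc_measurable[OF Di(1)[OF i]] Di(2)[OF i] \<phi>] by (auto simp: abs_mult mult_right_mono)
  qed
  note K = kern_test[OF \<rho> \<delta>]
  show "\<L> (%x. conv (?D i) (kern \<rho> \<delta>) x * q' i x)"
   "\<L> (%x. conv (?D i) (part_deriv i (kern \<rho> \<delta>)) x * q x)"
   "\<L> (%x. conv (?D i) (kern \<rho> \<delta>) x * q x)"
   by (rule bm[OF K q'(2)[OF i]] bm[OF test_part_deriv[OF K i] q(2)] bm[OF K q(2)])+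
 qed
 have neg: "(\<Sum>i\<in>Basis. \<integral>x. conv (?D i) (kern \<rho> \<delta>) x * q' i x) \<le> 0" if \<delta>: "\<delta> > 0" for \<delta>
 proof -
  let ?K = "kern \<rho> \<delta> :: 'a => real"
  have Kt: "?K \<in> test_functions" by (rule kern_test[OF \<rho> \<delta>])
  have pd: "part_deriv i ?K \<in> test_functions" if "i \<in> Basis" for i
   by (rule test_part_deriv[OF Kt that])
  note [measurable] = L1_loc_measurable[OF Di(1)] test_measurable[OF pd] test_measurable[OF Kt]
  note int = int0[OF \<delta>]
  have ibp: "(\<integral>x. conv (?D i) ?K x * q' i x) = - (\<integral>x. conv (?D i) (part_deriv i ?K) x * q x)"
   if i: "i \<in> Basis" for i
  proof -
   have dd: "has_dderiv (%x. conv (?D i) ?K x * q x) i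
    (%x. conv (?D i) ?K x * q' i x + conv (?D i) (part_deriv i ?K) x * q x)"
    by (rule has_dderiv_mult[OF conv_has_dderiv_Basis[OF Di(1)[OF i] Kt i] q'(1)[OF i]])
   from integral_dderiv_zero[OF dd int(3)[OF i]] int[OF i] show ?thesis by simp
  qed
  have "(\<Sum>i\<in>Basis. conv (?D i) (part_deriv i ?K) x) = conv divD ?K x" for x
   using div test_reflect[OF Kt, of x] integral_inner_grad_reflect[OF Kt Di(1), of x]
   unfolding has_weak_div_def conv_def by fastforce
  then have "(\<Sum>i\<in>Basis. \<integral>x. conv (?D i) (part_deriv i ?K) x * q x) = (\<integral>x. conv divD ?K x * q x)"
   using int(2) by (subst Bochner_Integration.integral_sum[symmetric]) (auto simp flip: sum_distrib_right)
  also have "\<dots> \<ge> 0"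
  proof (intro Bochner_Integration.integral_nonneg mult_nonneg_nonneg q(1))
   fix x show "conv divD ?K x \<ge> 0"
    unfolding conv_def by (rule integral_nonneg_AE) (use div(2) kern_nonneg[OF \<rho> \<delta>, where 'a='a] in \<open>auto elim!: eventually_mono\<close>)
  qed
  finally show ?thesis using ibp by (simp add: sum_negf)
 qed
 have lim: "(%n. \<integral>x. conv (?D i) (kern \<rho> (inverse (real (Suc n)))) x * q' i x)
   ----> (\<integral>x. (D x \<bullet> i) * q' i x)" if i: "i \<in> Basis" for i
 proof -
  let ?d = "%n. inverse (real (Suc n))" and ?h = "%x. D x \<bullet> i"
  note [measurable] = L1_loc_measurable[OF Di(1)[OF i]]
  have q'i: "\<L> (q' i)" by (rule q'(2)[OF i])
  then have [measurable]: "q' i \<in> \<M>" by auto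
  have bnd: "AE x. \<bar>?h x\<bar> \<le> m0" by (rule Di(2)[OF i])
  have hq: "\<L> (%x. ?h x * q' i x)"
   by (rule integrable_squeeze[of "%x. m0 * \<bar>q' i x\<bar>"]) (use bnd q'i in \<open>auto simp: abs_mult mult_right_mono elim!: eventually_mono\<close>)
  have wi: "\<L> (%x. \<bar>q' i x\<bar> * \<bar>?h (x + k) - ?h x\<bar>)" for k
  proof (rule integrable_squeeze[of "%x. (2 * m0) * \<bar>q' i x\<bar>"])
   show "AE x. \<bar>\<bar>q' i x\<bar> * \<bar>?h (x + k) - ?h x\<bar>\<bar> \<le> (2 * m0) * \<bar>q' i x\<bar>"
    using AE_shift[OF bnd, of k] bnd
   proof eventually_elim
    case (elim x)
    then have "\<bar>?h (x + k) - ?h x\<bar> \<le> 2 * m0" by linarith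
    from mult_left_mono[OF this abs_ge_zero[of "q' i x"]] show ?case by (simp add: mult.commute)
   qed
  qed (use q'i in auto)
  let ?T = "%n. \<integral>x. \<bar>q' i x\<bar> * \<bar>conv ?h (kern \<rho> (?d n)) x - ?h x\<bar>"
  have T: "?T ----> 0"
  proof (rule kern_scale_tendsto[OF _ _ _ LIMSEQ_inverse_real_of_nat, where F="%k. \<integral>x. \<bar>q' i x\<bar> * \<bar>?h (x + k) - ?h x\<bar>"])
   show "?T n \<le> e" if "e \<ge> 0" "!!k. norm k \<le> real DIM('a) * ?d n ==> (\<integral>x. \<bar>q' i x\<bar> * \<bar>?h (x + - k) - ?h x\<bar>) \<le> e" for n e
    by (rule conv_kern_weighted_le[OF \<rho> _ Di(1)[OF i] that(1)]) (use that(2) wi[of "- k" for k] in auto)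
   fix k :: "nat => 'a" assume k: "k ----> 0"
   \<comment> \<open>\<open>D\<close> is only bounded, so its translates are not close in norm. With
     the weight |q'| the difference is controlled by the translates of two integrable functions, q'
     and (D . i) q'.\<close>
   let ?A = "%n x. \<bar>q' i (x + k n) - q' i x\<bar>" and ?B = "%n x. \<bar>?h (x + k n) * q' i (x + k n) - ?h x * q' i x\<bar>"
   show "(%n. \<integral>x. \<bar>q' i x\<bar> * \<bar>?h (x + k n) - ?h x\<bar>) ----> 0"
   proof (rule Lim_null_comparison[OF always_eventually[OF allI]])
    show "(%n. m0 * (\<integral>x. ?A n x) + (\<integral>x. ?B n x)) ----> 0"
     using tendsto_add[OF tendsto_mult_right_zero[OF L1_translation_continuous[OF q'i k]] L1_translation_continuous[OF hq k]] by simp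
    have AB: "\<L> (?A n)" "\<L> (?B n)" for n
     using integrable_shift[OF q'i, of "k n"] q'i integrable_shift[OF hq, of "k n"] hq by auto
    have le: "(\<integral>x. \<bar>q' i x\<bar> * \<bar>?h (x + k n) - ?h x\<bar>) \<le> (\<integral>x. m0 * ?A n x + ?B n x)" for n
    proof (rule integral_mono_AE[OF wi])
     show "AE x. \<bar>q' i x\<bar> * \<bar>?h (x + k n) - ?h x\<bar> \<le> m0 * ?A n x + ?B n x"
      using AE_shift[OF bnd, of "k n"]
     proof eventually_elim
      case (elim x)
      have "\<bar>q' i x\<bar> * \<bar>?h (x + k n) - ?h x\<bar> = \<bar>(?h (x + k n) * q' i (x + k n) - ?h x * q' i x) - ?h (x + k n) * (q' i (x + k n) - q' i x)\<bar>"
       unfolding abs_mult[symmetric] by (simp add: algebra_simps)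
      also have "\<dots> \<le> ?B n x + \<bar>?h (x + k n)\<bar> * ?A n x" unfolding abs_mult[symmetric] by (rule abs_triangle_ineq4)
      also have "\<dots> \<le> ?B n x + m0 * ?A n x" using elim by (intro add_left_mono mult_right_mono) auto
      finally show ?case by simp
     qed
    qed (use AB in auto)
    show "norm (\<integral>x. \<bar>q' i x\<bar> * \<bar>?h (x + k n) - ?h x\<bar>) \<le> m0 * (\<integral>x. ?A n x) + (\<integral>x. ?B n x)" for n
     using le[of n] AB[of n] by simp
   qed
  qed simp
  show ?thesis
  proof (rule L1_tendsto_integral(1)[OF _ hq])
   show "\<L> (%x. conv ?h (kern \<rho> (?d n)) x * q' i x)" for n using int0[of "?d n", OF _ i] by simp
   show "(%n. \<integral>x. \<bar>conv ?h (kern \<rho> (?d n)) x * q' i x - ?h x * q' i x\<bar>) ----> 0"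
    using T by (simp add: mult.commute[of _ "q' i _"] flip: right_diff_distrib abs_mult del: of_nat_Suc)
  qed
 qed
 have "(%n. \<Sum>i\<in>Basis. \<integral>x. conv (?D i) (kern \<rho> (inverse (real (Suc n)))) x * q' i x) ---->
  (\<Sum>i\<in>Basis. \<integral>x. (D x \<bullet> i) * q' i x)" by (intro tendsto_sum lim)
 then show ?thesis by (rule LIMSEQ_le_const2) (use neg in auto)
qed

section \<open>Translation estimates\<close>


lemma convergent_abs_bound:
 fixes X :: "nat => real"
 assumes "X ----> L" shows "\<exists>B. \<forall>n. \<bar>X n\<bar> \<le> B"
 using convergent_imp_bounded[OF assms] by (auto simp: bounded_iff)

lemma directional_square_le:
 fixes w :: "'a::euclidean_space"
 shows "(\<Sum>i\<in>Basis. (w \<bullet> i) * d i)^2 \<le> (norm w)^2 * (\<Sum>i\<in>Basis. (d i)^2)"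
proof -
 have "(norm w)^2 = (\<Sum>i\<in>Basis. (w \<bullet> i)^2)"
  unfolding power2_norm_eq_inner using euclidean_inner[of w w] by (simp add: power2_eq_square)
 then show ?thesis using Cauchy_Schwarz_ineq_sum[of "%i. w \<bullet> i" d Basis] by simp
qed

text \<open>The energy estimate with S(v) as test function. The hypothesis \<open>link\<close> turns
  T(v) F . grad v into \<eta> D . grad H(v) with H' = K; by \<open>divergence_sign\<close> this has
  the favourable sign up to the term with grad \<eta>, which costs m1 times the integral of H(v).
  The gradient appears only for the mollified functions and leaves as a translation bound.\<close>

lemma master_translation:
 fixes D F :: "'a::euclidean_space => 'a" and v g \<eta> Bv :: "'a => real" and S T H K :: "real => real"
 assumes \<rho>: "standard_mollifier \<rho>"
  and eq: "weak_eq v F g" and v: "v \<in> L2" and g: "g \<in> L2"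
  and D[measurable]: "D \<in> \<M>" and bound: "AE x. norm (D x) \<le> m0"
  and div: "has_weak_div D divD" "AE x. divD x \<ge> 0"
  and F: "!!x. F x = (\<eta> x * Bv x) *\<^sub>R D x" and Bv: "Bv \<in> L2"
  and \<eta>: "!!i. i \<in> Basis ==> has_dderiv \<eta> i (\<eta>' i)" "!!x. 0 \<le> \<eta> x" "!!x. \<eta> x \<le> 1"
   "!!i x. i \<in> Basis ==> \<bar>\<eta>' i x\<bar> \<le> E" "AE x. \<bar>\<Sum>i\<in>Basis. \<eta>' i x * (D x \<bullet> i)\<bar> \<le> m1"
  and \<eta>m[measurable]: "\<eta> \<in> \<M>" "!!i. i \<in> Basis ==> \<eta>' i \<in> \<M>"
  and S: "!!r. (S has_real_derivative T r) (at r)" "!!r. 0 \<le> T r" "!!r. T r \<le> \<tau>" "S 0 = 0"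
  and Tc: "continuous_on UNIV T"
  and H: "!!r. (H has_real_derivative K r) (at r)" "!!r. \<bar>K r\<bar> \<le> C * \<bar>r\<bar>" "!!r. 0 \<le> H r" "!!r. H r \<le> C * r^2"
  and Kc: "continuous_on UNIV K"
  and link: "AE x. T (v x) * Bv x = K (v x)"
 shows "(\<integral>x. (S (v (x + w)) - S (v x))^2) \<le>
  (norm w)^2 * (\<tau> * ((\<integral>x. g x * S (v x)) + m1 * (\<integral>x. H (v x))))"
proof -
 have \<tau>: "\<tau> \<ge> 0" using S(2)[of 0] S(3)[of 0] by linarith
 have \<tau>T: "\<bar>T r\<bar> \<le> \<tau>" for r using S(2)[of r] S(3)[of r] by linarith
 have [measurable]: "T \<in> \<M>" "K \<in> \<M>"
  using Tc Kc by (auto intro: borel_measurable_continuous_onI)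
 have "continuous_on UNIV S" "continuous_on UNIV H"
  using S(1) H(1) by (meson DERIV_isCont continuous_at_imp_continuous_on)+
 then have Hc: "continuous_on UNIV H" and [measurable]: "S \<in> \<M>" "H \<in> \<M>"
  by (auto intro: borel_measurable_continuous_onI)
 note [measurable] = L2_measurable[OF v] L2_measurable[OF Bv] L2_measurable[OF g]
 have Di: "AE x. \<bar>D x \<bullet> i\<bar> \<le> m0" if "i \<in> Basis" for i
  using bound by eventually_elim (use Basis_le_norm[OF that] order_trans in blast)
 have m0: "m0 \<ge> 0"
  by (rule AE_lborel_const, use bound in eventually_elim) (use norm_ge_zero order_trans in blast)
 have FL: "(%x. F x \<bullet> i) \<in> L2" if i: "i \<in> Basis" for i
 proof (rule L2_dominated[OF Bv])
  show "AE x. \<bar>F x \<bullet> i\<bar> \<le> m0 * \<bar>Bv x\<bar>"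
   using Di[OF i]
  proof eventually_elim
   case (elim x)
   have "\<bar>F x \<bullet> i\<bar> = \<eta> x * (\<bar>Bv x\<bar> * \<bar>D x \<bullet> i\<bar>)" using \<eta>(2)[of x] by (simp add: F abs_mult)
   also have "\<dots> \<le> 1 * (\<bar>Bv x\<bar> * m0)" using elim \<eta>(2,3)[of x] by (intro mult_mono) auto
   finally show ?case by (simp add: mult.commute)
  qed
 qed (simp add: F)
 obtain k where kt: "!!n. k n \<in> test_functions" and kL: "L2_tendsto (%n. conv v (k n)) v" "L2_tendsto (%n. conv g (k n)) g"
  "!!i. i \<in> Basis ==> L2_tendsto (%n. conv (%x. F x \<bullet> i) (k n)) (%x. F x \<bullet> i)"
  "AE x. (%n. conv v (k n) x) ----> v x \<and> (\<forall>i\<in>Basis. (%n. conv (%x. F x \<bullet> i) (k n) x) ----> F x \<bullet> i)"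
  using mollifying_sequence[OF \<rho> v g, of "%i x. F x \<bullet> i", OF FL] by blast
 define vn where "vn n = conv v (k n)" for n
 define dv where "dv n i = conv v (part_deriv i (k n))" for n i
 define Fn where "Fn n i = conv (%x. F x \<bullet> i) (k n)" for n i
 define gn where "gn n = conv g (k n)" for n
 note vL = kL(1)[folded vn_def] and gL = kL(2)[folded gn_def] and FnL = kL(3)[folded Fn_def] and ae = kL(4)[folded vn_def Fn_def]
 have dvL: "dv n i \<in> L2" if "i \<in> Basis" for n i
  unfolding dv_def by (rule conv_L2[OF v test_part_deriv[OF kt that]])
 have L: "vn n \<in> L2" "gn n \<in> L2" "i \<in> Basis ==> Fn n i \<in> L2" for n i
  using vL gL FnL by (auto simp: L2_tendsto_def)
 note [measurable] = L[THEN L2_measurable] dvL[THEN L2_measurable]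
 have SL: "L2_tendsto (%n x. S (vn n x)) (%x. S (v x))"
  by (rule L2_tendsto_lipschitz[OF vL lipschitz_of_deriv[OF S(1) \<tau>T] S(4)]) measurable
 have TdvL: "(%x. T (vn n x) * dv n i x) \<in> L2" if "i \<in> Basis" for n i
  by (rule L2_bounded_mult[OF dvL[OF that], of _ \<tau>]) (use \<tau>T in auto)
 have C: "C \<ge> 0" using order_trans[OF abs_ge_zero H(2)[of 1]] by simp
 have KL: "(%x. K (vn n x)) \<in> L2" for n
  by (rule L2_dominated[OF L(1)[of n]]) (use H(2) in auto)
 have HL: "\<L> (%x. H (vn n x))" for n
  by (rule integrable_squeeze[of "%x. C * (vn n x)^2"]) (use L2_integrable[OF L(1)] H(3,4) in auto)
 have id1: "(\<Sum>i\<in>Basis. \<integral>x. (T (vn n x) * dv n i x) * (dv n i x - Fn n i x)) = (\<integral>x. gn n x * S (vn n x))" for n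
  using mollified_identity[OF eq kt v FL g S(1) \<tau>T S(4), of "%_. 1" "%_ _. 0" 1 n]
  by (simp add: has_dderiv_const vn_def dv_def Fn_def gn_def)
 have id2: "(\<Sum>i\<in>Basis. \<integral>x. dv n i x * (dv n i x - Fn n i x)) = (\<integral>x. gn n x * vn n x)" for n
  using mollified_identity[OF eq kt v FL g, of "%r. r" "%_. 1" 1 "%_. 1" "%_ _. 0" 1 n]
  by (simp add: has_dderiv_const vn_def dv_def Fn_def gn_def)
 \<comment> \<open>A crude gradient bound, uniform in n, from testing with v_n itself. Its size does
   not matter: it multiplies the error R n, which tends to 0.\<close>
 define G where "G n = (\<Sum>i\<in>Basis. \<integral>x. (dv n i x)^2)" for n
 have G_le: "G n \<le> (\<Sum>i\<in>Basis. \<integral>x. (Fn n i x)^2) + 2 * (\<integral>x. gn n x * vn n x)" for n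
 proof -
  have "(\<integral>x. (dv n i x)^2) \<le> 2 * (\<integral>x. dv n i x * (dv n i x - Fn n i x)) + (\<integral>x. (Fn n i x)^2)"
   if i: "i \<in> Basis" for i
  proof -
   note ii = L2_integrable[OF dvL[OF i, of n]] L2_integrable[OF L(3)[OF i, of n]] L2_mult[OF dvL[OF i, of n] L2_diff[OF dvL[OF i, of n] L(3)[OF i, of n]]]
   have "(\<integral>x. (dv n i x)^2) \<le> (\<integral>x. 2 * (dv n i x * (dv n i x - Fn n i x)) + (Fn n i x)^2)"
   proof (rule integral_mono)
    fix x show "(dv n i x)^2 \<le> 2 * (dv n i x * (dv n i x - Fn n i x)) + (Fn n i x)^2"
     using zero_le_power2[of "dv n i x - Fn n i x"] by (simp add: power2_eq_square algebra_simps)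
   qed (use ii in auto)
   then show ?thesis using ii by simp
  qed
  then have "G n \<le> (\<Sum>i\<in>Basis. 2 * (\<integral>x. dv n i x * (dv n i x - Fn n i x)) + (\<integral>x. (Fn n i x)^2))"
   unfolding G_def by (rule sum_mono)
  then show ?thesis using id2[of n] by (simp add: sum.distrib flip: sum_distrib_left)
 qed
 have "(%n. (\<Sum>i\<in>Basis. \<integral>x. (Fn n i x)^2) + 2 * (\<integral>x. gn n x * vn n x)) ---->
   (\<Sum>i\<in>Basis. \<integral>x. (F x \<bullet> i)^2) + 2 * (\<integral>x. g x * v x)"
  by (intro tendsto_intros L2_tendsto_square FnL L2_tendsto_mult gL vL)
 then obtain G0 where G0: "!!n. \<bar>(\<Sum>i\<in>Basis. \<integral>x. (Fn n i x)^2) + 2 * (\<integral>x. gn n x * vn n x)\<bar> \<le> G0"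
  using convergent_abs_bound by blast
 have GG: "G n \<le> G0" for n using G_le[of n] G0[of n] by linarith
 have Hlim: "(%n. \<integral>x. H (vn n x)) ----> (\<integral>x. H (v x))"
 proof (rule dominated_convergence_L1(3)[where k="%n x. C * (vn n x)^2" and k'="%x. C * (v x)^2"])
  show "AE x. (%n. H (vn n x)) ----> H (v x)"
   using ae by eventually_elim (use Hc in \<open>auto intro!: continuous_on_tendsto_compose[of UNIV H]\<close>)
  show "AE x. (%n. C * (vn n x)^2) ----> C * (v x)^2"
   using ae by eventually_elim (intro tendsto_intros, simp)
  show "(%n. \<integral>x. C * (vn n x)^2) ----> (\<integral>x. C * (v x)^2)"
   using tendsto_mult_left[OF L2_tendsto_square[OF vL], of C] by simp
  show "AE x. \<bar>H (vn n x)\<bar> \<le> C * (vn n x)^2" for n using H(3,4) by simp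
 qed (use L2_integrable[OF L(1)] L2_integrable[OF v] in auto)
 \<comment> \<open>Mollification does not commute with the product in F, so \<open>link\<close>
   fails for the mollified functions. R n is the defect; both of its terms have the same a.e. limit,
   so it tends to 0 in L^2.\<close>
 define R where "R n i x = T (vn n x) * Fn n i x - \<eta> x * (D x \<bullet> i) * K (vn n x)" for n i x
 have etaD: "AE x. \<bar>\<eta> x * (D x \<bullet> i)\<bar> \<le> m0" if i: "i \<in> Basis" for i
  using Di[OF i]
 proof eventually_elim
  case (elim x)
  have "\<bar>\<eta> x * (D x \<bullet> i)\<bar> = \<eta> x * \<bar>D x \<bullet> i\<bar>" using \<eta>(2)[of x] by (simp add: abs_mult)
  also have "\<dots> \<le> 1 * m0" using elim \<eta>(2,3)[of x] by (intro mult_mono) auto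
  finally show ?case by simp
 qed
 have DK: "(%x. \<eta> x * (D x \<bullet> i) * K (vn n x)) \<in> L2" if i: "i \<in> Basis" for n i
 proof (rule L2_dominated[OF KL[of n]])
  show "AE x. \<bar>\<eta> x * (D x \<bullet> i) * K (vn n x)\<bar> \<le> m0 * \<bar>K (vn n x)\<bar>"
   using etaD[OF i] by eventually_elim (simp only: abs_mult[of "_ * _" "K _"] mult_right_mono abs_ge_zero)
 qed measurable
 have RL: "R n i \<in> L2" if i: "i \<in> Basis" for n i
  unfolding R_def[abs_def] using that \<tau>T
  by (intro L2_diff DK L2_bounded_mult[OF L(3), of _ _ \<tau>]) auto
 note [measurable] = RL[THEN L2_measurable]
 have Rlim: "(%n. \<integral>x. (R n i x)^2) ----> 0" if i: "i \<in> Basis" for i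
 proof -
  define M where "M = 2 * \<tau>^2"
  define N where "N = 2 * (m0 * C)^2"
  have "(%n. \<integral>x. (R n i x)^2) ----> (\<integral>x. 0 \<partial>(lborel :: 'a measure))"
  proof (rule dominated_convergence_L1(3)[where k="%n x. M * (Fn n i x)^2 + N * (vn n x)^2" and k'="%x. M * (F x \<bullet> i)^2 + N * (v x)^2"])
   show "AE x. (%n. (R n i x)^2) ----> 0"
    using ae link
   proof eventually_elim
    case (elim x)
    have "(%n. (R n i x)^2) ----> (T (v x) * (F x \<bullet> i) - \<eta> x * (D x \<bullet> i) * K (v x))\<^sup>2"
     unfolding R_def using elim i Tc Kc
     by (intro tendsto_intros continuous_on_tendsto_compose[of UNIV T] continuous_on_tendsto_compose[of UNIV K]) auto
    moreover have "T (v x) * (F x \<bullet> i) - \<eta> x * (D x \<bullet> i) * K (v x) = 0"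
     using elim(2) by (simp add: F flip: elim(2))
    ultimately show ?case by simp
   qed
   show "AE x. (%n. M * (Fn n i x)^2 + N * (vn n x)^2) ----> M * (F x \<bullet> i)^2 + N * (v x)^2"
    using ae by eventually_elim (intro tendsto_intros, use i in auto)
   have "(%n. M * (\<integral>x. (Fn n i x)^2) + N * (\<integral>x. (vn n x)^2)) ---->
    M * (\<integral>x. (F x \<bullet> i)^2) + N * (\<integral>x. (v x)^2)"
    by (intro tendsto_intros L2_tendsto_square vL FnL[OF i])
   then show "(%n. \<integral>x. M * (Fn n i x)^2 + N * (vn n x)^2) ----> (\<integral>x. M * (F x \<bullet> i)^2 + N * (v x)^2)"
    using L2_integrable[OF L(1)] L2_integrable[OF L(3)[OF i]] L2_integrable[OF v] L2_integrable[OF FL[OF i]] by simp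
   show "AE x. \<bar>(R n i x)\<^sup>2\<bar> \<le> M * (Fn n i x)^2 + N * (vn n x)^2" for n
    using etaD[OF i]
   proof eventually_elim
    case (elim x)
    have "\<bar>T (vn n x) * Fn n i x\<bar> \<le> \<tau> * \<bar>Fn n i x\<bar>" using \<tau>T by (simp add: abs_mult mult_right_mono)
    then have 1: "(T (vn n x) * Fn n i x)^2 \<le> \<tau>^2 * (Fn n i x)^2"
     by (rule square_le_of_abs)
    have "\<bar>\<eta> x * (D x \<bullet> i) * K (vn n x)\<bar> \<le> m0 * (C * \<bar>vn n x\<bar>)"
     unfolding abs_mult[of "\<eta> x * (D x \<bullet> i)"] using elim H(2)[of "vn n x"] m0 by (intro mult_mono) auto
    then have 2: "(\<eta> x * (D x \<bullet> i) * K (vn n x))^2 \<le> (m0 * C)^2 * (vn n x)^2"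
     by (intro square_le_of_abs) (simp add: mult.assoc)
    show ?case using power2_add_le[of "T (vn n x) * Fn n i x" "- (\<eta> x * (D x \<bullet> i) * K (vn n x))"] 1 2
     unfolding R_def M_def N_def by simp
   qed
  qed (use RL[OF i] L2_integrable[OF L(1)] L2_integrable[OF L(3)[OF i]] L2_integrable[OF v] L2_integrable[OF FL[OF i]] i in auto)
  then show ?thesis by simp
 qed
 define A where "A n = (\<Sum>i\<in>Basis. \<integral>x. T (vn n x) * (dv n i x)^2)" for n
 let ?DK = "%n i. \<integral>x. \<eta> x * (D x \<bullet> i) * K (vn n x) * dv n i x"
 let ?TS = "%n x. \<tau> * (\<Sum>i\<in>Basis. T (vn n x) * (dv n i x)^2)"
 let ?I = "%n i. \<integral>x. (dv n i x)^2"
 let ?R = "%n i. \<integral>x. (R n i x)^2"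
 let ?St = "%n. \<integral>x. (S (vn n (x + w)) - S (vn n x))^2"
 let ?Sv = "\<integral>x. (S (v (x + w)) - S (v x))^2"
 let ?DH = "%n i x. (D x \<bullet> i) * (\<eta>' i x * H (vn n x))"
 let ?SDH = "%n x. \<Sum>i\<in>Basis. ?DH n i x"
 let ?wd = "%n x. \<Sum>i\<in>Basis. (w \<bullet> i) * dv n i x"
 let ?gS = "%n. \<integral>x. gn n x * S (vn n x)"
 let ?IH = "%n. \<integral>x. H (vn n x)"
 define Q where "Q n = (\<Sum>i\<in>Basis. sqrt (?R n i) * sqrt G0)" for n
 have Ti: "\<L> (%x. T (vn n x) * (dv n i x)^2)" if i: "i \<in> Basis" for i n
  using L2_mult[OF TdvL[OF i] dvL[OF i]] by (simp add: power2_eq_square mult.assoc)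
 have A_le: "A n \<le> Q n + m1 * ?IH n + ?gS n" for n
 proof -
  let ?q' = "%i x. \<eta> x * (K (vn n x) * dv n i x) + \<eta>' i x * H (vn n x)"
  have KdvI: "\<L> (%x. (K (vn n x) * dv n i x))" if i: "i \<in> Basis" for i
   by (rule L2_mult[OF KL dvL[OF i]])
  have e1I: "\<L> (%x. \<eta> x * (K (vn n x) * dv n i x))" if i: "i \<in> Basis" for i
   by (rule integrable_squeeze[of "%x. \<bar>K (vn n x) * dv n i x\<bar>"])
    (use KdvI[OF i, THEN integrable_abs] \<eta>(2,3) i in \<open>auto simp: abs_mult mult_left_le_one_le\<close>)
  have e2I: "\<L> (%x. \<eta>' i x * H (vn n x))" if i: "i \<in> Basis" for i
   by (rule integrable_squeeze[of "%x. E * H (vn n x)"])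
    (use HL \<eta>(4)[OF i] H(3) i in \<open>auto simp: abs_mult mult_right_mono\<close>)
  have qI: "\<L> (%x. \<eta> x * H (vn n x))"
   by (rule integrable_squeeze[of "%x. H (vn n x)"])
    (use HL \<eta>(2,3) H(3) in \<open>auto simp: abs_mult mult_left_le_one_le\<close>)
  have Dm: "\<L> (%x. (D x \<bullet> i) * h x)" if "\<L> h" "i \<in> Basis" for h :: "'a => real" and i
  proof (rule integrable_squeeze[of "%x. m0 * \<bar>h x\<bar>"])
   show "AE x. \<bar>(D x \<bullet> i) * h x\<bar> \<le> m0 * \<bar>h x\<bar>" using Di[OF that(2)]
    by eventually_elim (simp add: abs_mult mult_right_mono)
  qed (use that in auto)
  \<comment> \<open>Applied with q = \<eta> H(v_n). The product rule leaves the term grad \<eta> . D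
    H(v_n), bounded through m1.\<close>
  have ds: "(\<Sum>i\<in>Basis. \<integral>x. (D x \<bullet> i) * ?q' i x) \<le> 0"
  proof (rule divergence_sign[OF \<rho> D bound div])
   show "has_dderiv (%x. \<eta> x * H (vn n x)) i (?q' i)" if i: "i \<in> Basis" for i
   proof (rule has_dderiv_mult[OF \<eta>(1)[OF i]])
    have "has_dderiv (vn n) i (dv n i)"
     unfolding vn_def dv_def by (rule conv_has_dderiv_Basis[OF L2_L1_loc[OF v] kt i])
    then show "has_dderiv (%x. H (vn n x)) i (%x. K (vn n x) * dv n i x)"
     by (rule has_dderiv_chain[OF _ H(1)])
   qed
  qed (use \<eta>(2) H(3) qI e1I e2I in auto)
  have "(\<Sum>i\<in>Basis. \<integral>x. (D x \<bullet> i) * ?q' i x) =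
    (\<Sum>i\<in>Basis. ?DK n i + (\<integral>x. ?DH n i x))"
  proof (rule sum.cong[OF refl])
   fix i :: 'a assume i: "i \<in> Basis"
   have "(\<integral>x. (D x \<bullet> i) * ?q' i x) = (\<integral>x. (D x \<bullet> i) * (\<eta> x * (K (vn n x) * dv n i x)) + ?DH n i x)"
    by (simp add: distrib_left)
   also have "\<dots> = (\<integral>x. (D x \<bullet> i) * (\<eta> x * (K (vn n x) * dv n i x))) + (\<integral>x. ?DH n i x)"
    using Dm e1I e2I i by simp
   finally show "(\<integral>x. (D x \<bullet> i) * ?q' i x) =
    (?DK n i) + (\<integral>x. ?DH n i x)"
    by (simp add: mult_ac)
  qed
  also have "\<dots> = (\<Sum>i\<in>Basis. ?DK n i) + (\<Sum>i\<in>Basis. \<integral>x. ?DH n i x)"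
   by (rule sum.distrib)
  also have "(\<Sum>i\<in>Basis. \<integral>x. ?DH n i x) = (\<integral>x. ?SDH n x)"
   using Dm e2I by (intro Bochner_Integration.integral_sum[symmetric]) auto
  finally have split: "(\<Sum>i\<in>Basis. \<integral>x. (D x \<bullet> i) * ?q' i x) =
   (\<Sum>i\<in>Basis. ?DK n i) + (\<integral>x. ?SDH n x)" .
  have "(\<integral>x. ?SDH n x) \<ge> - (m1 * ?IH n)"
  proof -
   have "\<bar>\<integral>x. ?SDH n x\<bar> \<le> (\<integral>x. m1 * H (vn n x))"
   proof (rule order_trans[OF integral_abs_bound], rule integral_mono_abs)
    show "AE x. \<bar>\<Sum>i\<in>Basis. ?DH n i x\<bar> \<le> m1 * H (vn n x)"
     using \<eta>(5)
    proof eventually_elim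
     case (elim x)
     have "?SDH n x = (\<Sum>i\<in>Basis. \<eta>' i x * (D x \<bullet> i)) * H (vn n x)"
      unfolding sum_distrib_right by (intro sum.cong refl) (simp add: mult_ac)
     then show ?case using elim H(3)[of "vn n x"] by (simp add: abs_mult mult_right_mono)
    qed
   qed (use HL \<eta>m(2) in auto)
   then show ?thesis by simp
  qed
  then have ds': "(\<Sum>i\<in>Basis. ?DK n i) \<le> m1 * ?IH n"
   using ds split by linarith
  have "(\<Sum>i\<in>Basis. \<integral>x. (T (vn n x) * dv n i x) * (dv n i x - Fn n i x)) =
   (\<Sum>i\<in>Basis. (\<integral>x. T (vn n x) * (dv n i x)^2) - (\<integral>x. R n i x * dv n i x) - (?DK n i))"
  proof (rule sum.cong[OF refl])
   fix i :: 'a assume i: "i \<in> Basis"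
   have "(\<integral>x. (T (vn n x) * dv n i x) * (dv n i x - Fn n i x)) =
    (\<integral>x. T (vn n x) * (dv n i x)^2 - R n i x * dv n i x - \<eta> x * (D x \<bullet> i) * K (vn n x) * dv n i x)"
    by (intro Bochner_Integration.integral_cong) (auto simp: R_def power2_eq_square algebra_simps)
   also have "\<dots> = (\<integral>x. T (vn n x) * (dv n i x)^2) - (\<integral>x. R n i x * dv n i x) - (?DK n i)"
    using Ti[OF i] L2_mult[OF RL[OF i] dvL[OF i]] L2_mult[OF DK[OF i] dvL[OF i]] by simp
   finally show "(\<integral>x. (T (vn n x) * dv n i x) * (dv n i x - Fn n i x)) = \<dots>" .
  qed
  then have "A n = (\<Sum>i\<in>Basis. \<integral>x. R n i x * dv n i x) + (\<Sum>i\<in>Basis. ?DK n i) + ?gS n"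
   unfolding A_def using id1[of n] by (simp add: sum_subtractf)
  moreover have "(\<Sum>i\<in>Basis. \<integral>x. R n i x * dv n i x) \<le> Q n"
   unfolding Q_def
  proof (rule sum_mono)
   fix i :: 'a assume i: "i \<in> Basis"
   have "?I n i \<le> G n"
    unfolding G_def by (rule member_le_sum[OF i]) auto
   then have "sqrt (?I n i) \<le> sqrt G0" using GG[of n] by simp
   then have "sqrt (?R n i) * sqrt (?I n i) \<le> sqrt (?R n i) * sqrt G0"
    by (intro mult_left_mono) auto
   then show "(\<integral>x. R n i x * dv n i x) \<le> sqrt (?R n i) * sqrt G0"
    using cauchy_schwarz_L2[OF RL[OF i, of n] dvL[OF i, of n]] by linarith
  qed
  ultimately show ?thesis using ds' by linarith
 qed
 have Qlim: "(%n. Q n) ----> 0"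
 proof -
  have "(%n. Q n) ----> (\<Sum>i\<in>(Basis::'a set). sqrt 0 * sqrt G0)"
   unfolding Q_def by (intro tendsto_intros Rlim)
  then show ?thesis by simp
 qed
 have trans: "?St n \<le> (norm w)^2 * (\<tau> * A n)" for n
 proof -
  have dd: "has_dderiv (%x. S (vn n x)) w (%x. T (vn n x) * ?wd n x)"
   unfolding vn_def dv_def
   by (intro has_dderiv_chain[OF _ S(1)] conv_has_dderiv[OF L2_L1_loc[OF v] kt])
  have sm: "(%x. \<Sum>i\<in>Basis. (w \<bullet> i) * dv n i x) \<in> \<M>" by measurable
  have pt: "(T (vn n x) * ?wd n x)^2 \<le> (norm w)^2 * ?TS n x" for x
  proof -
   \<comment> \<open>One factor T is traded for its bound \<tau>; the other remains as the weight of
     the energy A n.\<close>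
   have "(T (vn n x))^2 \<le> \<tau> * T (vn n x)" using S(2,3)[of "vn n x"] by (simp add: power2_eq_square mult_right_mono)
   then have "(T (vn n x))^2 * ?wd n x^2 \<le> (\<tau> * T (vn n x)) * ((norm w)^2 * (\<Sum>i\<in>Basis. (dv n i x)^2))"
    by (intro mult_mono directional_square_le) (use S(2) \<tau> in auto)
   moreover have "(\<tau> * T (vn n x)) * ((norm w)^2 * (\<Sum>i\<in>Basis. (dv n i x)^2)) =
    (norm w)^2 * ?TS n x"
    by (simp add: sum_distrib_left mult_ac)
   ultimately show ?thesis by (simp only: power_mult_distrib)
  qed
  have I: "\<L> (%x. (norm w)^2 * ?TS n x)"
   using Ti by auto
  have SvL: "(%x. S (vn n x)) \<in> L2" using SL by (simp add: L2_tendsto_def)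
  have "ennreal (?St n) = (\<integral>\<^sup>+x. ennreal ((S (vn n (x + w)) - S (vn n x))^2))"
   using L2_integrable[OF L2_diff[OF L2_shift[OF SvL, of w] SvL]] by (simp add: nn_integral_eq_integral)
  also have "\<dots> \<le> (\<integral>\<^sup>+x. ennreal ((T (vn n x) * ?wd n x)^2))"
   using translation_le_dderiv[OF dd] sm by simp
  also have "\<dots> \<le> (\<integral>\<^sup>+x. ennreal ((norm w)^2 * ?TS n x))"
   by (intro nn_integral_mono ennreal_leI pt)
  also have "\<dots> = ennreal (\<integral>x. (norm w)^2 * ?TS n x)"
   using I S(2) \<tau> by (intro nn_integral_eq_integral) (auto intro!: mult_nonneg_nonneg sum_nonneg)
  also have "(\<integral>x. (norm w)^2 * ?TS n x) = (norm w)^2 * (\<tau> * A n)"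
   unfolding A_def using Ti by (simp add: Bochner_Integration.integral_sum)
  finally show ?thesis
   using S(2) \<tau> by (subst (asm) ennreal_le_iff) (auto simp: A_def intro!: mult_nonneg_nonneg sum_nonneg Bochner_Integration.integral_nonneg)
 qed
 have "(%n. \<integral>x. (S (vn n (x + w)) - S (vn n x))^2) ----> ?Sv"
  by (rule L2_tendsto_square[OF L2_tendsto_diff[OF L2_tendsto_shift[OF SL] SL]])
 moreover have "(%n. (norm w)^2 * (\<tau> * (Q n + m1 * ?IH n + ?gS n))) ---->
  (norm w)\<^sup>2 * (\<tau> * (0 + m1 * (\<integral>x. H (v x)) + (\<integral>x. g x * S (v x))))"
  by (intro tendsto_intros Qlim Hlim L2_tendsto_mult gL SL)
 moreover have "?St n \<le>
  (norm w)^2 * (\<tau> * (Q n + m1 * ?IH n + ?gS n))" for n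
  by (rule order_trans[OF trans]) (use A_le \<tau> in \<open>auto intro!: mult_left_mono\<close>)
 ultimately have "?Sv \<le>
  (norm w)^2 * (\<tau> * (0 + m1 * (\<integral>x. H (v x)) + (\<integral>x. g x * S (v x))))"
  by (intro LIMSEQ_le) auto
 then show ?thesis by (simp add: add.commute)
qed

section \<open>Degenerate nonlinearities, and estimates above a positive level\<close>

lemma continuous_antiderivative:
 fixes K :: "real => real"
 assumes "continuous_on UNIV K"
 obtains H where "!!r. (H has_real_derivative K r) (at r)" "H 0 = 0"
proof -
 define H where "H u = (LBINT y=ereal 0..ereal u. K y)" for u
 have "(H has_real_derivative K r) (at r)" for r
 proof -
  define a where "a = \<bar>r\<bar> + 1"
  have "((%u. LBINT y=ereal 0..ereal u. K y) has_vector_derivative K r) (at r within {-a..a})"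
   by (rule interval_integral_FTC2) (auto simp: a_def intro: continuous_on_subset[OF assms])
  moreover have "at r within {-a..a} = at r"
   by (rule at_within_interior) (auto simp: a_def interior_atLeastAtMost_real)
  ultimately show ?thesis unfolding H_def has_real_derivative_iff_has_vector_derivative by simp
 qed
 moreover have "H 0 = 0" by (simp add: H_def)
 ultimately show thesis using that by blast
qed

lemma deriv_le_imp_le:
 fixes f g :: "real => real"
 assumes "a \<le> b" "f a \<le> g a"
  and "!!x. (f has_real_derivative f' x) (at x)" "!!x. (g has_real_derivative g' x) (at x)"
  and le: "!!x. a \<le> x ==> x \<le> b ==> f' x \<le> g' x"
 shows "f b \<le> g b"
proof -
 have "(%x. g x - f x) a \<le> (%x. g x - f x) b"
 proof (rule DERIV_nonneg_imp_nondecreasing[OF assms(1)])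
  fix x assume "a \<le> x" "x \<le> b"
  then show "\<exists>y. ((%x. g x - f x) has_real_derivative y) (at x) \<and> 0 \<le> y"
   using le assms(3,4) by (intro exI[of _ "g' x - f' x"]) (auto intro: DERIV_diff)
 qed
 with assms(2) show ?thesis by simp
qed

text \<open>What \<beta> and its regularizations have in common, so that one level estimate serves
  both. The slope may vanish at 0, so the inverse is in general only continuous there.\<close>

locale nonlinearity =
 fixes \<Phi> \<Phi>' :: "real => real"
 assumes \<Phi>_deriv: "!!r. (\<Phi> has_real_derivative \<Phi>' r) (at r)"
  and \<Phi>'_cont: "continuous_on UNIV \<Phi>'"
  and \<Phi>_mono: "strict_mono \<Phi>" and \<Phi>_surj: "surj \<Phi>" and \<Phi>_0: "\<Phi> 0 = 0"
begin

abbreviation \<gamma> where "\<gamma> \<equiv> inv \<Phi>"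

lemma \<Phi>_inj: "inj \<Phi>"
 using \<Phi>_mono by (simp add: strict_mono_imp_inj_on)

lemma \<gamma>_\<Phi>[simp]: "\<gamma> (\<Phi> r) = r"
 by (rule inv_f_f[OF \<Phi>_inj])

lemma \<Phi>_\<gamma>[simp]: "\<Phi> (\<gamma> r) = r"
 by (rule surj_f_inv_f[OF \<Phi>_surj])

lemma \<gamma>_0[simp]: "\<gamma> 0 = 0"
 using \<gamma>_\<Phi>[of 0] by (simp add: \<Phi>_0)

lemma \<gamma>_less_iff: "\<gamma> x < \<gamma> y \<longleftrightarrow> x < y"
 using strict_mono_less[OF \<Phi>_mono, of "\<gamma> x" "\<gamma> y"] by simp

lemma \<gamma>_le_iff: "\<gamma> x \<le> \<gamma> y \<longleftrightarrow> x \<le> y"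
 using strict_mono_less_eq[OF \<Phi>_mono, of "\<gamma> x" "\<gamma> y"] by simp

lemma \<gamma>_isCont: "isCont \<gamma> x"
 using isCont_inverse_function[of 1 "\<gamma> x" \<gamma> \<Phi>] \<Phi>_deriv DERIV_isCont by force

lemma \<gamma>_cont: "continuous_on A \<gamma>"
 using \<gamma>_isCont by (simp add: continuous_at_imp_continuous_on)

lemma \<Phi>_cont: "continuous_on A \<Phi>"
 using \<Phi>_deriv DERIV_isCont continuous_at_imp_continuous_on by metis

lemma \<gamma>_deriv: assumes "\<Phi>' (\<gamma> x) \<noteq> 0" shows "(\<gamma> has_real_derivative inverse (\<Phi>' (\<gamma> x))) (at x)"
 by (rule DERIV_inverse_function[where f=\<Phi> and a="x - 1" and b="x + 1"])
  (use \<Phi>_deriv assms \<gamma>_isCont in auto)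

end

text \<open>\<open>\<eta>\<close> is the cutoff inside D_\<epsilon> and \<open>m1\<close> bounds
  grad \<eta> . D. The approximate problems use m1 = \<open>m0\<close>; the limit equation uses
  \<eta> = 1 and m1 = 0, so its estimates have no loss from the drift.\<close>

locale drift =
 fixes \<rho> :: "real => real" and D :: "'a::euclidean_space => 'a" and divD :: "'a => real" and m0 :: real
  and \<eta> :: "'a => real" and \<eta>' :: "'a => 'a => real" and E m1 :: real
 assumes \<rho>: "standard_mollifier \<rho>"
  and D_measurable[measurable]: "D \<in> \<M>" and D_bound: "AE x. norm (D x) \<le> m0"
  and D_div: "has_weak_div D divD" "AE x. divD x \<ge> 0"
  and \<eta>: "!!i. i \<in> Basis ==> has_dderiv \<eta> i (\<eta>' i)" "!!x. 0 \<le> \<eta> x" "!!x. \<eta> x \<le> 1"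
   "!!i x. i \<in> Basis ==> \<bar>\<eta>' i x\<bar> \<le> E" "AE x. \<bar>\<Sum>i\<in>Basis. \<eta>' i x * (D x \<bullet> i)\<bar> \<le> m1"
  and \<eta>_measurable[measurable]: "\<eta> \<in> \<M>" "!!i. i \<in> Basis ==> \<eta>' i \<in> \<M>"
begin

lemma m1_nonneg: "m1 \<ge> 0"
 by (rule AE_lborel_const, use \<eta>(5) in eventually_elim) (use abs_ge_zero order_trans in blast)

lemma m0_nonneg: "m0 \<ge> 0"
 by (rule AE_lborel_const, use D_bound in eventually_elim) (use norm_ge_zero order_trans in blast)

text \<open>The weak equation tested with \<open>s(u)\<close>, where \<open>s\<close> vanishes below a level \<open>\<kappa> > 0\<close>,
 so that only the nondegenerate range of \<open>\<Phi>\<close> matters.\<close>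

lemma level_translation:
 fixes u g :: "'a => real" and \<Phi> \<Phi>' bb s s' :: "real => real"
 assumes nl: "nonlinearity \<Phi> \<Phi>'" and \<Phi>'pos: "!!r. r > 0 ==> \<Phi>' r > 0"
  and eq: "weak_eq (%x. \<Phi> (u x)) (%x. (\<eta> x * (bb (u x) * u x)) *\<^sub>R D x) g"
  and u: "u \<in> L2" and v: "(%x. \<Phi> (u x)) \<in> L2" and g: "g \<in> L2"
  and bb: "continuous_on UNIV bb" "!!r. 0 \<le> bb r" "!!r. bb r \<le> b0"
  and \<kappa>: "\<kappa> > 0" "l > 0" "!!r. r \<ge> \<kappa> ==> \<Phi>' r \<ge> l"
  and s: "!!r. (s has_real_derivative s' r) (at r)" "continuous_on UNIV s'"
   "!!r. r \<le> \<kappa> ==> s r = 0" "!!r. r \<le> \<kappa> ==> s' r = 0" "!!r. 0 \<le> s' r" "!!r. s' r \<le> s1"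
 shows "(\<integral>x. (s (u (x + w)) - s (u x))^2) \<le>
  (norm w)^2 * (s1 / l * ((\<integral>x. g x * s (u x)) + m1 * b0 * (\<integral>x. u x * s (u x))))"
proof -
 interpret nonlinearity \<Phi> \<Phi>' by (rule nl)
 note [measurable] = L2_measurable[OF u] L2_measurable[OF g]
 have s1: "s1 \<ge> 0" using s(5)[of 0] s(6)[of 0] by linarith
 have b0: "b0 \<ge> 0" using bb(2)[of 0] bb(3)[of 0] by linarith
 \<comment> \<open>The estimate is carried out for v = \<Phi>(u). S is continuously differentiable
   although \<gamma> may not be so at 0, because s vanishes up to \<kappa>; K is chosen so that T(v)
   bb(u) u = K(v).\<close>
 define S where "S v = s (\<gamma> v)" for v
 define T where "T v = s' (\<gamma> v) / \<Phi>' (\<gamma> v)" for v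
 define K where "K v = bb (\<gamma> v) * \<gamma> v * T v" for v
 define q where "q = \<Phi> \<kappa>"
 have q: "q > 0" using strict_mono_less[OF \<Phi>_mono, of 0 \<kappa>] \<kappa>(1) by (simp add: q_def \<Phi>_0)
 have low: "\<gamma> v \<le> \<kappa>" if "v \<le> q" for v using that \<gamma>_le_iff[of v q] by (simp add: q_def)
 have high: "\<gamma> v > \<kappa>" if "v > q" for v using that \<gamma>_less_iff[of q v] by (simp add: q_def)
 have pos: "\<gamma> v > 0" if "v > 0" for v using that \<gamma>_less_iff[of 0 v] by simp
 have S0: "S v = 0" "T v = 0" if "v \<le> q" for v using low[OF that] s(3,4) by (auto simp: S_def T_def)
 have Sd: "(S has_real_derivative T v) (at v)" for v
 proof (cases "v < q")
  case True
  have "((%_. 0) has_real_derivative 0) (at v)" by simp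
  then have "(S has_real_derivative 0) (at v)"
   by (rule has_field_derivative_transform_within_open[of _ _ _ "{..<q}"]) (use True S0 in auto)
  then show ?thesis using S0(2)[of v] True by simp
 next
  case False
  then have "v > 0" using q by simp
  then have "(\<gamma> has_real_derivative inverse (\<Phi>' (\<gamma> v))) (at v)"
   using \<Phi>'pos[OF pos] by (intro \<gamma>_deriv) force
  from DERIV_chain2[OF s(1) this] show ?thesis by (simp add: S_def[abs_def] T_def divide_inverse)
 qed
 have Tc: "continuous_on UNIV T"
 proof -
  have "continuous_on {..<q} T"
   by (rule continuous_on_cong[THEN iffD1, OF refl _ continuous_on_const[of _ 0]]) (use S0 in auto)
  moreover have "continuous_on {0<..} T"
   unfolding T_def using \<Phi>'pos pos
   by (intro continuous_intros continuous_on_compose2[OF s(2) \<gamma>_cont] continuous_on_compose2[OF \<Phi>'_cont \<gamma>_cont])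
    (auto simp: less_imp_neq[symmetric])
  ultimately have "continuous_on ({..<q} \<union> {0<..}) T" by (intro continuous_on_open_Un) auto
  moreover have "{..<q} \<union> {0<..} = (UNIV :: real set)" using q by auto
  ultimately show ?thesis by simp
 qed
 have T_nn: "0 \<le> T v" for v
 proof (cases "v \<le> q")
  case False
  then have "\<Phi>' (\<gamma> v) > 0" using high[of v] \<kappa>(1) \<Phi>'pos by simp
  then show ?thesis using s(5) by (simp add: T_def)
 qed (simp add: S0)
 have T_le: "T v \<le> s1 / l" for v
 proof (cases "v \<le> q")
  case False
  then have "\<Phi>' (\<gamma> v) \<ge> l" using high[of v] \<kappa>(3) by simp
  then show ?thesis unfolding T_def using s(5,6) s1 \<kappa>(2) by (intro frac_le) auto
 qed (use s1 \<kappa> in \<open>simp add: S0\<close>)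
 have Kc: "continuous_on UNIV K"
  unfolding K_def by (intro continuous_intros continuous_on_compose2[OF bb(1) \<gamma>_cont] \<gamma>_cont Tc) auto
 have K0: "K v = 0" if "v \<le> q" for v using S0(2)[OF that] by (simp add: K_def)
 have K_nn: "K v \<ge> 0" for v
 proof (cases "v \<le> q")
  case False
  then show ?thesis unfolding K_def using high[of v] \<kappa>(1) bb(2) T_nn by (intro mult_nonneg_nonneg) auto
 qed (simp add: K0)
 have K_le: "K v \<le> b0 * \<gamma> v * T v" for v
 proof (cases "v \<le> q")
  case False
  then show ?thesis unfolding K_def using high[of v] \<kappa>(1) bb(3) T_nn by (intro mult_right_mono) auto
 qed (simp add: K0 S0)
 \<comment> \<open>Above q the slope bound gives \<gamma>(v) <= \<kappa> + v/l <= (\<kappa>/q + 1/l)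
   v; multiplied by b0 and the bound s1/l of T this is the linear growth of K.\<close>
 define C where "C = b0 * (\<kappa> / q + 1 / l) * (s1 / l)"
 have C: "C \<ge> 0" using b0 s1 q \<kappa> by (simp add: C_def)
 have K_lin: "K v \<le> C * \<bar>v\<bar>" for v
 proof (cases "v \<le> q")
  case False
  define r where "r = \<gamma> v"
  have r: "r > \<kappa>" "\<Phi> r = v" using high[of v] False by (auto simp: r_def)
  have "q + l * (r - \<kappa>) \<le> v"
  proof -
   have "(%r. q + l * (r - \<kappa>)) r \<le> \<Phi> r"
   proof (rule deriv_le_imp_le[OF less_imp_le[OF r(1)] _ _ \<Phi>_deriv, where f="%r. q + l * (r - \<kappa>)" and f'="%_. l"])
    show "((%r. q + l * (r - \<kappa>)) has_real_derivative l) (at x)" for x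
     by (auto intro!: derivative_eq_intros)
   qed (use \<kappa>(3) in \<open>auto simp: q_def\<close>)
   then show ?thesis using r by simp
  qed
  then have "l * (r - \<kappa>) \<le> v" using q by simp
  then have "r - \<kappa> \<le> v / l" using \<kappa>(2) by (simp add: field_simps)
  moreover have "\<kappa> \<le> \<kappa> * (v / q)" using False q \<kappa> by (simp add: field_simps)
  ultimately have "r \<le> (\<kappa> / q + 1 / l) * v" by (simp add: field_simps)
  then have "b0 * r * T v \<le> b0 * ((\<kappa> / q + 1 / l) * v) * (s1 / l)"
   using b0 T_nn T_le r \<kappa> False q by (intro mult_mono mult_left_mono) auto
  then show ?thesis using K_le[of v] False q by (simp add: C_def r_def mult_ac)
 qed (use C in \<open>simp add: K0\<close>)
 obtain H where H: "!!r. (H has_real_derivative K r) (at r)" "H 0 = 0"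
  by (rule continuous_antiderivative[OF Kc]) blast
 have H_neg: "H v = 0" if "v \<le> 0" for v
 proof -
  have "(%_. H v) 0 \<le> H 0" by (rule deriv_le_imp_le[OF that _ DERIV_const H(1)]) (use K_nn in auto)
  moreover have "H 0 \<le> H v"
  proof -
   have "H 0 - H v \<le> (%_. 0::real) 0"
    by (rule deriv_le_imp_le[OF that _ _ DERIV_const, where f="%x. H x - H v" and f'=K])
     (use H K0 q in \<open>auto intro!: derivative_eq_intros\<close>)
   then show ?thesis by simp
  qed
  ultimately show ?thesis using H(2) by simp
 qed
 have H_nn: "0 \<le> H v" for v
 proof (cases "v \<le> 0")
  case False
  then have "0 \<le> v" by simp
  from deriv_le_imp_le[OF this _ DERIV_const[of 0] H(1)] show ?thesis using K_nn H(2) by simp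
 qed (simp add: H_neg)
 have H_quad: "H v \<le> C * v^2" for v
 proof (cases "v \<le> 0")
  case False
  then have "0 \<le> v" by simp
  have d: "((%x. C * x^2) has_real_derivative C * (2 * x)) (at x)" for x
   by (auto intro!: derivative_eq_intros)
  have "K x \<le> C * (2 * x)" if "0 \<le> x" for x
  proof -
   have "C * \<bar>x\<bar> \<le> C * (2 * x)" using C that by (intro mult_left_mono) auto
   then show ?thesis using K_lin[of x] by linarith
  qed
  with deriv_le_imp_le[OF \<open>0 \<le> v\<close> _ H(1) d] show ?thesis using H(2) by simp
 qed (use C in \<open>simp add: H_neg\<close>)
 \<comment> \<open>Since \<gamma> is monotone, \<gamma>(x) <= \<gamma>(v) on [0, v]; the
   antiderivative of b0 \<gamma> T is thus at most b0 \<gamma>(v) S(v), that is b0 u s(u) for v =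
   \<Phi>(u).\<close>
 have H_S: "H v \<le> b0 * (\<gamma> v * S v)" for v
 proof (cases "v \<le> 0")
  case True
  then show ?thesis using H_neg S0(1)[of v] q by simp
 next
  case False
  then have "0 \<le> v" by simp
  have d: "((%x. b0 * \<gamma> v * S x) has_real_derivative b0 * \<gamma> v * T x) (at x)" for x
   using DERIV_cmult[OF Sd] by simp
  have "K x \<le> b0 * \<gamma> v * T x" if "0 \<le> x" "x \<le> v" for x
  proof -
   have "b0 * \<gamma> x * T x \<le> b0 * \<gamma> v * T x"
    using \<gamma>_le_iff[of x v] that b0 T_nn by (intro mult_right_mono mult_left_mono) auto
   then show ?thesis using K_le[of x] by linarith
  qed
  with deriv_le_imp_le[OF \<open>0 \<le> v\<close> _ H(1) d] show ?thesis using H(2) S0(1)[of 0] q by (simp add: mult_ac)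
 qed
 have s_lip: "\<bar>s x\<bar> \<le> s1 * \<bar>x\<bar>" for x
 proof -
  have "\<bar>s' r\<bar> \<le> s1" for r using s(5,6)[of r] by simp
  from lipschitz_of_deriv[OF s(1) this, of x 0] s(3)[of 0] \<kappa>(1) show ?thesis by simp
 qed
 have sm[measurable]: "s \<in> \<M>"
  using s(1) by (meson DERIV_isCont continuous_at_imp_continuous_on borel_measurable_continuous_onI)
 have [measurable]: "bb \<in> \<M>" using bb(1) by (rule borel_measurable_continuous_onI)
 have suL: "(%x. s (u x)) \<in> L2" by (rule L2_dominated[OF u, of _ s1]) (use s_lip in auto)
 have BvL: "(%x. bb (u x) * u x) \<in> L2" by (rule L2_bounded_mult[OF u, of _ b0]) (use bb in auto)
 have main: "(\<integral>x. (S (\<Phi> (u (x + w))) - S (\<Phi> (u x)))^2) \<le>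
  (norm w)^2 * (s1 / l * ((\<integral>x. g x * S (\<Phi> (u x))) + m1 * (\<integral>x. H (\<Phi> (u x)))))"
 proof (rule master_translation[OF \<rho> eq v g D_measurable D_bound D_div refl BvL \<eta> \<eta>_measurable Sd T_nn T_le _ Tc H(1) _ H_nn H_quad Kc])
  show "\<bar>K r\<bar> \<le> C * \<bar>r\<bar>" for r using K_nn[of r] K_lin[of r] by simp
  show "AE x. T (\<Phi> (u x)) * (bb (u x) * u x) = K (\<Phi> (u x))" by (simp add: K_def mult_ac)
 qed (use S0(1)[of 0] q in auto)
 have "(\<integral>x. H (\<Phi> (u x))) \<le> b0 * (\<integral>x. u x * s (u x))"
 proof -
  have us: "\<L> (%x. b0 * (u x * s (u x)))" using L2_mult[OF u suL] by simp
  have Hc: "H \<in> \<M>"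
   using H(1) by (meson DERIV_isCont continuous_at_imp_continuous_on borel_measurable_continuous_onI)
  have \<Phi>m: "\<Phi> \<in> \<M>" using \<Phi>_cont by (rule borel_measurable_continuous_onI)
  have "H (\<Phi> (u x)) \<le> b0 * (u x * s (u x))" for x using H_S[of "\<Phi> (u x)"] by (simp add: S_def)
  then have "(\<integral>x. \<bar>H (\<Phi> (u x))\<bar>) \<le> (\<integral>x. b0 * (u x * s (u x)))"
   using us Hc \<Phi>m H_nn by (intro integral_mono_abs) auto
  then show ?thesis using H_nn by simp
 qed
 then have "m1 * (\<integral>x. H (\<Phi> (u x))) \<le> m1 * b0 * (\<integral>x. u x * s (u x))"
  using m1_nonneg mult_left_mono by fastforce
 then have "(norm w)^2 * (s1 / l * ((\<integral>x. g x * S (\<Phi> (u x))) + m1 * (\<integral>x. H (\<Phi> (u x))))) \<le>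
  (norm w)^2 * (s1 / l * ((\<integral>x. g x * S (\<Phi> (u x))) + m1 * b0 * (\<integral>x. u x * s (u x))))"
  using s1 \<kappa>(2) by (intro mult_left_mono add_left_mono) auto
 with main show ?thesis by (simp add: S_def)
qed

end

section \<open>Weighted contraction\<close>


text \<open>A smooth approximation of the absolute value: the product of the second derivative with
 \<open>r\<^sup>2\<close> is at most \<open>\<theta>\<close>, which kills the drift term as \<open>\<theta> \<rightarrow> 0\<close>.\<close>

definition abs_sm :: "real => real => real" where "abs_sm \<theta> r = sqrt (r^2 + \<theta>^2) - \<theta>"
definition sgn_sm :: "real => real => real" where "sgn_sm \<theta> r = r / sqrt (r^2 + \<theta>^2)"
definition dsgn_sm :: "real => real => real" where "dsgn_sm \<theta> r = \<theta>^2 / sqrt (r^2 + \<theta>^2) ^ 3"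

context
 fixes \<theta> :: real assumes \<theta>: "\<theta> > 0"
begin

lemma root_pos: "sqrt (r^2 + \<theta>^2) > 0" "r^2 + \<theta>^2 > 0"
 using \<theta> by (simp_all add: add_nonneg_pos)

lemma root_ge: "\<theta> \<le> sqrt (r^2 + \<theta>^2)" "\<bar>r\<bar> \<le> sqrt (r^2 + \<theta>^2)"
 using \<theta> real_le_rsqrt[of \<theta> "r^2 + \<theta>^2"] by (simp_all add: real_le_rsqrt)

lemma abs_sm_deriv: "(abs_sm \<theta> has_real_derivative sgn_sm \<theta> r) (at r)"
 unfolding abs_sm_def[abs_def] sgn_sm_def using root_pos[of r]
 by (auto intro!: derivative_eq_intros simp: divide_simps)

lemma sgn_sm_deriv: "(sgn_sm \<theta> has_real_derivative dsgn_sm \<theta> r) (at r)"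
proof -
 define q where "q = sqrt (r^2 + \<theta>^2)"
 have q: "q > 0" "q^2 = r^2 + \<theta>^2" using root_pos[of r] by (auto simp: q_def)
 have d: "((%r. sqrt (r^2 + \<theta>^2)) has_real_derivative r / q) (at r)"
  unfolding q_def using root_pos[of r] by (auto intro!: derivative_eq_intros simp: divide_simps)
 have "(sgn_sm \<theta> has_real_derivative (1 * q - r * (r / q)) / (q * q)) (at r)"
  unfolding sgn_sm_def[abs_def] using DERIV_divide[OF DERIV_ident d] q(1) \<theta> unfolding q_def by simp
 moreover have "(1 * q - r * (r / q)) / (q * q) = dsgn_sm \<theta> r"
 proof -
  have "(1 * q - r * (r / q)) / (q * q) = (q^2 - r^2) / q ^ 3"
   using q(1) by (simp add: field_simps power2_eq_square power3_eq_cube)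
  then show ?thesis using q(2) by (simp add: dsgn_sm_def q_def)
 qed
 ultimately show ?thesis by simp
qed

lemma dsgn_sm_nonneg: "0 \<le> dsgn_sm \<theta> r"
 using root_pos[of r] by (simp add: dsgn_sm_def)

lemma dsgn_sm_le: "dsgn_sm \<theta> r \<le> 1 / \<theta>"
proof -
 have "\<theta>^2 / sqrt (r^2 + \<theta>^2) ^ 3 \<le> \<theta>^2 / \<theta> ^ 3"
  using root_ge[of r] root_pos[of r] \<theta> by (intro divide_left_mono power_mono mult_pos_pos zero_less_power) auto
 also have "\<dots> = 1 / \<theta>" using \<theta> by (simp add: power2_eq_square power3_eq_cube)
 finally show ?thesis by (simp add: dsgn_sm_def)
qed

lemma dsgn_sm_square: "dsgn_sm \<theta> r * r^2 \<le> \<theta>"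
proof -
 define q where "q = sqrt (r^2 + \<theta>^2)"
 have q: "q > 0" "q^2 = r^2 + \<theta>^2" "\<theta> \<le> q" using root_pos[of r] root_ge[of r] by (auto simp: q_def)
 have "dsgn_sm \<theta> r * r^2 = \<theta>^2 * r^2 / q ^ 3" by (simp add: dsgn_sm_def q_def)
 also have "\<dots> \<le> \<theta>^2 * q^2 / q ^ 3" using q by (intro divide_right_mono mult_left_mono) auto
 also have "\<dots> = \<theta> * (\<theta> / q)" using q(1) by (simp add: power2_eq_square power3_eq_cube)
 also have "\<dots> \<le> \<theta> * 1" using q \<theta> by (intro mult_left_mono) auto
 finally show ?thesis by simp
qed

lemma sgn_sm_abs_le: "\<bar>sgn_sm \<theta> r\<bar> \<le> 1"
 using root_ge(2)[of r] root_pos[of r] by (simp add: sgn_sm_def abs_divide)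

lemma sgn_sm_0: "sgn_sm \<theta> 0 = 0" by (simp add: sgn_sm_def)

lemma dsgn_sm_cont: "continuous_on UNIV (dsgn_sm \<theta>)"
 unfolding dsgn_sm_def using root_pos(2) \<theta> by (intro continuous_intros) auto

lemma sgn_sm_cont: "continuous_on UNIV (sgn_sm \<theta>)"
 using sgn_sm_deriv by (meson DERIV_isCont continuous_at_imp_continuous_on)

lemma abs_sm_cont: "continuous_on UNIV (abs_sm \<theta>)"
 using abs_sm_deriv by (meson DERIV_isCont continuous_at_imp_continuous_on)

lemma abs_sm_nonneg: "0 \<le> abs_sm \<theta> r"
 using root_ge(1)[of r] by (simp add: abs_sm_def)

lemma abs_sm_le_abs: "abs_sm \<theta> r \<le> \<bar>r\<bar>"
proof -
 have "sqrt (r^2 + \<theta>^2) \<le> \<bar>r\<bar> + \<theta>"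
  using \<theta> by (intro real_le_lsqrt) (auto simp: power2_sum)
 then show ?thesis by (simp add: abs_sm_def)
qed

lemma abs_sm_quad: "abs_sm \<theta> r \<le> r^2 / (2 * \<theta>)"
proof -
 have "sqrt (r^2 + \<theta>^2) \<le> r^2 / (2 * \<theta>) + \<theta>"
 proof (rule real_le_lsqrt)
  have "(r^2 / (2 * \<theta>) + \<theta>)^2 = (r^2 / (2 * \<theta>))^2 + \<theta>^2 + r^2" using \<theta> by (simp add: power2_sum)
  then show "r^2 + \<theta>^2 \<le> (r^2 / (2 * \<theta>) + \<theta>)^2" by simp
 qed (use \<theta> in simp)
 then show ?thesis by (simp add: abs_sm_def)
qed

end

lemma abs_sm_lim: "\<theta> ----> 0 ==> (%n. abs_sm (\<theta> n) r) ----> \<bar>r\<bar>"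
proof -
 assume "\<theta> ----> 0"
 then have "(%n. abs_sm (\<theta> n) r) ----> sqrt (r^2 + 0^2) - 0" unfolding abs_sm_def by (intro tendsto_intros)
 then show ?thesis by simp
qed

lemma sgn_sm_lim: "\<theta> ----> 0 ==> (%n. sgn_sm (\<theta> n) r) ----> sgn r"
proof (cases "r = 0")
 case False
 assume "\<theta> ----> 0"
 then have "(%n. sgn_sm (\<theta> n) r) ----> r / sqrt (r^2 + 0^2)" unfolding sgn_sm_def using False by (intro tendsto_intros) auto
 then show ?thesis using False by (simp add: sgn_real_def abs_if split: if_splits)
qed (simp add: sgn_sm_def)

text \<open>Kato's inequality with weight \<psi>: the test function sgn_sm(z) \<psi> approximates
  sgn(z) \<psi>, and the Laplacian is moved to the weight. Where the derivative of the smoothed sign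
  acts, completing the square leaves at most T(z) \<psi> |F|^2 / 4; as |F| <= L |\<delta>| |z| and
  T(z) z^2 <= \<theta>, this is O(\<theta>) with \<delta> in L^2.\<close>

lemma weighted_contraction:
 fixes z g \<psi> \<delta> :: "'a::euclidean_space => real" and F :: "'a => 'a" and \<psi>1 \<psi>2 :: "'a => 'a => real"
 assumes \<rho>: "standard_mollifier \<rho>" and eq: "weak_eq z F g"
  and z: "z \<in> L2" "\<L> z" and g: "g \<in> L2" "\<L> g"
  and F: "!!i. i \<in> Basis ==> (%x. F x \<bullet> i) \<in> L2" "!!i. i \<in> Basis ==> \<L> (%x. F x \<bullet> i)"
  and F_le: "AE x. norm (F x) \<le> L * \<bar>\<delta> x\<bar> * \<bar>z x\<bar>" and \<delta>: "\<delta> \<in> L2"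
  and \<psi>: "!!x. 0 \<le> \<psi> x" "!!x. \<psi> x \<le> P" "!!i x. i \<in> Basis ==> \<bar>\<psi>1 i x\<bar> \<le> P" "!!i x. i \<in> Basis ==> \<bar>\<psi>2 i x\<bar> \<le> P"
   "!!i. i \<in> Basis ==> has_dderiv \<psi> i (\<psi>1 i)" "!!i. i \<in> Basis ==> has_dderiv (\<psi>1 i) i (\<psi>2 i)"
  and \<psi>m[measurable]: "\<psi> \<in> \<M>" "!!i. i \<in> Basis ==> \<psi>1 i \<in> \<M>"
    "!!i. i \<in> Basis ==> \<psi>2 i \<in> \<M>"
 shows "(\<integral>x. \<bar>z x\<bar> * (- (\<Sum>i\<in>Basis. \<psi>2 i x))) \<le>
  (\<integral>x. g x * sgn (z x) * \<psi> x) + (\<integral>x. \<bar>\<Sum>i\<in>Basis. (F x \<bullet> i) * \<psi>1 i x\<bar>)"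
proof -
 obtain k where kt: "!!n. k n \<in> test_functions" and kL: "L2_tendsto (%n. conv z (k n)) z" "L2_tendsto (%n. conv g (k n)) g"
  "!!i. i \<in> Basis ==> L2_tendsto (%n. conv (%x. F x \<bullet> i) (k n)) (%x. F x \<bullet> i)"
  "AE x. (%n. conv z (k n) x) ----> z x \<and> (\<forall>i\<in>Basis. (%n. conv (%x. F x \<bullet> i) (k n) x) ----> F x \<bullet> i)"
  using mollifying_sequence[OF \<rho> z(1) g(1), of "%i x. F x \<bullet> i", OF F(1)] by blast
 define zn where "zn n = conv z (k n)" for n
 define dv where "dv n i = conv z (part_deriv i (k n))" for n i
 define Fn where "Fn n i = conv (%x. F x \<bullet> i) (k n)" for n i
 define gn where "gn n = conv g (k n)" for n
 have P: "P \<ge> 0" using \<psi>(1,2) order_trans by blast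
 let ?FQ = "\<integral>x. \<bar>\<Sum>i\<in>Basis. (F x \<bullet> i) * \<psi>1 i x\<bar>"
 note zL = kL(1)[folded zn_def] and gL = kL(2)[folded gn_def] and FnL = kL(3)[folded Fn_def] and ae = kL(4)[folded zn_def Fn_def]
 have dvL: "dv n i \<in> L2" if "i \<in> Basis" for n i
  unfolding dv_def by (rule conv_L2[OF z(1) test_part_deriv[OF kt that]])
 have L2s: "zn n \<in> L2" "gn n \<in> L2" "i \<in> Basis ==> Fn n i \<in> L2" for n i
  using zL gL FnL by (auto simp: L2_tendsto_def)
 note [measurable] = L2s[THEN L2_measurable] dvL[THEN L2_measurable] L2_measurable[OF z(1)] L2_measurable[OF g(1)] F(1)[THEN L2_measurable]
 have approx: "(\<integral>x. abs_sm \<theta> (z x) * (- (\<Sum>i\<in>Basis. \<psi>2 i x))) \<le>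
   (\<integral>x. g x * sgn_sm \<theta> (z x) * \<psi> x) + ?FQ
   + \<theta> * (P * L^2 / 4 * (\<integral>x. (\<delta> x)^2))" if \<theta>: "\<theta> > 0" for \<theta>
 proof -
  let ?S = "sgn_sm \<theta>" and ?T = "dsgn_sm \<theta>" and ?G = "abs_sm \<theta>"
  let ?TF = "%i x. ?T (z x) * \<psi> x * (F x \<bullet> i)^2"
  let ?FS = "%i x. (F x \<bullet> i) * (\<psi>1 i x * ?S (z x))"
  let ?G2 = "\<Sum>i\<in>Basis. \<integral>x. ?G (z x) * \<psi>2 i x"
  let ?A = "%n i x. ?T (zn n x) * dv n i x * \<psi> x + ?S (zn n x) * \<psi>1 i x"
  let ?FSn = "%n i x. Fn n i x * (\<psi>1 i x * ?S (zn n x))"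
  let ?gS = "%n. \<integral>x. gn n x * (\<psi> x * ?S (zn n x))"
  let ?TFn = "%n i x. ?T (zn n x) * \<psi> x * (Fn n i x)^2"
  let ?Gn = "%n i x. ?G (zn n x) * \<psi>2 i x"
  note [measurable] = borel_measurable_continuous_onI[OF sgn_sm_cont[OF \<theta>]] borel_measurable_continuous_onI[OF dsgn_sm_cont[OF \<theta>]]
   borel_measurable_continuous_onI[OF abs_sm_cont[OF \<theta>]]
  have T_abs: "\<bar>?T x\<bar> \<le> 1 / \<theta>" for x using dsgn_sm_nonneg[OF \<theta>, of x] dsgn_sm_le[OF \<theta>, of x] by linarith
  have SL: "L2_tendsto (%n x. ?S (zn n x)) (%x. ?S (z x))"
   by (rule L2_tendsto_lipschitz[OF zL lipschitz_of_deriv[OF sgn_sm_deriv[OF \<theta>] T_abs] sgn_sm_0[OF \<theta>]]) measurable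
  have SnL: "(%x. ?S (zn n x)) \<in> L2" "(%x. ?S (z x)) \<in> L2" for n using SL by (auto simp: L2_tendsto_def)
  have \<psi>P: "\<bar>\<psi> x\<bar> \<le> P" for x using \<psi>(1,2)[of x] by simp
  have GI: "\<L> (%x. ?G (zn n x))" for n
   by (rule integrable_squeeze[of "%x. (zn n x)^2 / (2 * \<theta>)"])
    (use L2_integrable[OF L2s(1)] abs_sm_quad[OF \<theta>] abs_sm_nonneg[OF \<theta>] in auto)
  have G\<psi>I: "\<L> (%x. ?G (zn n x) * h x)" if "h \<in> \<M>" "!!x. \<bar>h x\<bar> \<le> P" for n h
   by (rule integrable_squeeze[of "%x. P * ?G (zn n x)"])
    (use GI that abs_sm_nonneg[OF \<theta>] in \<open>auto simp: abs_mult mult.commute[of P] mult_left_mono\<close>)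
  have TF: "\<L> (%x. ?TFn n i x)" if i: "i \<in> Basis" for n i
  proof -
   have "(%x. ?T (zn n x) * (\<psi> x * Fn n i x)) \<in> L2"
    by (intro L2_bounded_mult[OF L2_bounded_mult[OF L2s(3)[OF i] _ \<psi>P] _ T_abs]) measurable
   from L2_mult[OF this L2s(3)[OF i]] show ?thesis by (simp add: power2_eq_square mult_ac)
  qed
  have step: "- (\<Sum>i\<in>Basis. \<integral>x. ?Gn n i x) \<le> ?gS n
    + (\<Sum>i\<in>Basis. \<integral>x. ?FSn n i x) + (\<Sum>i\<in>Basis. \<integral>x. ?TFn n i x) / 4" for n
  proof -
   have id: "(\<Sum>i\<in>Basis. \<integral>x. ?A n i x * (dv n i x - Fn n i x)) =
    (?gS n)"
    using mollified_identity[OF eq kt z(1) F(1) g(1) sgn_sm_deriv[OF \<theta>] T_abs sgn_sm_0[OF \<theta>] _ \<psi>(5) \<psi>P \<psi>(3) \<psi>m(1,2), of n]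
    by (simp add: zn_def dv_def Fn_def gn_def mult.commute[of "\<psi> _"])
   have "- (\<integral>x. ?Gn n i x) - (\<integral>x. ?FSn n i x) - (\<integral>x. ?TFn n i x) / 4
    \<le> (\<integral>x. ?A n i x * (dv n i x - Fn n i x))" if i: "i \<in> Basis" for i
   proof -
    have d: "has_dderiv (zn n) i (dv n i)"
     unfolding zn_def dv_def by (rule conv_has_dderiv_Basis[OF L2_L1_loc[OF z(1)] kt i])
    have dd: "has_dderiv (%x. ?G (zn n x) * \<psi>1 i x) i (%x. ?Gn n i x + ?S (zn n x) * dv n i x * \<psi>1 i x)"
     by (rule has_dderiv_mult[OF has_dderiv_chain[OF d abs_sm_deriv[OF \<theta>]] \<psi>(6)[OF i]])
    have i1: "\<L> (%x. ?Gn n i x)" "\<L> (%x. ?G (zn n x) * \<psi>1 i x)"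
     using G\<psi>I \<psi>(3,4)[OF i] i by auto
    have S1: "(%x. \<psi>1 i x * ?S (zn n x)) \<in> L2" by (rule L2_bounded_mult[OF SnL(1) \<psi>m(2)[OF i] \<psi>(3)[OF i]])
    have i2: "\<L> (%x. ?S (zn n x) * dv n i x * \<psi>1 i x)"
     using L2_mult[OF S1 dvL[OF i, of n]] by (simp add: mult_ac)
    have i3: "\<L> (%x. ?FSn n i x)" by (rule L2_mult[OF L2s(3)[OF i] S1])
    have z0: "(\<integral>x. ?Gn n i x) + (\<integral>x. ?S (zn n x) * dv n i x * \<psi>1 i x) = 0"
     using integral_dderiv_zero[OF dd i1(2)] i1 i2 by simp
    have i4: "\<L> (%x. ?A n i x * (dv n i x - Fn n i x))"
    proof -
     have "(%x. ?T (zn n x) * (\<psi> x * dv n i x)) \<in> L2"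
      by (intro L2_bounded_mult[OF L2_bounded_mult[OF dvL[OF i] _ \<psi>P] _ T_abs]) measurable
     from L2_mult[OF L2_add[OF this S1] L2_diff[OF dvL[OF i, of n] L2s(3)[OF i, of n]]]
     show ?thesis by (simp add: mult_ac)
    qed
    have "(\<integral>x. ?S (zn n x) * dv n i x * \<psi>1 i x - ?FSn n i x - ?TFn n i x / 4)
     \<le> (\<integral>x. ?A n i x * (dv n i x - Fn n i x))"
    proof (rule integral_mono)
     fix x
     \<comment> \<open>T \<psi> (dv^2 - dv F) = T \<psi> (dv - F/2)^2 - T \<psi> F^2/4: the square
       is dropped and the last term is the error \<open>?TFn\<close> / 4.\<close>
     have "0 \<le> ?T (zn n x) * \<psi> x * (dv n i x - Fn n i x / 2)^2"
      using dsgn_sm_nonneg[OF \<theta>] \<psi>(1) by simp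
     then show "?S (zn n x) * dv n i x * \<psi>1 i x - ?FSn n i x - ?TFn n i x / 4
      \<le> ?A n i x * (dv n i x - Fn n i x)"
      by (simp add: power2_eq_square algebra_simps)
    qed (use i2 i3 i4 TF[OF i] in auto)
    then show ?thesis using i2 i3 TF[OF i, of n] z0 by simp
   qed
   then have "(\<Sum>i\<in>Basis. - (\<integral>x. ?Gn n i x) - (\<integral>x. ?FSn n i x) - (\<integral>x. ?TFn n i x) / 4)
    \<le> ?gS n"
    unfolding id[symmetric] by (rule sum_mono)
   then show ?thesis by (simp add: sum_subtractf sum_negf flip: sum_divide_distrib)
  qed
  have lim1: "(%n. \<integral>x. ?Gn n i x) ----> (\<integral>x. ?G (z x) * \<psi>2 i x)" if i: "i \<in> Basis" for i
  proof (rule dominated_convergence_L1(3)[where k="%n x. P / (2 * \<theta>) * (zn n x)^2" and k'="%x. P / (2 * \<theta>) * (z x)^2"])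
   show "AE x. (%n. ?Gn n i x) ----> ?G (z x) * \<psi>2 i x"
    using ae by eventually_elim (auto intro!: tendsto_intros continuous_on_tendsto_compose[OF abs_sm_cont[OF \<theta>]])
   show "AE x. (%n. P / (2 * \<theta>) * (zn n x)^2) ----> P / (2 * \<theta>) * (z x)^2"
    using ae by eventually_elim (intro tendsto_intros, simp)
   show "(%n. \<integral>x. P / (2 * \<theta>) * (zn n x)^2) ----> (\<integral>x. P / (2 * \<theta>) * (z x)^2)"
    using tendsto_mult_left[OF L2_tendsto_square[OF zL], of "P / (2 * \<theta>)"] by simp
   show "AE x. \<bar>?Gn n i x\<bar> \<le> P / (2 * \<theta>) * (zn n x)^2" for n
   proof (intro AE_I2)
    fix x
    have "\<bar>?Gn n i x\<bar> = ?G (zn n x) * \<bar>\<psi>2 i x\<bar>" using abs_sm_nonneg[OF \<theta>] by (simp add: abs_mult)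
    also have "\<dots> \<le> ((zn n x)^2 / (2 * \<theta>)) * P"
     using abs_sm_quad[OF \<theta>] abs_sm_nonneg[OF \<theta>] \<psi>(4)[OF i] \<theta> by (intro mult_mono) auto
    finally show "\<bar>?Gn n i x\<bar> \<le> P / (2 * \<theta>) * (zn n x)^2" by (simp add: mult.commute)
   qed
  qed (use L2_integrable[OF L2s(1)] L2_integrable[OF z(1)] i in auto)
  have lim2: "(%n. \<integral>x. gn n x * (\<psi> x * ?S (zn n x))) ----> (\<integral>x. g x * (\<psi> x * ?S (z x)))"
   by (rule L2_tendsto_mult[OF gL L2_tendsto_bounded_mult[OF SL \<psi>m(1) \<psi>P]])
  have lim3: "(%n. \<integral>x. ?FSn n i x) ----> (\<integral>x. ?FS i x)"
   if i: "i \<in> Basis" for i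
   by (rule L2_tendsto_mult[OF FnL[OF i] L2_tendsto_bounded_mult[OF SL \<psi>m(2)[OF i] \<psi>(3)[OF i]]])
  have TP: "\<bar>?T y * \<psi> x * t\<^sup>2\<bar> \<le> P / \<theta> * t^2" for x y t
  proof -
   have "?T y * \<psi> x \<le> (1 / \<theta>) * P" using dsgn_sm_nonneg[OF \<theta>] dsgn_sm_le[OF \<theta>] \<psi>(1,2) \<theta> by (intro mult_mono) auto
   then have "?T y * \<psi> x * t^2 \<le> P / \<theta> * t^2" by (intro mult_right_mono) auto
   then show ?thesis using dsgn_sm_nonneg[OF \<theta>] \<psi>(1) by (simp add: abs_mult)
  qed
  have lim4: "(%n. \<integral>x. ?TFn n i x) ----> (\<integral>x. ?TF i x)"
   and i4: "\<L> (%x. ?TF i x)" if i: "i \<in> Basis" for i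
  proof -
   note dc = dominated_convergence_L1[where h="%n x. ?TFn n i x" and h'="%x. ?TF i x"
     and k="%n x. P / \<theta> * (Fn n i x)^2" and k'="%x. P / \<theta> * (F x \<bullet> i)^2"]
   have c: "AE x. (%n. ?TFn n i x) ----> ?TF i x"
    using ae by eventually_elim (use i in \<open>auto intro!: tendsto_intros continuous_on_tendsto_compose[OF dsgn_sm_cont[OF \<theta>]]\<close>)
   have d: "AE x. (%n. P / \<theta> * (Fn n i x)^2) ----> P / \<theta> * (F x \<bullet> i)^2"
    using ae by eventually_elim (use i in \<open>intro tendsto_intros, simp\<close>)
   have e: "(%n. \<integral>x. P / \<theta> * (Fn n i x)^2) ----> (\<integral>x. P / \<theta> * (F x \<bullet> i)^2)"
    using tendsto_mult_left[OF L2_tendsto_square[OF FnL[OF i]], of "P / \<theta>"] by simp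
   show "(%n. \<integral>x. ?TFn n i x) ----> (\<integral>x. ?TF i x)"
    by (rule dc(3)[OF _ _ _ _ _ c d e]) (use L2_integrable[OF L2s(3)[OF i]] L2_integrable[OF F(1)[OF i]] TP i in auto)
   show "\<L> (%x. ?TF i x)"
    by (rule dc(1)[OF _ _ _ _ _ c d e]) (use L2_integrable[OF L2s(3)[OF i]] L2_integrable[OF F(1)[OF i]] TP i in auto)
  qed
  have "- ?G2 \<le> (\<integral>x. g x * (\<psi> x * ?S (z x)))
    + (\<Sum>i\<in>Basis. \<integral>x. ?FS i x) + (\<Sum>i\<in>Basis. \<integral>x. ?TF i x) / 4"
  proof (rule LIMSEQ_le)
   show "(%n. - (\<Sum>i\<in>Basis. \<integral>x. ?Gn n i x)) ----> - ?G2"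
    by (intro tendsto_intros lim1)
   show "(%n. ?gS n + (\<Sum>i\<in>Basis. \<integral>x. ?FSn n i x)
    + (\<Sum>i\<in>Basis. \<integral>x. ?TFn n i x) / 4) ---->
    (\<integral>x. g x * (\<psi> x * ?S (z x))) + (\<Sum>i\<in>Basis. \<integral>x. ?FS i x) + (\<Sum>i\<in>Basis. \<integral>x. ?TF i x) / 4"
    by (intro tendsto_intros lim2 lim3 lim4) auto
  qed (use step in auto)
  moreover have "- ?G2 = (\<integral>x. ?G (z x) * (- (\<Sum>i\<in>Basis. \<psi>2 i x)))"
  proof -
   have "\<L> (%x. ?G (z x) * \<psi>2 i x)" if i: "i \<in> Basis" for i
   proof (rule integrable_squeeze[of "%x. P * \<bar>z x\<bar>"])
    show "AE x. \<bar>?G (z x) * \<psi>2 i x\<bar> \<le> P * \<bar>z x\<bar>"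
    proof (intro AE_I2)
     fix x
     have "?G (z x) * \<bar>\<psi>2 i x\<bar> \<le> \<bar>z x\<bar> * P"
      using abs_sm_le_abs[OF \<theta>] abs_sm_nonneg[OF \<theta>] \<psi>(4)[OF i] by (intro mult_mono) auto
     then show "\<bar>?G (z x) * \<psi>2 i x\<bar> \<le> P * \<bar>z x\<bar>" using abs_sm_nonneg[OF \<theta>] by (simp add: abs_mult mult.commute)
    qed
   qed (use z i in auto)
   then have "?G2 = (\<integral>x. (\<Sum>i\<in>Basis. ?G (z x) * \<psi>2 i x))"
    by (intro Bochner_Integration.integral_sum[symmetric])
   then show ?thesis by (simp add: sum_distrib_left)
  qed
  moreover have "(\<Sum>i\<in>Basis. \<integral>x. ?FS i x) \<le> ?FQ"
  proof -
   have int: "\<L> (%x. (F x \<bullet> i) * \<psi>1 i x)" if i: "i \<in> Basis" for i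
    by (rule integrable_squeeze[of "%x. P * \<bar>F x \<bullet> i\<bar>"])
     (use F(2)[OF i] \<psi>(3)[OF i] i in \<open>auto simp: abs_mult mult.commute[of P] mult_left_mono\<close>)
   have intS: "\<L> (%x. ?FS i x)" if i: "i \<in> Basis" for i
    by (rule L2_mult[OF F(1)[OF i] L2_bounded_mult[OF SnL(2) \<psi>m(2)[OF i] \<psi>(3)[OF i]]])
   have "(\<Sum>i\<in>Basis. \<integral>x. ?FS i x) = (\<integral>x. (\<Sum>i\<in>Basis. ?FS i x))"
    using intS by (intro Bochner_Integration.integral_sum[symmetric])
   also have "\<dots> \<le> ?FQ"
   proof (rule integral_mono)
    fix x
    have "(\<Sum>i\<in>Basis. ?FS i x) = (\<Sum>i\<in>Basis. (F x \<bullet> i) * \<psi>1 i x) * ?S (z x)"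
     by (simp add: sum_distrib_right mult.assoc)
    also have "\<dots> \<le> \<bar>(\<Sum>i\<in>Basis. (F x \<bullet> i) * \<psi>1 i x)\<bar> * 1"
     by (rule order_trans[OF abs_ge_self]) (use sgn_sm_abs_le[OF \<theta>] in \<open>auto simp: abs_mult intro!: mult_left_le\<close>)
    finally show "(\<Sum>i\<in>Basis. ?FS i x) \<le> \<bar>\<Sum>i\<in>Basis. (F x \<bullet> i) * \<psi>1 i x\<bar>" by simp
   qed (use int intS in auto)
   finally show ?thesis .
  qed
  moreover have "(\<Sum>i\<in>Basis. \<integral>x. ?TF i x) \<le> \<theta> * (P * L^2 * (\<integral>x. (\<delta> x)^2))"
  proof -
   have "(\<Sum>i\<in>Basis. \<integral>x. ?TF i x) = (\<integral>x. (\<Sum>i\<in>Basis. ?TF i x))"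
    using i4 by (intro Bochner_Integration.integral_sum[symmetric])
   also have "\<dots> \<le> (\<integral>x. \<theta> * (P * L^2) * (\<delta> x)^2)"
   proof (rule integral_mono_AE)
    show "AE x. (\<Sum>i\<in>Basis. ?TF i x) \<le> \<theta> * (P * L^2) * (\<delta> x)^2"
     using F_le
    proof eventually_elim
     case (elim x)
     have "(norm (F x))^2 = (\<Sum>i\<in>Basis. (F x \<bullet> i)^2)"
      unfolding power2_norm_eq_inner using euclidean_inner[of "F x" "F x"] by (simp add: power2_eq_square)
     then have "(\<Sum>i\<in>Basis. ?TF i x) = ?T (z x) * \<psi> x * (norm (F x))^2"
      by (simp flip: sum_distrib_left)
     also have "\<dots> \<le> ?T (z x) * \<psi> x * (L * \<bar>\<delta> x\<bar> * \<bar>z x\<bar>)^2"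
      using elim dsgn_sm_nonneg[OF \<theta>] \<psi>(1) by (intro mult_left_mono power_mono) auto
     also have "\<dots> = (?T (z x) * (z x)^2) * (\<psi> x * (L^2 * (\<delta> x)^2))" by (simp add: power_mult_distrib mult_ac)
     also have "\<dots> \<le> \<theta> * (P * (L^2 * (\<delta> x)^2))"
      using dsgn_sm_square[OF \<theta>, of "z x"] \<psi>(1,2)[of x] \<theta> by (intro mult_mono mult_right_mono) auto
     finally show ?case by (simp add: mult_ac)
    qed
   qed (use i4 L2_integrable[OF \<delta>] in auto)
   finally show ?thesis by (simp add: mult_ac)
  qed
  ultimately show ?thesis by (simp add: mult_ac)
 qed
 define th where "th n = inverse (real (Suc n))" for n
 have th: "th n > 0" "th ----> 0" for n
  using LIMSEQ_inverse_real_of_nat by (auto simp: th_def[abs_def])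
 note [measurable] = borel_measurable_continuous_onI[OF sgn_sm_cont[OF th(1)]] borel_measurable_continuous_onI[OF abs_sm_cont[OF th(1)]]
 define W where "W x = - (\<Sum>i\<in>Basis. \<psi>2 i x)" for x
 have [measurable]: "W \<in> \<M>" unfolding W_def[abs_def] by measurable
 have W: "\<bar>W x\<bar> \<le> real DIM('a) * P" for x
  unfolding W_def using \<psi>(4) sum_bounded_above[of Basis "%i. \<bar>\<psi>2 i x\<bar>" P]
  by (simp add: order_trans[OF sum_abs])
 have "(%n. \<integral>x. abs_sm (th n) (z x) * W x) ----> (\<integral>x. \<bar>z x\<bar> * W x)"
 proof (rule integral_dominated_convergence[where w="%x. real DIM('a) * P * \<bar>z x\<bar>"])
  show "AE x. (%n. abs_sm (th n) (z x) * W x) ----> \<bar>z x\<bar> * W x"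
   by (intro AE_I2 tendsto_intros abs_sm_lim th)
  show "AE x. norm (abs_sm (th n) (z x) * W x) \<le> real DIM('a) * P * \<bar>z x\<bar>" for n
  proof (intro AE_I2)
   fix x
   have "abs_sm (th n) (z x) * \<bar>W x\<bar> \<le> \<bar>z x\<bar> * (real DIM('a) * P)"
    using abs_sm_le_abs[OF th(1)] abs_sm_nonneg[OF th(1)] W by (intro mult_mono) auto
   then show "norm (abs_sm (th n) (z x) * W x) \<le> real DIM('a) * P * \<bar>z x\<bar>"
    using abs_sm_nonneg[OF th(1)] by (simp add: abs_mult mult_ac)
  qed
 qed (use z in auto)
 moreover have "(%n. \<integral>x. g x * sgn_sm (th n) (z x) * \<psi> x) ----> (\<integral>x. g x * sgn (z x) * \<psi> x)"
 proof (rule integral_dominated_convergence[where w="%x. P * \<bar>g x\<bar>"])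
  show "AE x. (%n. g x * sgn_sm (th n) (z x) * \<psi> x) ----> g x * sgn (z x) * \<psi> x"
   by (intro AE_I2 tendsto_intros sgn_sm_lim th)
  show "AE x. norm (g x * sgn_sm (th n) (z x) * \<psi> x) \<le> P * \<bar>g x\<bar>" for n
  proof (intro AE_I2)
   fix x
   have "\<bar>g x\<bar> * \<bar>sgn_sm (th n) (z x)\<bar> * \<psi> x \<le> \<bar>g x\<bar> * 1 * P"
    using sgn_sm_abs_le[OF th(1)] \<psi>(1,2) by (intro mult_mono) auto
   then show "norm (g x * sgn_sm (th n) (z x) * \<psi> x) \<le> P * \<bar>g x\<bar>"
    using \<psi>(1) by (simp add: abs_mult mult_ac)
  qed
 qed (use g in auto)
 ultimately have "(\<integral>x. \<bar>z x\<bar> * W x) \<le> (\<integral>x. g x * sgn (z x) * \<psi> x) + ?FQ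
   + 0 * (P * L^2 / 4 * (\<integral>x. (\<delta> x)^2))"
  by (intro LIMSEQ_le[OF _ tendsto_add[OF tendsto_add[OF _ tendsto_const] tendsto_mult_right[OF th(2)]]])
   (use approx[OF th(1)] in \<open>auto simp: W_def\<close>)
 then show ?thesis by (simp add: W_def)
qed

section \<open>The approximate equations\<close>


text \<open>The nondegenerate case. The Lipschitz bound of the inverse later lets a difference of
  fluxes be estimated by the difference of the diffusive terms, as
  \<open>weighted_contraction\<close> demands.\<close>

lemma nonlinearity_of_lower_bound:
 assumes d: "!!r. (\<Phi> has_real_derivative \<Phi>' r) (at r)" and c: "continuous_on UNIV \<Phi>'"
  and l: "l > 0" "!!r. \<Phi>' r \<ge> l" and "\<Phi> 0 = 0"
 shows "nonlinearity \<Phi> \<Phi>'" "!!x y. \<bar>x - y\<bar> \<le> \<bar>\<Phi> x - \<Phi> y\<bar> / l"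
proof -
 have lower: "l * (y - x) \<le> \<Phi> y - \<Phi> x" if "x \<le> y" for x y
 proof -
  have "(%t. l * (t - x) + \<Phi> x) y \<le> \<Phi> y"
   by (rule deriv_le_imp_le[OF that _ _ d, where f'="%_. l"])
    (use l in \<open>auto intro!: derivative_eq_intros\<close>)
  then show ?thesis by simp
 qed
 have mono: "strict_mono \<Phi>"
 proof (rule strict_monoI)
  fix x y :: real assume "x < y"
  then have "0 < l * (y - x)" using l by simp
  then show "\<Phi> x < \<Phi> y" using lower[of x y] \<open>x < y\<close> by linarith
 qed
 have "surj \<Phi>"
 proof -
  have "\<exists>x. \<Phi> x = y" for y
  proof -
   define M where "M = \<bar>y\<bar> / l"
   have M: "M \<ge> 0" "l * M = \<bar>y\<bar>" using l by (auto simp: M_def)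
   have "\<Phi> (-M) \<le> y" "y \<le> \<Phi> M"
    using lower[of "-M" 0] lower[of 0 M] M \<open>\<Phi> 0 = 0\<close> by auto
   then show ?thesis
    using IVT'[of \<Phi> "-M" y M] M(1) d DERIV_isCont continuous_at_imp_continuous_on[of "{-M..M}" \<Phi>] by fastforce
  qed
  then show ?thesis by (metis surjI)
 qed
 then show "nonlinearity \<Phi> \<Phi>'" using assms mono by unfold_locales auto
 show "\<bar>x - y\<bar> \<le> \<bar>\<Phi> x - \<Phi> y\<bar> / l" for x y
 proof -
  have "l * \<bar>x - y\<bar> \<le> \<bar>\<Phi> x - \<Phi> y\<bar>"
   using lower[of x y] lower[of y x] l by (cases "x \<le> y") (auto simp: abs_if algebra_simps split: if_splits)
  then show ?thesis using l by (simp add: field_simps)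
 qed
qed

text \<open>The symmetry u -> -u, which reduces estimates for the negative part to those for the
  positive part.\<close>

lemma nonlinearity_reflect:
 assumes "nonlinearity \<Phi> \<Phi>'" shows "nonlinearity (%r. - \<Phi> (- r)) (%r. \<Phi>' (- r))"
proof -
 interpret nonlinearity \<Phi> \<Phi>' by (rule assms)
 show ?thesis
 proof
  show "((%r. - \<Phi> (- r)) has_real_derivative \<Phi>' (- r)) (at r)" for r
  proof -
   have "((%r. \<Phi> (- r)) has_real_derivative \<Phi>' (- r) * (-1)) (at r)"
    by (rule DERIV_chain2[OF \<Phi>_deriv]) (auto intro!: derivative_eq_intros)
   from DERIV_minus[OF this] show ?thesis by simp
  qed
  show "continuous_on UNIV (%r. \<Phi>' (- r))"
   by (rule continuous_on_compose2[OF \<Phi>'_cont]) (auto intro: continuous_intros)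
  show "strict_mono (%r. - \<Phi> (- r))" using \<Phi>_mono by (simp add: strict_mono_def)
  show "surj (%r. - \<Phi> (- r))" by (rule surjI[of _ "%y. - \<gamma> (- y)"]) simp
  show "- \<Phi> (- 0) = 0" by (simp add: \<Phi>_0)
 qed
qed

lemma weak_eq_uminus:
 assumes "weak_eq v F g" shows "weak_eq (%x. - v x) (%x. - F x) (%x. - g x)"
 unfolding weak_eq_def
proof
 fix \<phi> :: "'a => real" assume "\<phi> \<in> test_functions"
 with assms have "- (\<integral>x. v x * laplacian \<phi> x) - (\<integral>x. F x \<bullet> grad \<phi> x) = (\<integral>x. g x * \<phi> x)"
  by (simp add: weak_eq_def)
 then show "- (\<integral>x. - v x * laplacian \<phi> x) - (\<integral>x. - F x \<bullet> grad \<phi> x) = (\<integral>x. - g x * \<phi> x)"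
  by simp
qed

lemma (in drift) level_translation_signed:
 fixes u g :: "'a => real" and \<Phi> \<Phi>' bb s s' :: "real => real" and \<sigma> :: real
 assumes nl: "nonlinearity \<Phi> \<Phi>'" and \<Phi>'pos: "!!r. r \<noteq> 0 ==> \<Phi>' r > 0"
  and eq: "weak_eq (%x. \<Phi> (u x)) (%x. (\<eta> x * (bb (u x) * u x)) *\<^sub>R D x) g"
  and u: "u \<in> L2" and v: "(%x. \<Phi> (u x)) \<in> L2" and g: "g \<in> L2"
  and bb: "continuous_on UNIV bb" "!!r. 0 \<le> bb r" "!!r. bb r \<le> b0"
  and \<kappa>: "\<kappa> > 0" "l > 0" "!!r. \<bar>r\<bar> \<ge> \<kappa> ==> \<Phi>' r \<ge> l"
  and s: "!!r. (s has_real_derivative s' r) (at r)" "continuous_on UNIV s'"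
   "!!r. r \<le> \<kappa> ==> s r = 0" "!!r. r \<le> \<kappa> ==> s' r = 0" "!!r. 0 \<le> s' r" "!!r. s' r \<le> s1"
  and \<sigma>: "\<sigma> = 1 \<or> \<sigma> = -1"
 shows "(\<integral>x. (s (\<sigma> * u (x + w)) - s (\<sigma> * u x))^2) \<le>
  (norm w)^2 * (s1 / l * ((\<integral>x. \<sigma> * g x * s (\<sigma> * u x)) + m1 * b0 * (\<integral>x. \<sigma> * u x * s (\<sigma> * u x))))"
 using \<sigma>
proof
 assume "\<sigma> = 1"
 moreover have "(\<integral>x. (s (u (x + w)) - s (u x))^2) \<le>
  (norm w)^2 * (s1 / l * ((\<integral>x. g x * s (u x)) + m1 * b0 * (\<integral>x. u x * s (u x))))"
  by (rule level_translation[OF nl _ eq u v g bb \<kappa>(1,2) _ s]) (use \<Phi>'pos \<kappa> in auto)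
 ultimately show ?thesis by simp
next
 assume "\<sigma> = -1"
 moreover have "(\<integral>x. (s (- u (x + w)) - s (- u x))^2) \<le>
  (norm w)^2 * (s1 / l * ((\<integral>x. - g x * s (- u x)) + m1 * b0 * (\<integral>x. - u x * s (- u x))))"
 proof (rule level_translation[OF nonlinearity_reflect[OF nl] _ _ _ _ _ _ _ _ \<kappa>(1,2) _ s])
  show "weak_eq (%x. - \<Phi> (- (- u x))) (%x. (\<eta> x * (bb (- (- u x)) * - u x)) *\<^sub>R D x) (%x. - g x)"
   using weak_eq_uminus[OF eq] by simp
  show "(%x. - u x) \<in> L2" "(%x. - g x) \<in> L2" using u g by (auto intro: L2_uminus)
  show "(%x. - \<Phi> (- (- u x))) \<in> L2" using L2_uminus[OF v] by simp
  show "continuous_on UNIV (%r. bb (- r))"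
   by (rule continuous_on_compose2[OF bb(1)]) (auto intro: continuous_intros)
 qed (use \<Phi>'pos \<kappa> bb in auto)
 ultimately show ?thesis by simp
qed

section \<open>The coefficients of the equation and their regularizations\<close>

lemma kern_real: "kern \<rho> \<xi> (x::real) = \<rho> (x / \<xi>) / \<xi>"
 by (simp add: kern_def)

locale fpe =
 fixes \<beta> b \<rho> :: "real => real" and a \<alpha> :: real and D :: "'a::euclidean_space => 'a" and divD :: "'a => real"
  and \<eta> :: "real => 'a => real"
 assumes \<beta>_C2: "C_k 2 \<beta>" and \<beta>_0: "\<beta> 0 = 0" and \<alpha>: "\<alpha> \<ge> 1" and a: "a > 0"
  and \<beta>'_ge: "!!r. deriv \<beta> r \<ge> a * \<bar>r\<bar> powr (\<alpha> - 1)"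
  and D_measurable: "D \<in> borel_measurable lborel" and D_Linf: "(%x. norm (D x)) \<in> Linf"
  and D_div: "has_weak_div D divD" "divD \<in> L2_plus_Linf" "AE x. divD x \<ge> 0"
  and b_bounded: "bounded (range b)" and b_C1: "C_k 1 b" and b_nonneg: "!!r. b r \<ge> 0"
  and \<eta>_cutoff: "cutoff_family \<eta>" and \<rho>: "standard_mollifier \<rho>"
begin

definition m0 :: real where "m0 = (SOME m. AE x. norm (D x) \<le> m)"
definition b0 :: real where "b0 = (SOME B. \<forall>r. b r \<le> B)"

lemma m0: "AE x. norm (D x) \<le> m0"
proof -
 have "\<exists>M. AE x. norm (D x) \<le> M" using D_Linf unfolding Linf_iff abs_norm_cancel by (rule conjunct2)
 then show ?thesis unfolding m0_def by (rule someI_ex)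
qed

lemma m0_nonneg: "m0 \<ge> 0"
 by (rule AE_lborel_const, use m0 in eventually_elim) (use norm_ge_zero order_trans in blast)

lemma b0: "b r \<le> b0"
proof -
 obtain B where "!!r. \<bar>b r\<bar> \<le> B" using b_bounded by (auto simp: bounded_iff)
 then have "\<forall>r. b r \<le> B" using abs_le_D1 by blast
 then have "\<forall>r. b r \<le> b0" unfolding b0_def by (rule someI)
 then show ?thesis ..
qed

lemma b0_nonneg: "b0 \<ge> 0" using b0[of 0] b_nonneg[of 0] by linarith

lemma b_cont: "continuous_on A b"
proof -
 have "continuous_on UNIV b" using C_k_le[OF b_C1, of 0] by simp
 then show ?thesis by (rule continuous_on_subset) simp
qed

definition \<beta>' where "\<beta>' = deriv \<beta>"

lemma \<beta>_deriv: "(\<beta> has_real_derivative \<beta>' r) (at r)"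
proof -
 have "\<beta> differentiable (at r)" using \<beta>_C2 by (simp add: numeral_eq_Suc differentiable_on_eq_differentiable_at)
 then show ?thesis by (simp add: \<beta>'_def DERIV_deriv_iff_real_differentiable)
qed

lemma \<beta>'_cont: "continuous_on A \<beta>'"
proof -
 have "part_deriv 1 \<beta> = \<beta>'"
  using part_deriv_eq[OF \<beta>_deriv[unfolded has_field_derivative_def], of 1] by auto
 moreover have "part_deriv 1 \<beta> differentiable_on UNIV" using \<beta>_C2 by (simp add: numeral_eq_Suc)
 ultimately have "continuous_on UNIV \<beta>'" by (metis differentiable_imp_continuous_on)
 then show ?thesis by (rule continuous_on_subset) simp
qed

lemma \<beta>'_nonneg: "\<beta>' r \<ge> 0"
proof -
 have "0 \<le> a * \<bar>r\<bar> powr (\<alpha> - 1)" using a by simp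
 then show ?thesis using \<beta>'_ge[of r] unfolding \<beta>'_def by linarith
qed

lemma \<beta>'_level: "r \<noteq> 0 ==> h > 0 ==> \<bar>r\<bar> \<ge> h ==> \<beta>' r \<ge> a * h powr (\<alpha> - 1)"
 unfolding \<beta>'_def using \<alpha> a
 by (intro order_trans[OF mult_left_mono \<beta>'_ge] powr_mono2) auto

lemma \<beta>'_pos: assumes "r \<noteq> 0" shows "\<beta>' r > 0"
proof -
 have "0 < a * \<bar>r\<bar> powr (\<alpha> - 1)" using a assms by simp
 also have "\<dots> \<le> \<beta>' r" unfolding \<beta>'_def by (rule \<beta>'_ge)
 finally show ?thesis .
qed

lemma \<beta>_nondecreasing: "x \<le> y ==> \<beta> x \<le> \<beta> y"
 by (rule DERIV_nonneg_imp_nondecreasing) (use \<beta>_deriv \<beta>'_nonneg in blast)+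

text \<open>The slope may vanish at 0, so strict monotonicity is proved on each half-line and joined
  at 0; surjectivity follows from the slope being at least a outside [-1, 1].\<close>

lemma \<beta>_nonlinearity: "nonlinearity \<beta> \<beta>'"
proof
 have cont: "continuous_on S \<beta>" for S using \<beta>_deriv DERIV_isCont continuous_at_imp_continuous_on by blast
 have *: "\<beta> x < \<beta> y" if "x < y" "0 \<le> x \<or> y \<le> 0" for x y
 proof (rule DERIV_pos_imp_increasing_open[OF that(1) _ cont])
  show "\<exists>d. (\<beta> has_real_derivative d) (at t) \<and> d > 0" if "x < t" "t < y" for t
   using \<beta>_deriv[of t] \<beta>'_pos[of t] that \<open>0 \<le> x \<or> y \<le> 0\<close> by (intro exI[of _ "\<beta>' t"]) auto
 qed
 show "strict_mono \<beta>"
 proof (rule strict_monoI)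
  fix x y :: real assume "x < y"
  then show "\<beta> x < \<beta> y" using *[of x y] *[of x 0] *[of 0 y] by (cases "x < 0 \<and> 0 < y") auto
 qed
 have grow: "\<beta> p + a * (q - p) \<le> \<beta> q" if "p \<le> q" "1 \<le> p \<or> q \<le> -1" for p q
 proof -
  have "(%t. \<beta> p + a * (t - p)) q \<le> \<beta> q"
  proof (rule deriv_le_imp_le[OF that(1) _ _ \<beta>_deriv, where f'="%_. a"])
   show "((%t. \<beta> p + a * (t - p)) has_real_derivative a) (at x)" for x by (auto intro!: derivative_eq_intros)
   show "a \<le> \<beta>' x" if "p \<le> x" "x \<le> q" for x
    using \<beta>'_level[of x 1] that \<open>1 \<le> p \<or> q \<le> -1\<close> by auto
  qed simp
  then show ?thesis by simp
 qed
 have "\<exists>x. \<beta> x = y" for y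
 proof -
  define M where "M = 1 + \<bar>y\<bar> / a"
  have M: "M \<ge> 1" "a * (M - 1) = \<bar>y\<bar>" using a by (simp_all add: M_def)
  have "\<beta> (-M) \<le> y" "y \<le> \<beta> M"
   using grow[of 1 M] grow[of "-M" "-1"] M \<beta>_nondecreasing[of 0 1] \<beta>_nondecreasing[of "-1" 0] \<beta>_0 by (auto simp: algebra_simps)
  then show ?thesis using IVT'[of \<beta> "-M" y M] M(1) cont by auto
 qed
 then show "surj \<beta>" by (metis surjI)
qed (use \<beta>_deriv \<beta>'_cont \<beta>_0 in auto)

sublocale \<beta>: nonlinearity \<beta> \<beta>' by (rule \<beta>_nonlinearity)

lemma \<beta>'_bounded: "\<exists>B\<ge>0. \<forall>r. \<bar>r\<bar> \<le> M \<longrightarrow> \<beta>' r \<le> B"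
proof -
 have "compact (\<beta>' ` {-M..M})" by (rule compact_continuous_image[OF \<beta>'_cont]) simp
 then obtain B where "!!r. r \<in> {-M..M} ==> \<bar>\<beta>' r\<bar> \<le> B"
  using compact_imp_bounded by (fastforce simp: bounded_iff)
 then have B: "\<bar>\<beta>' r\<bar> \<le> B" if "\<bar>r\<bar> \<le> M" for r using that by (simp add: abs_le_iff)
 have "\<forall>r. \<bar>r\<bar> \<le> M \<longrightarrow> \<beta>' r \<le> \<bar>B\<bar>"
 proof (intro allI impI)
  fix r :: real assume "\<bar>r\<bar> \<le> M"
  from B[OF this] show "\<beta>' r \<le> \<bar>B\<bar>" by linarith
 qed
 then show ?thesis by (intro exI[of _ "\<bar>B\<bar>"]) simp
qed

text \<open>A local Lipschitz constant of \<beta>, fixed once so that the bounds for its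
  regularizations are uniform in \<xi>.\<close>

definition lip :: "real => real" where "lip M = (SOME B. B \<ge> 0 \<and> (\<forall>r. \<bar>r\<bar> \<le> M \<longrightarrow> \<beta>' r \<le> B))"

lemma lip: "lip M \<ge> 0" "\<bar>r\<bar> \<le> M ==> \<beta>' r \<le> lip M"
 using someI_ex[of "%B. B \<ge> 0 \<and> (\<forall>r. \<bar>r\<bar> \<le> M \<longrightarrow> \<beta>' r \<le> B)"] \<beta>'_bounded unfolding lip_def by blast+

lemma \<beta>_abs_le: "\<bar>r\<bar> \<le> M ==> \<bar>\<beta> r\<bar> \<le> lip M * \<bar>r\<bar>"
 using field_differentiable_bound[of "{-M..M}" \<beta> \<beta>' "lip M" r 0] lip \<beta>'_nonneg \<beta>_0
 by (force simp: abs_le_iff intro: has_field_derivative_at_within[OF \<beta>_deriv])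

abbreviation bt :: "real => real => real" where "bt \<equiv> beta_tilde \<beta>"

context
 fixes \<xi> :: real assumes \<xi>: "0 < \<xi>" "\<xi> < 1"
begin

lemma resolvent_nonlinearity: "nonlinearity (%s. s + \<xi> * \<beta> s) (%s. 1 + \<xi> * \<beta>' s)"
 by (rule nonlinearity_of_lower_bound[of _ _ 1])
  (use \<xi> \<beta>'_nonneg \<beta>_0 in \<open>auto intro!: derivative_eq_intros \<beta>_deriv continuous_intros \<beta>'_cont\<close>)

text \<open>The resolvent of \<xi>\<beta>; \<beta> composed with it is the Yosida
  approximation.\<close>

definition \<iota> :: "real => real" where "\<iota> = inv (%s. s + \<xi> * \<beta> s)"

lemma \<iota>_eq: "\<iota> r + \<xi> * \<beta> (\<iota> r) = r"
 using nonlinearity.\<Phi>_\<gamma>[OF resolvent_nonlinearity] by (simp add: \<iota>_def)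

lemma \<iota>_0: "\<iota> 0 = 0"
 using nonlinearity.\<gamma>_0[OF resolvent_nonlinearity] by (simp add: \<iota>_def)

lemma \<iota>_abs_le: "\<bar>\<iota> r\<bar> \<le> \<bar>r\<bar>"
proof -
 have "\<bar>\<iota> r + \<xi> * \<beta> (\<iota> r)\<bar> \<ge> \<bar>\<iota> r\<bar>"
 proof (cases "\<iota> r \<ge> 0")
  case True
  then have "\<xi> * \<beta> (\<iota> r) \<ge> 0" using \<beta>_nondecreasing[of 0 "\<iota> r"] \<beta>_0 \<xi> by simp
  then show ?thesis using True by simp
 next
  case False
  then have "\<xi> * \<beta> (\<iota> r) \<le> 0" using \<beta>_nondecreasing[of "\<iota> r" 0] \<beta>_0 \<xi> by (simp add: mult_nonneg_nonpos)
  then show ?thesis using False by simp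
 qed
 then show ?thesis by (simp add: \<iota>_eq)
qed

lemma bt_eq: "bt \<xi> r = \<beta> (\<iota> r) + \<xi> * r"
 by (simp add: beta_tilde_def beta_eps_def \<iota>_def)

definition bt' :: "real => real" where "bt' r = \<beta>' (\<iota> r) / (1 + \<xi> * \<beta>' (\<iota> r)) + \<xi>"

lemma denom_pos: "1 + \<xi> * \<beta>' r > 0"
 using \<beta>'_nonneg[of r] \<xi> by (simp add: add_pos_nonneg)

lemma bt_deriv: "(bt \<xi> has_real_derivative bt' r) (at r)"
proof -
 have "(\<iota> has_real_derivative inverse (1 + \<xi> * \<beta>' (\<iota> r))) (at r)"
  unfolding \<iota>_def by (rule nonlinearity.\<gamma>_deriv[OF resolvent_nonlinearity]) (use denom_pos in \<open>simp add: less_imp_neq[symmetric]\<close>)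
 from DERIV_chain2[OF \<beta>_deriv this]
 have "((%r. \<beta> (\<iota> r) + \<xi> * r) has_real_derivative bt' r) (at r)"
  by (auto intro!: derivative_eq_intros simp: bt'_def divide_inverse)
 moreover have "bt \<xi> = (%r. \<beta> (\<iota> r) + \<xi> * r)" using bt_eq by auto
 ultimately show ?thesis by simp
qed

lemma bt'_ge: "bt' r \<ge> \<xi>"
 using denom_pos[of "\<iota> r"] \<beta>'_nonneg[of "\<iota> r"] by (simp add: bt'_def)

lemma bt'_cont: "continuous_on UNIV bt'"
proof -
 have "continuous_on UNIV \<iota>" unfolding \<iota>_def by (rule nonlinearity.\<gamma>_cont[OF resolvent_nonlinearity])
 then have "continuous_on UNIV (%r. \<beta>' (\<iota> r))" by (rule continuous_on_compose2[OF \<beta>'_cont[of UNIV]]) auto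
 then show ?thesis unfolding bt'_def using denom_pos
  by (intro continuous_intros) (auto simp: less_imp_neq[symmetric])
qed

lemma bt_0: "bt \<xi> 0 = 0"
 by (simp add: bt_eq \<iota>_0 \<beta>_0)

lemma bt_nonlinearity: "nonlinearity (bt \<xi>) bt'"
 by (rule nonlinearity_of_lower_bound(1)[OF bt_deriv bt'_cont \<xi>(1) bt'_ge bt_0])

lemma bt_inverse_lip: "\<bar>x - y\<bar> \<le> \<bar>bt \<xi> x - bt \<xi> y\<bar> / \<xi>"
 by (rule nonlinearity_of_lower_bound(2)[OF bt_deriv bt'_cont \<xi>(1) bt'_ge bt_0])

lemma bt_lip: "\<bar>bt \<xi> x\<bar> \<le> (1 / \<xi> + \<xi>) * \<bar>x\<bar>"
proof -
 have "\<bar>bt' r\<bar> \<le> 1 / \<xi> + \<xi>" for r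
 proof -
  have "\<beta>' (\<iota> r) / (1 + \<xi> * \<beta>' (\<iota> r)) \<le> 1 / \<xi>"
   using denom_pos[of "\<iota> r"] \<xi> by (simp add: divide_le_eq field_simps)
  then show ?thesis using bt'_ge[of r] \<xi> by (simp add: bt'_def)
 qed
 from lipschitz_of_deriv[OF bt_deriv this, of x 0] show ?thesis by (simp add: bt_0)
qed

lemma bt_abs_le: assumes "\<bar>r\<bar> \<le> M" shows "\<bar>bt \<xi> r\<bar> \<le> (lip M + 1) * \<bar>r\<bar>"
proof -
 have "\<bar>\<beta> (\<iota> r)\<bar> \<le> lip M * \<bar>\<iota> r\<bar>" using \<iota>_abs_le[of r] assms by (intro \<beta>_abs_le) simp
 also have "\<dots> \<le> lip M * \<bar>r\<bar>" using \<iota>_abs_le lip(1) by (intro mult_left_mono) auto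
 finally have "\<bar>\<beta> (\<iota> r)\<bar> \<le> lip M * \<bar>r\<bar>" .
 moreover have "\<bar>\<xi> * r\<bar> \<le> \<bar>r\<bar>" using \<xi> by (simp add: abs_mult mult_left_le_one_le)
 ultimately show ?thesis unfolding bt_eq by (simp add: distrib_right)
qed

lemma bt_sgn: "r * bt \<xi> r \<ge> 0"
 using strict_mono_less_eq[OF nonlinearity.\<Phi>_mono[OF bt_nonlinearity], of 0 r]
  strict_mono_less_eq[OF nonlinearity.\<Phi>_mono[OF bt_nonlinearity], of r 0] bt_0
 by (cases "r \<ge> 0") (auto simp: mult_nonpos_nonpos)

text \<open>A lower bound, independent of \<xi>, of the slope of the regularized nonlinearity above
  level \<kappa>. The minimum records the two cases of the next lemma.\<close>

definition level_bound :: "real => real" where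
 "level_bound \<kappa> = (let m = a * (\<kappa> / 2) powr (\<alpha> - 1) in min (m / (1 + m)) (1 / (lip (\<kappa> / 2) + 1)))"

text \<open>If the resolvent stays above \<kappa>/2, the slope x of \<beta> there is at least m, and
  x / (1 + \<xi> x) >= m / (1 + m). If it has dropped below \<kappa>/2, then \<xi>\<beta> makes up
  the difference, which forces \<xi> >= 1 / (lip(\<kappa>/2) + 1), and the added term \<xi> r alone
  provides the slope.\<close>

lemma bt'_level:
 assumes \<kappa>: "\<kappa> > 0" "\<bar>r\<bar> \<ge> \<kappa>"
 shows "0 < level_bound \<kappa>" "level_bound \<kappa> \<le> bt' r"
proof -
 define m where "m = a * (\<kappa> / 2) powr (\<alpha> - 1)"
 have m: "m > 0" using a \<kappa> by (simp add: m_def)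
 show "0 < level_bound \<kappa>" using m lip(1)[of "\<kappa> / 2"] by (simp add: level_bound_def Let_def m_def[symmetric])
 show "level_bound \<kappa> \<le> bt' r"
 proof (cases "\<bar>\<iota> r\<bar> \<ge> \<kappa> / 2")
  case True
  define x where "x = \<beta>' (\<iota> r)"
  have x: "m \<le> x" unfolding x_def m_def by (rule \<beta>'_level) (use True \<kappa> in auto)
  have "\<xi> * (m * x) \<le> 1 * (m * x)" using m x \<xi> by (intro mult_right_mono) auto
  then have "m * (1 + \<xi> * x) \<le> x * (1 + m)" using x by (simp add: algebra_simps)
  moreover have "1 + \<xi> * x > 0" using m x \<xi> by (simp add: add_pos_nonneg)
  ultimately have "m / (1 + m) \<le> x / (1 + \<xi> * x)" using m by (simp add: divide_simps)
  then show ?thesis using \<xi> by (simp add: level_bound_def Let_def m_def[symmetric] bt'_def x_def)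
 next
  case False
  then have "\<bar>\<beta> (\<iota> r)\<bar> \<le> lip (\<kappa> / 2) * (\<kappa> / 2)"
   using \<beta>_abs_le[of "\<iota> r" "\<kappa> / 2"] mult_left_mono[of "\<bar>\<iota> r\<bar>" "\<kappa> / 2" "lip (\<kappa> / 2)"] lip(1) by simp
  then have "\<xi> * \<bar>\<beta> (\<iota> r)\<bar> \<le> \<xi> * (lip (\<kappa> / 2) * (\<kappa> / 2))" using \<xi> by (intro mult_left_mono) auto
  moreover have "\<bar>r\<bar> \<le> \<bar>\<iota> r\<bar> + \<xi> * \<bar>\<beta> (\<iota> r)\<bar>" using \<iota>_eq[of r] \<xi> abs_triangle_ineq[of "\<iota> r" "\<xi> * \<beta> (\<iota> r)"] by (simp add: abs_mult)
  ultimately have "1 * (\<kappa> / 2) \<le> (\<xi> * lip (\<kappa> / 2)) * (\<kappa> / 2)" using False \<kappa> unfolding mult_1 mult.assoc by linarith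
  then have "1 \<le> \<xi> * lip (\<kappa> / 2)" by (rule mult_right_le_imp_le) (use \<kappa> in simp)
  then have "1 / (lip (\<kappa> / 2) + 1) \<le> \<xi>" using \<xi> lip(1)[of "\<kappa> / 2"] by (simp add: divide_le_eq algebra_simps)
  then show ?thesis using bt'_ge[of r] by (simp add: level_bound_def Let_def)
 qed
qed

abbreviation be :: "real => real" where "be \<equiv> b_eps b \<rho> \<xi>"

lemma b_measurable[measurable]: "b \<in> \<M>"
 by (rule borel_measurable_continuous_onI[OF b_cont])

lemma b_L1_loc: "b \<in> L1_loc"
 by (rule Linf_L1_loc[where M=b0]) (use b0 b_nonneg in auto)

lemma be_alt: "be r = (if b constant_on UNIV then b r else conv b (kern \<rho> \<xi>) r / (1 + \<xi> * \<bar>r\<bar>))"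
 unfolding b_eps_def using conv_alt[OF b_measurable kern_measurable[OF \<rho> \<xi>(1), where 'a=real], of r]
 by (simp add: kern_real)

lemma conv_b_bounds: "0 \<le> conv b (kern \<rho> \<xi>) r" "conv b (kern \<rho> \<xi>) r \<le> b0"
proof -
 show "0 \<le> conv b (kern \<rho> \<xi>) r"
  unfolding conv_def using b_nonneg kern_nonneg[OF \<rho> \<xi>(1), where 'a=real]
  by (intro Bochner_Integration.integral_nonneg) auto
 have "AE z in lborel. \<bar>b z\<bar> \<le> b0" using b0 b_nonneg by auto
 from conv_bounded[OF b_measurable this kern_test[OF \<rho> \<xi>(1)], of r]
 show "conv b (kern \<rho> \<xi>) r \<le> b0"
  using kern_nonneg[OF \<rho> \<xi>(1), where 'a=real] kern_integral[OF \<rho> \<xi>(1), where 'a=real] by simp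
qed

lemma weight_bounds: "1 \<le> 1 + \<xi> * \<bar>r\<bar>"
 using \<xi> by simp

lemma weight_pos: "0 < 1 + \<xi> * \<bar>r\<bar>"
 using weight_bounds[of r] by linarith

lemma be_nonneg: "0 \<le> be r"
 unfolding be_alt using b_nonneg conv_b_bounds(1)[of r] weight_bounds[of r] by simp

lemma be_le: "be r \<le> b0"
proof -
 have "conv b (kern \<rho> \<xi>) r / (1 + \<xi> * \<bar>r\<bar>) \<le> b0 / 1"
  using conv_b_bounds weight_bounds[of r] b0_nonneg by (intro frac_le) auto
 then show ?thesis unfolding be_alt using b0 by simp
qed

text \<open>\<open>b\<close> has no global Lipschitz bound; after mollification the derivative falls
  on the kernel and only the bound of \<open>b\<close> enters.\<close>

lemma conv_b_lip: "\<exists>C\<ge>0. \<forall>x y. \<bar>conv b (kern \<rho> \<xi>) x - conv b (kern \<rho> \<xi>) y\<bar> \<le> C * \<bar>x - y\<bar>"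
proof -
 let ?K = "kern \<rho> \<xi> :: real => real"
 have Kt: "?K \<in> test_functions" by (rule kern_test[OF \<rho> \<xi>(1)])
 have pd: "part_deriv 1 ?K \<in> test_functions" by (rule test_part_deriv[OF Kt]) simp
 have dd: "has_dderiv (conv b ?K) 1 (conv b (part_deriv 1 ?K))"
  by (rule conv_has_dderiv_Basis[OF b_L1_loc Kt]) simp
 have "((%r. conv b ?K r) has_real_derivative conv b (part_deriv 1 ?K) x) (at x)" for x
  using has_dderiv_at[OF dd, of 0 x UNIV] by simp
 moreover have "AE z in lborel. \<bar>b z\<bar> \<le> b0" using b0 b_nonneg by auto
 then have "\<bar>conv b (part_deriv 1 ?K) x\<bar> \<le> b0 * (\<integral>z. \<bar>part_deriv 1 ?K z\<bar>)" for x
  using conv_bounded[OF b_measurable _ pd] by blast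
 ultimately have "\<bar>conv b ?K x - conv b ?K y\<bar> \<le> (b0 * (\<integral>z. \<bar>part_deriv 1 ?K z\<bar>)) * \<bar>x - y\<bar>" for x y
  by (rule lipschitz_of_deriv)
 moreover have "b0 * (\<integral>z. \<bar>part_deriv 1 ?K z\<bar>) \<ge> 0" using b0_nonneg by simp
 ultimately show ?thesis by blast
qed

lemma be_cont: "continuous_on UNIV be"
proof -
 obtain C where C: "C \<ge> 0" "!!x y. \<bar>conv b (kern \<rho> \<xi>) x - conv b (kern \<rho> \<xi>) y\<bar> \<le> C * \<bar>x - y\<bar>"
  using conv_b_lip by blast
 have "C-lipschitz_on UNIV (conv b (kern \<rho> \<xi>))"
  by (rule lipschitz_onI) (use C in \<open>auto simp: dist_real_def\<close>)
 then have "continuous_on UNIV (conv b (kern \<rho> \<xi>))" by (rule lipschitz_on_continuous_on)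
 then have "continuous_on UNIV (%r. conv b (kern \<rho> \<xi>) r / (1 + \<xi> * \<bar>r\<bar>))"
  using weight_pos by (intro continuous_intros) (auto simp: less_imp_neq[symmetric])
 then show ?thesis unfolding be_alt using b_cont[of UNIV] by (cases "b constant_on UNIV") auto
qed

text \<open>Here the factor 1 / (1 + \<xi>|r|) is used: r / (1 + \<xi>|r|) is bounded by 1/\<xi> and
  Lipschitz. The constant depends on \<xi>, which is harmless because it enters only terms that
  disappear with \<theta>.\<close>

lemma be_mult_lip: "\<exists>C\<ge>0. \<forall>x y. \<bar>be x * x - be y * y\<bar> \<le> C * \<bar>x - y\<bar>"
proof (cases "b constant_on UNIV")
 case True
 then obtain c where c: "!!r. b r = c" by (auto simp: constant_on_def)
 then have "be x * x - be y * y = c * (x - y)" for x y using True by (simp add: be_alt right_diff_distrib)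
 then show ?thesis by (intro exI[of _ "\<bar>c\<bar>"]) (simp add: abs_mult)
next
 case False
 obtain C where C: "C \<ge> 0" "!!x y. \<bar>conv b (kern \<rho> \<xi>) x - conv b (kern \<rho> \<xi>) y\<bar> \<le> C * \<bar>x - y\<bar>"
  using conv_b_lip by blast
 define k where "k r = r / (1 + \<xi> * \<bar>r\<bar>)" for r
 have k_le: "\<bar>k r\<bar> \<le> 1 / \<xi>" for r
 proof -
  have "\<xi> * \<bar>r\<bar> \<le> 1 * (1 + \<xi> * \<bar>r\<bar>)" by simp
  moreover have "\<bar>k r\<bar> = \<bar>r\<bar> / (1 + \<xi> * \<bar>r\<bar>)" using weight_bounds[of r] by (simp add: k_def abs_divide)
  ultimately show ?thesis using \<xi> by (simp add: pos_divide_le_eq[OF weight_pos] field_simps)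
 qed
 have k_lip: "\<bar>k x - k y\<bar> \<le> 2 * \<bar>x - y\<bar>" for x y
 proof -
  define p q where "p = 1 + \<xi> * \<bar>x\<bar>" and "q = 1 + \<xi> * \<bar>y\<bar>"
  have pq: "p \<ge> 1" "q \<ge> 1" using weight_bounds by (auto simp: p_def q_def)
  have "k x - k y = (x - y) / p + y * (q - p) / (p * q)"
   using pq by (simp add: k_def field_simps flip: p_def q_def)
  also have "\<bar>\<dots>\<bar> \<le> \<bar>x - y\<bar> / p + \<bar>y\<bar> * \<bar>q - p\<bar> / (p * q)"
   using pq by (intro order_trans[OF abs_triangle_ineq]) (auto simp: abs_divide abs_mult)
  also have "\<bar>y\<bar> * \<bar>q - p\<bar> / (p * q) \<le> \<bar>x - y\<bar>"
  proof -
   have "\<bar>q - p\<bar> = \<xi> * \<bar>\<bar>y\<bar> - \<bar>x\<bar>\<bar>" using \<xi> by (simp add: p_def q_def abs_mult flip: right_diff_distrib)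
   also have "\<dots> \<le> \<xi> * \<bar>x - y\<bar>" using \<xi> by (intro mult_left_mono) auto
   finally have "\<bar>y\<bar> * \<bar>q - p\<bar> \<le> (\<xi> * \<bar>y\<bar>) * \<bar>x - y\<bar>" by (metis abs_ge_zero mult.commute mult.left_commute mult_left_mono)
   also have "\<dots> \<le> (p * q) * \<bar>x - y\<bar>"
   proof (rule mult_right_mono)
    have "\<xi> * \<bar>y\<bar> \<le> 1 * q" by (simp add: q_def)
    also have "\<dots> \<le> p * q" using pq by (intro mult_right_mono) auto
    finally show "\<xi> * \<bar>y\<bar> \<le> p * q" .
   qed simp
   finally show ?thesis using pq by (simp add: divide_le_eq mult.commute)
  qed
  also have "\<bar>x - y\<bar> / p \<le> \<bar>x - y\<bar>" using pq mult_left_mono[of 1 p "\<bar>x - y\<bar>"] by (simp add: divide_le_eq)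
  finally show ?thesis by simp
 qed
 define m where "m = conv b (kern \<rho> \<xi>)"
 have "\<bar>be x * x - be y * y\<bar> \<le> (C / \<xi> + b0 * 2) * \<bar>x - y\<bar>" for x y
 proof -
  have "be x * x - be y * y = (m x - m y) * k x + m y * (k x - k y)"
   using False by (simp add: be_alt m_def k_def algebra_simps)
  also have "\<bar>\<dots>\<bar> \<le> \<bar>m x - m y\<bar> * \<bar>k x\<bar> + \<bar>m y\<bar> * \<bar>k x - k y\<bar>"
   by (rule order_trans[OF abs_triangle_ineq]) (simp add: abs_mult)
  also have "\<dots> \<le> (C * \<bar>x - y\<bar>) * (1 / \<xi>) + b0 * (2 * \<bar>x - y\<bar>)"
   using C k_le k_lip conv_b_bounds b0_nonneg by (intro add_mono mult_mono) (auto simp: m_def)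
  finally show ?thesis by (simp add: algebra_simps)
 qed
 moreover have "C / \<xi> + b0 * 2 \<ge> 0" using C \<xi> b0_nonneg by simp
 ultimately show ?thesis by blast
qed

end

end

declare test_measurable[measurable del] kern_measurable[measurable del] mollifier_measurable[measurable del]

section \<open>Elementary rules for weak equations\<close>

lemma integrable_inner_grad:
 fixes F :: "'a::euclidean_space => 'a"
 assumes "!!i. i \<in> Basis ==> (%x. F x \<bullet> i) \<in> L1_loc" "\<phi> \<in> test_functions"
 shows "\<L> (%x. F x \<bullet> grad \<phi> x)"
proof -
 have "\<L> (%x. \<Sum>i\<in>Basis. (F x \<bullet> i) * part_deriv i \<phi> x)"
  using test_integrable_mult[OF test_part_deriv[OF assms(2)] assms(1)] by (intro Bochner_Integration.integrable_sum)
 then show ?thesis by (simp add: grad_def inner_sum_right mult.commute)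
qed

lemma integrable_mult_laplacian:
 fixes v :: "'a::euclidean_space => real"
 assumes "v \<in> L1_loc" "\<phi> \<in> test_functions"
 shows "\<L> (%x. v x * laplacian \<phi> x)"
proof -
 have "\<L> (%x. \<Sum>i\<in>Basis. v x * part_deriv i (part_deriv i \<phi>) x)"
  using test_integrable_mult[OF test_part_deriv[OF test_part_deriv[OF assms(2)]] assms(1)] by (intro Bochner_Integration.integrable_sum)
 then show ?thesis by (simp add: laplacian_def sum_distrib_left)
qed

lemma laplacian_measurable:
 assumes "\<phi> \<in> test_functions" shows "laplacian \<phi> \<in> \<M>"
 unfolding laplacian_def[abs_def]
 using test_measurable[OF test_part_deriv[OF test_part_deriv[OF assms]]] by (intro borel_measurable_sum) auto

lemma grad_measurable:
 assumes "\<phi> \<in> test_functions" shows "grad \<phi> \<in> \<M>"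
 unfolding grad_def[abs_def]
 using test_measurable[OF test_part_deriv[OF assms]] by (intro borel_measurable_sum borel_measurable_scaleR) auto

lemma weak_eq_diff:
 fixes v1 v2 :: "'a::euclidean_space => real"
 assumes eq: "weak_eq v1 F1 g1" "weak_eq v2 F2 g2"
  and v: "v1 \<in> L1_loc" "v2 \<in> L1_loc" and g: "g1 \<in> L1_loc" "g2 \<in> L1_loc"
  and F: "!!i. i \<in> Basis ==> (%x. F1 x \<bullet> i) \<in> L1_loc" "!!i. i \<in> Basis ==> (%x. F2 x \<bullet> i) \<in> L1_loc"
 shows "weak_eq (%x. v1 x - v2 x) (%x. F1 x - F2 x) (%x. g1 x - g2 x)"
 unfolding weak_eq_def
proof
 fix \<phi> :: "'a => real" assume \<phi>: "\<phi> \<in> test_functions"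
 note i = integrable_mult_laplacian[OF v(1) \<phi>] integrable_mult_laplacian[OF v(2) \<phi>]
  integrable_inner_grad[OF F(1) \<phi>] integrable_inner_grad[OF F(2) \<phi>]
  test_integrable_mult[OF \<phi> g(1)] test_integrable_mult[OF \<phi> g(2)]
 have "- (\<integral>x. v1 x * laplacian \<phi> x) - (\<integral>x. F1 x \<bullet> grad \<phi> x) = (\<integral>x. g1 x * \<phi> x)"
  "- (\<integral>x. v2 x * laplacian \<phi> x) - (\<integral>x. F2 x \<bullet> grad \<phi> x) = (\<integral>x. g2 x * \<phi> x)"
  using eq \<phi> by (auto simp: weak_eq_def)
 then show "- (\<integral>x. (v1 x - v2 x) * laplacian \<phi> x) - (\<integral>x. (F1 x - F2 x) \<bullet> grad \<phi> x) = (\<integral>x. (g1 x - g2 x) * \<phi> x)"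
  using i by (simp add: left_diff_distrib inner_diff_left)
qed

lemma weak_eq_cong_AE:
 fixes v v' :: "'a::euclidean_space => real" and F F' :: "'a => 'a"
 assumes eq: "weak_eq v F g" and ae: "AE x. v x = v' x" "AE x. F x = F' x" "AE x. g x = g' x"
  and [measurable]: "v \<in> \<M>" "v' \<in> \<M>" "F \<in> \<M>"
   "F' \<in> \<M>" "g \<in> \<M>" "g' \<in> \<M>"
 shows "weak_eq v' F' g'"
 unfolding weak_eq_def
proof
 fix \<phi> :: "'a => real" assume \<phi>: "\<phi> \<in> test_functions"
 note [measurable] = laplacian_measurable[OF \<phi>] grad_measurable[OF \<phi>] test_measurable[OF \<phi>]
 have "(\<integral>x. v x * laplacian \<phi> x) = (\<integral>x. v' x * laplacian \<phi> x)"
  by (rule integral_cong_AE, measurable) (use ae(1) in \<open>auto elim!: eventually_mono\<close>)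
 moreover have "(\<integral>x. F x \<bullet> grad \<phi> x) = (\<integral>x. F' x \<bullet> grad \<phi> x)"
  by (rule integral_cong_AE, measurable) (use ae(2) in \<open>auto elim!: eventually_mono\<close>)
 moreover have "(\<integral>x. g x * \<phi> x) = (\<integral>x. g' x * \<phi> x)"
  by (rule integral_cong_AE, measurable) (use ae(3) in \<open>auto elim!: eventually_mono\<close>)
 moreover have "- (\<integral>x. v x * laplacian \<phi> x) - (\<integral>x. F x \<bullet> grad \<phi> x) = (\<integral>x. g x * \<phi> x)"
  using eq \<phi> by (simp add: weak_eq_def)
 ultimately show "- (\<integral>x. v' x * laplacian \<phi> x) - (\<integral>x. F' x \<bullet> grad \<phi> x) = (\<integral>x. g' x * \<phi> x)"
  by simp
qed

section \<open>Test profiles that vanish below a level\<close>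

lemma pos_part_square_deriv: "((%x::real. (max 0 x)^2) has_real_derivative 2 * max 0 x) (at x)"
proof (cases x "0 :: real" rule: linorder_cases)
 case less
 have "((%_. 0) has_real_derivative 0) (at x)" by simp
 then have "((%x::real. (max 0 x)^2) has_real_derivative 0) (at x)"
  by (rule has_field_derivative_transform_within_open[of _ _ _ "{..<0}"]) (use less in auto)
 then show ?thesis using less by simp
next
 case greater
 have "((%x. x^2) has_real_derivative 2 * x) (at x)" by (auto intro!: derivative_eq_intros)
 then have "((%x::real. (max 0 x)^2) has_real_derivative 2 * x) (at x)"
  by (rule has_field_derivative_transform_within_open[of _ _ _ "{0<..}"]) (use greater in auto)
 then show ?thesis using greater by simp
next
 case equal
 have "((%y::real. ((max 0 y)^2 - (max 0 0)^2) / (y - 0)) \<longlongrightarrow> 0) (at 0)"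
 proof (rule Lim_null_comparison)
  show "\<forall>\<^sub>F y in at 0. norm (((max 0 y)^2 - (max 0 0)^2) / (y - 0)) \<le> \<bar>y :: real\<bar>"
   by (intro always_eventually allI) (auto simp: max_def power2_eq_square)
  show "((%y::real. \<bar>y\<bar>) \<longlongrightarrow> 0) (at 0)" using tendsto_rabs_zero[OF tendsto_ident_at[of "0::real" UNIV]] .
 qed
 then show ?thesis using equal by (simp add: has_field_derivative_iff)
qed

text \<open>A C^1 profile that is 0 on the negative axis, strictly increasing on the positive one,
  below 1, and of slope at most 2. Boundedness allows integrable data, and strict growth lets it
  detect differences of its argument.\<close>

definition ramp :: "real => real" where "ramp x = (max 0 x)^2 / (1 + (max 0 x)^2)"
definition ramp' :: "real => real" where "ramp' x = 2 * max 0 x / (1 + (max 0 x)^2)^2"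

lemma one_plus_square_pos: "0 < 1 + (y::real)^2"
 by (simp add: add_pos_nonneg)

lemma ramp_deriv: "(ramp has_real_derivative ramp' x) (at x)"
proof -
 have nz: "1 + (max 0 x)^2 \<noteq> 0" using one_plus_square_pos[of "max 0 x"] by simp
 have "((%x::real. 1 + (max 0 x)^2) has_real_derivative 0 + 2 * max 0 x) (at x)"
  by (intro DERIV_add DERIV_const pos_part_square_deriv)
 from DERIV_divide[OF pos_part_square_deriv this nz]
 have "(ramp has_real_derivative (2 * max 0 x * (1 + (max 0 x)^2) - (max 0 x)^2 * (0 + 2 * max 0 x)) / ((1 + (max 0 x)^2) * (1 + (max 0 x)^2))) (at x)"
  by (simp add: ramp_def[abs_def])
 then show ?thesis by (simp add: ramp'_def power2_eq_square algebra_simps)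
qed

lemma ramp'_cont: "continuous_on UNIV ramp'"
 unfolding ramp'_def using one_plus_square_pos
 by (intro continuous_intros) (auto simp: less_imp_neq[symmetric])

lemma ramp_cont: "continuous_on UNIV ramp"
 using ramp_deriv by (meson DERIV_isCont continuous_at_imp_continuous_on)

lemma ramp_bounds: "0 \<le> ramp x" "ramp x \<le> 1"
 using one_plus_square_pos[of "max 0 x"] by (auto simp: ramp_def divide_le_eq)

lemma ramp_nonpos: "x \<le> 0 ==> ramp x = 0" "x \<le> 0 ==> ramp' x = 0"
 by (auto simp: ramp_def ramp'_def)

lemma ramp_pos: "x > 0 ==> ramp x > 0"
 using one_plus_square_pos[of x] by (simp add: ramp_def)

lemma ramp_gap: assumes "0 \<le> q" "q + \<tau> \<le> p" "p \<le> R" "\<tau> > 0" shows "\<tau>^2 / (1 + R^2)^2 \<le> ramp p - ramp q"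
proof -
 have sq: "p^2 \<le> R^2" "q^2 \<le> R^2" using assms by (auto intro: power_mono)
 have "\<tau>^2 \<le> (p - q)^2" using assms by (intro power_mono) auto
 also have "\<dots> \<le> p^2 - q^2" using assms mult_nonneg_nonneg[of q "p - q"] by (simp add: power2_eq_square algebra_simps)
 finally have le: "\<tau>^2 \<le> p^2 - q^2" .
 then have "\<tau>^2 / ((1 + R^2) * (1 + R^2)) \<le> (p^2 - q^2) / ((1 + p^2) * (1 + q^2))"
  using sq one_plus_square_pos le order_trans[OF zero_le_power2 le] by (intro frac_le mult_mono mult_pos_pos) auto
 also have "\<dots> = ramp p - ramp q"
  using assms one_plus_square_pos[of p] one_plus_square_pos[of q] by (simp add: ramp_def field_simps)
 finally show ?thesis by (simp add: power2_eq_square)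
qed

text \<open>If x >= y + \<tau>, then x >= \<tau>/2 or -y >= \<tau>/2, so one of the two signs lifts
  the larger value clear of the level \<tau>/4 and \<open>ramp_gap\<close> applies. Bounds above
  positive levels thereby control u across 0 too, where the diffusion degenerates.\<close>

lemma ramp_separation:
 assumes \<tau>: "\<tau> > 0" and xy: "\<tau> \<le> \<bar>x - y\<bar>" "\<bar>x\<bar> \<le> R" "\<bar>y\<bar> \<le> R"
 shows "\<exists>\<sigma>. (\<sigma> = 1 \<or> \<sigma> = -1) \<and> (\<tau> / 4)\<^sup>2 / (1 + R^2)^2 \<le> \<bar>ramp (\<sigma> * x - \<tau> / 4) - ramp (\<sigma> * y - \<tau> / 4)\<bar>"
proof -
 have *: "(\<tau> / 4)^2 / (1 + R^2)^2 \<le> ramp (x - \<tau> / 4) - ramp (y - \<tau> / 4)" if "y + \<tau> \<le> x" "\<tau> / 2 \<le> x" "x \<le> R" for x y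
 proof -
  have "ramp (y - \<tau> / 4) = ramp (max 0 (y - \<tau> / 4))" by (simp add: ramp_def)
  moreover have "(\<tau> / 4)^2 / (1 + R^2)^2 \<le> ramp (x - \<tau> / 4) - ramp (max 0 (y - \<tau> / 4))"
   by (rule ramp_gap) (use that \<tau> in auto)
  ultimately show ?thesis by simp
 qed
 have **: "(\<tau> / 4)^2 / (1 + R^2)^2 \<le> \<bar>ramp (x - \<tau> / 4) - ramp (y - \<tau> / 4)\<bar>
   \<or> (\<tau> / 4)\<^sup>2 / (1 + R^2)^2 \<le> \<bar>ramp (- x - \<tau> / 4) - ramp (- y - \<tau> / 4)\<bar>"
  if "y + \<tau> \<le> x" "x \<le> R" "- y \<le> R" for x y
 proof (cases "\<tau> / 2 \<le> x")
  case True then show ?thesis using *[of y x] that by linarith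
 next
  case False then show ?thesis using *[of "- x" "- y"] that by linarith
 qed
 have "y + \<tau> \<le> x \<or> x + \<tau> \<le> y" using xy(1) by linarith
 then have "(\<tau> / 4)^2 / (1 + R^2)^2 \<le> \<bar>ramp (x - \<tau> / 4) - ramp (y - \<tau> / 4)\<bar>
   \<or> (\<tau> / 4)\<^sup>2 / (1 + R^2)^2 \<le> \<bar>ramp (- x - \<tau> / 4) - ramp (- y - \<tau> / 4)\<bar>"
 proof
  assume "y + \<tau> \<le> x" then show ?thesis using **[of y x] xy by linarith
 next
  assume "x + \<tau> \<le> y" then show ?thesis using **[of x y] xy by linarith
 qed
 then show ?thesis by (auto intro: exI[of _ "1::real"] exI[of _ "-1::real"])
qed

lemma ramp'_bounds: "0 \<le> ramp' x" "ramp' x \<le> 2"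
proof -
 show "0 \<le> ramp' x" by (simp add: ramp'_def)
 define m where "m = max 0 x"
 have "m \<le> 1 + m^2" using sum_squares_bound[of m 1] by (simp add: power2_eq_square) (smt (verit) one_plus_square_pos power2_eq_square)
 moreover have "1 * (1 + m^2) \<le> (1 + m^2) * (1 + m^2)" by (intro mult_right_mono) auto
 then have "1 + m^2 \<le> (1 + m^2)^2" by (simp add: power2_eq_square[of "1 + m^2"])
 ultimately have "2 * m \<le> 2 * (1 + m^2)^2" by linarith
 then show "ramp' x \<le> 2" using one_plus_square_pos[of m] by (simp add: ramp'_def m_def divide_le_eq)
qed

section \<open>The approximate problem as a weak equation with cut-off drift\<close>

context fpe
begin

definition D_in_L2 :: bool where
 "D_in_L2 \<longleftrightarrow> (%x. norm (D x)) \<in> L2 \<and> (\<exists>v\<in>L2_plus_Linf. has_weak_div D v)"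
text \<open>With the value 1 when \<open>D\<close> is kept, both cases of \<open>D_eps\<close>
  become a cutoff times \<open>D\<close>.\<close>

definition eta :: "real => 'a => real" where "eta \<xi> x = (if D_in_L2 then 1 else \<eta> \<xi> x)"
definition eta' :: "real => 'a => 'a => real" where "eta' \<xi> i x = (if D_in_L2 then 0 else part_deriv i (\<eta> \<xi>) x)"

lemma D_eps_eq: "D_eps D \<eta> \<xi> x = eta \<xi> x *\<^sub>R D x"
 by (auto simp: D_eps_def eta_def D_in_L2_def)

context
 fixes \<xi> :: real assumes \<xi>: "0 < \<xi>" "\<xi> < 1"
begin

lemma \<eta>_props: "C_k 1 (\<eta> \<xi>)" "bounded {x. \<eta> \<xi> x \<noteq> 0}" "0 \<le> \<eta> \<xi> x" "\<eta> \<xi> x \<le> 1" "norm (grad (\<eta> \<xi>) x) \<le> 1"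
  "norm x \<le> 1 / \<xi> ==> \<eta> \<xi> x = 1"
 using \<eta>_cutoff \<xi> unfolding cutoff_family_def compactly_supported_iff by auto

lemma eta_measurable[measurable]: "eta \<xi> \<in> \<M>"
proof -
 have "continuous_on UNIV (\<eta> \<xi>)" using C_k_le[OF \<eta>_props(1), of 0] by simp
 then have [measurable]: "\<eta> \<xi> \<in> \<M>" by (rule borel_measurable_continuous_onI)
 show ?thesis unfolding eta_def[abs_def] by measurable
qed

lemma eta_bounds: "0 \<le> eta \<xi> x" "eta \<xi> x \<le> 1"
 using \<eta>_props by (auto simp: eta_def)

lemma D_meas[measurable]: "D \<in> \<M>"
 using D_measurable by simp

text \<open>The bound 1 on grad \<eta> gives m1 = \<open>m0\<close>. This does not become small with
  \<xi>, so the approximate estimates carry the factor 1 - lam m0 b0.\<close>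

lemma drift_eps: "drift \<rho> D divD m0 (eta \<xi>) (eta' \<xi>) 1 m0"
proof
 have pc: "continuous_on UNIV (part_deriv i (\<eta> \<xi>))" if "i \<in> Basis" for i
  using \<eta>_props(1) that by simp
 show "standard_mollifier \<rho>" by (rule \<rho>)
 show "D \<in> \<M>" by measurable
 show "AE x. norm (D x) \<le> m0" by (rule m0)
 show "has_weak_div D divD" "AE x. 0 \<le> divD x" using D_div by auto
 show "has_dderiv (eta \<xi>) i (eta' \<xi> i)" if "i \<in> Basis" for i
 proof (cases D_in_L2)
  case True
  then have "eta \<xi> = (%_. 1)" "eta' \<xi> i = (%_. 0)" by (auto simp: eta_def eta'_def)
  then show ?thesis by (simp add: has_dderiv_const)
 next
  case False
  then have "eta \<xi> = \<eta> \<xi>" "eta' \<xi> i = part_deriv i (\<eta> \<xi>)" by (auto simp: eta_def eta'_def)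
  then show ?thesis using C_1_has_dderiv_Basis[OF \<eta>_props(1) that] by simp
 qed
 show "0 \<le> eta \<xi> x" "eta \<xi> x \<le> 1" for x by (rule eta_bounds)+
 show "\<bar>eta' \<xi> i x\<bar> \<le> 1" if "i \<in> Basis" for i x
 proof -
  have "grad (\<eta> \<xi>) x \<bullet> i = part_deriv i (\<eta> \<xi>) x" using that by (simp add: grad_def inner_sum_left_Basis)
  then show ?thesis using Basis_le_norm[OF that, of "grad (\<eta> \<xi>) x"] \<eta>_props(5)[of x] by (simp add: eta'_def)
 qed
 show "AE x. \<bar>\<Sum>i\<in>Basis. eta' \<xi> i x * (D x \<bullet> i)\<bar> \<le> m0"
  using m0
 proof eventually_elim
  case (elim x)
  show ?case
  proof (cases D_in_L2)
   case True
   then show ?thesis using m0_nonneg by (simp add: eta'_def)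
  next
   case False
   then have "(\<Sum>i\<in>Basis. eta' \<xi> i x * (D x \<bullet> i)) = grad (\<eta> \<xi>) x \<bullet> D x"
    by (simp add: eta'_def grad_def inner_sum_left inner_commute[of "D x"])
   also have "\<bar>\<dots>\<bar> \<le> norm (grad (\<eta> \<xi>) x) * norm (D x)" by (rule Cauchy_Schwarz_ineq2)
   also have "\<dots> \<le> 1 * m0" using \<eta>_props(5) elim by (intro mult_mono) auto
   finally show ?thesis by simp
  qed
 qed
 show "eta \<xi> \<in> \<M>" by measurable
 show "eta' \<xi> i \<in> \<M>" if "i \<in> Basis" for i
  unfolding eta'_def[abs_def] using borel_measurable_continuous_onI[OF pc[OF that]] by (cases D_in_L2) auto
qed

text \<open>The purpose of the cutoff: \<open>weighted_contraction\<close> needs the flux difference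
  to be at most an L^2 function times |z|.\<close>

lemma norm_D_eps_L2: "(%x. eta \<xi> x * norm (D x)) \<in> L2"
proof (cases D_in_L2)
 case True
 then show ?thesis by (simp add: eta_def D_in_L2_def)
next
 case False
 define K where "K = closure {x. \<eta> \<xi> x \<noteq> 0}"
 have K: "compact K" using \<eta>_props(2) by (simp add: K_def)
 have [measurable]: "K \<in> sets borel" using K by (simp add: borel_compact)
 have e: "(%x. (indicator K x :: real)^2) = indicator K" by (auto simp: indicator_def)
 have "(indicator K :: 'a => real) \<in> L2"
  using emeasure_compact_finite[OF K] by (intro L2_I) (simp_all add: integrable_indicator_iff e)
 then show ?thesis
 proof (rule L2_dominated)
  show "AE x. \<bar>eta \<xi> x * norm (D x)\<bar> \<le> m0 * \<bar>indicator K x\<bar>"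
   using m0
  proof eventually_elim
   case (elim x)
   have "\<eta> \<xi> x = 0" if "x \<notin> K" using that closure_subset[of "{x. \<eta> \<xi> x \<noteq> 0}"] by (auto simp: K_def)
   moreover have "\<eta> \<xi> x * norm (D x) \<le> 1 * m0" using elim \<eta>_props(3,4)[of x] by (intro mult_mono) auto
   ultimately show ?case using False \<eta>_props(3)[of x] by (auto simp: eta_def indicator_def abs_mult)
  qed
 qed measurable
qed

definition drift_term :: "('a => real) => 'a => 'a" where
 "drift_term u x = (eta \<xi> x * (b_eps b \<rho> \<xi> (u x) * u x)) *\<^sub>R D x"

lemma be_measurable[measurable]: "b_eps b \<rho> \<xi> \<in> \<M>"
 by (rule borel_measurable_continuous_onI[OF be_cont[OF \<xi>]])

lemma bt_measurable[measurable]: "bt \<xi> \<in> \<M>"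
 by (rule borel_measurable_continuous_onI[OF nonlinearity.\<Phi>_cont[OF bt_nonlinearity[OF \<xi>]]])

lemma bt_L2: "u \<in> L2 ==> (%x. bt \<xi> (u x)) \<in> L2"
 by (rule L2_dominated[of u _ "1 / \<xi> + \<xi>"]) (use bt_lip[OF \<xi>] L2_measurable in auto)

lemma beu_L2: "u \<in> L2 ==> (%x. b_eps b \<rho> \<xi> (u x) * u x) \<in> L2"
 by (rule L2_bounded_mult[of u _ b0]) (use be_le[OF \<xi>] be_nonneg[OF \<xi>] L2_measurable in \<open>auto simp: abs_of_nonneg\<close>)

lemma drift_term_component_le:
 assumes "i \<in> Basis"
 shows "AE x. \<bar>drift_term u x \<bullet> i\<bar> \<le> m0 * \<bar>b_eps b \<rho> \<xi> (u x) * u x\<bar>"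
 using m0
proof eventually_elim
 case (elim x)
 have "\<bar>D x \<bullet> i\<bar> \<le> m0" using Basis_le_norm[OF assms, of "D x"] elim by linarith
 then have "eta \<xi> x * \<bar>D x \<bullet> i\<bar> \<le> 1 * m0" using eta_bounds[of x] by (intro mult_mono) auto
 then have "\<bar>b_eps b \<rho> \<xi> (u x) * u x\<bar> * (eta \<xi> x * \<bar>D x \<bullet> i\<bar>) \<le> \<bar>b_eps b \<rho> \<xi> (u x) * u x\<bar> * m0"
  by (intro mult_left_mono) auto
 then show ?case using eta_bounds(1)[of x] by (simp add: drift_term_def abs_mult mult_ac)
qed

lemma drift_term_measurable: "u \<in> \<M> ==> drift_term u \<in> \<M>"
 unfolding drift_term_def[abs_def] by (rule borel_measurable_scaleR[OF _ D_meas]) measurable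

lemma drift_term_L2: "u \<in> L2 ==> i \<in> Basis ==> (%x. drift_term u x \<bullet> i) \<in> L2"
 by (rule L2_dominated[OF beu_L2 _ drift_term_component_le])
  (use drift_term_measurable[OF L2_measurable] in auto)

lemma approx_solution_weak_eq:
 assumes sol: "approx_solution \<beta> D b \<eta> \<rho> \<xi> lam f u" and lam: "lam > 0" and f: "f \<in> L2"
 shows "u \<in> L2" "weak_eq (%x. bt \<xi> (u x)) (drift_term u) (%x. (f x - u x) / lam - \<xi> * bt \<xi> (u x))"
proof -
 show u: "u \<in> L2" using sol by (simp add: approx_solution_def)
 show "weak_eq (%x. bt \<xi> (u x)) (drift_term u) (%x. (f x - u x) / lam - \<xi> * bt \<xi> (u x))"
  unfolding weak_eq_def
 proof
  fix \<phi> :: "'a => real" assume \<phi>: "\<phi> \<in> test_functions"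
  have i: "\<L> (%x. u x * \<phi> x)" "\<L> (%x. f x * \<phi> x)" "\<L> (%x. bt \<xi> (u x) * \<phi> x)"
   using test_integrable_mult[OF \<phi>] L2_L1_loc u f bt_L2[OF u] by auto
  have F: "b_eps b \<rho> \<xi> (u x) * u x * (D_eps D \<eta> \<xi> x \<bullet> grad \<phi> x) = drift_term u x \<bullet> grad \<phi> x" for x
   by (simp add: D_eps_eq drift_term_def mult_ac)
  have eq: "(\<integral>x. u x * \<phi> x)
    - lam * (\<integral>x. bt \<xi> (u x) * laplacian \<phi> x)
    + lam * \<xi> * (\<integral>x. bt \<xi> (u x) * \<phi> x)
    - lam * (\<integral>x. drift_term u x \<bullet> grad \<phi> x)
    = (\<integral>x. f x * \<phi> x)"
   using bspec[OF conjunct2[OF conjunct2[OF sol[unfolded approx_solution_def]]] \<phi>] unfolding F .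
  have "(\<integral>x. ((f x - u x) / lam - \<xi> * bt \<xi> (u x)) * \<phi> x) =
    (\<integral>x. (f x * \<phi> x - u x * \<phi> x) / lam - \<xi> * (bt \<xi> (u x) * \<phi> x))"
   by (intro Bochner_Integration.integral_cong) (auto simp: field_simps)
  also have "\<dots> = ((\<integral>x. f x * \<phi> x) - (\<integral>x. u x * \<phi> x)) / lam - \<xi> * (\<integral>x. bt \<xi> (u x) * \<phi> x)"
   using i by simp
  also have "\<dots> = - (\<integral>x. bt \<xi> (u x) * laplacian \<phi> x) - (\<integral>x. drift_term u x \<bullet> grad \<phi> x)"
   using eq lam by (simp add: field_simps)
  finally show "- (\<integral>x. bt \<xi> (u x) * laplacian \<phi> x) - (\<integral>x. drift_term u x \<bullet> grad \<phi> x)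
   = (\<integral>x. ((f x - u x) / lam - \<xi> * bt \<xi> (u x)) * \<phi> x)" by simp
 qed
qed

text \<open>The zero-order terms (f - u)/lam stay on the right, \<xi> bt(u) has the favourable sign
  and is dropped, and the drift cost m0 b0 is absorbed into the coefficient of u. The constant 2 is
  the slope bound of \<open>ramp\<close>.\<close>

lemma approx_level_translation:
 assumes u: "u \<in> L2" and f: "f \<in> L2" and lam: "lam > 0" and \<kappa>: "\<kappa> > 0" and \<sigma>: "\<sigma> = 1 \<or> \<sigma> = -1"
  and l: "l > 0" "!!r. \<bar>r\<bar> \<ge> \<kappa> ==> l \<le> bt' \<xi> r"
  and eq: "weak_eq (%x. bt \<xi> (u x)) (drift_term u) (%x. (f x - u x) / lam - \<xi> * bt \<xi> (u x))"
 shows "(\<integral>x. (ramp (\<sigma> * u (x + w) - \<kappa>) - ramp (\<sigma> * u x - \<kappa>))^2) \<le>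
  (norm w)^2 * (2 / (l * lam) * (\<integral>x. (\<sigma> * f x - (1 - lam * m0 * b0) * (\<sigma> * u x)) * ramp (\<sigma> * u x - \<kappa>)))"
proof -
 interpret drift \<rho> D divD m0 "eta \<xi>" "eta' \<xi>" 1 m0 by (rule drift_eps)
 define g where "g x = (f x - u x) / lam - \<xi> * bt \<xi> (u x)" for x
 let ?d = "%x. \<sigma> * f x - (1 - lam * m0 * b0) * (\<sigma> * u x)"
 define s where "s r = ramp (r - \<kappa>)" for r
 have gL: "g \<in> L2" unfolding g_def[abs_def]
  using L2_diff[OF L2_cmult[OF L2_diff[OF f u], of "1 / lam"] L2_cmult[OF bt_L2[OF u], of \<xi>]] by simp
 note [measurable] = L2_measurable[OF u] L2_measurable[OF f] L2_measurable[OF gL] borel_measurable_continuous_onI[OF ramp_cont]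
 have sd: "(s has_real_derivative ramp' (r - \<kappa>)) (at r)" for r
 proof -
  have "((%r. r - \<kappa>) has_real_derivative 1) (at r)" by (auto intro!: derivative_eq_intros)
  from DERIV_chain2[OF ramp_deriv this] show ?thesis by (simp add: s_def[abs_def])
 qed
 define I where "I = (\<integral>x. \<sigma> * g x * s (\<sigma> * u x)) + m0 * b0 * (\<integral>x. \<sigma> * u x * s (\<sigma> * u x))"
 have tr: "(\<integral>x. (s (\<sigma> * u (x + w)) - s (\<sigma> * u x))^2) \<le> (norm w)^2 * (2 / l * I)"
  unfolding I_def
 proof (rule level_translation_signed[OF bt_nonlinearity[OF \<xi>] _ _ u bt_L2[OF u] gL be_cont[OF \<xi>] be_nonneg[OF \<xi>] be_le[OF \<xi>] \<kappa> l(1) l(2) sd _ _ _ _ _ \<sigma>])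
  show "bt' \<xi> r > 0" for r using bt'_ge[OF \<xi>, of r] \<xi> by linarith
  show "weak_eq (%x. bt \<xi> (u x)) (%x. (eta \<xi> x * (b_eps b \<rho> \<xi> (u x) * u x)) *\<^sub>R D x) g"
   using eq unfolding drift_term_def[abs_def] g_def[abs_def] .
  show "continuous_on UNIV (%r. ramp' (r - \<kappa>))"
   by (rule continuous_on_compose2[OF ramp'_cont]) (auto intro: continuous_intros)
 qed (use ramp_nonpos ramp'_bounds in \<open>auto simp: s_def\<close>)
 have suL: "(%x. s (\<sigma> * u x)) \<in> L2"
 proof (rule L2_dominated[OF u])
  have "\<bar>ramp' (r - \<kappa>)\<bar> \<le> 2" for r using ramp'_bounds[of "r - \<kappa>"] by simp
  from lipschitz_of_deriv[OF sd this, of _ 0] have "\<bar>s r\<bar> \<le> 2 * \<bar>r\<bar>" for r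
   using \<kappa> by (simp add: s_def ramp_nonpos)
  from this[of "\<sigma> * u _"] show "AE x. \<bar>s (\<sigma> * u x)\<bar> \<le> 2 * \<bar>u x\<bar>" using \<sigma> by (auto simp: abs_mult)
 qed (simp add: s_def)
 have i1: "\<L> (%x. \<sigma> * g x * s (\<sigma> * u x))" using L2_mult[OF L2_cmult[OF gL] suL] by simp
 have i2: "\<L> (%x. \<sigma> * u x * s (\<sigma> * u x))" using L2_mult[OF L2_cmult[OF u] suL] by simp
 have i3: "\<L> (%x. ?d x * s (\<sigma> * u x))"
  using L2_mult[OF L2_diff[OF L2_cmult[OF f, of \<sigma>] L2_cmult[OF L2_cmult[OF u, of \<sigma>], of "1 - lam * m0 * b0"]] suL] by simp
 have "lam * I = (\<integral>x. lam * (\<sigma> * g x * s (\<sigma> * u x)) + lam * (m0 * b0) * (\<sigma> * u x * s (\<sigma> * u x)))"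
  using i1 i2 by (simp add: I_def distrib_left mult.assoc)
 also have "\<dots> \<le> (\<integral>x. ?d x * s (\<sigma> * u x))"
 proof (rule integral_mono)
  fix x
  have "0 \<le> (\<sigma> * bt \<xi> (u x)) * s (\<sigma> * u x)"
  proof (cases "\<sigma> * u x \<le> \<kappa>")
   case False
   then have p: "\<sigma> * u x > 0" using \<kappa> by linarith
   have "\<sigma> * bt \<xi> (u x) \<ge> 0" using bt_sgn[OF \<xi>, of "u x"] p \<sigma> by (auto simp: zero_le_mult_iff)
   then show ?thesis using ramp_bounds by (simp add: s_def)
  qed (simp add: s_def ramp_nonpos)
  then have "0 \<le> lam * \<xi> * ((\<sigma> * bt \<xi> (u x)) * s (\<sigma> * u x))" using lam \<xi> by simp
  moreover have "lam * (\<sigma> * g x * s (\<sigma> * u x)) + lam * (m0 * b0) * (\<sigma> * u x * s (\<sigma> * u x)) =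
   (?d x) * s (\<sigma> * u x) - lam * \<xi> * ((\<sigma> * bt \<xi> (u x)) * s (\<sigma> * u x))"
   using lam by (simp add: g_def field_simps)
  ultimately show "lam * (\<sigma> * g x * s (\<sigma> * u x)) + lam * (m0 * b0) * (\<sigma> * u x * s (\<sigma> * u x)) \<le>
   (?d x) * s (\<sigma> * u x)" by linarith
 qed (use i1 i2 i3 in auto)
 finally have "I \<le> (\<integral>x. ?d x * s (\<sigma> * u x)) / lam" (is "_ \<le> ?Z / lam")
  using lam by (simp add: pos_le_divide_eq mult.commute)
 then have "(norm w)^2 * (2 / l * I) \<le> (norm w)^2 * (2 / l * (?Z / lam))" using l by (intro mult_left_mono) auto
 with tr show ?thesis by (simp add: s_def)
qed

text \<open>Only the sign survives: the left side of the translation bound is a square, so the crude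
  slope bound \<xi> and any unit vector suffice.\<close>

lemma approx_level_inequality:
 assumes "u \<in> L2" "f \<in> L2" "lam > 0" "\<kappa> > 0" "\<sigma> = 1 \<or> \<sigma> = -1"
  and "weak_eq (%x. bt \<xi> (u x)) (drift_term u) (%x. (f x - u x) / lam - \<xi> * bt \<xi> (u x))"
 shows "0 \<le> (\<integral>x. (\<sigma> * f x - (1 - lam * m0 * b0) * (\<sigma> * u x)) * ramp (\<sigma> * u x - \<kappa>))" (is "0 \<le> ?Z")
proof -
 obtain w :: 'a where w: "w \<in> Basis" using nonempty_Basis by blast
 have "0 \<le> (norm w)^2 * (2 / (\<xi> * lam) * ?Z)"
  by (rule order_trans[OF _ approx_level_translation[OF assms(1-5) \<xi>(1) bt'_ge[OF \<xi>] assms(6)]]) simp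
 moreover have "2 / (\<xi> * lam) > 0" using \<xi> assms(3) by simp
 ultimately show ?thesis unfolding norm_Basis[OF w] power_one mult_1 by (simp only: zero_le_mult_iff) linarith
qed

end

end

section \<open>The approximate resolvents\<close>


definition truncate :: "('a => real) => nat => 'a => real" where
 "truncate f n x = max (- real n) (min (real n) (f x))"

lemma truncate_abs_le: "\<bar>truncate f n x\<bar> \<le> \<bar>f x\<bar>" "\<bar>truncate f n x\<bar> \<le> real n"
 by (auto simp: truncate_def)

lemma truncate_measurable[measurable (raw)]: "f \<in> borel_measurable M ==> truncate f n \<in> borel_measurable M"
 unfolding truncate_def[abs_def] by (intro borel_measurable_max borel_measurable_min borel_measurable_const)

lemma truncate_mem: assumes "f \<in> L1" shows "truncate f n \<in> L1 \<inter> (Linf :: ('a::euclidean_space => real) set)"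
proof -
 have f: "\<L> f" using assms by (simp add: L1_def)
 then have [measurable]: "f \<in> \<M>" by auto
 have "\<L> (truncate f n)"
  by (rule integrable_squeeze[of "%x. \<bar>f x\<bar>"]) (use f truncate_abs_le(1)[of f n] in auto)
 moreover have "truncate f n \<in> Linf"
  unfolding Linf_iff using truncate_abs_le(2)[of f n] by (intro conjI exI[of _ "real n"]) auto
 ultimately show ?thesis by (simp add: L1_def)
qed

lemma truncate_tendsto: "(%n. truncate f n x) ----> f x"
proof (rule tendsto_eventually)
 obtain N where "\<bar>f x\<bar> \<le> real N" using real_arch_simple by blast
 then show "\<forall>\<^sub>F n in sequentially. truncate f n x = f x"
  by (intro eventually_sequentiallyI[of N]) (auto simp: truncate_def)
qed

lemma truncate_L1_lim: assumes "f \<in> L1" shows "(%n. \<integral>x. \<bar>truncate f n x - f (x::'a::euclidean_space)\<bar>) ----> 0"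
proof (rule dominated_convergence_L1(2)[where k="%_ x. \<bar>f x\<bar>" and k'="%x. \<bar>f x\<bar>"])
 have f: "\<L> f" using assms by (simp add: L1_def)
 then have [measurable]: "f \<in> \<M>" by auto
 show "truncate f n \<in> \<M>" "f \<in> \<M>" for n by measurable
qed (use assms truncate_abs_le(1)[of f] truncate_tendsto[of f] in \<open>auto simp: L1_def\<close>)

lemma Linf_bound: assumes "f \<in> Linf" obtains M where "M > 0" "AE x. \<bar>f x\<bar> \<le> (M::real)"
proof -
 have "\<exists>M. AE x. \<bar>f x\<bar> \<le> M" using assms unfolding Linf_iff by (elim conjE)
 then obtain M where "AE x. \<bar>f x\<bar> \<le> M" ..
 then have "AE x. \<bar>f x\<bar> \<le> \<bar>M\<bar> + 1" by eventually_elim simp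
 then show thesis by (intro that[of "\<bar>M\<bar> + 1"]) auto
qed

locale fpe_resolvents = fpe \<beta> b \<rho> a \<alpha> D divD \<eta>
 for \<beta> b \<rho> :: "real => real" and a \<alpha> :: real and D :: "'a::euclidean_space => 'a" and divD :: "'a => real"
  and \<eta> :: "real => 'a => real" +
 fixes U :: "real => real => ('a => real) => 'a => real" and e :: "nat => real"
  and J :: "real => ('a => real) => 'a => real"
 assumes U: "approx_resolvents \<beta> D b \<eta> \<rho> U" and J: "limit_resolvents U e J"
begin

text \<open>Keeps 1 - lam m0 b0 at least 1/2. The steps t/n of the implicit scheme are eventually of
  this kind.\<close>

definition small :: "real => bool" where "small lam \<longleftrightarrow> lam > 0 \<and> lam * m0 * b0 \<le> 1 / 2"

text \<open>The resolvent identity with truncated right-hand sides \<open>Gn n\<close>: testing the equation for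
 \<open>U \<xi> l1 (Gn n)\<close> above the level \<open>3 M\<close> and letting \<open>n \<rightarrow> \<infinity>\<close> bounds \<open>U \<xi> lam f\<close> for every small \<open>lam\<close>,
 although it is only known to be integrable.\<close>

lemma U_props:
 assumes \<xi>: "0 < \<xi>" "\<xi> < 1" and lam: "small lam" and f: "f \<in> L1" and M: "M > 0" "AE x. \<bar>f x\<bar> \<le> M"
 shows "U \<xi> lam f \<in> L1" "AE x. \<bar>U \<xi> lam f x\<bar> \<le> 3 * M"
  "weak_eq (%x. bt \<xi> (U \<xi> lam f x)) (drift_term \<xi> (U \<xi> lam f)) (%x. (f x - U \<xi> lam f x) / lam - \<xi> * bt \<xi> (U \<xi> lam f x))"
proof -
 have lam0: "lam > 0" and lamc: "lam * m0 * b0 \<le> 1 / 2" using lam by (auto simp: small_def)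
 obtain l0 where l0: "l0 > 0"
  "!!l f. l \<in> {0<..<l0} ==> f \<in> L1 \<inter> L2 ==> approx_solution \<beta> D b \<eta> \<rho> \<xi> l f (U \<xi> l f)"
  "!!l. l \<in> {0<..<l0} ==> L1_extension_from (L1 \<inter> L2) (U \<xi> l)"
  "!!l1 l2 f. l1 \<in> {0<..<l0} ==> l2 > 0 ==> f \<in> L1 ==> U \<xi> l2 f \<in> L1"
  "!!l1 l2 f. l1 \<in> {0<..<l0} ==> l2 > 0 ==> f \<in> L1 ==> (AE x. U \<xi> l2 f x =
      U \<xi> l1 (%y. l1 / l2 * f y + (1 - l1 / l2) * U \<xi> l2 f y) x)"
 proof -
  have "\<xi> \<in> {0<..<1}" using \<xi> by simp
  from bspec[OF U[unfolded approx_resolvents_def] this] show thesis using that by blast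
 qed
 \<comment> \<open>Below l0 the approximate problem is solved directly, and below lam the resolvent
   identity has weights \<theta> and 1 - \<theta> in (0, 1).\<close>
 define l1 where "l1 = min (l0 / 2) (lam / 2)"
 have l1: "l1 \<in> {0<..<l0}" "l1 < lam" "l1 > 0" using l0(1) lam0 by (auto simp: l1_def)
 define \<theta> where "\<theta> = l1 / lam"
 have \<theta>: "0 < \<theta>" "\<theta> < 1" using l1 lam0 by (auto simp: \<theta>_def)
 define u where "u = U \<xi> lam f"
 show uL1: "U \<xi> lam f \<in> L1" by (rule l0(4)[OF l1(1) lam0 f])
 then have ui: "\<L> u" and fi: "\<L> f" using f by (auto simp: u_def L1_def)
 then have [measurable]: "u \<in> \<M>" "f \<in> \<M>" by auto
 define G where "G y = \<theta> * f y + (1 - \<theta>) * u y" for y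
 have Gi: "\<L> G" unfolding G_def[abs_def] using ui fi by auto
 have uG: "AE x. u x = U \<xi> l1 G x"
  using l0(5)[OF l1(1) lam0 f] by (simp add: G_def[abs_def] u_def \<theta>_def)
 have uL: "u \<in> L1" using uL1 by (simp add: u_def)
 define Gn where "Gn n y = \<theta> * f y + (1 - \<theta>) * truncate u n y" for n y
 have T: "truncate u n \<in> L1" "truncate u n \<in> Linf" for n using truncate_mem[OF uL, of n] by auto
 then have Ti: "\<L> (truncate u n)" for n by (simp add: L1_def)
 have fLinf: "f \<in> Linf" unfolding Linf_iff using M(2) by auto
 have f2: "f \<in> L2" and T2: "truncate u n \<in> L2" for n using L1_Linf_L2 f fLinf T by blast+
 have Gn: "Gn n \<in> L1 \<inter> L2" for n
  unfolding Gn_def[abs_def] using fi Ti L2_add[OF L2_cmult[OF f2] L2_cmult[OF T2]] by (auto simp: L1_def)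
 have "Gn n x - G x = (1 - \<theta>) * (truncate u n x - u x)" for n x by (simp add: Gn_def G_def algebra_simps)
 then have Glim: "(%n. \<integral>x. \<bar>Gn n x - G x\<bar>) ----> 0"
  using tendsto_mult_right_zero[OF truncate_L1_lim[OF uL], of "1 - \<theta>"] \<theta> by (simp add: abs_mult)
 define un where "un n = U \<xi> l1 (Gn n)" for n
 have sol: "approx_solution \<beta> D b \<eta> \<rho> \<xi> l1 (Gn n) (un n)" for n
  unfolding un_def by (rule l0(2)[OF l1(1) Gn])
 have G2: "Gn n \<in> L2" for n using Gn by blast
 note un_eq = approx_solution_weak_eq[OF \<xi> sol l1(3) G2]
 have uni: "\<L> (un n)" for n
  using l0(3)[OF l1(1)] Gn unfolding un_def L1_extension_from_def by (auto simp: L1_def)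
 have [measurable]: "un n \<in> \<M>" "Gn n \<in> \<M>" "G \<in> \<M>" for n
  using uni G2 Gi L2_measurable by auto
 have "L1_lim un (U \<xi> l1 G)"
 proof -
  have "G \<in> L1" "L1_lim Gn G" using Gi Glim by (auto simp: L1_def L1_lim_def L1_norm_def)
  then show ?thesis using l0(3)[OF l1(1)] Gn unfolding L1_extension_from_def un_def by blast
 qed
 moreover have "U \<xi> l1 G \<in> L1" using l0(3)[OF l1(1)] Gi unfolding L1_extension_from_def L1_def by blast
 then have [measurable]: "U \<xi> l1 G \<in> \<M>" by (auto simp: L1_def)
 have "(\<integral>x. \<bar>un n x - u x\<bar>) = (\<integral>x. \<bar>un n x - U \<xi> l1 G x\<bar>)" for n
  by (rule integral_cong_AE) (use uG in auto)
 ultimately have ulim: "(%n. \<integral>x. \<bar>un n x - u x\<bar>) ----> 0"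
  by (simp add: L1_lim_def L1_norm_def)
 obtain r where r: "strict_mono r" and ae: "AE x. (%n. un (r n) x) ----> u x"
  using L1_lim_AE_subseq[OF uni ui ulim] by blast
 define c where "c = lam * m0 * b0"
 have c: "0 \<le> c" "c \<le> 1 / 2" using lamc lam0 m0_nonneg b0_nonneg by (auto simp: c_def)
 have c1: "l1 * m0 * b0 = \<theta> * c" using lam0 by (simp add: \<theta>_def c_def)
 note [measurable] = borel_measurable_continuous_onI[OF ramp_cont]
 have bound: "AE x. \<sigma> * u x \<le> 3 * M" if \<sigma>: "\<sigma> = 1 \<or> \<sigma> = -1" for \<sigma> :: real
 proof -
  define w where "w n x = \<sigma> * Gn n x - (1 - \<theta> * c) * (\<sigma> * un n x)" for n x
  define w' where "w' x = \<sigma> * G x - (1 - \<theta> * c) * (\<sigma> * u x)" for x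
  define s where "s r = ramp (r - 3 * M)" for r
  let ?d = "%x. \<sigma> * f x - (1 - c) * (\<sigma> * u x)"
  have [measurable]: "s \<in> \<M>" unfolding s_def by measurable
  have s_cont: "continuous_on UNIV s" unfolding s_def
   by (rule continuous_on_compose2[OF ramp_cont]) (auto intro: continuous_intros)
  have Gni: "\<L> (Gn n)" for n using Gn by (auto simp: L1_def)
  have "(%n. \<integral>x. \<bar>w n x - w' x\<bar>) ----> 0"
   using L1_tendsto_lincomb[OF Gni uni Gi ui Glim ulim, of \<sigma> "- ((1 - \<theta> * c) * \<sigma>)"] by (simp add: w_def w'_def mult_ac)
  from L1_tendsto_integral(2)[OF _ _ this]
  have wlim: "(%n. \<integral>x. \<bar>w n x\<bar>) ----> (\<integral>x. \<bar>w' x\<bar>)"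
   using Gni Gi uni ui by (simp add: w_def[abs_def] w'_def[abs_def])
  have wae: "AE x. (%n. w (r n) x) ----> w' x"
   using ae unfolding w_def w'_def Gn_def G_def
   by eventually_elim (intro tendsto_intros LIMSEQ_subseq_LIMSEQ[OF truncate_tendsto r, unfolded o_def])
  have lim: "(%n. \<integral>x. w (r n) x * s (\<sigma> * un (r n) x)) ----> (\<integral>x. w' x * s (\<sigma> * u x))"
  proof (rule dominated_convergence_L1(3)[where k="%n x. \<bar>w (r n) x\<bar>" and k'="%x. \<bar>w' x\<bar>"])
   show "AE x. (%n. w (r n) x * s (\<sigma> * un (r n) x)) ----> w' x * s (\<sigma> * u x)"
    using ae wae by eventually_elim (intro tendsto_mult continuous_on_tendsto_compose[OF s_cont] tendsto_intros; simp)
   show "AE x. (%n. \<bar>w (r n) x\<bar>) ----> \<bar>w' x\<bar>" using wae by eventually_elim (rule tendsto_rabs)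
   show "AE x. \<bar>w (r n) x * s (\<sigma> * un (r n) x)\<bar> \<le> \<bar>w (r n) x\<bar>" for n
    using ramp_bounds by (simp add: abs_mult s_def mult_left_le)
   show "(%n. \<integral>x. \<bar>w (r n) x\<bar>) ----> (\<integral>x. \<bar>w' x\<bar>)"
    using LIMSEQ_subseq_LIMSEQ[OF wlim r] by (simp add: o_def)
   show "(%x. w (r n) x * s (\<sigma> * un (r n) x)) \<in> \<M>" "(%x. w' x * s (\<sigma> * u x)) \<in> \<M>" for n
    unfolding w_def w'_def by measurable
  qed (use Gni Gi uni ui in \<open>auto simp: w_def w'_def\<close>)
  have nn: "0 \<le> (\<integral>x. w n x * s (\<sigma> * un n x))" for n
   using approx_level_inequality[OF \<xi> un_eq(1) G2 l1(3) _ \<sigma> un_eq(2), of "3 * M" n] M(1)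
   unfolding w_def s_def c1 by simp
  have "0 \<le> (\<integral>x. w' x * s (\<sigma> * u x))"
   by (rule LIMSEQ_le_const[OF lim]) (use nn in auto)
  moreover have w'_eq: "w' x = \<theta> * ?d x" for x by (simp add: w'_def G_def algebra_simps)
  ultimately have nn': "0 \<le> (\<integral>x. ?d x * s (\<sigma> * u x))"
   using \<theta> by (simp add: mult.assoc zero_le_mult_iff)
  \<comment> \<open>Where \<sigma>u exceeds 3M the first factor is at most M - 3M/2 < 0, because 1 -
    c >= 1/2, while the profile is positive. The integral being nonnegative, this set must be
    null.\<close>
  have neg: "AE x. ?d x * s (\<sigma> * u x) \<le> 0 \<and>
    (?d x * s (\<sigma> * u x) = 0 \<longrightarrow> \<sigma> * u x \<le> 3 * M)"
   using M(2)
  proof eventually_elim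
   case (elim x)
   show ?case
   proof (cases "\<sigma> * u x \<le> 3 * M")
    case False
    have "\<sigma> * f x \<le> M" using elim \<sigma> by auto
    moreover have "(1 / 2) * (\<sigma> * u x) \<le> (1 - c) * (\<sigma> * u x)"
     by (rule mult_right_mono) (use False c M(1) in auto)
    ultimately have n: "\<sigma> * f x - (1 - c) * (\<sigma> * u x) < 0" using M(1) False by linarith
    have "s (\<sigma> * u x) > 0" using False by (simp add: s_def ramp_pos)
    with n have "?d x * s (\<sigma> * u x) < 0" by (rule mult_neg_pos)
    then show ?thesis by (intro conjI impI) linarith+
   qed (simp add: s_def ramp_nonpos)
  qed
  have int: "\<L> (%x. - (?d x * s (\<sigma> * u x)))"
   by (rule integrable_squeeze[of "%x. \<bar>\<sigma> * f x - (1 - c) * (\<sigma> * u x)\<bar>"])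
    (use fi ui ramp_bounds in \<open>auto simp: abs_mult s_def intro!: mult_left_le\<close>)
  have "(\<integral>x. - (?d x * s (\<sigma> * u x))) = 0"
  proof (rule antisym)
   show "(\<integral>x. - (?d x * s (\<sigma> * u x))) \<le> 0" using nn' by simp
   show "0 \<le> (\<integral>x. - (?d x * s (\<sigma> * u x)))"
    by (rule integral_nonneg_AE) (use neg in eventually_elim, simp)
  qed
  moreover have "AE x. 0 \<le> - (?d x * s (\<sigma> * u x))"
   using neg by eventually_elim simp
  ultimately have "AE x. - (?d x * s (\<sigma> * u x)) = 0"
   using integral_nonneg_eq_0_iff_AE[OF int] by blast
  then show ?thesis using neg by eventually_elim simp
 qed
 have "AE x. 1 * u x \<le> 3 * M" "AE x. -1 * u x \<le> 3 * M"
  by (rule bound, simp)+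
 then have ub: "AE x. \<bar>u x\<bar> \<le> 3 * M"
  by eventually_elim (simp add: abs_le_iff)
 then show "AE x. \<bar>U \<xi> lam f x\<bar> \<le> 3 * M" by (simp add: u_def)
 have u2: "u \<in> L2" by (rule L1_Linf_L2) (use ui ub in \<open>auto simp: L1_def Linf_iff\<close>)
 \<comment> \<open>Once u is bounded, G lies in L^2, so U \<xi> l1 G solves the equation with step
   l1; since G - u = \<theta> (f - u), dividing by l1 gives the equation with step lam.\<close>
 have G2': "G \<in> L1 \<inter> L2" unfolding G_def[abs_def]
  using fi ui L2_add[OF L2_cmult[OF f2] L2_cmult[OF u2]] by (auto simp: L1_def)
 then have G22: "G \<in> L2" by blast
 note eqG = approx_solution_weak_eq[OF \<xi> l0(2)[OF l1(1) G2'] l1(3) G22]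
 note [measurable] = bt_measurable[OF \<xi>]
 have "weak_eq (%x. bt \<xi> (u x)) (drift_term \<xi> u) (%x. (f x - u x) / lam - \<xi> * bt \<xi> (u x))"
 proof (rule weak_eq_cong_AE[OF eqG(2)])
  show "AE x. bt \<xi> (U \<xi> l1 G x) = bt \<xi> (u x)" using uG by eventually_elim simp
  show "AE x. drift_term \<xi> (U \<xi> l1 G) x = drift_term \<xi> u x"
   using uG by eventually_elim (simp add: drift_term_def[OF \<xi>])
  show "AE x. (G x - U \<xi> l1 G x) / l1 - \<xi> * bt \<xi> (U \<xi> l1 G x) = (f x - u x) / lam - \<xi> * bt \<xi> (u x)"
   using uG
  proof eventually_elim
   case (elim x)
   have "G x - u x = \<theta> * (f x - u x)" by (simp add: G_def algebra_simps)
   then have "(G x - u x) / l1 = (f x - u x) / lam" using l1 lam0 by (simp add: \<theta>_def)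
   then show ?case using elim by simp
  qed
 qed (use drift_term_measurable[OF \<xi>] in measurable)
 then show "weak_eq (%x. bt \<xi> (U \<xi> lam f x)) (drift_term \<xi> (U \<xi> lam f)) (%x. (f x - U \<xi> lam f x) / lam - \<xi> * bt \<xi> (U \<xi> lam f x))"
  by (simp add: u_def)
qed

text \<open>\<open>weighted_contraction\<close> for the difference z of the diffusive terms. By
  strict monotonicity sgn z = sgn(u1 - u2), so the zero-order part of the right side contributes |f1
  - f2| - |u1 - u2| at most. The function q dominates the gradient of the weight and collects the
  drift.\<close>

lemma U_weighted_contraction:
 fixes \<psi> q :: "'a => real" and \<psi>1 \<psi>2 :: "'a => 'a => real"
 assumes \<xi>: "0 < \<xi>" "\<xi> < 1" and lam: "small lam" and f: "f1 \<in> L1 \<inter> Linf" "f2 \<in> L1 \<inter> Linf"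
  and \<psi>: "!!x. 0 \<le> \<psi> x" "!!x. \<psi> x \<le> P" "!!i x. i \<in> Basis ==> \<bar>\<psi>1 i x\<bar> \<le> P" "!!i x. i \<in> Basis ==> \<bar>\<psi>2 i x\<bar> \<le> P"
   "!!i. i \<in> Basis ==> has_dderiv \<psi> i (\<psi>1 i)" "!!i. i \<in> Basis ==> has_dderiv (\<psi>1 i) i (\<psi>2 i)"
  and \<psi>m[measurable]: "\<psi> \<in> \<M>" "!!i. i \<in> Basis ==> \<psi>1 i \<in> \<M>"
    "!!i. i \<in> Basis ==> \<psi>2 i \<in> \<M>" "q \<in> \<M>"
  and q: "!!x y. \<bar>\<Sum>i\<in>Basis. (y \<bullet> i) * \<psi>1 i x\<bar> \<le> norm y * q x" "!!x. 0 \<le> q x" "!!x. q x \<le> P"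
 defines "u1 \<equiv> U \<xi> lam f1" and "u2 \<equiv> U \<xi> lam f2"
 shows "(\<integral>x. \<bar>u1 x - u2 x\<bar> * \<psi> x) + lam * (\<integral>x. \<bar>bt \<xi> (u1 x) - bt \<xi> (u2 x)\<bar> * (- (\<Sum>i\<in>Basis. \<psi>2 i x))) \<le>
  (\<integral>x. \<bar>f1 x - f2 x\<bar> * \<psi> x) + lam * m0 * (\<integral>x. \<bar>b_eps b \<rho> \<xi> (u1 x) * u1 x - b_eps b \<rho> \<xi> (u2 x) * u2 x\<bar> * q x)"
proof -
 have lam0: "lam > 0" using lam by (auto simp: small_def)
 obtain M1 where M1: "M1 > 0" "AE x. \<bar>f1 x\<bar> \<le> M1" using f(1) Linf_bound by blast
 obtain M2 where M2: "M2 > 0" "AE x. \<bar>f2 x\<bar> \<le> M2" using f(2) Linf_bound by blast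
 have fL: "f1 \<in> L1" "f2 \<in> L1" using f by auto
 note p1 = U_props[OF \<xi> lam fL(1) M1, folded u1_def] and p2 = U_props[OF \<xi> lam fL(2) M2, folded u2_def]
 have ui: "\<L> u1" "\<L> u2" and fi: "\<L> f1" "\<L> f2"
  using p1(1) p2(1) fL by (auto simp: L1_def)
 then have [measurable]: "u1 \<in> \<M>" "u2 \<in> \<M>" "f1 \<in> \<M>" "f2 \<in> \<M>"
  by auto
 have uLinf: "u1 \<in> Linf" "u2 \<in> Linf" unfolding Linf_iff using p1(2) p2(2) by auto
 have u: "u1 \<in> L2" "u2 \<in> L2" using L1_Linf_L2 p1(1) p2(1) uLinf by auto
 have f2: "f1 \<in> L2" "f2 \<in> L2" using L1_Linf_L2 f by auto
 note [measurable] = bt_measurable[OF \<xi>] be_measurable[OF \<xi>]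
 define z where "z x = bt \<xi> (u1 x) - bt \<xi> (u2 x)" for x
 define g where "g x = ((f1 x - u1 x) / lam - \<xi> * bt \<xi> (u1 x)) - ((f2 x - u2 x) / lam - \<xi> * bt \<xi> (u2 x))" for x
 define F where "F x = drift_term \<xi> u1 x - drift_term \<xi> u2 x" for x
 define B where "B x = b_eps b \<rho> \<xi> (u1 x) * u1 x - b_eps b \<rho> \<xi> (u2 x) * u2 x" for x
 let ?I = "(\<integral>x. \<bar>f1 x - f2 x\<bar> * \<psi> x) - (\<integral>x. \<bar>u1 x - u2 x\<bar> * \<psi> x)"
 let ?q = "%x. \<bar>f1 x - f2 x\<bar> * \<psi> x - \<bar>u1 x - u2 x\<bar> * \<psi> x"
 let ?Z = "\<integral>x. \<bar>z x\<bar> * (- (\<Sum>i\<in>Basis. \<psi>2 i x))"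
 let ?e = "%x. \<bar>f1 x - f2 x\<bar> - \<bar>u1 x - u2 x\<bar>"
 let ?FQ = "\<integral>x. \<bar>\<Sum>i\<in>Basis. (F x \<bullet> i) * \<psi>1 i x\<bar>"
 have [measurable]: "B \<in> \<M>" unfolding B_def[abs_def] by measurable
 obtain C where C: "C \<ge> 0" "!!x y. \<bar>b_eps b \<rho> \<xi> x * x - b_eps b \<rho> \<xi> y * y\<bar> \<le> C * \<bar>x - y\<bar>"
  using be_mult_lip[OF \<xi>] by blast
 have F_eq: "F x = (eta \<xi> x * B x) *\<^sub>R D x" for x
  by (simp add: F_def B_def drift_term_def[OF \<xi>] algebra_simps)
 have vi: "\<L> (%x. bt \<xi> (u1 x))" "\<L> (%x. bt \<xi> (u2 x))"
  by (rule integrable_squeeze[of "%x. (1 / \<xi> + \<xi>) * \<bar>u1 x\<bar>"] integrable_squeeze[of "%x. (1 / \<xi> + \<xi>) * \<bar>u2 x\<bar>"],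
    use ui bt_lip[OF \<xi>] in auto)+
 have Bi: "\<L> B"
  by (rule integrable_squeeze[of "%x. C * \<bar>u1 x - u2 x\<bar>"]) (use ui C in \<open>auto simp: B_def\<close>)
 have gL: "(%x. (f1 x - u1 x) / lam - \<xi> * bt \<xi> (u1 x)) \<in> L2" "(%x. (f2 x - u2 x) / lam - \<xi> * bt \<xi> (u2 x)) \<in> L2"
  using L2_diff[OF L2_cmult[OF L2_diff[OF f2(1) u(1)], of "1 / lam"] L2_cmult[OF bt_L2[OF \<xi> u(1)], of \<xi>]]
   L2_diff[OF L2_cmult[OF L2_diff[OF f2(2) u(2)], of "1 / lam"] L2_cmult[OF bt_L2[OF \<xi> u(2)], of \<xi>]] by simp_all
 have eq: "weak_eq z F g"
  unfolding z_def[abs_def] F_def[abs_def] g_def[abs_def]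
  by (rule weak_eq_diff[OF p1(3) p2(3)]) (use bt_L2[OF \<xi>] u gL drift_term_L2[OF \<xi>] L2_L1_loc in auto)
 have zL: "z \<in> L2" "\<L> z" unfolding z_def[abs_def]
  using L2_diff[OF bt_L2[OF \<xi> u(1)] bt_L2[OF \<xi> u(2)]] Bochner_Integration.integrable_diff[OF vi] by blast+
 have gL': "g \<in> L2" "\<L> g" unfolding g_def[abs_def]
  using L2_diff[OF gL] by blast (use fi ui vi in auto)
 have FL: "(%x. F x \<bullet> i) \<in> L2" if "i \<in> Basis" for i
  unfolding F_def[abs_def] inner_diff_left
  by (rule L2_diff[OF drift_term_L2[OF \<xi> u(1) that] drift_term_L2[OF \<xi> u(2) that]])
 have normF: "AE x. norm (F x) \<le> m0 * \<bar>B x\<bar>"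
  using m0
 proof eventually_elim
  case (elim x)
  have "norm (F x) = \<bar>B x\<bar> * (eta \<xi> x * norm (D x))" using eta_bounds[OF \<xi>, of x] by (simp add: F_eq abs_mult)
  also have "\<dots> \<le> \<bar>B x\<bar> * (1 * m0)" using elim eta_bounds[OF \<xi>, of x] by (intro mult_left_mono mult_mono) auto
  finally show ?case by (simp add: mult.commute)
 qed
 have Fi: "\<L> (%x. F x \<bullet> i)" if i: "i \<in> Basis" for i
 proof (rule integrable_squeeze[of "%x. m0 * \<bar>B x\<bar>"])
  show "AE x. \<bar>F x \<bullet> i\<bar> \<le> m0 * \<bar>B x\<bar>"
   using normF by eventually_elim (use Basis_le_norm[OF i] order_trans in blast)
 qed (use Bi FL[OF i, THEN L2_measurable] in auto)
 have bm: "\<L> (%x. h x * \<psi> x)" if "\<L> h" for h :: "'a => real"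
  by (rule integrable_squeeze[of "%x. P * \<bar>h x\<bar>"])
   (use that \<psi> in \<open>auto simp: abs_mult mult.commute[of P] mult_left_mono\<close>)
 have "?Z \<le>
  (\<integral>x. g x * sgn (z x) * \<psi> x) + ?FQ"
 proof (rule weighted_contraction[OF \<rho> eq zL gL' FL Fi _ norm_D_eps_L2[OF \<xi>] \<psi> \<psi>m(1-3)])
  show "AE x. norm (F x) \<le> C / \<xi> * \<bar>eta \<xi> x * norm (D x)\<bar> * \<bar>z x\<bar>"
  proof (intro AE_I2)
   fix x
   have "\<bar>B x\<bar> \<le> C * \<bar>u1 x - u2 x\<bar>" using C(2) by (simp add: B_def)
   also have "\<dots> \<le> C * (\<bar>z x\<bar> / \<xi>)" unfolding z_def by (rule mult_left_mono[OF bt_inverse_lip[OF \<xi>] C(1)])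
   finally have "\<bar>B x\<bar> * (eta \<xi> x * norm (D x)) \<le> C * (\<bar>z x\<bar> / \<xi>) * (eta \<xi> x * norm (D x))"
    using eta_bounds[OF \<xi>, of x] by (intro mult_right_mono) auto
   then show "norm (F x) \<le> C / \<xi> * \<bar>eta \<xi> x * norm (D x)\<bar> * \<bar>z x\<bar>"
    using eta_bounds[OF \<xi>, of x] by (simp add: F_eq abs_mult mult_ac)
  qed
 qed
 also have "(\<integral>x. g x * sgn (z x) * \<psi> x) \<le> (\<integral>x. ?q x / lam)"
 proof (rule integral_mono)
  have "\<L> (%x. g x * sgn (z x))"
   by (rule integrable_squeeze[of "%x. \<bar>g x\<bar>"])
    (use gL' zL L2_measurable in \<open>auto simp: abs_mult sgn_real_def\<close>)
  then show "\<L> (%x. g x * sgn (z x) * \<psi> x)" by (rule bm)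
  show "\<L> (%x. ?q x / lam)"
   using bm[of "%x. \<bar>f1 x - f2 x\<bar>"] bm[of "%x. \<bar>u1 x - u2 x\<bar>"] fi ui by auto
  fix x
  have sg: "sgn (z x) = sgn (u1 x - u2 x)"
   using strict_mono_less[OF nonlinearity.\<Phi>_mono[OF bt_nonlinearity[OF \<xi>]], of "u1 x" "u2 x"]
    strict_mono_less[OF nonlinearity.\<Phi>_mono[OF bt_nonlinearity[OF \<xi>]], of "u2 x" "u1 x"]
   by (auto simp: z_def sgn_real_def)
  have gx: "g x = ((f1 x - f2 x) - (u1 x - u2 x)) / lam - \<xi> * z x"
   using lam0 by (simp add: g_def z_def divide_inverse algebra_simps)
  have "g x * sgn (z x) = ((f1 x - f2 x) * sgn (u1 x - u2 x) - (u1 x - u2 x) * sgn (u1 x - u2 x)) / lam - \<xi> * (z x * sgn (z x))"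
   unfolding gx by (simp add: left_diff_distrib diff_divide_distrib sg mult.assoc)
  also have "\<dots> \<le> ?e x / lam"
  proof -
   have "\<xi> * (z x * sgn (z x)) \<ge> 0" using \<xi> by (simp add: sgn_real_def mult_nonneg_nonneg)
   moreover have "(f1 x - f2 x) * sgn (u1 x - u2 x) \<le> \<bar>f1 x - f2 x\<bar>" by (auto simp: sgn_real_def)
   moreover have "(u1 x - u2 x) * sgn (u1 x - u2 x) = \<bar>u1 x - u2 x\<bar>" by (auto simp: sgn_real_def)
   ultimately have "((f1 x - f2 x) * sgn (u1 x - u2 x) - (u1 x - u2 x) * sgn (u1 x - u2 x)) / lam \<le> ?e x / lam"
    using lam0 by (intro divide_right_mono) auto
   then show ?thesis using \<open>\<xi> * (z x * sgn (z x)) \<ge> 0\<close> by linarith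
  qed
  finally have "g x * sgn (z x) * \<psi> x \<le> ?e x / lam * \<psi> x"
   using \<psi>(1) by (intro mult_right_mono) auto
  then show "g x * sgn (z x) * \<psi> x \<le> ?q x / lam"
   by (simp add: field_simps)
 qed
 also have "\<dots> = ?I / lam"
  using bm[of "%x. \<bar>f1 x - f2 x\<bar>"] bm[of "%x. \<bar>u1 x - u2 x\<bar>"] fi ui by simp
 also have "?FQ \<le> (\<integral>x. m0 * (\<bar>B x\<bar> * q x))"
 proof (rule integral_mono_abs)
  have "\<L> (%x. \<bar>B x\<bar> * q x)"
   by (rule integrable_squeeze[of "%x. P * \<bar>B x\<bar>"])
    (use Bi q in \<open>auto simp: abs_mult mult.commute[of P] mult_left_mono\<close>)
  then show "\<L> (%x. m0 * (\<bar>B x\<bar> * q x))" by simp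
  show "AE x. \<bar>\<Sum>i\<in>Basis. (F x \<bullet> i) * \<psi>1 i x\<bar> \<le> m0 * (\<bar>B x\<bar> * q x)"
   using normF
  proof eventually_elim
   case (elim x)
   have "\<bar>\<Sum>i\<in>Basis. (F x \<bullet> i) * \<psi>1 i x\<bar> \<le> norm (F x) * q x" by (rule q(1))
   also have "\<dots> \<le> (m0 * \<bar>B x\<bar>) * q x" using elim q(2) by (intro mult_right_mono) auto
   finally show ?case by (simp add: mult.assoc)
  qed
  show "(%x. \<Sum>i\<in>Basis. (F x \<bullet> i) * \<psi>1 i x) \<in> \<M>"
   using FL[THEN L2_measurable] by (intro borel_measurable_sum borel_measurable_times) auto
 qed
 finally have "?Z \<le>
   ?I / lam + m0 * (\<integral>x. \<bar>B x\<bar> * q x)" by simp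
 then have "lam * ?Z \<le>
   lam * (?I / lam + m0 * (\<integral>x. \<bar>B x\<bar> * q x))"
  using lam0 by (intro mult_left_mono) auto
 then show ?thesis using lam0 by (simp add: z_def B_def distrib_left mult.assoc)
qed

lemma U_contraction:
 assumes "0 < \<xi>" "\<xi> < 1" "small lam" "f1 \<in> L1 \<inter> Linf" "f2 \<in> L1 \<inter> Linf"
 shows "(\<integral>x. \<bar>U \<xi> lam f1 x - U \<xi> lam f2 x\<bar>) \<le> (\<integral>x. \<bar>f1 x - f2 x\<bar>)"
 using U_weighted_contraction[OF assms, of "%_. 1" 1 "%_ _. 0" "%_ _. 0" "%_. 0"]
 by (simp add: has_dderiv_const)

text \<open>U applied to 0 is 0, being bounded by 3M for every M > 0; the contraction then compares
  with it.\<close>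

lemma U_L1_le:
 assumes "0 < \<xi>" "\<xi> < 1" "small lam" "f \<in> L1 \<inter> Linf"
 shows "(\<integral>x. \<bar>U \<xi> lam f x\<bar>) \<le> (\<integral>x. \<bar>f x\<bar>)"
proof -
 have z: "(%_. 0) \<in> L1 \<inter> (Linf :: ('a => real) set)" by (auto simp: L1_def Linf_iff)
 have "AE x. \<forall>n. \<bar>U \<xi> lam (%_. 0) x\<bar> \<le> 3 * inverse (real (Suc n))"
  unfolding AE_all_countable
 proof
  fix n show "AE x. \<bar>U \<xi> lam (%_. 0) x\<bar> \<le> 3 * inverse (real (Suc n))"
   by (rule U_props(2)[OF assms(1-3)]) (use z in auto)
 qed
 then have "AE x. U \<xi> lam (%_. 0) x = 0"
 proof eventually_elim
  case (elim x)
  have "\<bar>U \<xi> lam (%_. 0) x\<bar> \<le> 0"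
   by (rule LIMSEQ_le_const[OF tendsto_mult_right_zero[OF LIMSEQ_inverse_real_of_nat]]) (use elim in blast)
  then show ?case by simp
 qed
 moreover have "\<L> (U \<xi> lam (%_. 0))" "\<L> (U \<xi> lam f)"
 proof -
  obtain M where "M > 0" "AE x. \<bar>f x\<bar> \<le> M" using assms(4) Linf_bound by blast
  then show "\<L> (U \<xi> lam f)" using U_props(1)[OF assms(1-3), of f M] assms(4) by (auto simp: L1_def)
  show "\<L> (U \<xi> lam (%_. 0))" using U_props(1)[OF assms(1-3), of "%_. 0" 1] by (auto simp: L1_def)
 qed
 ultimately have "(\<integral>x. \<bar>U \<xi> lam f x\<bar>) = (\<integral>x. \<bar>U \<xi> lam f x - U \<xi> lam (%_. 0) x\<bar>)"
  by (intro integral_cong_AE) auto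
 also have "\<dots> \<le> (\<integral>x. \<bar>f x - 0\<bar>)" by (rule U_contraction[OF assms z])
 finally show ?thesis by simp
qed

end

section \<open>Convergence of the approximations\<close>


context fpe
begin

text \<open>For bounded arguments r - \<iota>(r) = \<xi> \<beta>(\<iota>(r)) is O(\<xi>), and
  |\<iota>(r)| <= |r| keeps \<beta> on a compact interval.\<close>

lemma bt_tendsto:
 assumes \<xi>: "!!n. 0 < \<xi> n" "!!n. \<xi> n < 1" "\<xi> ----> 0" and r: "r ----> r'" "!!n. \<bar>r n\<bar> \<le> M"
 shows "(%n. bt (\<xi> n) (r n)) ----> \<beta> r'"
proof -
 have "(%n. r n - \<iota> (\<xi> n) (r n)) ----> 0"
 proof (rule Lim_null_comparison)
  show "(%n. \<xi> n * (lip M * M)) ----> 0" using tendsto_mult_left_zero[OF \<xi>(3)] .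
  show "\<forall>\<^sub>F n in sequentially. norm (r n - \<iota> (\<xi> n) (r n)) \<le> \<xi> n * (lip M * M)"
  proof (intro always_eventually allI)
   fix n
   have b: "\<bar>\<iota> (\<xi> n) (r n)\<bar> \<le> M" using \<iota>_abs_le[OF \<xi>(1,2), of n "r n"] r(2)[of n] by linarith
   have "r n - \<iota> (\<xi> n) (r n) = \<xi> n * \<beta> (\<iota> (\<xi> n) (r n))" using \<iota>_eq[OF \<xi>(1,2), of n "r n"] by linarith
   moreover have "\<bar>\<beta> (\<iota> (\<xi> n) (r n))\<bar> \<le> lip M * M"
    using \<beta>_abs_le[OF b] mult_left_mono[OF b lip(1)[of M]] by linarith
   ultimately show "norm (r n - \<iota> (\<xi> n) (r n)) \<le> \<xi> n * (lip M * M)"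
    using \<xi>(1)[of n] by (simp add: abs_mult mult_left_mono)
  qed
 qed
 from tendsto_diff[OF r(1) this] have "(%n. \<iota> (\<xi> n) (r n)) ----> r'" by simp
 then have "(%n. \<beta> (\<iota> (\<xi> n) (r n))) ----> \<beta> r'"
  by (rule continuous_on_tendsto_compose[OF \<beta>.\<Phi>_cont[of UNIV]]) auto
 from tendsto_add[OF this tendsto_mult[OF \<xi>(3) r(1)]] show ?thesis
  by (simp add: bt_eq[OF \<xi>(1,2)])
qed

text \<open>The argument moves together with \<xi>; rescaling the mollification variable by \<xi>
  fixes the kernel and leaves a dominated convergence.\<close>

lemma be_tendsto:
 assumes \<xi>: "!!n. 0 < \<xi> n" "!!n. \<xi> n < 1" "\<xi> ----> 0" and r: "r ----> r'"
 shows "(%n. b_eps b \<rho> (\<xi> n) (r n)) ----> b r'"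
proof (cases "b constant_on UNIV")
 case True
 then obtain c where "!!r. b r = c" by (auto simp: constant_on_def)
 then show ?thesis using True be_alt[OF \<xi>(1,2)] by simp
next
 case False
 have [measurable]: "b \<in> \<M>" by (rule borel_measurable_continuous_onI[OF b_cont])
 have [measurable]: "\<rho> \<in> \<M>" by (rule mollifier_measurable[OF \<rho>, of 1]) simp
 have \<rho>1: "\<L> \<rho>" "(\<integral>t. \<rho> t) = 1" "!!t. \<rho> t \<ge> 0"
  using mollifier_integrable[OF \<rho>, of 1] \<rho> by (auto simp: standard_mollifier_def)
 have e: "conv b (kern \<rho> (\<xi> n)) (r n) = (\<integral>t. b (r n - \<xi> n * t) * \<rho> t)" for n
 proof -
  have "conv b (kern \<rho> (\<xi> n)) (r n) = (\<integral>k. b (r n - k) * (\<rho> (k / \<xi> n) / \<xi> n))"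
   by (subst conv_alt[OF _ kern_measurable[OF \<rho> \<xi>(1)]]) (simp_all add: kern_real)
  also have "\<dots> = \<bar>\<xi> n\<bar> *\<^sub>R (\<integral>t. b (r n - (0 + \<xi> n * t)) * (\<rho> ((0 + \<xi> n * t) / \<xi> n) / \<xi> n))"
   by (rule lborel_integral_real_affine) (use \<xi>(1)[of n] in simp)
  also have "\<dots> = (\<integral>t. \<xi> n * (b (r n - \<xi> n * t) * (\<rho> t / \<xi> n)))"
   using \<xi>(1)[of n] by simp
  finally show ?thesis using \<xi>(1)[of n] by simp
 qed
 have "(%n. \<integral>t. b (r n - \<xi> n * t) * \<rho> t) ----> (\<integral>t. b r' * \<rho> t)"
 proof (rule integral_dominated_convergence[where w="%t. b0 * \<rho> t"])
  have "(%n. b (r n - \<xi> n * t) * \<rho> t) ----> b r' * \<rho> t" for t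
  proof -
   have "(%n. r n - \<xi> n * t) ----> r' - 0 * t" by (intro tendsto_intros r \<xi>)
   then have "(%n. b (r n - \<xi> n * t)) ----> b r'"
    by (intro continuous_on_tendsto_compose[OF b_cont[of UNIV]]) auto
   then show ?thesis by (rule tendsto_mult_right)
  qed
  then show "AE t in lborel. (%n. b (r n - \<xi> n * t) * \<rho> t) ----> b r' * \<rho> t" by simp
  show "AE t in lborel. norm (b (r n - \<xi> n * t) * \<rho> t) \<le> b0 * \<rho> t" for n
   using b0 b_nonneg \<rho>1(3) by (auto simp: abs_mult mult_right_mono)
 qed (use \<rho>1 in auto)
 then have "(%n. conv b (kern \<rho> (\<xi> n)) (r n)) ----> b r'" using \<rho>1 by (simp add: e)
 then have "(%n. conv b (kern \<rho> (\<xi> n)) (r n) / (1 + \<xi> n * \<bar>r n\<bar>)) ----> b r' / (1 + 0 * \<bar>r'\<bar>)"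
  by (intro tendsto_intros \<xi> r) auto
 then show ?thesis using False be_alt[OF \<xi>(1,2)] by simp
qed

lemma eta_tendsto:
 assumes \<xi>: "!!n. 0 < \<xi> n" "!!n. \<xi> n < 1" "\<xi> ----> 0"
 shows "(%n. eta (\<xi> n) x) ----> 1"
proof (rule tendsto_eventually)
 have "\<forall>\<^sub>F n in sequentially. \<xi> n < 1 / (norm x + 1)"
  using order_tendstoD(2)[OF \<xi>(3), of "1 / (norm x + 1)"] by (simp add: add_nonneg_pos)
 then show "\<forall>\<^sub>F n in sequentially. eta (\<xi> n) x = 1"
 proof eventually_elim
  case (elim n)
  have p: "norm x + 1 > 0" by (simp add: add_nonneg_pos)
  then have "\<xi> n * (norm x + 1) < 1" using elim by (simp add: pos_less_divide_eq)
  then have "norm x \<le> 1 / \<xi> n" using \<xi>(1)[of n] by (simp add: le_divide_eq algebra_simps)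
  then show ?case using \<eta>_props(6)[OF \<xi>(1,2)] by (simp add: eta_def)
 qed
qed

end

context fpe_resolvents
begin

lemma e: "0 < e n" "e n < 1" "e ----> 0"
 using J by (auto simp: limit_resolvents_def)

lemma J_weak_star:
 assumes "lam > 0" "f \<in> L1 \<inter> Linf" "\<phi> \<in> L1"
 shows "(%n. \<integral>x. U (e n) lam f x * \<phi> x) ----> (\<integral>x. J lam f x * \<phi> x)"
 using J assms unfolding limit_resolvents_def weak_star_lim_def by blast

lemma J_extension: "lam > 0 ==> L1_extension_from (L1 \<inter> Linf) (J lam)"
 using J unfolding limit_resolvents_def by blast

lemma J_L1: "lam > 0 ==> f \<in> L1 ==> J lam f \<in> L1"
 using J_extension unfolding L1_extension_from_def by blast

lemma J_Linf: "lam > 0 ==> f \<in> L1 \<inter> Linf ==> J lam f \<in> Linf"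
 using J unfolding limit_resolvents_def weak_star_lim_def by blast

text \<open>The constant is independent of \<xi>, thanks to \<open>level_bound\<close>; where
  \<sigma>u > \<kappa> the term with u only helps, so |f| bounds the integrand.\<close>

lemma U_level_translation:
 assumes \<xi>: "0 < \<xi>" "\<xi> < 1" and lam: "small lam" and f: "f \<in> L1" and M: "M > 0" "AE x. \<bar>f x\<bar> \<le> M"
  and \<kappa>: "\<kappa> > 0" and \<sigma>: "\<sigma> = 1 \<or> \<sigma> = -1"
 defines "u \<equiv> U \<xi> lam f"
 shows "(\<integral>x. (ramp (\<sigma> * u (x + w) - \<kappa>) - ramp (\<sigma> * u x - \<kappa>))^2) \<le>
  (norm w)^2 * (2 / (level_bound \<kappa> * lam) * (\<integral>x. \<bar>f x\<bar>))"
proof -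
 have lam0: "lam > 0" "lam * m0 * b0 \<le> 1 / 2" using lam by (auto simp: small_def)
 note p = U_props[OF \<xi> lam f M, folded u_def]
 have fi: "\<L> f" using f by (simp add: L1_def)
 let ?d = "%x. \<sigma> * f x - (1 - lam * m0 * b0) * (\<sigma> * u x)"
 have L2: "u \<in> L2" "f \<in> L2"
  by (rule L1_Linf_L2; use p(1,2) f M(2) in \<open>force simp: Linf_iff L1_def\<close>)+
 note [measurable] = L2_measurable[OF L2(1)] L2_measurable[OF L2(2)] borel_measurable_continuous_onI[OF ramp_cont]
 have l: "level_bound \<kappa> > 0" using bt'_level(1)[OF \<xi> \<kappa>, of \<kappa>] by simp
 note tr = approx_level_translation[OF \<xi> L2 lam0(1) \<kappa> \<sigma> l bt'_level(2)[OF \<xi> \<kappa>] p(3), of w]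
 have le: "(\<integral>x. ?d x * ramp (\<sigma> * u x - \<kappa>)) \<le> (\<integral>x. \<bar>f x\<bar>)"
 proof (rule integral_mono_AE)
  show "\<L> (%x. ?d x * ramp (\<sigma> * u x - \<kappa>))"
  proof (rule integrable_squeeze)
   show "\<L> (%x. \<bar>\<sigma> * f x - (1 - lam * m0 * b0) * (\<sigma> * u x)\<bar>)"
    using p(1) fi by (simp add: L1_def)
   show "AE x. \<bar>(?d x) * ramp (\<sigma> * u x - \<kappa>)\<bar>
     \<le> \<bar>\<sigma> * f x - (1 - lam * m0 * b0) * (\<sigma> * u x)\<bar>"
    using ramp_bounds by (simp add: abs_mult mult_left_le)
  qed measurable
  have "?d x * ramp (\<sigma> * u x - \<kappa>) \<le> \<bar>f x\<bar>" for x
  proof (cases "\<sigma> * u x \<le> \<kappa>")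
   case False
   have "0 \<le> (1 - lam * m0 * b0) * (\<sigma> * u x)" by (rule mult_nonneg_nonneg) (use False \<kappa> lam0 in auto)
   then have "\<sigma> * f x - (1 - lam * m0 * b0) * (\<sigma> * u x) \<le> \<bar>f x\<bar>" using \<sigma> by auto
   then have "?d x * ramp (\<sigma> * u x - \<kappa>) \<le> \<bar>f x\<bar> * ramp (\<sigma> * u x - \<kappa>)"
    by (rule mult_right_mono) (rule ramp_bounds)
   then show ?thesis using mult_left_le[OF ramp_bounds(2), of "\<bar>f x\<bar>"] by (rule order_trans) simp
  qed (simp add: ramp_nonpos)
  then show "AE x. ?d x * ramp (\<sigma> * u x - \<kappa>) \<le> \<bar>f x\<bar>" by simp
 qed (use fi in simp)
 have "0 \<le> 2 / (level_bound \<kappa> * lam)" using l lam0 by simp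
 from order_trans[OF tr mult_left_mono[OF mult_left_mono[OF le this]]] show ?thesis by simp
qed

text \<open>Differences below s contribute at most s times the mass of the weight. Larger ones are
  seen by one of the two shifted profiles, whose L^2 translation bounds control them as in
  Chebyshev's inequality.\<close>

lemma U_equicontinuous:
 fixes p :: "'a => real"
 assumes lam: "small lam" and f: "f \<in> L1" and M: "M > 0" "AE x. \<bar>f x\<bar> \<le> M"
  and p: "\<L> p" "!!x. 0 \<le> p x" "!!x. p x \<le> 1" and \<omega>: "\<omega> > 0"
 shows "\<exists>d>0. \<forall>n w. norm w < d \<longrightarrow> (\<integral>x. p x * \<bar>U (e n) lam f (x + w) - U (e n) lam f x\<bar>) \<le> \<omega>"
proof -
 define u where "u n = U (e n) lam f" for n
 have up: "u n \<in> L1" "AE x. \<bar>u n x\<bar> \<le> 3 * M" for n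
  using U_props(1,2)[OF e(1,2) lam f M] by (auto simp: u_def)
 then have ui: "\<L> (u n)" for n by (simp add: L1_def)
 have u2: "u n \<in> L2" for n by (rule L1_Linf_L2) (use up[of n] in \<open>auto simp: Linf_iff L1_def\<close>)
 note [measurable] = L2_measurable[OF u2] borel_measurable_integrable[OF p(1)] borel_measurable_continuous_onI[OF ramp_cont]
 define P where "P = (\<integral>x. p x)"
 have P: "P \<ge> 0" using p by (simp add: P_def)
 \<comment> \<open>s spends half of \<omega>. Then c is the gap of \<open>ramp_separation\<close>
   for values up to 3M, B = 6M/c^2 turns a squared gap into the largest possible difference 6M, and
   d is chosen so that 2 B C d^2 <= \<omega>/2.\<close>
 define s where "s = \<omega> / (2 * (P + 1))"
 have s: "s > 0" "s * P \<le> \<omega> / 2" using \<omega> P by (auto simp: s_def field_simps)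
 define c where "c = (s / 4)^2 / (1 + (3 * M)^2)^2"
 have c: "c > 0" unfolding c_def using s(1) by (intro divide_pos_pos zero_less_power one_plus_square_pos) simp_all
 define C where "C = 2 / (level_bound (s / 4) * lam) * (\<integral>x. \<bar>f x\<bar>)"
 have "level_bound (s / 4) > 0" using bt'_level(1)[OF e(1,2), of "s / 4" "s / 4"] s by simp
 then have C: "C \<ge> 0" using lam by (simp add: C_def small_def)
 define B where "B = 6 * M / c^2"
 have B: "B \<ge> 0" using M by (simp add: B_def)
 define d where "d = sqrt (\<omega> / (4 * (B * C + 1)))"
 have d: "d > 0" using \<omega> B C by (simp add: d_def add_nonneg_pos)
 have "(\<integral>x. p x * \<bar>u n (x + w) - u n x\<bar>) \<le> \<omega>" if w: "norm w < d" for n w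
 proof -
  define h where "h \<sigma> x = ramp (\<sigma> * u n (x + w) - s / 4) - ramp (\<sigma> * u n x - s / 4)" for \<sigma> x
  have hi: "\<L> (%x. (h \<sigma> x)^2)" "(\<integral>x. (h \<sigma> x)^2) \<le> (norm w)^2 * C" if \<sigma>: "\<sigma> = 1 \<or> \<sigma> = -1" for \<sigma>
  proof -
   have "(%x. ramp (\<sigma> * u n x - s / 4)) \<in> L2"
   proof (rule L2_dominated[OF u2[of n], of _ 2])
    have "\<bar>ramp' r\<bar> \<le> 2" for r using ramp'_bounds[of r] by simp
    then have "\<bar>ramp r\<bar> \<le> 2 * max 0 r" for r
     using lipschitz_of_deriv[OF ramp_deriv, of 2 "max 0 r" 0] ramp_nonpos[of r] ramp_nonpos[of 0] by (cases "r \<le> 0") auto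
    then have "\<bar>ramp (\<sigma> * u n x - s / 4)\<bar> \<le> 2 * \<bar>u n x\<bar>" for x
     by (rule order_trans) (use \<sigma> s in auto)
    then show "AE x. \<bar>ramp (\<sigma> * u n x - s / 4)\<bar> \<le> 2 * \<bar>u n x\<bar>" by simp
   qed measurable
   then show "\<L> (%x. (h \<sigma> x)^2)" unfolding h_def using L2_integrable[OF L2_diff[OF L2_shift]] by blast
   show "(\<integral>x. (h \<sigma> x)^2) \<le> (norm w)^2 * C"
    unfolding h_def u_def C_def by (rule U_level_translation[OF e(1,2) lam f M _ \<sigma>]) (use s in simp)
  qed
  have ud: "AE x. \<bar>u n (x + w)\<bar> \<le> 3 * M \<and> \<bar>u n x\<bar> \<le> 3 * M"
   using up(2)[of n] AE_shift[OF up(2), of n w] by eventually_elim simp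
  have pi: "\<L> (%x. p x * \<bar>u n (x + w) - u n x\<bar>)"
   by (rule integrable_squeeze[of "%x. \<bar>u n (x + w)\<bar> + \<bar>u n x\<bar>"], use ui integrable_shift[OF ui] in simp, measurable)
    (use p in \<open>auto simp: abs_mult intro!: AE_I2 order_trans[OF mult_left_le_one_le]\<close>)
  have "(\<integral>x. p x * \<bar>u n (x + w) - u n x\<bar>) \<le> (\<integral>x. s * p x + (B * (h 1 x)^2 + B * (h (-1) x)^2))"
  proof (rule integral_mono_AE[OF pi])
   show "AE x. p x * \<bar>u n (x + w) - u n x\<bar> \<le> s * p x + (B * (h 1 x)^2 + B * (h (-1) x)^2)"
    using ud
   proof eventually_elim
    case (elim x)
    have nn: "B * (h \<sigma> x)^2 \<ge> 0" for \<sigma> using B by simp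
    show ?case
    proof (cases "\<bar>u n (x + w) - u n x\<bar> \<ge> s")
     case True
     have "p x * \<bar>u n (x + w) - u n x\<bar> \<le> 1 * (6 * M)" using elim p by (intro mult_mono) auto
     also have "\<dots> = B * c^2" using c by (simp add: B_def)
     also obtain \<sigma> where "\<sigma> = 1 \<or> \<sigma> = -1" "c \<le> \<bar>h \<sigma> x\<bar>"
      using ramp_separation[OF s(1) True conjunct1[OF elim] conjunct2[OF elim]] unfolding h_def c_def by blast
     then have "B * c^2 \<le> B * (h 1 x)^2 + B * (h (-1) x)^2"
      using mult_left_mono[OF power_mono[of c "\<bar>h \<sigma> x\<bar>" 2] B] c nn[of 1] nn[of "-1"] by fastforce
     finally show ?thesis using mult_nonneg_nonneg[of s "p x"] s p by (simp add: add_increasing)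
    next
     case False
     then have "p x * \<bar>u n (x + w) - u n x\<bar> \<le> p x * s" using p by (intro mult_left_mono) auto
     then show ?thesis using nn[of 1] nn[of "-1"] by (simp add: mult.commute)
    qed
   qed
  qed (use hi p in auto)
  also have "\<dots> = s * P + (B * (\<integral>x. (h 1 x)^2) + B * (\<integral>x. (h (-1) x)^2))" using hi p by (simp add: P_def)
  also have "\<dots> \<le> s * P + (B * ((norm w)^2 * C) + B * ((norm w)^2 * C))"
   using hi B by (intro add_left_mono add_mono mult_left_mono) auto
  also have "\<dots> = s * P + 2 * (B * C) * (norm w)^2" by simp
  also have "2 * (B * C) * (norm w)^2 \<le> 2 * (B * C) * d^2" using w B C by (intro mult_left_mono power_mono) auto
  also have "\<dots> \<le> \<omega> / 2"
  proof -
   have "B * C + 1 > 0" using mult_nonneg_nonneg[OF B C] by linarith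
   then have "d^2 * (4 * (B * C + 1)) = \<omega>" using \<omega> by (simp add: d_def)
   then have "2 * (B * C) * d^2 + 2 * d^2 = \<omega> / 2" by (simp add: algebra_simps)
   then show ?thesis using zero_le_power2[of d] by linarith
  qed
  finally show ?thesis using s(2) by simp
 qed
 then show ?thesis using d by (auto simp: u_def)
qed

text \<open>Equicontinuity makes the convolutions with a fixed kernel uniformly close to \<open>U (e n) lam f\<close>, and
 they converge by weak-star convergence.\<close>

lemma J_strong_limit:
 fixes p :: "'a => real"
 assumes lam: "small lam" and f: "f \<in> L1 \<inter> Linf" and p: "\<L> p" "!!x. 0 \<le> p x" "!!x. p x \<le> 1"
 shows "(%n. \<integral>x. p x * \<bar>U (e n) lam f x - J lam f x\<bar>) ----> 0"
proof (rule LIMSEQ_I)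
 fix r :: real assume r: "r > 0"
 have lam0: "lam > 0" using lam by (simp add: small_def)
 have fL: "f \<in> L1" "f \<in> Linf" using f by auto
 obtain M where M: "M > 0" "AE x. \<bar>f x\<bar> \<le> M" using fL(2) by (rule Linf_bound)
 define u where "u n = U (e n) lam f" for n
 define y where "y = J lam f"
 have up: "u n \<in> L1" "AE x. \<bar>u n x\<bar> \<le> 3 * M" for n
  using U_props(1,2)[OF e(1,2) lam fL(1) M] by (auto simp: u_def)
 have ui: "\<L> (u n)" "\<L> y" for n using up J_L1[OF lam0 fL(1)] by (auto simp: L1_def y_def)
 have um[measurable]: "u n \<in> \<M>" "y \<in> \<M>" "p \<in> \<M>" for n
  using ui p(1) by auto
 have pb: "\<L> (%x. p x * \<bar>h x\<bar>)" if "h \<in> \<M>" "AE x. \<bar>h x\<bar> \<le> B" for h :: "'a => real" and B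
 proof (rule integrable_squeeze[of "%x. B * p x"])
  show "AE x. \<bar>p x * \<bar>h x\<bar>\<bar> \<le> B * p x"
   using that(2) by eventually_elim (use p in \<open>simp add: abs_mult mult.commute[of B] mult_left_mono\<close>)
 qed (use that p in auto)
 obtain d where d: "d > 0" "!!n w. norm w < d ==> (\<integral>x. p x * \<bar>u n (x + w) - u n x\<bar>) \<le> r / 8"
  using U_equicontinuous[OF lam fL(1) M p, of "r / 8"] r unfolding u_def by auto
 obtain d' where d': "d' > 0" "!!k. norm k < d' ==> (\<integral>x. \<bar>y (x + k) - y x\<bar>) \<le> r / 8"
  using small_translation_bound[of "%k. \<integral>x. \<bar>y (x + k) - y x\<bar>" "r / 8"] L1_translation_continuous[OF ui(2)] r by auto
 \<comment> \<open>The kernel is supported in the ball of radius DIM \<delta>, which is now inside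
   the regions where translates of all u n, and of the limit, move by at most r/8.\<close>
 define \<delta> where "\<delta> = min d d' / (2 * real DIM('a))"
 have "real DIM('a) * \<delta> = min d d' / 2" by (simp add: \<delta>_def)
 then have \<delta>: "\<delta> > 0" "real DIM('a) * \<delta> < d" "real DIM('a) * \<delta> < d'" using d(1) d'(1) by (auto simp: \<delta>_def)
 define K :: "'a => real" where "K = kern \<rho> \<delta>"
 have Kt: "K \<in> test_functions" unfolding K_def by (rule kern_test[OF \<rho> \<delta>(1)])
 have K1: "(\<integral>z. \<bar>K z\<bar>) = 1"
  using kern_integral[OF \<rho> \<delta>(1), where 'a='a] kern_nonneg[OF \<rho> \<delta>(1), where 'a='a] by (simp add: K_def)
 define v where "v n = conv (u n) K" for n
 have vb: "\<bar>v n x\<bar> \<le> 3 * M" for n x using conv_bounded[OF um(1) up(2) Kt, of n x] K1 by (simp add: v_def)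
 have [measurable]: "v n \<in> \<M>" "conv y K \<in> \<M>" for n
  unfolding v_def by (intro conv_measurable um test_measurable[OF Kt])+
 have vlim: "(%n. v n x) ----> conv y K x" for x
  unfolding v_def conv_def u_def y_def
  by (rule J_weak_star[OF lam0 f]) (use test_integrable[OF test_reflect[OF Kt]] in \<open>simp add: L1_def\<close>)
 have yb: "\<bar>conv y K x\<bar> \<le> 3 * M" for x by (rule LIMSEQ_le_const2[OF tendsto_rabs[OF vlim]]) (use vb in auto)
 define a where "a n = (\<integral>x. p x * \<bar>v n x - conv y K x\<bar>)" for n
 have "a ----> (\<integral>x. 0 \<partial>(lborel :: 'a measure))"
  unfolding a_def
 proof (rule integral_dominated_convergence[where w="%x. 6 * M * p x"])
  show "AE x. (%n. p x * \<bar>v n x - conv y K x\<bar>) ----> 0"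
  proof (rule AE_I2)
   fix x
   have "(%n. p x * \<bar>v n x - conv y K x\<bar>) ----> p x * \<bar>conv y K x - conv y K x\<bar>" by (intro tendsto_intros vlim)
   then show "(%n. p x * \<bar>v n x - conv y K x\<bar>) ----> 0" by simp
  qed
  show "AE x. norm (p x * \<bar>v n x - conv y K x\<bar>) \<le> 6 * M * p x" for n
  proof (rule AE_I2)
   fix x
   have "\<bar>v n x - conv y K x\<bar> \<le> 6 * M" using vb[of n x] yb[of x] by linarith
   from mult_left_mono[OF this p(2)[of x]] show "norm (p x * \<bar>v n x - conv y K x\<bar>) \<le> 6 * M * p x"
    using p(2)[of x] by (simp add: abs_mult mult.commute)
  qed
 qed (use p in auto)
 then have "a ----> 0" by simp
 from order_tendstoD(2)[OF this, of "r / 8"] r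
 obtain N where N: "!!n. n \<ge> N ==> a n < r / 8" by (auto simp: eventually_sequentially)
 have av: "AE x. \<bar>u n x - v n x\<bar> \<le> 6 * M" "AE x. \<bar>v n x - conv y K x\<bar> \<le> 6 * M" for n
 proof -
  show "AE x. \<bar>u n x - v n x\<bar> \<le> 6 * M" using up(2)[of n]
  proof eventually_elim
   case (elim x) then show ?case using vb[of n x] by linarith
  qed
  have "\<bar>v n x - conv y K x\<bar> \<le> 6 * M" for x using vb[of n x] yb[of x] by linarith
  then show "AE x. \<bar>v n x - conv y K x\<bar> \<le> 6 * M" by simp
 qed
 have i: "\<L> (%x. p x * \<bar>u n x - v n x\<bar>)" "\<L> (%x. p x * \<bar>v n x - conv y K x\<bar>)" for n
  by (rule pb[OF _ av(1)] pb[OF _ av(2)], measurable)+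
 have cK: "(\<integral>x. p x * \<bar>conv h K x - h x\<bar>) \<le> r / 8"
  if h: "\<L> h" "AE x. \<bar>h x\<bar> \<le> B"
   and le: "!!k. norm k \<le> real DIM('a) * \<delta> ==> (\<integral>x. p x * \<bar>h (x + k) - h x\<bar>) \<le> r / 8" for h :: "'a => real" and B
  unfolding K_def
 proof (rule conv_kern_weighted_le[OF \<rho> \<delta>(1) L1_L1_loc[OF h(1)]])
  have [measurable]: "h \<in> \<M>" using h(1) by auto
  show "(\<integral>x. p x * \<bar>h (x - k) - h x\<bar>) \<le> r / 8" if "norm k \<le> real DIM('a) * \<delta>" for k
   using le[of "- k"] that by simp
  show "\<L> (%x. p x * \<bar>h (x - k) - h x\<bar>)" for k
  proof (rule pb)
   show "AE x. \<bar>h (x - k) - h x\<bar> \<le> 2 * B" using h(2) AE_shift[OF h(2), of "- k"] by eventually_elim simp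
  qed measurable
 qed (use p r in auto)
 have uv: "(\<integral>x. p x * \<bar>u n x - v n x\<bar>) \<le> r / 8" for n
  using cK[OF ui(1) up(2), of n] d(2) \<delta>(2) by (simp add: v_def abs_minus_commute)
 obtain B where B: "B > 0" "AE x. \<bar>y x\<bar> \<le> B" using J_Linf[OF lam0 f] unfolding y_def by (rule Linf_bound)
 have yK: "(\<integral>x. p x * \<bar>conv y K x - y x\<bar>) \<le> r / 8"
 proof (rule cK[OF ui(2) B(2)])
  fix k :: 'a assume "norm k \<le> real DIM('a) * \<delta>"
  then have "(\<integral>x. \<bar>y (x + k) - y x\<bar>) \<le> r / 8" using d'(2)[of k] \<delta>(3) by simp
  moreover have "(\<integral>x. \<bar>p x * \<bar>y (x + k) - y x\<bar>\<bar>) \<le> (\<integral>x. \<bar>y (x + k) - y x\<bar>)"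
   by (rule integral_mono_abs) (use ui(2) integrable_shift[OF ui(2), of k] p in \<open>auto simp: abs_mult mult_left_le_one_le\<close>)
  ultimately show "(\<integral>x. p x * \<bar>y (x + k) - y x\<bar>) \<le> r / 8" using p(2) by simp
 qed
 have yKi: "\<L> (%x. p x * \<bar>conv y K x - y x\<bar>)"
 proof (rule pb)
  show "AE x. \<bar>conv y K x - y x\<bar> \<le> 3 * M + B" using B(2)
  proof eventually_elim
   case (elim x) then show ?case using yb[of x] by linarith
  qed
 qed measurable
 have "(\<integral>x. p x * \<bar>u n x - y x\<bar>) < r" if n: "n \<ge> N" for n
 proof -
  let ?s = "%x. p x * \<bar>u n x - v n x\<bar> + p x * \<bar>v n x - conv y K x\<bar> + p x * \<bar>conv y K x - y x\<bar>"
  have "(\<integral>x. \<bar>p x * \<bar>u n x - y x\<bar>\<bar>) \<le> (\<integral>x. ?s x)"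
  proof (rule integral_mono_abs)
   have "p x * \<bar>u n x - y x\<bar> \<le> p x * (\<bar>u n x - v n x\<bar> + \<bar>v n x - conv y K x\<bar> + \<bar>conv y K x - y x\<bar>)" for x
    using p(2) by (intro mult_left_mono) auto
   then show "AE x. \<bar>p x * \<bar>u n x - y x\<bar>\<bar> \<le> ?s x" using p(2) by (simp add: distrib_left)
  qed (use i yKi in auto)
  also have "\<dots> = (\<integral>x. p x * \<bar>u n x - v n x\<bar>) + a n + (\<integral>x. p x * \<bar>conv y K x - y x\<bar>)"
   using i yKi by (simp add: a_def)
  finally show ?thesis using uv[of n] N[OF n] yK r p(2) by simp
 qed
 then show "\<exists>N. \<forall>n\<ge>N. norm ((\<integral>x. p x * \<bar>U (e n) lam f x - J lam f x\<bar>) - 0) < r"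
  using p(2) by (intro exI[of _ N]) (auto simp: u_def y_def)
qed

text \<open>A strictly positive integrable weight makes weighted L^1 convergence strong enough for
  a.e. convergence along a subsequence. The extraction starts from an arbitrary subsequence so that
  it can be repeated for a second datum.\<close>

lemma J_AE_subseq:
 assumes lam: "small lam" and f: "f \<in> L1 \<inter> Linf" and s: "strict_mono (s :: nat => nat)"
 obtains r where "strict_mono r" "AE x. (%n. U (e (s (r n))) lam f x) ----> J lam f x"
proof -
 obtain p :: "'a => real" where p: "\<L> p" "!!x. 0 < p x" "!!x. p x \<le> 1"
  by (rule sigma_finite_measure.obtain_positive_integrable_function[OF sigma_finite_lborel]) blast
 have lam0: "lam > 0" using lam by (simp add: small_def)
 have fL1: "f \<in> L1" using f by simp
 obtain M where M: "M > 0" "AE x. \<bar>f x\<bar> \<le> M" using f Linf_bound by blast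
 have ui: "\<L> (U (e n) lam f)" "\<L> (J lam f)" for n
  using U_props(1)[OF e(1,2) lam fL1 M] J_L1[OF lam0 fL1] by (auto simp: L1_def)
 have lim: "(%n. \<integral>x. p x * \<bar>U (e (s n)) lam f x - J lam f x\<bar>) ----> 0"
  using LIMSEQ_subseq_LIMSEQ[OF J_strong_limit[OF lam f p(1) less_imp_le[OF p(2)] p(3)] s] by (simp add: o_def)
 have "\<L> (%x. p x * (U (e (s n)) lam f x - J lam f x))" for n
  by (rule integrable_squeeze[of "%x. \<bar>U (e (s n)) lam f x - J lam f x\<bar>"])
   (use ui p in \<open>auto simp: abs_mult less_imp_le mult_left_le_one_le\<close>)
 moreover have "norm (p x * (U (e (s n)) lam f x - J lam f x)) = p x * \<bar>U (e (s n)) lam f x - J lam f x\<bar>" for x n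
  using p(2)[of x] by (simp add: abs_mult)
 ultimately obtain r where r: "strict_mono r" "AE x. (%n. p x * (U (e (s (r n))) lam f x - J lam f x)) ----> 0"
  using tendsto_L1_AE_subseq[of lborel "%n x. p x * (U (e (s n)) lam f x - J lam f x)"] lim by auto
 have "AE x. (%n. U (e (s (r n))) lam f x) ----> J lam f x"
  using r(2)
 proof eventually_elim
  case (elim x)
  then have "(%n. inverse (p x) * (p x * (U (e (s (r n))) lam f x - J lam f x))) ----> inverse (p x) * 0"
   by (intro tendsto_intros)
  then have "(%n. U (e (s (r n))) lam f x - J lam f x) ----> 0" using p(2)[of x] by (simp add: mult.assoc[symmetric])
  then show ?case by (simp add: LIM_zero_iff)
 qed
 with r(1) that show thesis by blast
qed

end

section \<open>Passage to the limit in integrals and in weak equations\<close>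

lemma integral_fatou_le:
 fixes h :: "nat => 'a::euclidean_space => real"
 assumes h: "!!n. \<L> (h n)" "!!n. AE x. 0 \<le> h n x" "!!n. (\<integral>x. h n x) \<le> c n" "c ----> c'"
  and [measurable]: "h' \<in> \<M>" and lim: "AE x. (%n. h n x) ----> h' x"
 shows "\<L> h'" "(\<integral>x. h' x) \<le> c'"
proof -
 have [measurable]: "h n \<in> \<M>" for n using h(1) by auto
 have nn: "AE x. \<forall>n. 0 \<le> h n x" using h(2) by (simp add: AE_all_countable)
 have nn': "AE x. 0 \<le> h' x" using nn lim
  by eventually_elim (metis LIMSEQ_le_const)
 have c: "0 \<le> c n" for n
 proof -
  have "0 \<le> (\<integral>x. h n x)" by (rule integral_nonneg_AE[OF h(2)])
  then show ?thesis using h(3)[of n] by linarith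
 qed
 have c': "0 \<le> c'" by (rule LIMSEQ_le_const[OF h(4)]) (use c in auto)
 have "(\<integral>\<^sup>+x. ennreal (h' x)) = (\<integral>\<^sup>+x. liminf (%n. ennreal (h n x)))"
 proof (rule nn_integral_cong_AE)
  show "AE x. ennreal (h' x) = liminf (%n. ennreal (h n x))"
   using lim
  proof eventually_elim
   case (elim x)
   then have "(%n. ennreal (h n x)) ----> ennreal (h' x)" by (rule tendsto_ennrealI)
   then show ?case using lim_imp_Liminf[OF sequentially_bot] by metis
  qed
 qed
 also have "\<dots> \<le> liminf (%n. \<integral>\<^sup>+x. ennreal (h n x))"
  by (rule nn_integral_liminf) measurable
 also have "\<dots> \<le> liminf (%n. ennreal (c n))"
 proof (intro Liminf_mono always_eventually allI)
  fix n
  have "(\<integral>\<^sup>+x. ennreal (h n x)) = ennreal (\<integral>x. h n x)"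
   by (rule nn_integral_eq_integral[OF h(1,2)])
  also have "\<dots> \<le> ennreal (c n)" by (rule ennreal_leI[OF h(3)])
  finally show "(\<integral>\<^sup>+x. ennreal (h n x)) \<le> ennreal (c n)" .
 qed
 also have "\<dots> = ennreal c'"
  using lim_imp_Liminf[OF sequentially_bot tendsto_ennrealI[OF h(4)]] .
 finally have le: "(\<integral>\<^sup>+x. ennreal (h' x)) \<le> ennreal c'" .
 then have "(\<integral>\<^sup>+x. ennreal (h' x)) < \<infinity>" by (rule le_less_trans) simp
 then show i: "\<L> h'" using nn' by (intro integrableI_nonneg) auto
 have "ennreal (\<integral>x. h' x) \<le> ennreal c'"
  using le nn_integral_eq_integral[OF i nn'] by simp
 then show "(\<integral>x. h' x) \<le> c'" using c' by (simp add: ennreal_le_iff)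
qed

text \<open>Bounds in L^1 and L^\<infinity> with a.e. convergence still allow mass to escape to
  infinity. A weight vanishing there does not see it: dominated convergence on a large ball, and d
  times the L^1 bound outside.\<close>

lemma tendsto_integral_weight_vanishing:
 fixes h :: "nat => 'a::euclidean_space => real" and q :: "'a => real"
 assumes h: "!!n. \<L> (h n)" "!!n. (\<integral>x. \<bar>h n x\<bar>) \<le> C" "!!n. AE x. \<bar>h n x\<bar> \<le> B"
  and h': "\<L> h'" and lim: "AE x. (%n. h n x) ----> h' x"
  and q[measurable]: "q \<in> \<M>" and q_nn: "!!x. 0 \<le> q x" and q_le: "!!x. q x \<le> 1"
  and q_inf: "!!d. d > 0 ==> \<exists>R. \<forall>x. norm x > R \<longrightarrow> q x \<le> d"
 shows "(%n. \<integral>x. h n x * q x) ----> (\<integral>x. h' x * q x)"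
proof -
 have [measurable]: "h n \<in> \<M>" "h' \<in> \<M>" for n using h h' by auto
 define k where "k n x = \<bar>h n x - h' x\<bar>" for n x
 have k: "\<L> (k n)" "0 \<le> k n x" for n x using h(1) h' by (auto simp: k_def[abs_def])
 then have [measurable]: "k n \<in> \<M>" for n by auto
 define C' where "C' = C + (\<integral>x. \<bar>h' x\<bar>)"
 have kC: "(\<integral>x. k n x) \<le> C'" for n
 proof -
  have "(\<integral>x. k n x) \<le> (\<integral>x. \<bar>h n x\<bar> + \<bar>h' x\<bar>)"
   by (rule integral_mono) (use k h(1) h' in \<open>auto simp: k_def\<close>)
  then show ?thesis using h(1,2)[of n] h' by (simp add: C'_def)
 qed
 have "0 \<le> (\<integral>x. k 0 x)" using k(2) by simp
 then have C': "C' \<ge> 0" using kC[of 0] by linarith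
 have iq: "\<L> (%x. w x * q x)" if "\<L> w" for w :: "'a => real"
  by (rule integrable_squeeze[of "%x. \<bar>w x\<bar>"]) (use that q_nn q_le in \<open>auto simp: abs_mult intro!: mult_left_le\<close>)
 have "(%n. \<integral>x. k n x * q x) ----> 0"
 proof (rule LIMSEQ_I)
  fix r :: real assume r: "r > 0"
  define d where "d = r / (2 * (C' + 1))"
  have d: "d > 0" "d * C' < r / 2" using r C' by (auto simp: d_def field_simps)
  obtain R where R: "!!x. norm x > R ==> q x \<le> d" using q_inf[OF d(1)] by blast
  let ?I = "indicator (cball 0 R) :: 'a => real"
  have Ii: "\<L> ?I" using emeasure_compact_finite[of "cball (0::'a) R"] by (simp add: integrable_indicator_iff)
  have "(%n. \<integral>x. k n x * ?I x) ----> (\<integral>x. 0 \<partial>(lborel :: 'a measure))"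
  proof (rule integral_dominated_convergence[where w="%x. B * ?I x + \<bar>h' x\<bar>"])
   show "AE x. (%n. k n x * ?I x) ----> 0"
    using lim unfolding k_def by eventually_elim (intro tendsto_mult_left_zero tendsto_rabs_zero, simp add: LIM_zero_iff)
   show "AE x. norm (k n x * ?I x) \<le> B * ?I x + \<bar>h' x\<bar>" for n
    using h(3)[of n] by eventually_elim (auto simp: k_def indicator_def)
  qed (use Ii h' in auto)
  then have "(%n. \<integral>x. k n x * ?I x) ----> 0" by simp
  from order_tendstoD(2)[OF this, of "r / 2"] r
  obtain N where N: "!!n. n \<ge> N ==> (\<integral>x. k n x * ?I x) < r / 2" by (auto simp: eventually_sequentially)
  have "(\<integral>x. k n x * q x) < r" if "n \<ge> N" for n
  proof -
   have kI: "\<L> (%x. k n x * ?I x)"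
    by (rule integrable_squeeze[OF k(1)[of n]]) (use k(2) Ii in \<open>auto simp: indicator_def\<close>)
   have "(\<integral>x. k n x * q x) \<le> (\<integral>x. k n x * ?I x + d * k n x)"
   proof (rule integral_mono)
    fix x
    have "q x \<le> ?I x + d" using R[of x] q_le[of x] d(1) by (auto simp: indicator_def)
    from mult_left_mono[OF this k(2)[of n x]] show "k n x * q x \<le> k n x * ?I x + d * k n x" by (simp add: algebra_simps)
   qed (use iq[OF k(1)] kI k(1)[of n] in auto)
   also have "\<dots> = (\<integral>x. k n x * ?I x) + d * (\<integral>x. k n x)" using kI k(1)[of n] by simp
   also have "\<dots> < r" using N[OF that] mult_left_mono[OF kC[of n], of d] d by linarith
   finally show ?thesis .
  qed
  moreover have "0 \<le> (\<integral>x. k n x * q x)" for n using k(2) q_nn by simp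
  ultimately show "\<exists>N. \<forall>n\<ge>N. norm ((\<integral>x. k n x * q x) - 0) < r" by (intro exI[of _ N]) simp
 qed
 moreover have "\<bar>h n x * q x - h' x * q x\<bar> = k n x * q x" for n x
  using q_nn[of x] by (simp add: k_def abs_mult flip: left_diff_distrib)
 ultimately show ?thesis by (intro L1_tendsto_integral(1) iq h(1) h') simp
qed

lemma L1_dist_tendsto:
 fixes a b :: "nat => 'a::euclidean_space => real"
 assumes i: "!!n. \<L> (a n)" "!!n. \<L> (b n)" "\<L> a'" "\<L> b'"
  and lim: "(%n. \<integral>x. \<bar>a n x - a' x\<bar>) ----> 0" "(%n. \<integral>x. \<bar>b n x - b' x\<bar>) ----> 0"
 shows "(%n. \<integral>x. \<bar>a n x - b n x\<bar>) ----> (\<integral>x. \<bar>a' x - b' x\<bar>)"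
 using L1_tendsto_integral(2)[of "%n x. a n x - b n x" "%x. a' x - b' x"] i L1_tendsto_lincomb[OF i lim, of 1 "-1"] by simp

text \<open>Convergence as distributions. Integrability is recorded because a Bochner integral that
  does not exist has the value 0.\<close>

definition test_lim :: "(nat => 'a::euclidean_space => real) => ('a => real) => bool" where
 "test_lim h h' \<longleftrightarrow> (\<forall>\<phi>\<in>test_functions. (\<forall>n. \<L> (%x. h n x * \<phi> x)) \<and> \<L> (%x. h' x * \<phi> x)
   \<and> (%n. \<integral>x. h n x * \<phi> x) ----> (\<integral>x. h' x * \<phi> x))"

lemma test_lim_bounded:
 fixes h :: "nat => 'a::euclidean_space => real"
 assumes [measurable]: "!!n. h n \<in> \<M>" "h' \<in> \<M>"
  and B: "!!n. AE x. \<bar>h n x\<bar> \<le> B" and lim: "AE x. (%n. h n x) ----> h' x"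
 shows "test_lim h h'"
 unfolding test_lim_def
proof
 fix \<phi> :: "'a => real" assume \<phi>: "\<phi> \<in> test_functions"
 note [measurable] = test_measurable[OF \<phi>]
 have m: "(%x. h' x * \<phi> x) \<in> borel_measurable lborel" "!!n. (%x. h n x * \<phi> x) \<in> borel_measurable lborel" by measurable
 have w: "\<L> (%x. B * \<bar>\<phi> x\<bar>)" using test_integrable[OF \<phi>] by simp
 have l: "AE x. (%n. h n x * \<phi> x) ----> h' x * \<phi> x" using lim by eventually_elim (rule tendsto_mult_right)
 have le: "AE x. norm (h n x * \<phi> x) \<le> B * \<bar>\<phi> x\<bar>" for n
  using B[of n] by eventually_elim (simp add: abs_mult mult_right_mono)
 show "(\<forall>n. \<L> (%x. h n x * \<phi> x)) \<and> \<L> (%x. h' x * \<phi> x)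
   \<and> (%n. \<integral>x. h n x * \<phi> x) ----> (\<integral>x. h' x * \<phi> x)"
  using integrable_dominated_convergence2[OF m w l le] integrable_dominated_convergence[OF m w l le]
   integral_dominated_convergence[OF m w l le] by blast
qed

text \<open>For weights such as wt^5 that dominate every test function up to a constant. The
  weighted distance being integrable also makes the limit integrable against test functions.\<close>

lemma test_lim_weighted:
 fixes h :: "nat => 'a::euclidean_space => real"
 assumes h: "!!n. h n \<in> L1_loc" and h'[measurable]: "h' \<in> \<M>"
  and i: "!!n. \<L> (%x. \<bar>h n x - h' x\<bar> * p x)" and lim: "(%n. \<integral>x. \<bar>h n x - h' x\<bar> * p x) ----> 0"
  and p: "!!\<phi> :: 'a => real. \<phi> \<in> test_functions ==> \<exists>C. \<forall>x. \<bar>\<phi> x\<bar> \<le> C * p x"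
 shows "test_lim h h'"
 unfolding test_lim_def
proof
 fix \<phi> :: "'a => real" assume \<phi>: "\<phi> \<in> test_functions"
 note [measurable] = test_measurable[OF \<phi>] L1_loc_measurable[OF h]
 obtain C where "!!x. \<bar>\<phi> x\<bar> \<le> C * p x" using p[OF \<phi>] by blast
 then have le: "\<bar>h n x * \<phi> x - h' x * \<phi> x\<bar> \<le> C * (\<bar>h n x - h' x\<bar> * p x)" for n x
  using mult_left_mono[of "\<bar>\<phi> x\<bar>" "C * p x" "\<bar>h n x - h' x\<bar>"]
  unfolding left_diff_distrib[symmetric] abs_mult by (simp add: mult.left_commute)
 have hn: "\<L> (%x. h n x * \<phi> x)" for n by (rule test_integrable_mult[OF \<phi> h])
 have di: "\<L> (%x. h n x * \<phi> x - h' x * \<phi> x)" for n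
  by (rule integrable_squeeze[of "%x. C * (\<bar>h n x - h' x\<bar> * p x)"]) (use i le in auto)
 have h'i: "\<L> (%x. h' x * \<phi> x)" using Bochner_Integration.integrable_diff[OF hn di, of 0 0] by simp
 have "(%n. \<integral>x. \<bar>h n x * \<phi> x - h' x * \<phi> x\<bar>) ----> 0"
 proof (rule Lim_null_comparison[OF always_eventually[OF allI] tendsto_mult_right_zero[OF lim, of C]])
  fix n
  have "(\<integral>x. \<bar>h n x * \<phi> x - h' x * \<phi> x\<bar>) \<le> (\<integral>x. C * (\<bar>h n x - h' x\<bar> * p x))"
   by (rule integral_mono) (use i di le in auto)
  then show "norm (\<integral>x. \<bar>h n x * \<phi> x - h' x * \<phi> x\<bar>) \<le> C * (\<integral>x. \<bar>h n x - h' x\<bar> * p x)" by simp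
 qed
 from L1_tendsto_integral(1)[OF hn h'i this] hn h'i
 show "(\<forall>n. \<L> (%x. h n x * \<phi> x)) \<and> \<L> (%x. h' x * \<phi> x)
   \<and> (%n. \<integral>x. h n x * \<phi> x) ----> (\<integral>x. h' x * \<phi> x)" by blast
qed

lemma test_lim_L1:
 fixes h :: "nat => 'a::euclidean_space => real"
 assumes "!!n. \<L> (h n)" "\<L> h'" "(%n. \<integral>x. \<bar>h n x - h' x\<bar>) ----> 0"
 shows "test_lim h h'"
proof (rule test_lim_weighted[where p="%_. 1"])
 show "\<exists>C. \<forall>x. \<bar>\<phi> x\<bar> \<le> C * 1" if "\<phi> \<in> test_functions" for \<phi> :: "'a => real"
  using test_bounded[OF that] by auto
qed (use assms L1_L1_loc in auto)

lemma weak_eq_limit: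
 fixes F :: "nat => 'a::euclidean_space => 'a"
 assumes eq: "!!n. weak_eq (v n) (F n) (g n)" and v: "test_lim v v'" and g: "test_lim g g'"
  and F: "!!i. i \<in> Basis ==> test_lim (%n x. F n x \<bullet> i) (%x. F' x \<bullet> i)"
 shows "weak_eq v' F' g'"
 unfolding weak_eq_def
proof
 fix \<phi> :: "'a => real" assume \<phi>: "\<phi> \<in> test_functions"
 note pd = test_part_deriv[OF \<phi>] and pdd = test_part_deriv[OF test_part_deriv[OF \<phi>]]
 have V: "(\<integral>x. w x * laplacian \<phi> x) = (\<Sum>i\<in>Basis. \<integral>x. w x * part_deriv i (part_deriv i \<phi>) x)"
  if "!!i. i \<in> Basis ==> \<L> (%x. w x * part_deriv i (part_deriv i \<phi>) x)" for w
  unfolding laplacian_def sum_distrib_left using that by (rule Bochner_Integration.integral_sum)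
 have G: "(\<integral>x. H x \<bullet> grad \<phi> x) = (\<Sum>i\<in>Basis. \<integral>x. (H x \<bullet> i) * part_deriv i \<phi> x)"
  if "!!i. i \<in> Basis ==> \<L> (%x. (H x \<bullet> i) * part_deriv i \<phi> x)" for H
  unfolding grad_def inner_sum_right inner_scaleR_right mult.commute[of "part_deriv _ _ _"] using that by (rule Bochner_Integration.integral_sum)
 have "(%n. \<integral>x. v n x * laplacian \<phi> x) ----> (\<integral>x. v' x * laplacian \<phi> x)"
  using v pdd by (subst (1 2) V) (auto simp: test_lim_def intro!: tendsto_sum)
 moreover have "(%n. \<integral>x. F n x \<bullet> grad \<phi> x) ----> (\<integral>x. F' x \<bullet> grad \<phi> x)"
  using F pd by (subst (1 2) G) (auto simp: test_lim_def intro!: tendsto_sum)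
 moreover have "(%n. \<integral>x. g n x * \<phi> x) ----> (\<integral>x. g' x * \<phi> x)" using g \<phi> by (simp add: test_lim_def)
 moreover have "(\<integral>x. g n x * \<phi> x) = - (\<integral>x. v n x * laplacian \<phi> x) - (\<integral>x. F n x \<bullet> grad \<phi> x)" for n
  using eq[of n] \<phi> by (simp add: weak_eq_def)
 ultimately show "- (\<integral>x. v' x * laplacian \<phi> x) - (\<integral>x. F' x \<bullet> grad \<phi> x) = (\<integral>x. g' x * \<phi> x)"
  using LIMSEQ_unique[OF tendsto_diff[OF tendsto_minus]] by simp
qed

text \<open>All mollifications of the difference vanish identically, and they converge to it in
  L^1.\<close>

lemma L1_eq_of_test:
 fixes w1 w2 :: "'a::euclidean_space => real"
 assumes \<rho>: "standard_mollifier \<rho>" and w: "\<L> w1" "\<L> w2"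
  and eq: "!!\<phi>. \<phi> \<in> test_functions ==> (\<integral>x. w1 x * \<phi> x) = (\<integral>x. w2 x * \<phi> x)"
 shows "AE x. w1 x = w2 x"
proof -
 define h where "h x = w1 x - w2 x" for x
 have h: "\<L> h" using w by (simp add: h_def[abs_def])
 have z: "conv h (kern \<rho> \<delta>) x = 0" if "\<delta> > 0" for \<delta> x
 proof -
  have t: "(%z. kern \<rho> \<delta> (x - z)) \<in> test_functions" by (rule test_reflect[OF kern_test[OF \<rho> that]])
  show ?thesis
   using eq[OF t] test_integrable_mult[OF t L1_L1_loc[OF w(1)]] test_integrable_mult[OF t L1_L1_loc[OF w(2)]]
   by (simp add: conv_def h_def left_diff_distrib)
 qed
 have "(%n. \<integral>x. \<bar>conv h (kern \<rho> (inverse (real (Suc n)))) x - h x\<bar>) ----> 0"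
  by (rule conv_kern_L1_tendsto[OF \<rho> h _ LIMSEQ_inverse_real_of_nat]) simp
 then have "(\<integral>x. \<bar>h x\<bar>) = 0" by (simp add: z LIMSEQ_const_iff)
 then have "AE x. \<bar>h x\<bar> = 0" using integral_nonneg_eq_0_iff_AE[of "lborel" "%x. \<bar>h x\<bar>"] h by auto
 then show ?thesis by eventually_elim (simp add: h_def)
qed

context fpe_resolvents
begin

lemma b_meas[measurable]: "b \<in> \<M>"
 by (rule borel_measurable_continuous_onI[OF b_cont])

lemma \<beta>_meas[measurable]: "\<beta> \<in> \<M>"
 by (rule borel_measurable_continuous_onI[OF \<beta>.\<Phi>_cont])

lemma D_meas'[measurable]: "D \<in> \<M>"
 using D_measurable by simp

text \<open>Along an a.e. convergent subsequence the limit passes through \<beta> and b; for bounded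
  data every term is bounded uniformly in n, by way of |u n| <= 3M.\<close>

lemma J_weak_eq:
 assumes lam: "small lam" and f: "f \<in> L1 \<inter> Linf"
 shows "weak_eq (%x. \<beta> (J lam f x)) (%x. (b (J lam f x) * J lam f x) *\<^sub>R D x) (%x. (f x - J lam f x) / lam)"
proof -
 have lam0: "lam > 0" using lam by (simp add: small_def)
 have fL1: "f \<in> L1" using f by simp
 obtain M where M: "M > 0" "AE x. \<bar>f x\<bar> \<le> M" using f Linf_bound by blast
 obtain r where r: "strict_mono r" "AE x. (%n. U (e (id (r n))) lam f x) ----> J lam f x"
  using J_AE_subseq[OF lam f strict_mono_id] by blast
 define \<xi> where "\<xi> n = e (r n)" for n
 define u where "u n = U (\<xi> n) lam f" for n
 define y where "y = J lam f"
 have \<xi>: "!!n. 0 < \<xi> n" "!!n. \<xi> n < 1" "\<xi> ----> 0"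
  using e(1,2) LIMSEQ_subseq_LIMSEQ[OF e(3) r(1)] by (auto simp: \<xi>_def[abs_def] o_def)
 have ae: "AE x. (%n. u n x) ----> y x" using r(2) by (simp add: u_def \<xi>_def y_def)
 note up = U_props[OF \<xi>(1,2) lam fL1 M, folded u_def]
 have ui: "\<L> (u n)" "\<L> y" "\<L> f" for n
  using up(1) J_L1[OF lam0 fL1] fL1 by (auto simp: L1_def y_def)
 then have [measurable]: "u n \<in> \<M>" "y \<in> \<M>" "f \<in> \<M>" for n by auto
 have btm[measurable]: "bt (\<xi> n) \<in> \<M>" "b_eps b \<rho> (\<xi> n) \<in> \<M>" "drift_term (\<xi> n) (u n) \<in> \<M>" for n
  using bt_measurable[OF \<xi>(1,2)] be_measurable[OF \<xi>(1,2)] drift_term_measurable[OF \<xi>(1,2)] by auto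
 have all: "AE x. (\<forall>n. \<bar>u n x\<bar> \<le> 3 * M) \<and> ((%n. u n x) ----> y x) \<and> norm (D x) \<le> m0"
 proof -
  have "AE x. \<forall>n. \<bar>u n x\<bar> \<le> 3 * M" using up(2) by (simp add: AE_all_countable)
  then show ?thesis using ae m0 by eventually_elim simp
 qed
 define \<Lambda> where "\<Lambda> = (lip (3 * M) + 1) * (3 * M)"
 have v_le: "\<bar>bt (\<xi> n) s\<bar> \<le> \<Lambda>" if "\<bar>s\<bar> \<le> 3 * M" for n s
 proof -
  have "\<bar>bt (\<xi> n) s\<bar> \<le> (lip (3 * M) + 1) * \<bar>s\<bar>" by (rule bt_abs_le[OF \<xi>(1,2) that])
  also have "\<dots> \<le> \<Lambda>" unfolding \<Lambda>_def using that lip(1)[of "3 * M"] by (intro mult_left_mono) auto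
  finally show ?thesis .
 qed
 have v_lim: "AE x. (%n. bt (\<xi> n) (u n x)) ----> \<beta> (y x)"
  using all by eventually_elim (rule bt_tendsto[OF \<xi>], auto)
 have "weak_eq (%x. \<beta> (y x)) (%x. (b (y x) * y x) *\<^sub>R D x) (%x. (f x - y x) / lam)"
 proof (rule weak_eq_limit[OF up(3)])
  show "test_lim (%n x. bt (\<xi> n) (u n x)) (%x. \<beta> (y x))"
  proof (rule test_lim_bounded[OF _ _ _ v_lim])
   show "AE x. \<bar>bt (\<xi> n) (u n x)\<bar> \<le> \<Lambda>" for n using all by eventually_elim (simp add: v_le)
  qed measurable
  show "test_lim (%n x. drift_term (\<xi> n) (u n) x \<bullet> i) (%x. ((b (y x) * y x) *\<^sub>R D x) \<bullet> i)" if i: "i \<in> Basis" for i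
  proof (rule test_lim_bounded)
   show "AE x. \<bar>drift_term (\<xi> n) (u n) x \<bullet> i\<bar> \<le> m0 * (b0 * (3 * M))" for n
    using all drift_term_component_le[OF \<xi>(1,2) i, of n "u n"]
   proof eventually_elim
    case (elim x)
    have "\<bar>b_eps b \<rho> (\<xi> n) (u n x)\<bar> * \<bar>u n x\<bar> \<le> b0 * (3 * M)"
     using elim be_nonneg[OF \<xi>(1,2), of n "u n x"] be_le[OF \<xi>(1,2), of n "u n x"] b0_nonneg by (intro mult_mono) auto
    from mult_left_mono[OF this m0_nonneg] show ?case using elim(2) by (simp add: abs_mult)
   qed
   show "AE x. (%n. drift_term (\<xi> n) (u n) x \<bullet> i) ----> ((b (y x) * y x) *\<^sub>R D x) \<bullet> i"
    using all
   proof eventually_elim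
    case (elim x)
    then have l: "(%n. u n x) ----> y x" by simp
    have "(%n. ((eta (\<xi> n) x * (b_eps b \<rho> (\<xi> n) (u n x) * u n x)) *\<^sub>R D x) \<bullet> i) ----> ((1 * (b (y x) * y x)) *\<^sub>R D x) \<bullet> i"
     by (intro tendsto_intros eta_tendsto[OF \<xi>] be_tendsto[OF \<xi> l] l)
    then show ?case by (simp add: drift_term_def[OF \<xi>(1,2)])
   qed
  qed measurable
  show "test_lim (%n x. (f x - u n x) / lam - \<xi> n * bt (\<xi> n) (u n x)) (%x. (f x - y x) / lam)"
  proof (rule test_lim_bounded)
   show "AE x. (%n. (f x - u n x) / lam - \<xi> n * bt (\<xi> n) (u n x)) ----> (f x - y x) / lam"
    using all v_lim
   proof eventually_elim
    case (elim x)
    then have l: "(%n. u n x) ----> y x" by simp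
    have "(%n. (f x - u n x) / lam - \<xi> n * bt (\<xi> n) (u n x)) ----> (f x - y x) / lam - 0 * \<beta> (y x)"
     using lam0 by (intro tendsto_intros l \<xi>(3) elim(2)) simp
    then show ?case by simp
   qed
   show "AE x. \<bar>(f x - u n x) / lam - \<xi> n * bt (\<xi> n) (u n x)\<bar> \<le> 4 * M / lam + \<Lambda>" for n
    using all M(2)
   proof eventually_elim
    case (elim x)
    have uM: "\<bar>u n x\<bar> \<le> 3 * M" using elim by blast
    then have "\<bar>f x - u n x\<bar> \<le> 4 * M" using elim(2) by linarith
    then have 1: "\<bar>(f x - u n x) / lam\<bar> \<le> 4 * M / lam" using lam0 by (simp add: abs_divide divide_right_mono)
    have "\<xi> n * \<bar>bt (\<xi> n) (u n x)\<bar> \<le> 1 * \<Lambda>" using v_le[OF uM, of n] \<xi>(1,2)[of n] by (intro mult_mono) auto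
    then have "\<bar>\<xi> n * bt (\<xi> n) (u n x)\<bar> \<le> \<Lambda>" using \<xi>(1)[of n] by (simp add: abs_mult)
    then show ?case using 1 by linarith
   qed
  qed measurable
 qed
 then show ?thesis by (simp add: y_def)
qed

lemma J_AE_subseq2:
 assumes lam: "small lam" and f: "f1 \<in> L1 \<inter> Linf" "f2 \<in> L1 \<inter> Linf"
 obtains r where "strict_mono r" "AE x. (%n. U (e (r n)) lam f1 x) ----> J lam f1 x"
  "AE x. (%n. U (e (r n)) lam f2 x) ----> J lam f2 x"
proof -
 obtain r1 where r1: "strict_mono r1" "AE x. (%n. U (e (id (r1 n))) lam f1 x) ----> J lam f1 x"
  using J_AE_subseq[OF lam f(1) strict_mono_id] by blast
 obtain r2 where r2: "strict_mono r2" "AE x. (%n. U (e (r1 (r2 n))) lam f2 x) ----> J lam f2 x"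
  using J_AE_subseq[OF lam f(2) r1(1)] by blast
 have "AE x. (%n. U (e (r1 (r2 n))) lam f1 x) ----> J lam f1 x"
  using r1(2) by eventually_elim (use LIMSEQ_subseq_LIMSEQ[OF _ r2(1)] in \<open>force simp: o_def\<close>)
 with r2 strict_mono_o[OF r1(1) r2(1)] show thesis by (intro that[of "r1 \<circ> r2"]) (auto simp: o_def)
qed

lemma J_contraction_bounded:
 assumes lam: "small lam" and f: "f1 \<in> L1 \<inter> Linf" "f2 \<in> L1 \<inter> Linf"
 shows "(\<integral>x. \<bar>J lam f1 x - J lam f2 x\<bar>) \<le> (\<integral>x. \<bar>f1 x - f2 x\<bar>)"
proof -
 have lam0: "lam > 0" using lam by (simp add: small_def)
 obtain r where r: "strict_mono r" "AE x. (%n. U (e (r n)) lam f1 x) ----> J lam f1 x"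
  "AE x. (%n. U (e (r n)) lam f2 x) ----> J lam f2 x" using J_AE_subseq2[OF lam f] by blast
 have Ji: "\<L> (J lam f1)" "\<L> (J lam f2)"
  using J_L1[OF lam0] f by (auto simp: L1_def)
 have Ui: "\<L> (U (e n) lam h)" if "h \<in> L1 \<inter> Linf" for n h
 proof -
  have "h \<in> Linf" using that by simp
  then obtain M where M: "M > 0" "AE x. \<bar>h x\<bar> \<le> M" by (rule Linf_bound)
  show ?thesis using U_props(1)[OF e(1,2) lam _ M] that by (auto simp: L1_def)
 qed
 show ?thesis
 proof (rule integral_fatou_le(2)[where h="%n x. \<bar>U (e (r n)) lam f1 x - U (e (r n)) lam f2 x\<bar>", OF _ _ _ tendsto_const])
  show "AE x. (%n. \<bar>U (e (r n)) lam f1 x - U (e (r n)) lam f2 x\<bar>) ----> \<bar>J lam f1 x - J lam f2 x\<bar>"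
   using r(2,3) by eventually_elim (intro tendsto_intros)
  show "(\<integral>x. \<bar>U (e (r n)) lam f1 x - U (e (r n)) lam f2 x\<bar>) \<le> (\<integral>x. \<bar>f1 x - f2 x\<bar>)" for n
   by (rule U_contraction[OF e(1,2) lam f])
 qed (use Ui f Ji in auto)
qed

lemma J_L1_lim:
 assumes "lam > 0" "f \<in> L1" "!!n. g n \<in> L1 \<inter> Linf" "(%n. \<integral>x. \<bar>g n x - f x\<bar>) ----> 0"
 shows "(%n. \<integral>x. \<bar>J lam (g n) x - J lam f x\<bar>) ----> 0"
 using J_extension[OF assms(1)] assms(2-4) unfolding L1_extension_from_def L1_lim_def L1_norm_def by blast

lemma J_contraction:
 assumes lam: "small lam" and f: "f1 \<in> L1" "f2 \<in> L1"
 shows "(\<integral>x. \<bar>J lam f1 x - J lam f2 x\<bar>) \<le> (\<integral>x. \<bar>f1 x - f2 x\<bar>)"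
proof -
 have lam0: "lam > 0" using lam by (simp add: small_def)
 have i: "\<L> (J lam h)" "\<L> h" if "h \<in> L1" for h
  using J_L1[OF lam0 that] that by (auto simp: L1_def)
 have t: "truncate h n \<in> L1" if "h \<in> L1" for h :: "'a => real" and n using truncate_mem[OF that] by blast
 show ?thesis
 proof (rule LIMSEQ_le)
  show "(%n. \<integral>x. \<bar>J lam (truncate f1 n) x - J lam (truncate f2 n) x\<bar>) ----> (\<integral>x. \<bar>J lam f1 x - J lam f2 x\<bar>)"
   by (rule L1_dist_tendsto[OF _ _ _ _ J_L1_lim[OF lam0 f(1) truncate_mem[OF f(1)] truncate_L1_lim[OF f(1)]]
    J_L1_lim[OF lam0 f(2) truncate_mem[OF f(2)] truncate_L1_lim[OF f(2)]]]) (use i t f in auto)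
  show "(%n. \<integral>x. \<bar>truncate f1 n x - truncate f2 n x\<bar>) ----> (\<integral>x. \<bar>f1 x - f2 x\<bar>)"
   by (rule L1_dist_tendsto[OF _ _ _ _ truncate_L1_lim[OF f(1)] truncate_L1_lim[OF f(2)]]) (use i t f in auto)
 qed (use J_contraction_bounded[OF lam truncate_mem[OF f(1)] truncate_mem[OF f(2)]] in auto)
qed

end

section \<open>Integrable data\<close>


text \<open>The function (1 + |x|^2)^(-1/2), for which -\<Delta>wt = wt^5 (d + (d - 3) |x|^2). It is
  superharmonic for d >= 3, and its gradient is at most wt^2, which vanishes at infinity.\<close>

definition wt :: "'a::euclidean_space => real" where "wt x = 1 / sqrt (1 + x \<bullet> x)"

lemma wt_bounds: "0 < wt x" "wt x \<le> 1" "(wt x)^2 * (1 + x \<bullet> x) = 1"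
proof -
 have p: "1 + x \<bullet> x > 0" by (simp add: add_pos_nonneg)
 then show "0 < wt x" "wt x \<le> 1" "(wt x)^2 * (1 + x \<bullet> x) = 1" by (simp_all add: wt_def power_divide)
qed

lemma wt_norm: "norm x * wt x \<le> 1" "\<bar>x \<bullet> i\<bar> * wt x \<le> norm i"
proof -
 have "(norm x * wt x)^2 = (wt x)^2 * (x \<bullet> x)" by (simp add: power_mult_distrib power2_norm_eq_inner mult.commute)
 also have "\<dots> \<le> 1" using wt_bounds(3)[of x] zero_le_power2[of "wt x"] unfolding distrib_left by linarith
 finally show n: "norm x * wt x \<le> 1" using wt_bounds(1)[of x] by (simp add: power2_le_imp_le[of _ 1] abs_square_le_1)
 have "\<bar>x \<bullet> i\<bar> * wt x \<le> (norm x * norm i) * wt x"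
  using wt_bounds(1)[of x] by (intro mult_right_mono Cauchy_Schwarz_ineq2) auto
 also have "\<dots> = norm i * (norm x * wt x)" by simp
 also have "\<dots> \<le> norm i" using n by (intro mult_left_le) auto
 finally show "\<bar>x \<bullet> i\<bar> * wt x \<le> norm i" .
qed

lemma wt_measurable[measurable]: "wt \<in> \<M>"
 unfolding wt_def[abs_def] by measurable

lemma wt_dderiv:
 fixes i :: "'a::euclidean_space" assumes i: "i \<in> Basis"
 shows "has_dderiv wt i (%x. - (x \<bullet> i) * wt x ^ 3)"
 unfolding has_dderiv_def
proof
 fix x :: 'a
 have p: "1 + x \<bullet> x > 0" by (simp add: add_pos_nonneg)
 have "wt (x + r *\<^sub>R i) = 1 / sqrt (1 + x \<bullet> x + 2 * r * (x \<bullet> i) + r * r)" for r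
  using i by (simp add: wt_def inner_add_left inner_add_right inner_commute algebra_simps)
 moreover have "((%r. 1 / sqrt (1 + x \<bullet> x + 2 * r * (x \<bullet> i) + r * r)) has_real_derivative - (x \<bullet> i) * wt x ^ 3) (at 0)"
 proof -
  define q where "q = sqrt (1 + x \<bullet> x)"
  have q: "q > 0" "wt x = 1 / q" using p by (simp_all add: q_def wt_def)
  have d: "((%r. sqrt (1 + x \<bullet> x + 2 * r * (x \<bullet> i) + r * r)) has_real_derivative (x \<bullet> i) / q) (at 0)"
   unfolding q_def using p by (auto intro!: derivative_eq_intros simp: divide_simps)
  have "((%r. 1 / sqrt (1 + x \<bullet> x + 2 * r * (x \<bullet> i) + r * r)) has_real_derivative (0 * q - 1 * ((x \<bullet> i) / q)) / (q * q)) (at 0)"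
   using DERIV_divide[OF DERIV_const d, of 1] q(1) by (simp add: q_def)
  then show ?thesis by (simp add: q(2) power3_eq_cube field_simps)
 qed
 ultimately show "((%r. wt (x + r *\<^sub>R i)) has_real_derivative - (x \<bullet> i) * wt x ^ 3) (at 0)" by simp
qed

lemma wt_dderiv2:
 fixes i :: "'a::euclidean_space" assumes i: "i \<in> Basis"
 shows "has_dderiv (%x. - (x \<bullet> i) * wt x ^ 3) i (%x. - (wt x ^ 3) + 3 * (x \<bullet> i)^2 * wt x ^ 5)"
proof -
 have 1: "has_dderiv (%x. - (x \<bullet> i)) i (%x. -1)" unfolding has_dderiv_def
  using i by (auto simp: inner_add_left intro!: derivative_eq_intros)
 have 2: "has_dderiv (%x. wt x ^ 3) i (%x. 3 * wt x ^ 2 * (- (x \<bullet> i) * wt x ^ 3))"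
  by (rule has_dderiv_chain[OF wt_dderiv[OF i]]) (auto intro!: derivative_eq_intros)
 have "- (x \<bullet> i) * (3 * wt x ^ 2 * (- (x \<bullet> i) * wt x ^ 3)) + -1 * wt x ^ 3 = - (wt x ^ 3) + 3 * (x \<bullet> i)^2 * wt x ^ 5" for x
  by (simp add: power2_eq_square eval_nat_numeral)
 then show ?thesis using has_dderiv_mult[OF 1 2] by presburger
qed

text \<open>The Laplacian is computed by rewriting wt^3 as wt^5 (1 + |x|^2); in dimension three the
  inequality is an equality.\<close>

lemma wt_superharmonic:
 assumes "DIM('a) \<ge> 3"
 shows "3 * wt x ^ 5 \<le> - (\<Sum>i\<in>Basis. - (wt x ^ 3) + 3 * (x \<bullet> i)^2 * wt (x::'a::euclidean_space) ^ 5)"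
proof -
 have n: "(\<Sum>i\<in>Basis. (x \<bullet> i)^2) = x \<bullet> x" by (simp add: euclidean_inner[of x x] power2_eq_square)
 have "wt x ^ 3 = wt x ^ 5 * (1 + x \<bullet> x)"
 proof -
  have "wt x ^ 5 * (1 + x \<bullet> x) = wt x ^ 3 * ((wt x)^2 * (1 + x \<bullet> x))" by (simp add: eval_nat_numeral)
  then show ?thesis using wt_bounds(3)[of x] by simp
 qed
 moreover have "(\<Sum>i\<in>Basis. - (wt x ^ 3) + 3 * (x \<bullet> i)^2 * wt x ^ 5) = - real DIM('a) * wt x ^ 3 + 3 * (x \<bullet> x) * wt x ^ 5"
  unfolding n[symmetric] by (simp add: sum_subtractf sum_distrib_left sum_distrib_right)
 ultimately have e: "- (\<Sum>i\<in>Basis. - (wt x ^ 3) + 3 * (x \<bullet> i)^2 * wt x ^ 5) = wt x ^ 5 * (real DIM('a) + (real DIM('a) - 3) * (x \<bullet> x))"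
  by (simp add: algebra_simps)
 have "wt x ^ 5 * 3 \<le> wt x ^ 5 * (real DIM('a) + (real DIM('a) - 3) * (x \<bullet> x))"
 proof (rule mult_left_mono)
  have "(real DIM('a) - 3) * (x \<bullet> x) \<ge> 0" using assms by (intro mult_nonneg_nonneg) auto
  moreover have "real DIM('a) \<ge> 3" using assms by simp
  ultimately show "3 \<le> real DIM('a) + (real DIM('a) - 3) * (x \<bullet> x)" by linarith
 qed (use wt_bounds(1)[of x] in simp)
 then show ?thesis unfolding e by simp
qed

lemma wt_decay: assumes "d > 0" shows "\<exists>R. \<forall>x. norm x > R \<longrightarrow> (wt x)\<^sup>2 \<le> d"
proof (intro exI allI impI)
 fix x :: 'a assume "norm x > sqrt (1 / d)"
 then have "1 / d < (norm x)\<^sup>2" using power_strict_mono[of "sqrt (1 / d)" "norm x" 2] assms by simp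
 then have "1 \<le> d * (1 + x \<bullet> x)" using assms by (simp add: power2_norm_eq_inner field_simps)
 then have "(wt x)^2 * 1 \<le> (wt x)^2 * (d * (1 + x \<bullet> x))" by (intro mult_left_mono) auto
 also have "\<dots> = d * ((wt x)^2 * (1 + x \<bullet> x))" by simp
 finally show "(wt x)^2 \<le> d" by (simp only: wt_bounds(3) mult_1_right)
qed

context fpe_resolvents
begin

lemma b_flux_bound: "\<bar>b t * t\<bar> \<le> b0 * \<bar>t\<bar>"
 using b_nonneg[of t] b0[of t] by (simp add: abs_mult mult_right_mono)

lemma be_flux_bound: assumes "0 < \<xi>" "\<xi> < 1"
 shows "\<bar>b_eps b \<rho> \<xi> r * r - b_eps b \<rho> \<xi> s * s\<bar> \<le> b0 * (\<bar>r\<bar> + \<bar>s\<bar>)"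
proof -
 have "\<bar>b_eps b \<rho> \<xi> t * t\<bar> \<le> b0 * \<bar>t\<bar>" for t
  using be_nonneg[OF assms, of t] be_le[OF assms, of t] by (simp add: abs_mult mult_right_mono)
 from this[of r] this[of s] show ?thesis by (simp add: distrib_left)
qed

text \<open>The superharmonic weight \<open>wt\<close> (here \<open>d \<ge> 3\<close> enters) controls differences of \<open>\<beta> \<circ> J\<close> locally,
 which for integrable data is not possible through a bound on \<open>J\<close>.\<close>

lemma J_weighted_contraction:
 assumes d3: "DIM('a) \<ge> 3" and lam: "small lam" and f: "f1 \<in> L1 \<inter> Linf" "f2 \<in> L1 \<inter> Linf"
 defines "y1 \<equiv> J lam f1" and "y2 \<equiv> J lam f2"
 shows "\<L> (%x. \<bar>\<beta> (y1 x) - \<beta> (y2 x)\<bar> * wt x ^ 5)"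
  "3 * lam * (\<integral>x. \<bar>\<beta> (y1 x) - \<beta> (y2 x)\<bar> * wt x ^ 5) \<le>
   (\<integral>x. \<bar>f1 x - f2 x\<bar>) + lam * m0 * (\<integral>x. \<bar>b (y1 x) * y1 x - b (y2 x) * y2 x\<bar>)"
proof -
 have lam0: "lam > 0" using lam by (simp add: small_def)
 have fL: "f1 \<in> L1" "f2 \<in> L1" "f1 \<in> Linf" "f2 \<in> Linf" using f by auto
 obtain M1 where M1: "M1 > 0" "AE x. \<bar>f1 x\<bar> \<le> M1" using fL(3) by (rule Linf_bound)
 obtain M2 where M2: "M2 > 0" "AE x. \<bar>f2 x\<bar> \<le> M2" using fL(4) by (rule Linf_bound)
 obtain r where r: "strict_mono r" "AE x. (%n. U (e (r n)) lam f1 x) ----> y1 x"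
  "AE x. (%n. U (e (r n)) lam f2 x) ----> y2 x" using J_AE_subseq2[OF lam f] unfolding y1_def y2_def by blast
 define \<xi> where "\<xi> n = e (r n)" for n
 have \<xi>: "!!n. 0 < \<xi> n" "!!n. \<xi> n < 1" "\<xi> ----> 0"
  using e(1,2) LIMSEQ_subseq_LIMSEQ[OF e(3) r(1)] by (auto simp: \<xi>_def[abs_def] o_def)
 define u1 u2 where "u1 n = U (\<xi> n) lam f1" and "u2 n = U (\<xi> n) lam f2" for n
 note u1p = U_props(1,2)[OF \<xi>(1,2) lam fL(1) M1, folded u1_def]
 note u2p = U_props(1,2)[OF \<xi>(1,2) lam fL(2) M2, folded u2_def]
 have i: "\<L> (u1 n)" "\<L> (u2 n)" "\<L> y1" "\<L> y2"
  "\<L> f1" "\<L> f2" for n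
  using u1p(1) u2p(1) J_L1[OF lam0 fL(1)] J_L1[OF lam0 fL(2)] fL by (auto simp: L1_def y1_def y2_def)
 then have [measurable]: "u1 n \<in> \<M>" "u2 n \<in> \<M>" "y1 \<in> \<M>"
  "y2 \<in> \<M>" for n by auto
 have [measurable]: "bt (\<xi> n) \<in> \<M>" "b_eps b \<rho> (\<xi> n) \<in> \<M>" for n
  using bt_measurable[OF \<xi>(1,2)] be_measurable[OF \<xi>(1,2)] by auto
 have all: "AE x. (\<forall>n. \<bar>u1 n x\<bar> \<le> 3 * M1) \<and> (\<forall>n. \<bar>u2 n x\<bar> \<le> 3 * M2) \<and> ((%n. u1 n x) ----> y1 x) \<and> ((%n. u2 n x) ----> y2 x)"
 proof -
  have "AE x. \<forall>n. \<bar>u1 n x\<bar> \<le> 3 * M1" "AE x. \<forall>n. \<bar>u2 n x\<bar> \<le> 3 * M2"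
   using u1p(2) u2p(2) by (simp_all add: AE_all_countable)
  then show ?thesis using r(2,3) unfolding u1_def u2_def \<xi>_def by eventually_elim simp
 qed
 define h where "h n x = \<bar>b_eps b \<rho> (\<xi> n) (u1 n x) * u1 n x - b_eps b \<rho> (\<xi> n) (u2 n x) * u2 n x\<bar>" for n x
 let ?bu = "%n x. \<bar>bt (\<xi> n) (u1 n x) - bt (\<xi> n) (u2 n x)\<bar> * wt x ^ 5"
 let ?by = "%x. \<bar>\<beta> (y1 x) - \<beta> (y2 x)\<bar> * wt x ^ 5"
 let ?u12 = "%n x. \<bar>u1 n x\<bar> + \<bar>u2 n x\<bar>"
 let ?f12 = "\<integral>x. \<bar>f1 x - f2 x\<bar>"
 define h' where "h' x = \<bar>b (y1 x) * y1 x - b (y2 x) * y2 x\<bar>" for x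
 have hm[measurable]: "h n \<in> \<M>" "h' \<in> \<M>" for n unfolding h_def h'_def by measurable
 have hle: "\<bar>h n x\<bar> \<le> b0 * ?u12 n x" for n x
  using be_flux_bound[OF \<xi>(1,2)] by (simp add: h_def)
 have hi: "\<L> (h n)" for n
  by (rule integrable_squeeze[of "%x. b0 * ?u12 n x"]) (use i hle in auto)
 have hC: "(\<integral>x. \<bar>h n x\<bar>) \<le> b0 * ((\<integral>x. \<bar>f1 x\<bar>) + (\<integral>x. \<bar>f2 x\<bar>))" for n
 proof -
  have "(\<integral>x. \<bar>h n x\<bar>) \<le> (\<integral>x. b0 * ?u12 n x)"
   by (rule integral_mono) (use i hi hle in auto)
  also have "\<dots> = b0 * ((\<integral>x. \<bar>u1 n x\<bar>) + (\<integral>x. \<bar>u2 n x\<bar>))" using i by simp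
  also have "\<dots> \<le> b0 * ((\<integral>x. \<bar>f1 x\<bar>) + (\<integral>x. \<bar>f2 x\<bar>))"
   using U_L1_le[OF \<xi>(1,2) lam f(1)] U_L1_le[OF \<xi>(1,2) lam f(2)] b0_nonneg
   unfolding u1_def u2_def by (intro mult_left_mono add_mono) auto
  finally show ?thesis .
 qed
 have hB: "AE x. \<bar>h n x\<bar> \<le> b0 * (3 * M1 + 3 * M2)" for n
  using all
 proof eventually_elim
  case (elim x)
  have "b0 * ?u12 n x \<le> b0 * (3 * M1 + 3 * M2)" using elim b0_nonneg by (intro mult_left_mono add_mono) auto
  then show ?case using hle[of n x] by linarith
 qed
 have hlim: "AE x. (%n. h n x) ----> h' x"
  using all unfolding h_def h'_def by eventually_elim (intro tendsto_intros be_tendsto[OF \<xi>], auto)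
 have h'i: "\<L> h'"
 proof (rule integrable_squeeze[of "%x. b0 * (\<bar>y1 x\<bar> + \<bar>y2 x\<bar>)"])
  show "AE x. \<bar>h' x\<bar> \<le> b0 * (\<bar>y1 x\<bar> + \<bar>y2 x\<bar>)"
  proof (rule AE_I2)
   fix x show "\<bar>h' x\<bar> \<le> b0 * (\<bar>y1 x\<bar> + \<bar>y2 x\<bar>)" using b_flux_bound[of "y1 x"] b_flux_bound[of "y2 x"] by (simp add: h'_def distrib_left)
  qed
 qed (use i in auto)
 have wt2: "0 \<le> (wt x)^2" "(wt x)^2 \<le> 1" for x :: 'a
  using wt_bounds(1,2)[of x] by (auto intro: power_le_one)
 \<comment> \<open>The fluxes converge a.e. but are bounded only in L^1 and L^\<infinity>. The
   factor wt^2, coming from the gradient of the weight, tends to 0 at infinity and prevents loss of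
   mass.\<close>
 have lim: "(%n. \<integral>x. h n x * (wt x)^2) ----> (\<integral>x. h' x * (wt x)^2)"
  by (rule tendsto_integral_weight_vanishing[OF hi hC hB h'i hlim _ wt2 wt_decay]) measurable
 define W where "W x = - (\<Sum>i\<in>Basis. - (wt x ^ 3) + 3 * (x \<bullet> i)^2 * wt x ^ 5)" for x :: 'a
 define F where "F = (\<integral>x. \<bar>f1 x - f2 x\<bar> * wt x)"
 have F: "F \<le> ?f12"
  unfolding F_def
 proof (rule integral_mono)
  show "\<L> (%x. \<bar>f1 x - f2 x\<bar> * wt x)"
   by (rule integrable_squeeze[of "%x. \<bar>f1 x - f2 x\<bar>"]) (use i wt_bounds(2) in \<open>auto simp: abs_mult abs_of_pos[OF wt_bounds(1)] intro!: AE_I2 mult_left_le\<close>)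
  show "\<bar>f1 x - f2 x\<bar> * wt x \<le> \<bar>f1 x - f2 x\<bar>" for x using wt_bounds(2)[of x] by (simp add: mult_left_le)
 qed (use i in auto)
 have pw: "wt x ^ k \<le> 1" "0 \<le> wt x ^ k" for x :: 'a and k using wt_bounds(1,2)[of x] by (auto intro: power_le_one)
 have bd1: "\<bar>- (x \<bullet> i) * wt x ^ 3\<bar> \<le> 4" if "i \<in> Basis" for x i :: 'a
 proof -
  have "\<bar>- (x \<bullet> i) * wt x ^ 3\<bar> = (\<bar>x \<bullet> i\<bar> * wt x) * (wt x)^2" using pw(2)[of x 3] wt_bounds(1)[of x]
   by (simp add: abs_mult eval_nat_numeral)
  also have "\<dots> \<le> 1 * 1" using wt_norm(2)[of x i] that wt2 by (intro mult_mono) auto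
  finally show ?thesis by simp
 qed
 have sq: "(x \<bullet> i)^2 * wt x ^ 5 \<le> 1" if "i \<in> Basis" for x i :: 'a
 proof -
  have "(x \<bullet> i)^2 * wt x ^ 5 = (\<bar>x \<bullet> i\<bar> * wt x)^2 * wt x ^ 3" by (simp add: power_mult_distrib eval_nat_numeral)
  also have "\<dots> \<le> 1 * 1" using wt_norm(2)[of x i] that pw[of x 3] wt_bounds(1,2)[of x]
   by (intro mult_mono power_le_one) auto
  finally show ?thesis by simp
 qed
 \<comment> \<open>4 = 1 + 3 from the two terms; it serves as the common bound P of the weight and
   its derivatives.\<close>
 have bd2: "\<bar>- (wt x ^ 3) + 3 * (x \<bullet> i)^2 * wt x ^ 5\<bar> \<le> 4" if "i \<in> Basis" for x i :: 'a
 proof -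
  have "0 \<le> (x \<bullet> i)^2 * wt x ^ 5" using pw(2)[of x 5] by simp
  then show ?thesis using sq[OF that, of x] pw[of x 3] by linarith
 qed
 have qb: "\<bar>\<Sum>i\<in>Basis. (y \<bullet> i) * (- (x \<bullet> i) * wt x ^ 3)\<bar> \<le> norm y * (wt x)^2" for x y :: 'a
 proof -
  have "(\<Sum>i\<in>Basis. (y \<bullet> i) * (- (x \<bullet> i) * wt x ^ 3)) = - (y \<bullet> x) * wt x ^ 3"
   by (simp add: euclidean_inner[of y x] sum_distrib_right sum_negf mult.assoc)
  then have "\<bar>\<Sum>i\<in>Basis. (y \<bullet> i) * (- (x \<bullet> i) * wt x ^ 3)\<bar> = \<bar>y \<bullet> x\<bar> * wt x ^ 3" using pw(2)[of x 3] by (simp add: abs_mult)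
  also have "\<dots> \<le> (norm y * norm x) * wt x ^ 3" using pw(2)[of x 3] by (intro mult_right_mono Cauchy_Schwarz_ineq2) auto
  also have "\<dots> = (norm y * (wt x)^2) * (norm x * wt x)" by (simp add: eval_nat_numeral)
  also have "\<dots> \<le> norm y * (wt x)^2" using wt_norm(1)[of x] by (intro mult_left_le) auto
  finally show ?thesis .
 qed
 have main: "3 * lam * (\<integral>x. ?bu n x) \<le> F + lam * m0 * (\<integral>x. h n x * (wt x)^2)"
  and vi: "\<L> (%x. ?bu n x)" for n
 proof -
  have Wb: "0 \<le> W x" "W x \<le> 4 * real DIM('a)" "3 * wt x ^ 5 \<le> W x" for x
  proof -
   show *: "3 * wt x ^ 5 \<le> W x" unfolding W_def by (rule wt_superharmonic[OF d3])
   then show "0 \<le> W x" using pw(2)[of x 5] by linarith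
   have "\<bar>\<Sum>i\<in>Basis. - (wt x ^ 3) + 3 * (x \<bullet> i)^2 * wt x ^ 5\<bar> \<le> (\<Sum>i\<in>(Basis::'a set). 4)"
    by (rule order_trans[OF sum_abs sum_mono[OF bd2]])
   then show "W x \<le> 4 * real DIM('a)" by (simp add: W_def mult.commute)
  qed
  have [measurable]: "W \<in> \<M>" unfolding W_def by measurable
  define g where "g x = \<bar>bt (\<xi> n) (u1 n x) - bt (\<xi> n) (u2 n x)\<bar>" for x
  have gi: "\<L> g" "!!x. g x \<ge> 0"
  proof -
   define c where "c = 1 / \<xi> n + \<xi> n"
   show "\<L> g"
   proof (rule integrable_squeeze[of "%x. c * \<bar>u1 n x\<bar> + c * \<bar>u2 n x\<bar>"])
    show "AE x. \<bar>g x\<bar> \<le> c * \<bar>u1 n x\<bar> + c * \<bar>u2 n x\<bar>"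
    proof (rule AE_I2)
     fix x show "\<bar>g x\<bar> \<le> c * \<bar>u1 n x\<bar> + c * \<bar>u2 n x\<bar>"
      using bt_lip[OF \<xi>(1,2), of n "u1 n x"] bt_lip[OF \<xi>(1,2), of n "u2 n x"] by (simp add: g_def c_def)
    qed
    show "g \<in> \<M>" unfolding g_def by measurable
   qed (use i in auto)
  qed (simp add: g_def)
  then have [measurable]: "g \<in> \<M>" by auto
  have gW: "\<L> (%x. g x * W x)"
   by (rule integrable_squeeze[of "%x. g x * (4 * real DIM('a))"]) (use gi Wb in \<open>auto simp: abs_mult intro!: AE_I2 mult_left_mono\<close>)
  have gw: "\<L> (%x. g x * wt x ^ 5)"
   by (rule integrable_squeeze[of g]) (use gi pw(1) in \<open>auto simp: abs_mult abs_of_nonneg[OF pw(2)] intro!: AE_I2 mult_left_le\<close>)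
  then show "\<L> (%x. ?bu n x)" by (simp add: g_def)
  have Wg: "3 * (g x * wt x ^ 5) \<le> g x * W x" for x using mult_left_mono[OF Wb(3) gi(2), of x x] by simp
  have "3 * (\<integral>x. g x * wt x ^ 5) = (\<integral>x. 3 * (g x * wt x ^ 5))" by simp
  also have "\<dots> \<le> (\<integral>x. g x * W x)"
   by (rule integral_mono) (use gw gW Wg in auto)
  finally have l: "lam * (3 * (\<integral>x. g x * wt x ^ 5)) \<le> lam * (\<integral>x. g x * W x)" using lam0 by (intro mult_left_mono) auto
  have nn: "0 \<le> (\<integral>x. \<bar>u1 n x - u2 n x\<bar> * wt x)" by (intro Bochner_Integration.integral_nonneg mult_nonneg_nonneg abs_ge_zero less_imp_le wt_bounds(1))
  have "(\<integral>x. \<bar>u1 n x - u2 n x\<bar> * wt x) + lam * (\<integral>x. g x * W x) \<le> F + lam * m0 * (\<integral>x. h n x * (wt x)^2)"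
   unfolding F_def h_def g_def W_def u1_def u2_def
  proof (rule U_weighted_contraction[OF \<xi>(1,2) lam f, where P=4])
   show "!!i x :: 'a. i \<in> Basis ==> \<bar>- (x \<bullet> i) * wt x ^ 3\<bar> \<le> 4" by (rule bd1)
   show "!!i x :: 'a. i \<in> Basis ==> \<bar>- (wt x ^ 3) + 3 * (x \<bullet> i)^2 * wt x ^ 5\<bar> \<le> 4" by (rule bd2)
   show "!!i :: 'a. i \<in> Basis ==> has_dderiv wt i (%x. - (x \<bullet> i) * wt x ^ 3)" by (rule wt_dderiv)
   show "!!i :: 'a. i \<in> Basis ==> has_dderiv (%x. - (x \<bullet> i) * wt x ^ 3) i (%x. - (wt x ^ 3) + 3 * (x \<bullet> i)^2 * wt x ^ 5)" by (rule wt_dderiv2)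
   show "!!x y :: 'a. \<bar>\<Sum>i\<in>Basis. (y \<bullet> i) * (- (x \<bullet> i) * wt x ^ 3)\<bar> \<le> norm y * (wt x)^2" by (rule qb)
   show "0 \<le> wt x" "wt x \<le> 4" for x :: 'a using wt_bounds(1,2)[of x] by auto
   show "(wt x)^2 \<le> 4" for x :: 'a using wt2(2)[of x] by linarith
  qed (use wt2 in measurable)
  then show "3 * lam * (\<integral>x. ?bu n x) \<le> F + lam * m0 * (\<integral>x. h n x * (wt x)^2)"
   using l nn by (simp add: g_def)
 qed
 define c where "c n = (F + lam * m0 * (\<integral>x. h n x * (wt x)^2)) / (3 * lam)" for n
 define c' where "c' = (F + lam * m0 * (\<integral>x. h' x * (wt x)^2)) / (3 * lam)"
 have cl: "c ----> c'" unfolding c_def c'_def using lam0 by (intro tendsto_intros lim) auto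
 have cm: "(\<integral>x. ?bu n x) \<le> c n" for n
  using main[of n] lam0 by (simp add: c_def field_simps)
 have vlim: "AE x. (%n. ?bu n x) ----> ?by x"
  using all
 proof eventually_elim
  case (elim x)
  have "(%n. bt (\<xi> n) (u1 n x)) ----> \<beta> (y1 x)" "(%n. bt (\<xi> n) (u2 n x)) ----> \<beta> (y2 x)"
   by (rule bt_tendsto[OF \<xi>, where M="3 * M1"], use elim in auto)
    (rule bt_tendsto[OF \<xi>, where M="3 * M2"], use elim in auto)
  then show ?case by (intro tendsto_intros)
 qed
 have vn: "AE x. 0 \<le> ?bu n x" for n by (intro AE_I2 mult_nonneg_nonneg abs_ge_zero pw(2))
 note fat = integral_fatou_le[OF vi vn cm cl _ vlim]
 show "\<L> (%x. ?by x)" by (rule fat(1)) measurable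
 have "(\<integral>x. ?by x) \<le> c'" by (rule fat(2)) measurable
 then have "3 * lam * (\<integral>x. ?by x) \<le> F + lam * m0 * (\<integral>x. h' x * (wt x)^2)"
  using lam0 by (simp add: c'_def field_simps)
 also have "\<dots> \<le> ?f12 + lam * m0 * (\<integral>x. h' x)"
 proof (intro add_mono F mult_left_mono integral_mono)
  show "\<L> (%x. h' x * (wt x)^2)"
   by (rule integrable_squeeze[of h']) (use h'i wt2 in \<open>auto simp: abs_mult h'_def intro!: AE_I2 mult_left_le\<close>)
  show "h' x * (wt x)^2 \<le> h' x" for x using wt2(2)[of x] by (intro mult_left_le) (auto simp: h'_def)
  show "0 \<le> lam * m0" using lam0 m0_nonneg by simp
 qed (use h'i in auto)
 finally show "3 * lam * (\<integral>x. ?by x) \<le>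
   ?f12 + lam * m0 * (\<integral>x. \<bar>b (y1 x) * y1 x - b (y2 x) * y2 x\<bar>)" by (simp add: h'_def)
qed

end

lemma wt_ge: assumes "bounded S" obtains c where "c > 0" "!!x. x \<in> S ==> c \<le> wt x ^ 5"
proof -
 obtain R where R: "!!x. x \<in> S ==> norm x \<le> R" using assms by (auto simp: bounded_iff)
 have p: "1 + y \<bullet> y > 0" for y :: 'a by (simp add: add_pos_nonneg)
 show thesis
 proof (rule that[of "(1 / sqrt (1 + R^2)) ^ 5"])
  show "(1 / sqrt (1 + R^2)) ^ 5 > 0" by (simp add: add_pos_nonneg)
  fix x assume "x \<in> S"
  then have "(norm x)^2 \<le> R^2" using R by (intro power_mono) auto
  then have "1 / sqrt (1 + R^2) \<le> wt x" using p[of x] unfolding wt_def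
   by (intro divide_left_mono) (auto simp: power2_norm_eq_inner add_pos_nonneg)
  then show "(1 / sqrt (1 + R^2)) ^ 5 \<le> wt x ^ 5" by (intro power_mono) auto
 qed
qed

text \<open>The weight is bounded below by a positive constant on the compact support.\<close>

lemma test_le_wt:
 fixes \<phi> :: "'a::euclidean_space => real"
 assumes "\<phi> \<in> test_functions" obtains C where "C \<ge> 0" "!!x. \<bar>\<phi> x\<bar> \<le> C * wt x ^ 5"
proof -
 obtain K where K: "compact K" "!!x. x \<notin> K ==> \<phi> x = 0" using test_compact_support[OF assms] by blast
 obtain B where B: "B \<ge> 0" "!!x. \<bar>\<phi> x\<bar> \<le> B" using test_bounded[OF assms] by blast
 obtain c where c: "c > 0" "!!x. x \<in> K ==> c \<le> wt x ^ 5" using wt_ge[OF compact_imp_bounded[OF K(1)]] by blast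
 show thesis
 proof (rule that[of "B / c"])
  fix x :: 'a
  have "0 \<le> wt x ^ 5" using wt_bounds(1)[of x] by simp
  then show "\<bar>\<phi> x\<bar> \<le> B / c * wt x ^ 5"
   using B K(2)[of x] c mult_mono[OF B(2)[of x] c(2)[of x]] by (cases "x \<in> K") (simp_all add: field_simps)
 qed (use B c in simp)
qed

context fpe_resolvents
begin

text \<open>r b(r) need not be Lipschitz. In b(y_n)(y_n - y) + (b(y_n) - b(y)) y the first part is
  small by boundedness of b, the second by a.e. convergence and domination by |y|.\<close>

lemma flux_L1_tendsto:
 fixes y :: "nat => 'a => real"
 assumes y: "!!n. \<L> (y n)" "\<L> y'" "(%n. \<integral>x. \<bar>y n x - y' x\<bar>) ----> 0"
  and ae: "AE x. (%n. y n x) ----> y' x"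
 shows "(%n. \<integral>x. \<bar>b (y n x) * y n x - b (y' x) * y' x\<bar>) ----> 0"
proof (rule Lim_null_comparison)
 have [measurable]: "y n \<in> \<M>" "y' \<in> \<M>" for n using y by auto
 have le: "\<bar>(b (y n x) - b (y' x)) * y' x\<bar> \<le> b0 * \<bar>y' x\<bar>" for n x
  unfolding abs_mult using b_nonneg[of "y n x"] b_nonneg[of "y' x"] b0[of "y n x"] b0[of "y' x"] by (intro mult_right_mono) auto
 have "(%n. \<integral>x. \<bar>(b (y n x) - b (y' x)) * y' x\<bar>) ----> (\<integral>x. 0 \<partial>(lborel :: 'a measure))"
 proof (rule integral_dominated_convergence[where w="%x. b0 * \<bar>y' x\<bar>"])
  show "AE x. (%n. \<bar>(b (y n x) - b (y' x)) * y' x\<bar>) ----> 0"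
   using ae
  proof eventually_elim
   case (elim x)
   have "(%n. \<bar>(b (y n x) - b (y' x)) * y' x\<bar>) ----> \<bar>(b (y' x) - b (y' x)) * y' x\<bar>"
    by (intro tendsto_intros continuous_on_tendsto_compose[OF b_cont[of UNIV] elim]) auto
   then show ?case by simp
  qed
 qed (use y le in auto)
 then show "(%n. b0 * (\<integral>x. \<bar>y n x - y' x\<bar>) + (\<integral>x. \<bar>(b (y n x) - b (y' x)) * y' x\<bar>)) ----> 0"
  using tendsto_add[OF tendsto_mult_right_zero[OF y(3), of b0]] by simp
 have i2: "\<L> (%x. \<bar>(b (y n x) - b (y' x)) * y' x\<bar>)" for n
  by (rule integrable_squeeze[of "%x. b0 * \<bar>y' x\<bar>"]) (use y le in auto)
 have "(\<integral>x. \<bar>b (y n x) * y n x - b (y' x) * y' x\<bar>) \<le> (\<integral>x. b0 * \<bar>y n x - y' x\<bar> + \<bar>(b (y n x) - b (y' x)) * y' x\<bar>)" for n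
 proof (rule integral_mono_abs)
  show "AE x. \<bar>b (y n x) * y n x - b (y' x) * y' x\<bar> \<le> b0 * \<bar>y n x - y' x\<bar> + \<bar>(b (y n x) - b (y' x)) * y' x\<bar>"
  proof (rule AE_I2)
   fix x
   have "b (y n x) * y n x - b (y' x) * y' x = b (y n x) * (y n x - y' x) + (b (y n x) - b (y' x)) * y' x" by (simp add: algebra_simps)
   moreover have "\<bar>b (y n x) * (y n x - y' x)\<bar> \<le> b0 * \<bar>y n x - y' x\<bar>"
    unfolding abs_mult using b_nonneg[of "y n x"] b0[of "y n x"] by (intro mult_right_mono) auto
   ultimately show "\<bar>b (y n x) * y n x - b (y' x) * y' x\<bar> \<le> b0 * \<bar>y n x - y' x\<bar> + \<bar>(b (y n x) - b (y' x)) * y' x\<bar>" by linarith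
  qed
 qed (use y i2[of n] in auto)
 then show "\<forall>\<^sub>F n in sequentially. norm (\<integral>x. \<bar>b (y n x) * y n x - b (y' x) * y' x\<bar>) \<le>
   b0 * (\<integral>x. \<bar>y n x - y' x\<bar>) + (\<integral>x. \<bar>(b (y n x) - b (y' x)) * y' x\<bar>)"
  using i2 y by simp
qed

text \<open>For the truncated data, \<open>J_weighted_contraction\<close> makes \<beta>(z n) a
  Cauchy sequence in L^1 with weight wt^5. Fatou in the second index identifies the limit as
  \<beta>(y) and gives the rate c' n, so the equation passes to the limit.\<close>

lemma J_weak_eq_L1:
 assumes d3: "DIM('a) \<ge> 3" and lam: "small lam" and g: "g \<in> L1"
 shows "weak_eq (%x. \<beta> (J lam g x)) (%x. (b (J lam g x) * J lam g x) *\<^sub>R D x) (%x. (g x - J lam g x) / lam)"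
proof -
 have lam0: "lam > 0" using lam by (simp add: small_def)
 define y where "y = J lam g"
 have Jt: "\<L> (J lam (truncate g n))" for n using J_L1[OF lam0, of "truncate g n"] truncate_mem[OF g, of n] by (simp add: L1_def)
 have gi: "\<L> g" "\<L> y" using g J_L1[OF lam0 g] by (auto simp: L1_def y_def)
 have Jlim: "(%n. \<integral>x. \<bar>J lam (truncate g n) x - y x\<bar>) ----> 0"
  unfolding y_def by (rule J_L1_lim[OF lam0 g truncate_mem[OF g] truncate_L1_lim[OF g]])
 obtain r where r: "strict_mono r" "AE x. (%n. J lam (truncate g (r n)) x) ----> y x"
  using L1_lim_AE_subseq[OF Jt gi(2) Jlim] by blast
 define h where "h n = truncate g (r n)" for n
 define z where "z n = J lam (h n)" for n
 have h: "h n \<in> L1 \<inter> Linf" for n unfolding h_def by (rule truncate_mem[OF g])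
 have i: "\<L> (z n)" "\<L> (h n)" for n
  using Jt[of "r n"] h[of n] by (simp_all add: z_def h_def L1_def)
 have [measurable]: "z n \<in> \<M>" "y \<in> \<M>" "h n \<in> \<M>" "g \<in> \<M>" for n using i gi by auto
 have zl: "(%n. \<integral>x. \<bar>z n x - y x\<bar>) ----> 0" and hl: "(%n. \<integral>x. \<bar>h n x - g x\<bar>) ----> 0"
  using LIMSEQ_subseq_LIMSEQ[OF Jlim r(1)] LIMSEQ_subseq_LIMSEQ[OF truncate_L1_lim[OF g] r(1)] by (simp_all add: z_def h_def o_def)
 have ae: "AE x. (%n. z n x) ----> y x" using r(2) by (simp add: z_def h_def)
 define B where "B n x = b (z n x) * z n x" for n x
 define B' where "B' x = b (y x) * y x" for x
 have [measurable]: "B n \<in> \<M>" "B' \<in> \<M>" for n unfolding B_def B'_def by measurable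
 have Bi: "\<L> (B n)" "\<L> B'" for n
 proof -
  show "\<L> (B n)" by (rule integrable_squeeze[of "%x. b0 * \<bar>z n x\<bar>"]) (use i b_flux_bound in \<open>auto simp: B_def\<close>)
  show "\<L> B'" by (rule integrable_squeeze[of "%x. b0 * \<bar>y x\<bar>"]) (use gi b_flux_bound in \<open>auto simp: B'_def\<close>)
 qed
 have Bl: "(%n. \<integral>x. \<bar>B n x - B' x\<bar>) ----> 0"
  unfolding B_def B'_def by (rule flux_L1_tendsto[OF i(1) gi(2) zl ae])
 define c where "c n m = ((\<integral>x. \<bar>h n x - h m x\<bar>) + lam * m0 * (\<integral>x. \<bar>B n x - B m x\<bar>)) / (3 * lam)" for n m
 define c' where "c' n = ((\<integral>x. \<bar>h n x - g x\<bar>) + lam * m0 * (\<integral>x. \<bar>B n x - B' x\<bar>)) / (3 * lam)" for n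
 have cl: "(%m. c n m) ----> c' n" for n
  unfolding c_def c'_def using lam0
  by (intro tendsto_intros L1_dist_tendsto i Bi gi hl Bl) auto
 have c'l: "c' ----> 0"
 proof -
  have "c' ----> (0 + lam * m0 * 0) / (3 * lam)" unfolding c'_def using lam0 by (intro tendsto_intros hl Bl) auto
  then show ?thesis by simp
 qed
 note wc = J_weighted_contraction[OF d3 lam h h, folded z_def]
 have cm: "(\<integral>x. \<bar>\<beta> (z n x) - \<beta> (z m x)\<bar> * wt x ^ 5) \<le> c n m" for n m
  using wc(2)[of n m] lam0 by (simp add: c_def B_def field_simps)
 have wt5: "0 \<le> wt x ^ 5" for x :: 'a using wt_bounds(1)[of x] by simp
 have zlim: "AE x. (%m. \<bar>\<beta> (z n x) - \<beta> (z m x)\<bar> * wt x ^ 5) ----> \<bar>\<beta> (z n x) - \<beta> (y x)\<bar> * wt x ^ 5" for n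
  using ae by eventually_elim (intro tendsto_intros continuous_on_tendsto_compose[OF \<beta>.\<Phi>_cont[of UNIV]], auto)
 have fat: "\<L> (%x. \<bar>\<beta> (z n x) - \<beta> (y x)\<bar> * wt x ^ 5)" "(\<integral>x. \<bar>\<beta> (z n x) - \<beta> (y x)\<bar> * wt x ^ 5) \<le> c' n" for n
  by (rule integral_fatou_le[OF wc(1) _ cm cl _ zlim]; use wt5 in simp)+
 have "weak_eq (%x. \<beta> (y x)) (%x. B' x *\<^sub>R D x) (%x. (g x - y x) / lam)"
 proof (rule weak_eq_limit[OF J_weak_eq[OF lam h, folded z_def]])
  show "test_lim (%n x. \<beta> (z n x)) (%x. \<beta> (y x))"
  proof (rule test_lim_weighted[OF _ _ fat(1)])
   fix n
   obtain M where M: "M > 0" "AE x. \<bar>z n x\<bar> \<le> M"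
    using J_Linf[OF lam0 h[of n]] unfolding z_def by (rule Linf_bound)
   show "(%x. \<beta> (z n x)) \<in> L1_loc"
   proof (rule Linf_L1_loc)
    show "AE x. \<bar>\<beta> (z n x)\<bar> \<le> lip M * M"
     using M(2)
    proof eventually_elim
     case (elim x)
     then show ?case using \<beta>_abs_le[OF elim] mult_left_mono[OF elim lip(1)[of M]] by linarith
    qed
   qed measurable
  next
   show "(%n. \<integral>x. \<bar>\<beta> (z n x) - \<beta> (y x)\<bar> * wt x ^ 5) ----> 0"
    by (rule Lim_null_comparison[OF always_eventually c'l]) (use fat(2) wt5 in simp)
   show "\<exists>C. \<forall>x. \<bar>\<phi> x\<bar> \<le> C * wt x ^ 5" if "\<phi> \<in> test_functions" for \<phi> :: "'a => real" using test_le_wt[OF that] by metis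
  qed measurable
  show "test_lim (%n x. ((b (z n x) * z n x) *\<^sub>R D x) \<bullet> i) (%x. (B' x *\<^sub>R D x) \<bullet> i)" if i: "i \<in> Basis" for i
   unfolding inner_scaleR_left B_def[symmetric]
  proof (rule test_lim_L1)
   have le: "AE x. \<bar>k x * (D x \<bullet> i)\<bar> \<le> m0 * \<bar>k x\<bar>" for k :: "'a => real"
    using m0 by eventually_elim (use Basis_le_norm[OF i] in \<open>auto simp: abs_mult mult.commute[of m0] intro!: mult_left_mono elim: order_trans[rotated]\<close>)
   have Di: "\<L> (%x. k x * (D x \<bullet> i))" if "\<L> k" for k
    by (rule integrable_squeeze[OF _ _ le]) (use that in auto)
   show "\<L> (%x. B n x * (D x \<bullet> i))" "\<L> (%x. B' x * (D x \<bullet> i))" for n using Bi by (intro Di; simp)+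
   show "(%n. \<integral>x. \<bar>B n x * (D x \<bullet> i) - B' x * (D x \<bullet> i)\<bar>) ----> 0"
   proof (rule Lim_null_comparison[OF always_eventually[OF allI] tendsto_mult_right_zero[OF Bl, of m0]])
    fix n
    have "(\<integral>x. \<bar>(B n x - B' x) * (D x \<bullet> i)\<bar>) \<le> (\<integral>x. m0 * \<bar>B n x - B' x\<bar>)"
     by (rule integral_mono_abs[OF _ _ le]) (use Bi in auto)
    then show "norm (\<integral>x. \<bar>B n x * (D x \<bullet> i) - B' x * (D x \<bullet> i)\<bar>) \<le> m0 * (\<integral>x. \<bar>B n x - B' x\<bar>)"
     by (simp add: left_diff_distrib)
   qed
  qed
  show "test_lim (%n x. (h n x - z n x) / lam) (%x. (g x - y x) / lam)"
   using L1_tendsto_lincomb[OF i(2,1) gi hl zl, of "1 / lam" "- 1 / lam"] i gi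
   by (intro test_lim_L1) (simp_all add: diff_divide_distrib)
 qed
 then show ?thesis by (simp add: y_def B'_def)
qed

text \<open>One step of the scheme for A is one step of J. By the definition of the domain v = J lam
  g for some g; the equation for J lam g determines w a.e., which forces g = f a.e. Since J acts on
  representatives, g is returned and \<open>J_contraction\<close> later disposes of the
  difference.\<close>

lemma resolvent_graph_J:
 assumes d3: "DIM('a) \<ge> 3" and lam: "small lam" and fv: "(f, v) \<in> resolvent_graph (A_graph \<beta> D b J) lam"
 obtains g where "g \<in> L1" "AE x. v x = J lam g x" "AE x. g x = f x"
proof -
 have lam0: "lam > 0" using lam by (simp add: small_def)
 obtain w where w: "(v, w) \<in> A0_graph \<beta> D b" "v \<in> dom_A J" "AE x. v x + lam * w x = f x" and f: "f \<in> L1"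
  using fv by (auto simp: resolvent_graph_def A_graph_def)
 obtain g where g: "g \<in> L1" "AE x. v x = J lam g x" using w(2) lam0 by (auto simp: dom_A_def)
 have vi: "\<L> v" "\<L> w" "\<L> g" "\<L> (J lam g)"
  using w(1) g(1) J_L1[OF lam0 g(1)] by (auto simp: A0_graph_def L1_def)
 then have [measurable]: "v \<in> \<M>" "w \<in> \<M>" "g \<in> \<M>" "J lam g \<in> \<M>" by auto
 have "AE x. w x = (g x - J lam g x) / lam"
 proof (rule L1_eq_of_test[OF \<rho>])
  show "\<L> w" "\<L> (%x. (g x - J lam g x) / lam)" using vi by auto
  fix \<phi> :: "'a => real" assume \<phi>: "\<phi> \<in> test_functions"
  note [measurable] = test_measurable[OF \<phi>] laplacian_measurable[OF \<phi>] grad_measurable[OF \<phi>]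
  have "(\<integral>x. w x * \<phi> x) = - (\<integral>x. \<beta> (v x) * laplacian \<phi> x) - (\<integral>x. b (v x) * v x * (D x \<bullet> grad \<phi> x))"
   using w(1) \<phi> by (simp add: A0_graph_def)
  also have "(\<integral>x. \<beta> (v x) * laplacian \<phi> x) = (\<integral>x. \<beta> (J lam g x) * laplacian \<phi> x)"
   by (rule integral_cong_AE) (use g(2) in auto)
  also have "(\<integral>x. b (v x) * v x * (D x \<bullet> grad \<phi> x)) = (\<integral>x. ((b (J lam g x) * J lam g x) *\<^sub>R D x) \<bullet> grad \<phi> x)"
   by (rule integral_cong_AE) (use g(2) in auto)
  also have "- (\<integral>x. \<beta> (J lam g x) * laplacian \<phi> x) - (\<integral>x. ((b (J lam g x) * J lam g x) *\<^sub>R D x) \<bullet> grad \<phi> x) = (\<integral>x. (g x - J lam g x) / lam * \<phi> x)"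
   using J_weak_eq_L1[OF d3 lam g(1)] \<phi> by (simp add: weak_eq_def)
  finally show "(\<integral>x. w x * \<phi> x) = (\<integral>x. (g x - J lam g x) / lam * \<phi> x)" .
 qed
 then have "AE x. g x = f x" using w(3) g(2)
 proof eventually_elim
  case (elim x)
  then have "lam * w x = g x - J lam g x" using lam0 by simp
  then show ?case using elim by simp
 qed
 with g that show thesis by blast
qed

end

section \<open>Nash inequality\<close>


text \<open>Expanding the square, the correlation of w with its translate by h is at least |w|_2^2 -
  \<delta>^2 Q/2 for |h| < \<delta>. Integrating over this ball of shifts bounds it by (integral of
  w)^2. Q plays the part of the Dirichlet integral.\<close>

lemma nash_translation:
 fixes w :: "'a::euclidean_space => real"
 assumes w: "\<L> w" "w \<in> L2" "!!x. 0 \<le> w x" and \<delta>: "\<delta> > 0" and Q: "Q \<ge> 0"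
  and tr: "!!h. (\<integral>x. (w (x + h) - w x)^2) \<le> (norm h)^2 * Q"
 shows "unit_ball_vol DIM('a) * \<delta> ^ DIM('a) * ((\<integral>x. (w x)^2) - \<delta>^2 * Q / 2) \<le> (\<integral>x. w x)^2"
proof -
 have [measurable]: "w \<in> \<M>" using w by auto
 define G where "G = (\<integral>x. (w x)^2) - \<delta>^2 * Q / 2"
 define A where "A = (\<integral>x. w x)"
 have A: "A \<ge> 0" "(\<integral>\<^sup>+x. ennreal (w x)) = ennreal A"
  using nn_integral_eq_integral[OF w(1)] w(3) by (auto simp: A_def)
 have G: "ennreal G \<le> (\<integral>\<^sup>+x. ennreal (w x * w (x + h)))" if "h \<in> ball 0 \<delta>" for h
 proof -
  note sh = L2_shift[OF w(2), of h]
  have i: "\<L> (%x. w x * w (x + h))" by (rule L2_mult[OF w(2) sh])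
  have "(\<integral>x. (w (x + h) - w x)^2) = (\<integral>x. (w (x + h))^2 + (w x)^2 - 2 * (w x * w (x + h)))"
   by (simp add: power2_diff mult_ac)
  also have "\<dots> = (\<integral>x. (w (x + h))^2) + (\<integral>x. (w x)^2) - 2 * (\<integral>x. w x * w (x + h))"
   using i L2_integrable[OF sh] L2_integrable[OF w(2)] by simp
  also have "(\<integral>x. (w (x + h))^2) = (\<integral>x. (w x)^2)" by (rule integral_shift) measurable
  finally have "2 * (\<integral>x. w x * w (x + h)) \<ge> 2 * (\<integral>x. (w x)^2) - (norm h)^2 * Q" using tr[of h] by linarith
  moreover have "(norm h)^2 * Q \<le> \<delta>^2 * Q" using that Q by (intro mult_right_mono power_mono) auto
  ultimately have "G \<le> (\<integral>x. w x * w (x + h))" by (simp add: G_def)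
  then show ?thesis using nn_integral_eq_integral[OF i] w(3) by (simp add: ennreal_leI)
 qed
 have "ennreal G * emeasure lborel (ball (0::'a) \<delta>) = (\<integral>\<^sup>+h. ennreal G * indicator (ball (0::'a) \<delta>) h)"
  by (simp add: nn_integral_cmult_indicator)
 also have "\<dots> \<le> (\<integral>\<^sup>+h. \<integral>\<^sup>+x. ennreal (w x * w (x + h)))"
  by (intro nn_integral_mono) (auto simp: indicator_def G)
 also have "\<dots> = (\<integral>\<^sup>+x. \<integral>\<^sup>+h. ennreal (w x * w (x + h)))"
  by (rule lborel_pair.Fubini') measurable
 also have "\<dots> = (\<integral>\<^sup>+x. ennreal (w x) * ennreal A)"
 proof (rule nn_integral_cong)
  fix x
  have "(\<integral>\<^sup>+h. ennreal (w x * w (x + h))) = (\<integral>\<^sup>+h. ennreal (w x) * ennreal (w (h + x)))"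
   using w(3) by (simp add: ennreal_mult add.commute)
  also have "\<dots> = ennreal (w x) * (\<integral>\<^sup>+h. ennreal (w (h + x)))" by (rule nn_integral_cmult) measurable
  also have "(\<integral>\<^sup>+h. ennreal (w (h + x))) = ennreal A"
   using nn_integral_shift[of "%h. ennreal (w h)" x] A(2) by simp
  finally show "(\<integral>\<^sup>+h. ennreal (w x * w (x + h))) = ennreal (w x) * ennreal A" .
 qed
 also have "\<dots> = ennreal (A^2)" using A by (simp add: nn_integral_multc ennreal_mult power2_eq_square)
 finally have "ennreal (unit_ball_vol DIM('a) * \<delta> ^ DIM('a) * G) \<le> ennreal (A^2)" if "G \<ge> 0"
  using that \<delta> by (simp add: emeasure_ball ennreal_mult mult.commute)
 moreover have "unit_ball_vol DIM('a) * \<delta> ^ DIM('a) > 0" using \<delta> by simp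
 ultimately have "unit_ball_vol DIM('a) * \<delta> ^ DIM('a) * G \<le> A^2"
  using mult_nonneg_nonpos[of "unit_ball_vol DIM('a) * \<delta> ^ DIM('a)" G] zero_le_power2[of A] by (cases "G \<ge> 0") (simp, linarith)
 then show ?thesis by (simp add: G_def A_def)
qed

lemma nash_decay:
 fixes w :: "'a::euclidean_space => real"
 assumes w: "\<L> w" "w \<in> L2" "!!x. 0 \<le> w x" and Q: "Q \<ge> 0"
  and tr: "!!h. (\<integral>x. (w (x + h) - w x)^2) \<le> (norm h)^2 * Q"
  and A: "A > 0" "(\<integral>x. w x) \<le> A"
 defines "E \<equiv> (\<integral>x. (w x)^2)"
 shows "E powr (1 + 2 / DIM('a)) * (unit_ball_vol DIM('a) / (2 * A^2)) powr (2 / DIM('a)) \<le> Q"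
proof (cases "E = 0")
 case True then show ?thesis using Q by simp
next
 case False
 define d where "d = real DIM('a)"
 define \<omega> where "\<omega> = unit_ball_vol DIM('a)"
 have d: "d > 0" by (simp add: d_def)
 have \<omega>: "\<omega> > 0" by (simp add: \<omega>_def)
 have E: "E > 0" using False by (simp add: E_def less_le)
 \<comment> \<open>The radius is chosen so that \<omega> \<delta>^d = 2A^2/E; then
   \<open>nash_translation\<close> reduces to E <= \<delta>^2 Q, which is the claim.\<close>
 define z where "z = \<omega> * E / (2 * A^2)"
 have z: "z > 0" using \<omega> E A by (simp add: z_def)
 define \<delta> where "\<delta> = z powr (- (1 / d))"
 have \<delta>: "\<delta> > 0" using z by (simp add: \<delta>_def)
 have \<delta>d: "\<delta> ^ DIM('a) = 1 / z"
 proof -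
  have "\<delta> ^ DIM('a) = \<delta> powr d" unfolding d_def by (rule powr_realpow[OF \<delta>, symmetric])
  also have "\<dots> = z powr (- 1)" unfolding \<delta>_def powr_powr using d by simp
  finally show ?thesis using z by (simp add: powr_minus_divide)
 qed
 have \<delta>2: "\<delta>^2 = z powr (- (2 / d))" using z by (simp add: \<delta>_def powr_realpow[symmetric] powr_powr)
 have "\<omega> * \<delta> ^ DIM('a) * (E - \<delta>^2 * Q / 2) \<le> (\<integral>x. w x)^2"
  unfolding E_def \<omega>_def by (rule nash_translation[OF w \<delta> Q tr])
 also have "\<dots> \<le> A^2" using A w(3) by (intro power_mono) auto
 finally have "2 * A^2 / E * (E - \<delta>^2 * Q / 2) \<le> A^2" using \<omega> by (simp add: \<delta>d z_def)
 then have "2 * A^2 * (E - \<delta>^2 * Q / 2) \<le> A^2 * E" using E by (simp add: field_simps)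
 then have "A^2 * (2 * (E - \<delta>^2 * Q / 2)) \<le> A^2 * E" by (simp only: mult_ac)
 then have "2 * (E - \<delta>^2 * Q / 2) \<le> E" using A by simp
 then have "E \<le> z powr (- (2 / d)) * Q" by (simp add: \<delta>2)
 then have "z powr (2 / d) * E \<le> z powr (2 / d) * (z powr (- (2 / d)) * Q)" by (intro mult_left_mono) auto
 also have "\<dots> = Q" using z by (simp add: powr_minus)
 also have "z powr (2 / d) * E = E powr (1 + 2 / d) * (\<omega> / (2 * A^2)) powr (2 / d)"
  using E \<omega> A by (simp add: z_def powr_add powr_mult powr_divide)
 finally show ?thesis by (simp add: d_def \<omega>_def)
qed

text \<open>The implicit Euler analogue of x' = -c x^(1+\<nu>), along which x^(-\<nu>) grows at the
  rate c \<nu>. Each step raises x^(-\<nu>) by at least c \<nu> 2^(-\<nu>-1); c X^\<nu> <= 1 keeps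
  the relative decrease per step bounded.\<close>

lemma discrete_power_decay:
 fixes x :: "nat => real"
 assumes \<nu>: "\<nu> > 0" and c: "c > 0" and x0: "!!i. 0 \<le> x i" and X: "x 0 \<le> X" "c * X powr \<nu> \<le> 1"
  and step: "!!i. i < n ==> x (Suc i) + c * x (Suc i) powr (1 + \<nu>) \<le> x i" and n: "n > 0"
 shows "x n \<le> (real n * c * (\<nu> * 2 powr (- \<nu> - 1))) powr (- (1 / \<nu>))"
proof (cases "x n = 0")
 case False
 define c1 where "c1 = \<nu> * 2 powr (- \<nu> - 1)"
 have c1: "c1 > 0" using \<nu> by (simp add: c1_def)
 have mono: "x (Suc i) \<le> x i" if "i < n" for i
 proof -
  have "0 \<le> c * x (Suc i) powr (1 + \<nu>)" using c by simp
  then show ?thesis using step[OF that] by linarith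
 qed
 have low: "x n \<le> x i" if "i \<le> n" for i
  using that
 proof (induction i rule: inc_induct)
  case (step i) then show ?case using mono[of i] by linarith
 qed simp
 have up: "x i \<le> X" if "i \<le> n" for i
  using that
 proof (induction i)
  case (Suc i) then show ?case using mono[of i] by linarith
 qed (use X in simp)
 have pos: "x i > 0" if "i \<le> n" for i using low[OF that] x0[of n] False by linarith
 have z: "x (Suc i) powr (- \<nu>) \<ge> x i powr (- \<nu>) + c * c1" if i: "i < n" for i
 proof -
  define p where "p = x (Suc i) powr \<nu>"
  have xp: "x (Suc i) > 0" "x i > 0" using pos i by auto
  then have p: "p > 0" by (simp add: p_def)
  define q where "q = c * p"
  have "p \<le> X powr \<nu>" unfolding p_def using \<nu> xp up[of "Suc i"] i by (intro powr_mono2) auto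
  then have "c * p \<le> c * X powr \<nu>" using c by (intro mult_left_mono) auto
  then have q: "q > 0" "q \<le> 1" using mult_pos_pos[OF c p] X(2) unfolding q_def by linarith+
  have "x (Suc i) * (1 + q) \<le> x i" using step[OF i] xp by (simp add: q_def p_def powr_add algebra_simps)
  then have "x i powr (- \<nu>) \<le> (x (Suc i) * (1 + q)) powr (- \<nu>)" using xp q \<nu> by (intro powr_mono2') auto
  also have "\<dots> = x (Suc i) powr (- \<nu>) * (1 + q) powr (- \<nu>)" using xp q by (simp add: powr_mult)
  also have "\<dots> = (1 / p) * (1 + q) powr (- \<nu>)" using xp by (simp add: p_def powr_minus_divide)
  also have "\<dots> \<le> (1 / p) * (1 - q * c1)"
  proof (rule mult_left_mono)
   \<comment> \<open>The mean value theorem on [1, 1 + q], a subinterval of [1, 2]; the factor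
     2^(-\<nu>-1) is the smallest value of the power there.\<close>
   have "\<exists>\<xi>>1. \<xi> < 1 + q \<and> (1 + q) powr (- \<nu>) - 1 powr (- \<nu>) = ((1 + q) - 1) * (- \<nu> * \<xi> powr (- \<nu> - 1))"
    by (rule MVT2) (use q in \<open>auto intro!: derivative_eq_intros\<close>)
   then obtain \<xi> where \<xi>: "1 < \<xi>" "\<xi> < 1 + q" "(1 + q) powr (- \<nu>) - 1 = q * (- \<nu> * \<xi> powr (- \<nu> - 1))" by auto
   have "2 powr (- \<nu> - 1) \<le> \<xi> powr (- \<nu> - 1)" using \<xi> q \<nu> by (intro powr_mono2') auto
   then have "q * (\<nu> * 2 powr (- \<nu> - 1)) \<le> q * (\<nu> * \<xi> powr (- \<nu> - 1))" using q \<nu> by (intro mult_left_mono) auto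
   then show "(1 + q) powr (- \<nu>) \<le> 1 - q * c1" using \<xi>(3) by (simp add: c1_def)
  qed (use p in simp)
  also have "\<dots> = x (Suc i) powr (- \<nu>) - c * c1" using xp p by (simp add: q_def p_def powr_minus_divide field_simps)
  finally show ?thesis by linarith
 qed
 have "real i * (c * c1) \<le> x i powr (- \<nu>)" if "i \<le> n" for i
  using that
 proof (induction i)
  case (Suc i) then show ?case using z[of i] by (simp add: algebra_simps)
 qed simp
 from this[of n] have zn: "real n * (c * c1) \<le> x n powr (- \<nu>)" by simp
 have "x n = (x n powr (- \<nu>)) powr (- (1 / \<nu>))" using pos[of n] \<nu> by (simp add: powr_powr)
 also have "\<dots> \<le> (real n * (c * c1)) powr (- (1 / \<nu>))" using zn c c1 n \<nu> by (intro powr_mono2') auto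
 finally show ?thesis by (simp add: c1_def mult.assoc)
qed simp

section \<open>Positive parts and levels\<close>

definition pos_part :: "real => real" where "pos_part x = max 0 x"

lemma pos_part_bounds: "0 \<le> pos_part x" "x \<le> pos_part x" "pos_part x \<le> \<bar>x\<bar>" "c \<ge> 0 ==> pos_part (x - c) \<le> pos_part x" "x > 0 ==> pos_part x = x" "x \<le> 0 ==> pos_part x = 0"
 by (auto simp: pos_part_def)

lemma pos_part_measurable[measurable]: "pos_part \<in> \<M>"
 unfolding pos_part_def by measurable

lemma pos_part_diff_le: "pos_part x - pos_part y \<le> \<bar>x - y\<bar>"
 by (auto simp: pos_part_def)

text \<open>From (x - 2h)^2 >= 0. It bounds the mass above a raised level by the squared L^2 norm
  above the old one, the gain that drives the iteration over levels.\<close>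

lemma pos_part_level: assumes "h > 0" shows "pos_part (x - h) \<le> (pos_part x)^2 / (4 * h)"
proof (cases "x > h")
 case True
 have "0 \<le> (x - 2 * h)^2" by simp
 then have "4 * h * (x - h) \<le> x^2" by (simp add: power2_eq_square algebra_simps)
 then show ?thesis using True assms by (simp add: pos_part_def field_simps)
qed (use assms in \<open>simp add: pos_part_def\<close>)

lemma ramp_scaled_lim: "(%n. ramp (real n * x)) ----> (if x > 0 then 1 else 0)"
proof (cases "x > 0")
 case True
 have "(%n. 1 - 1 / (1 + (real n * x)^2)) ----> 1 - 0"
 proof (intro tendsto_intros)
  show "(%n. 1 / (1 + (real n * x)^2)) ----> 0" using True by real_asymp
 qed
 moreover have "ramp (real n * x) = 1 - 1 / (1 + (real n * x)^2)" for n
 proof -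
  have "1 + (real n * x)^2 > 0" by (simp add: add_pos_nonneg)
  then show ?thesis using True by (simp add: ramp_def field_simps)
 qed
 ultimately show ?thesis using True by simp
next
 case False
 then have "ramp (real n * x) = 0" for n by (intro ramp_nonpos) (simp add: mult_nonneg_nonpos)
 then show ?thesis using False by simp
qed

lemma pos_part_integrable:
 fixes q :: "'a::euclidean_space => real"
 assumes "\<L> q" "c \<ge> 0" "\<sigma> = 1 \<or> \<sigma> = -1"
 shows "\<L> (%x. pos_part (\<sigma> * q x - c))"
proof (rule integrable_squeeze)
 have [measurable]: "q \<in> \<M>" using assms by auto
 show "(%x. pos_part (\<sigma> * q x - c)) \<in> \<M>" by measurable
 show "AE x. \<bar>pos_part (\<sigma> * q x - c)\<bar> \<le> \<bar>q x\<bar>" using assms by (intro AE_I2) (auto simp: pos_part_def)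
qed (use assms in auto)

lemma AE_abs_le_of_pos_part:
 fixes q :: "'a::euclidean_space => real"
 assumes q: "\<L> q" and c: "c \<ge> 0"
  and le: "!!\<sigma>. \<sigma> = 1 \<or> \<sigma> = -1 ==> (\<integral>x. pos_part (\<sigma> * q x - c)) \<le> 0"
 shows "AE x. \<bar>q x\<bar> \<le> c"
proof -
 have "AE x. pos_part (\<sigma> * q x - c) = 0" if \<sigma>: "\<sigma> = 1 \<or> \<sigma> = -1" for \<sigma>
 proof -
  have "(\<integral>x. pos_part (\<sigma> * q x - c)) = 0"
   using le[OF \<sigma>] pos_part_bounds(1) by (intro antisym Bochner_Integration.integral_nonneg) auto
  then show ?thesis using integral_nonneg_eq_0_iff_AE[OF pos_part_integrable[OF q c \<sigma>]] pos_part_bounds(1) by auto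
 qed
 from this[of 1] this[of "-1"] show ?thesis by (auto simp: pos_part_def max_def split: if_splits)
qed

section \<open>Energy estimates for the resolvents\<close>


context fpe_resolvents
begin

text \<open>The limit equation contains no cutoff, so m1 = 0 and the drift leaves no trace. The base
  level \<kappa>0 fixes one diffusion constant for all higher levels \<kappa> of the
  iteration.\<close>

lemma J_level:
 assumes lam: "small lam" and f: "f \<in> L1 \<inter> Linf" and \<kappa>: "0 < \<kappa>0" "\<kappa>0 \<le> \<kappa>"
  and s: "!!r. (s has_real_derivative s' r) (at r)" "continuous_on UNIV s'"
   "!!r. r \<le> \<kappa> ==> s r = 0" "!!r. r \<le> \<kappa> ==> s' r = 0" "!!r. 0 \<le> s' r" "!!r. s' r \<le> s1"
  and \<sigma>: "\<sigma> = 1 \<or> \<sigma> = -1"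
 defines "y \<equiv> J lam f"
 shows "(\<integral>x. (s (\<sigma> * y (x + w)) - s (\<sigma> * y x))^2) \<le>
  (norm w)^2 * (s1 / (a * \<kappa>0 powr (\<alpha> - 1) * lam) * (\<integral>x. (\<sigma> * f x - \<sigma> * y x) * s (\<sigma> * y x)))"
proof -
 have lam0: "lam > 0" using lam by (simp add: small_def)
 have fL: "f \<in> L1" "f \<in> Linf" using f by auto
 have yL: "y \<in> L1" "y \<in> Linf" unfolding y_def using J_L1[OF lam0 fL(1)] J_Linf[OF lam0 f] by auto
 have y2: "y \<in> L2" "f \<in> L2" using L1_Linf_L2 yL fL by blast+
 note [measurable] = L2_measurable[OF y2(1)] L2_measurable[OF y2(2)]
 interpret d: drift \<rho> D divD m0 "%_. 1" "%_ _. 0" 0 0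
  by standard (use \<rho> D_measurable m0 D_div has_dderiv_const in auto)
 define g where "g x = (f x - y x) / lam" for x
 have gL: "g \<in> L2" unfolding g_def[abs_def] using L2_cmult[OF L2_diff[OF y2(2,1)], of "1 / lam"] by simp
 obtain M where M: "M > 0" "AE x. \<bar>y x\<bar> \<le> M" using yL(2) by (rule Linf_bound)
 have \<beta>L: "(%x. \<beta> (y x)) \<in> L2"
 proof (rule L2_dominated[OF y2(1)])
  show "AE x. \<bar>\<beta> (y x)\<bar> \<le> lip M * \<bar>y x\<bar>" using M(2) by eventually_elim (rule \<beta>_abs_le)
 qed measurable
 have "(\<integral>x. (s (\<sigma> * y (x + w)) - s (\<sigma> * y x))^2) \<le>
  (norm w)^2 * (s1 / (a * \<kappa>0 powr (\<alpha> - 1)) * ((\<integral>x. \<sigma> * g x * s (\<sigma> * y x)) + 0 * b0 * (\<integral>x. \<sigma> * y x * s (\<sigma> * y x))))"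
 proof (rule d.level_translation_signed[OF \<beta>_nonlinearity \<beta>'_pos _ y2(1) \<beta>L gL b_cont b_nonneg b0 _ _ _ s \<sigma>])
  show "weak_eq (%x. \<beta> (y x)) (%x. (1 * (b (y x) * y x)) *\<^sub>R D x) g"
   using J_weak_eq[OF lam f] unfolding y_def g_def[abs_def] by simp
  show "a * \<kappa>0 powr (\<alpha> - 1) \<le> \<beta>' r" if "\<kappa> \<le> \<bar>r\<bar>" for r by (rule \<beta>'_level) (use that \<kappa> in auto)
 qed (use \<kappa> a in auto)
 also have "(\<integral>x. \<sigma> * g x * s (\<sigma> * y x)) = (\<integral>x. (\<sigma> * f x - \<sigma> * y x) * s (\<sigma> * y x) / lam)"
  by (simp add: g_def right_diff_distrib)
 also have "\<dots> = (\<integral>x. (\<sigma> * f x - \<sigma> * y x) * s (\<sigma> * y x)) / lam" by (rule integral_divide_zero)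
 finally show ?thesis by simp
qed

text \<open>The sign of the level estimate, tested with profiles ramp(n(\<sigma>y - \<kappa>)) that
  tend to the indicator of \<sigma>y > \<kappa>. On that set \<sigma>f - \<sigma>y is at most the
  difference of the two positive parts, and off it that difference is nonnegative.\<close>

lemma J_pos_part:
 assumes lam: "small lam" and f: "f \<in> L1 \<inter> Linf" and \<kappa>: "0 < \<kappa>" and \<sigma>: "\<sigma> = 1 \<or> \<sigma> = -1"
 shows "(\<integral>x. pos_part (\<sigma> * J lam f x - \<kappa>)) \<le> (\<integral>x. pos_part (\<sigma> * f x - \<kappa>))"
proof -
 define y where "y = J lam f"
 have lam0: "lam > 0" using lam by (simp add: small_def)
 have i: "\<L> f" "\<L> y" using f J_L1[OF lam0, of f] by (auto simp: L1_def y_def)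
 then have [measurable]: "f \<in> \<M>" "y \<in> \<M>" by auto
 note [measurable] = borel_measurable_continuous_onI[OF ramp_cont]
 define h where "h n x = (\<sigma> * f x - \<sigma> * y x) * ramp (real n * (\<sigma> * y x - \<kappa>))" for n x
 let ?d = "%x. \<sigma> * f x - \<sigma> * y x"
 let ?p = "%x. pos_part (\<sigma> * f x - \<kappa>)"
 let ?r = "%x. pos_part (\<sigma> * y x - \<kappa>)"
 have nn: "0 \<le> (\<integral>x. h n x)" for n
 proof (cases "n = 0")
  case True then show ?thesis by (simp add: h_def ramp_nonpos)
 next
  case False
  define s where "s r = ramp (real n * (r - \<kappa>))" for r
  have sd: "(s has_real_derivative ramp' (real n * (r - \<kappa>)) * real n) (at r)" for r
  proof -
   have "((%r. real n * (r - \<kappa>)) has_real_derivative real n) (at r)" by (auto intro!: derivative_eq_intros)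
   from DERIV_chain2[OF ramp_deriv this] show ?thesis by (simp add: s_def[abs_def])
  qed
  obtain w :: 'a where w: "w \<in> Basis" using nonempty_Basis by blast
  have le: "(\<integral>x. (s (\<sigma> * y (x + w)) - s (\<sigma> * y x))^2) \<le>
   (norm w)^2 * (2 * real n / (a * \<kappa> powr (\<alpha> - 1) * lam) * (\<integral>x. ?d x * s (\<sigma> * y x)))"
   unfolding y_def
  proof (rule J_level[OF lam f \<kappa> order_refl sd _ _ _ _ _ \<sigma>])
   show "continuous_on UNIV (%r. ramp' (real n * (r - \<kappa>)) * real n)"
    by (intro continuous_intros continuous_on_compose2[OF ramp'_cont]) auto
   show "s r = 0" "ramp' (real n * (r - \<kappa>)) * real n = 0" if "r \<le> \<kappa>" for r
    using that by (simp_all add: s_def ramp_nonpos mult_nonneg_nonpos)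
  qed (use ramp'_bounds in \<open>auto intro: mult_right_mono\<close>)
  have I: "(\<integral>x. ?d x * s (\<sigma> * y x)) = (\<integral>x. h n x)" by (simp add: h_def s_def)
  have "0 \<le> (norm w)^2 * (2 * real n / (a * \<kappa> powr (\<alpha> - 1) * lam) * (\<integral>x. h n x))"
   using le unfolding I by (rule order_trans[rotated]) simp
  moreover have "2 * real n / (a * \<kappa> powr (\<alpha> - 1) * lam) > 0" using False a \<kappa> lam0 by simp
  ultimately show ?thesis unfolding norm_Basis[OF w] power_one mult_1 by (simp only: zero_le_mult_iff) linarith
 qed
 define h' where "h' x = ?d x * (if \<sigma> * y x - \<kappa> > 0 then 1 else 0)" for x
 have [measurable]: "h n \<in> \<M>" "h' \<in> \<M>" for n unfolding h_def h'_def by measurable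
 have hl: "\<bar>(?d x) * c\<bar> \<le> \<bar>f x\<bar> + \<bar>y x\<bar>" if "0 \<le> c" "c \<le> 1" for c x
 proof -
  have "\<bar>\<sigma> * f x - \<sigma> * y x\<bar> * \<bar>c\<bar> \<le> (\<bar>f x\<bar> + \<bar>y x\<bar>) * 1" using that \<sigma> by (intro mult_mono) auto
  then show ?thesis by (simp add: abs_mult)
 qed
 have lim: "(%n. \<integral>x. h n x) ----> (\<integral>x. h' x)"
 proof (rule integral_dominated_convergence[where w="%x. \<bar>f x\<bar> + \<bar>y x\<bar>"])
  show "AE x. (%n. h n x) ----> h' x"
   unfolding h_def h'_def by (intro AE_I2 tendsto_intros ramp_scaled_lim)
  show "AE x. norm (h n x) \<le> \<bar>f x\<bar> + \<bar>y x\<bar>" for n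
   using hl[OF ramp_bounds] by (simp add: h_def)
 qed (use i in auto)
 have "0 \<le> (\<integral>x. h' x)" by (rule LIMSEQ_le_const[OF lim]) (use nn in auto)
 also have "\<dots> \<le> (\<integral>x. ?p x - ?r x)"
 proof (rule integral_mono)
  show "\<L> h'"
   by (rule integrable_squeeze[of "%x. \<bar>f x\<bar> + \<bar>y x\<bar>"]) (use i hl in \<open>auto simp: h'_def\<close>)
  show "h' x \<le> ?p x - ?r x" for x by (auto simp: h'_def pos_part_def)
 qed (use pos_part_integrable[OF i(1) _ \<sigma>] pos_part_integrable[OF i(2) _ \<sigma>] \<kappa> in auto)
 also have "\<dots> = (\<integral>x. ?p x) - (\<integral>x. ?r x)"
  using pos_part_integrable[OF i(1) _ \<sigma>] pos_part_integrable[OF i(2) _ \<sigma>] \<kappa> by simp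
 finally show ?thesis by (simp add: y_def)
qed

text \<open>The level estimate for s(r) = (r - \<kappa>)^+. The test term is (\<sigma>f - \<sigma>y)
  v, and (F - v) v <= (F^2 - v^2)/2 makes it a difference of energies, the discrete form of a time
  derivative.\<close>

lemma J_energy:
 assumes lam: "small lam" and f: "f \<in> L1 \<inter> Linf" and \<kappa>: "0 < \<kappa>0" "\<kappa>0 \<le> \<kappa>" and \<sigma>: "\<sigma> = 1 \<or> \<sigma> = -1"
 defines "v \<equiv> %x. pos_part (\<sigma> * J lam f x - \<kappa>)"
 shows "(\<integral>x. (v (x + w) - v x)^2) \<le>
  (norm w)^2 * (((\<integral>x. (pos_part (\<sigma> * f x - \<kappa>))^2) - (\<integral>x. (v x)^2)) / (2 * a * \<kappa>0 powr (\<alpha> - 1) * lam))"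
proof -
 define y where "y = J lam f"
 have lam0: "lam > 0" using lam by (simp add: small_def)
 have fL: "f \<in> L1" "f \<in> Linf" using f by auto
 have yL: "y \<in> L1" "y \<in> Linf" unfolding y_def using J_L1[OF lam0 fL(1)] J_Linf[OF lam0 f] by auto
 have L2: "y \<in> L2" "f \<in> L2" using L1_Linf_L2 yL fL by blast+
 note [measurable] = L2_measurable[OF L2(1)] L2_measurable[OF L2(2)]
 have pl: "0 \<le> pos_part (\<sigma> * r - \<kappa>)" "pos_part (\<sigma> * r - \<kappa>) \<le> \<bar>r\<bar>" for r
  using \<sigma> \<kappa> by (auto simp: pos_part_def)
 have v2: "v \<in> L2" unfolding v_def y_def[symmetric]
  by (rule L2_dominated[OF L2(1), of _ 1]) (use pl in auto)
 have F2: "(%x. pos_part (\<sigma> * f x - \<kappa>)) \<in> L2"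
  by (rule L2_dominated[OF L2(2), of _ 1]) (use pl in auto)
 note [measurable] = L2_measurable[OF v2]
 define \<theta> where "\<theta> n = inverse (real (Suc n))" for n
 let ?d = "%x. \<sigma> * f x - \<sigma> * y x"
 let ?q = "%x. (pos_part (\<sigma> * f x - \<kappa>))^2 - (v x)^2"
 have \<theta>: "\<theta> n > 0" "\<theta> ----> 0" for n using LIMSEQ_inverse_real_of_nat by (auto simp: \<theta>_def[abs_def])
 \<comment> \<open>(r - \<kappa>)^+ has a corner at \<kappa>; composing with \<open>abs_sm\<close>,
   whose derivative vanishes at 0, gives C^1 functions increasing to slope 1.\<close>
 define s where "s n r = abs_sm (\<theta> n) (pos_part (r - \<kappa>))" for n r
 let ?sd = "%n x. s n (\<sigma> * y (x + w)) - s n (\<sigma> * y x)"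
 have s_le: "0 \<le> s n r" "s n r \<le> pos_part (r - \<kappa>)" for n r
  using abs_sm_nonneg[OF \<theta>(1)] abs_sm_le_abs[OF \<theta>(1), of n "pos_part (r - \<kappa>)"] pos_part_bounds(1)[of "r - \<kappa>"] by (auto simp: s_def)
 have s_lim: "(%n. s n r) ----> pos_part (r - \<kappa>)" for r
  using abs_sm_lim[OF \<theta>(2), of "pos_part (r - \<kappa>)"] pos_part_bounds(1)[of "r - \<kappa>"] by (simp add: s_def)
 have s_deriv: "(s n has_real_derivative sgn_sm (\<theta> n) (pos_part (r - \<kappa>))) (at r)" for n r
 proof -
  have "((%r. (max 0 (r - \<kappa>))^2) has_real_derivative 2 * max 0 (r - \<kappa>)) (at r)"
  proof -
   have "((%r. r - \<kappa>) has_real_derivative 1) (at r)" by (auto intro!: derivative_eq_intros)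
   from DERIV_chain2[OF pos_part_square_deriv this] show ?thesis by simp
  qed
  from DERIV_chain2[OF DERIV_real_sqrt[OF root_pos(2)[OF \<theta>(1), of "max 0 (r - \<kappa>)" n]] DERIV_add[OF this DERIV_const[of "(\<theta> n)^2"], simplified]]
  have "((%r. sqrt ((max 0 (r - \<kappa>))^2 + (\<theta> n)^2) - \<theta> n) has_real_derivative
    inverse (sqrt ((max 0 (r - \<kappa>))^2 + (\<theta> n)^2)) / 2 * (2 * max 0 (r - \<kappa>)) - 0) (at r)"
   by (intro DERIV_diff DERIV_const)
  then show ?thesis by (simp add: s_def[abs_def] abs_sm_def pos_part_def sgn_sm_def field_simps)
 qed
 have s_cont: "continuous_on UNIV (s n)" for n using s_deriv by (meson DERIV_isCont continuous_at_imp_continuous_on)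
 note [measurable] = borel_measurable_continuous_onI[OF s_cont]
 define \<mu> where "\<mu> = a * \<kappa>0 powr (\<alpha> - 1) * lam"
 have \<mu>: "\<mu> > 0" using a \<kappa> lam0 by (simp add: \<mu>_def)
 have le: "(\<integral>x. ?sd n x^2) \<le> (norm w)^2 * (1 / \<mu> * (\<integral>x. ?d x * s n (\<sigma> * y x)))" for n
  unfolding \<mu>_def y_def
 proof (rule J_level[OF lam f \<kappa> s_deriv _ _ _ _ _ \<sigma>])
  show "continuous_on UNIV (%r. sgn_sm (\<theta> n) (pos_part (r - \<kappa>)))"
   unfolding pos_part_def by (intro continuous_on_compose2[OF sgn_sm_cont[OF \<theta>(1)]] continuous_intros) auto
  show "0 \<le> sgn_sm (\<theta> n) (pos_part (r - \<kappa>))" for r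
   using root_pos(1)[OF \<theta>(1)] pos_part_bounds(1) by (simp add: sgn_sm_def less_imp_le)
  show "sgn_sm (\<theta> n) (pos_part (r - \<kappa>)) \<le> 1" for r using sgn_sm_abs_le[OF \<theta>(1), of n "pos_part (r - \<kappa>)"] by linarith
  show "s n r = 0" "sgn_sm (\<theta> n) (pos_part (r - \<kappa>)) = 0" if "r \<le> \<kappa>" for r
   using that \<theta>(1)[of n] by (simp_all add: s_def abs_sm_def sgn_sm_def pos_part_bounds)
 qed
 have lim1: "(%n. \<integral>x. ?sd n x^2) ----> (\<integral>x. (v (x + w) - v x)^2)"
 proof (rule integral_dominated_convergence[where w="%x. 2 * (v (x + w))^2 + 2 * (v x)^2"])
  show "AE x. (%n. ?sd n x^2) ----> (v (x + w) - v x)\<^sup>2"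
   unfolding v_def y_def[symmetric] by (intro AE_I2 tendsto_intros s_lim)
  show "AE x. norm (?sd n x^2) \<le> 2 * (v (x + w))^2 + 2 * (v x)^2" for n
  proof (rule AE_I2)
   fix x
   have sq: "(s n (\<sigma> * y z))^2 \<le> (v z)^2" for z
    using s_le[of n "\<sigma> * y z"] by (intro power_mono) (auto simp: v_def y_def)
   have "(s n (\<sigma> * y (x + w)) + - s n (\<sigma> * y x))^2 \<le> 2 * (s n (\<sigma> * y (x + w)))^2 + 2 * (- s n (\<sigma> * y x))^2" by (rule power2_add_le)
   then show "norm (?sd n x^2) \<le> 2 * (v (x + w))^2 + 2 * (v x)^2"
    using sq[of "x + w"] sq[of x] by simp
  qed
  show "\<L> (%x. 2 * (v (x + w))^2 + 2 * (v x)^2)"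
   using L2_integrable[OF L2_shift[OF v2, of w]] L2_integrable[OF v2] by auto
 qed auto
 have fy: "(%x. \<sigma> * f x - \<sigma> * y x) \<in> L2" by (intro L2_diff L2_cmult L2)
 have lim2: "(%n. \<integral>x. ?d x * s n (\<sigma> * y x)) ----> (\<integral>x. ?d x * v x)"
 proof (rule integral_dominated_convergence[where w="%x. \<bar>(?d x) * v x\<bar>"])
  show "AE x. (%n. ?d x * s n (\<sigma> * y x)) ----> (?d x) * v x"
   unfolding v_def y_def[symmetric] by (intro AE_I2 tendsto_intros s_lim)
  show "AE x. norm (?d x * s n (\<sigma> * y x)) \<le> \<bar>(?d x) * v x\<bar>" for n
   using s_le[of n] pos_part_bounds(1) by (intro AE_I2) (auto simp: abs_mult v_def y_def abs_of_nonneg intro!: mult_left_mono)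
 qed (use L2_mult[OF fy v2] in auto)
 have "(\<integral>x. (v (x + w) - v x)^2) \<le> (norm w)^2 * (1 / \<mu> * (\<integral>x. ?d x * v x))"
  by (rule LIMSEQ_le[OF lim1 tendsto_mult_left[OF tendsto_mult_left[OF lim2]]]) (use le in blast)
 also have "\<dots> \<le> (norm w)^2 * (1 / \<mu> * (\<integral>x. ?q x / 2))"
 proof (intro mult_left_mono integral_mono)
  show "\<L> (%x. ?d x * v x)" by (rule L2_mult[OF fy v2])
  show "\<L> (%x. ?q x / 2)"
   using L2_integrable[OF v2] L2_integrable[OF F2] by auto
  fix x
  show "?d x * v x \<le> ?q x / 2"
  proof (cases "\<sigma> * y x - \<kappa> > 0")
   case True
   then have vx: "v x = \<sigma> * y x - \<kappa>" "v x > 0" by (simp_all add: v_def y_def pos_part_def)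
   define F where "F = pos_part (\<sigma> * f x - \<kappa>)"
   have "?d x * v x \<le> (F - v x) * v x"
    using vx pos_part_bounds(2)[of "\<sigma> * f x - \<kappa>"] by (intro mult_right_mono) (auto simp: F_def)
   also have "\<dots> \<le> (F^2 - (v x)^2) / 2" using zero_le_power2[of "F - v x"] by (simp add: power2_eq_square algebra_simps)
   finally show ?thesis by (simp add: F_def)
  qed (simp add: v_def y_def pos_part_def)
 qed (use \<mu> in auto)
 also have "(\<integral>x. ?q x / 2) = ((\<integral>x. (pos_part (\<sigma> * f x - \<kappa>))^2) - (\<integral>x. (v x)^2)) / 2"
  using L2_integrable[OF v2] L2_integrable[OF F2] by simp
 finally show ?thesis by (simp add: \<mu>_def mult_ac)
qed

text \<open>The energy lost in one step, divided by \<mu>, is an admissible Q in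
  \<open>nash_decay\<close>; the mass bound A is inherited through
  \<open>J_pos_part\<close>.\<close>

lemma J_step:
 assumes lam: "small lam" and f: "f \<in> L1 \<inter> Linf" and \<kappa>: "0 < \<kappa>0" "\<kappa>0 \<le> \<kappa>" and \<sigma>: "\<sigma> = 1 \<or> \<sigma> = -1"
  and A: "A > 0" "(\<integral>x. pos_part (\<sigma> * f x - \<kappa>)) \<le> A"
 defines "E \<equiv> %y. \<integral>x. (pos_part (\<sigma> * y x - \<kappa>))^2 \<partial>(lborel :: 'a measure)"
 shows "E (J lam f) + 2 * a * \<kappa>0 powr (\<alpha> - 1) * lam * (unit_ball_vol DIM('a) / (2 * A^2)) powr (2 / DIM('a))
   * E (J lam f) powr (1 + 2 / DIM('a)) \<le> E f"
proof -
 define v where "v x = pos_part (\<sigma> * J lam f x - \<kappa>)" for x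
 define \<mu> where "\<mu> = 2 * a * \<kappa>0 powr (\<alpha> - 1) * lam"
 have lam0: "lam > 0" using lam by (simp add: small_def)
 have \<mu>: "\<mu> > 0" using a \<kappa> lam0 by (simp add: \<mu>_def)
 have fL: "f \<in> L1" "f \<in> Linf" using f by auto
 have yL: "J lam f \<in> L1" "J lam f \<in> Linf" using J_L1[OF lam0 fL(1)] J_Linf[OF lam0 f] by auto
 then have y2: "J lam f \<in> L2" using L1_Linf_L2 by blast
 note [measurable] = L2_measurable[OF y2]
 have pl: "0 \<le> pos_part (\<sigma> * r - \<kappa>)" "pos_part (\<sigma> * r - \<kappa>) \<le> \<bar>r\<bar>" for r
  using \<sigma> \<kappa> by (auto simp: pos_part_def)
 have v2: "v \<in> L2" unfolding v_def by (rule L2_dominated[OF y2, of _ 1]) (use pl in auto)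
 have vi: "\<L> v" unfolding v_def
  by (rule integrable_squeeze[of "%x. \<bar>J lam f x\<bar>"]) (use yL pl in \<open>auto simp: L1_def\<close>)
 define Q where "Q = (E f - E (J lam f)) / \<mu>"
 have tr: "(\<integral>x. (v (x + w) - v x)^2) \<le> (norm w)^2 * Q" for w
  using J_energy[OF lam f \<kappa> \<sigma>, of w] by (simp add: v_def Q_def E_def \<mu>_def)
 obtain w :: 'a where w: "w \<in> Basis" using nonempty_Basis by blast
 have "0 \<le> (\<integral>x. (v (x + w) - v x)^2)" by simp
 also have "\<dots> \<le> Q" using tr[of w] norm_Basis[OF w] by simp
 finally have Q: "Q \<ge> 0" .
 have "(\<integral>x. v x) \<le> A" using J_pos_part[OF lam f _ \<sigma>, of \<kappa>] \<kappa> A(2) by (simp add: v_def)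
 from nash_decay[OF vi v2 _ Q tr A(1) this] have
  "E (J lam f) powr (1 + 2 / DIM('a)) * (unit_ball_vol DIM('a) / (2 * A^2)) powr (2 / DIM('a)) \<le> Q"
  using pl(1) by (simp add: v_def E_def)
 then have "\<mu> * (E (J lam f) powr (1 + 2 / DIM('a)) * (unit_ball_vol DIM('a) / (2 * A^2)) powr (2 / DIM('a))) \<le> \<mu> * Q"
  using \<mu> by (intro mult_left_mono) auto
 also have "\<mu> * Q = E f - E (J lam f)" using \<mu> by (simp add: Q_def)
 finally show ?thesis by (simp add: \<mu>_def mult_ac)
qed

text \<open>The level M itself is used, which improves 3M to M; only this sharp form can be iterated
  along the scheme.\<close>

lemma J_bounded:
 assumes lam: "small lam" and f: "f \<in> L1" and M: "M > 0" "AE x. \<bar>f x\<bar> \<le> M"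
 shows "AE x. \<bar>J lam f x\<bar> \<le> M"
proof -
 have lam0: "lam > 0" using lam by (simp add: small_def)
 have fm[measurable]: "f \<in> \<M>" using f by (auto simp: L1_def)
 have fL: "f \<in> L1 \<inter> Linf" using f M(2) by (auto simp: Linf_iff)
 have yi: "\<L> (J lam f)" using J_L1[OF lam0 f] by (simp add: L1_def)
 then have [measurable]: "J lam f \<in> \<M>" by auto
 show ?thesis
 proof (rule AE_abs_le_of_pos_part[OF yi])
  fix \<sigma> :: real assume \<sigma>: "\<sigma> = 1 \<or> \<sigma> = -1"
  have "(\<integral>x. pos_part (\<sigma> * J lam f x - M)) \<le> (\<integral>x. pos_part (\<sigma> * f x - M))"
   by (rule J_pos_part[OF lam fL M(1) \<sigma>])
  also have "\<dots> = (\<integral>x. 0 \<partial>(lborel :: 'a measure))"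
   by (rule integral_cong_AE) (measurable, use M(2) in eventually_elim, use \<sigma> in \<open>auto simp: pos_part_def\<close>)
  finally show "(\<integral>x. pos_part (\<sigma> * J lam f x - M)) \<le> 0" by simp
 qed (use M in simp)
qed

end

section \<open>De Giorgi iteration\<close>


text \<open>The constant \<nu> 2^(-\<nu>-1) of \<open>discrete_power_decay\<close> for the Nash
  exponent \<nu> = 2/d.\<close>

definition decay_exp :: "real => real" where "decay_exp d = (2 / d) * 2 powr (- (2 / d) - 1)"

text \<open>What remains of the decay rate and the Nash constant once A and the elapsed diffusion
  time are split off; see the end of \<open>J_stage\<close>.\<close>

definition nash_const :: "real => real" where
 "nash_const d = 2 / unit_ball_vol d * (2 * decay_exp d) powr (- (d / 2))"

text \<open>The price of one stage of the iteration: halving the increment of the level costs 2 and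
  halving the time costs 2^(d/2). It is also the ratio by which the mass has to shrink.\<close>

definition geo :: "real => real" where "geo d = 2 powr (1 + d / 2)"

lemma pos_part_integral_le:
 fixes q :: "'a::euclidean_space => real"
 assumes "\<L> q" "0 \<le> c" "c \<le> c'" "\<sigma> = 1 \<or> \<sigma> = -1"
 shows "(\<integral>x. pos_part (\<sigma> * q x - c')) \<le> (\<integral>x. pos_part (\<sigma> * q x - c))"
proof (rule integral_mono)
 show "\<L> (%x. pos_part (\<sigma> * q x - c'))" "\<L> (%x. pos_part (\<sigma> * q x - c))"
  using assms by (auto intro!: pos_part_integrable)
qed (use assms in \<open>auto simp: pos_part_def\<close>)

context fpe_resolvents
begin

lemma J_iter:
 assumes lam: "small lam" and q0: "q 0 \<in> L1" and M: "M > 0" "AE x. \<bar>q 0 x\<bar> \<le> M" and q: "!!i. q (Suc i) = J lam (q i)"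
 shows "q i \<in> L1 \<inter> Linf" "AE x. \<bar>q i x\<bar> \<le> M"
proof -
 have lam0: "lam > 0" using lam by (simp add: small_def)
 have "q i \<in> L1 \<and> (AE x. \<bar>q i x\<bar> \<le> M)"
 proof (induction i)
  case (Suc i) then show ?case using J_L1[OF lam0, of "q i"] J_bounded[OF lam, of "q i" M] M(1) by (simp add: q)
 qed (use q0 M in simp)
 then show "q i \<in> L1 \<inter> Linf" "AE x. \<bar>q i x\<bar> \<le> M" by (auto simp: L1_def Linf_iff)
qed

lemma J_iter_pos_part:
 assumes lam: "small lam" and q0: "q 0 \<in> L1" and M: "M > 0" "AE x. \<bar>q 0 x\<bar> \<le> M" and q: "!!i. q (Suc i) = J lam (q i)"
  and \<kappa>: "0 < \<kappa>" and \<sigma>: "\<sigma> = 1 \<or> \<sigma> = -1"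
 shows "(\<integral>x. pos_part (\<sigma> * q (m + i) x - \<kappa>)) \<le> (\<integral>x. pos_part (\<sigma> * q m x - \<kappa>))"
proof (induction i)
 case (Suc i)
 then show ?case using J_pos_part[OF lam J_iter(1)[OF lam q0 M q, where i="m + i"] \<kappa> \<sigma>] by (simp add: q)
qed simp

text \<open>Mass at most A above \<kappa> yields decay of the energy in l steps, and
  \<open>pos_part_level\<close> converts it into mass above \<kappa> + h. The bound is quadratic in
  A, which makes the iteration converge. \<open>tiny\<close> is the smallness condition of
  \<open>discrete_power_decay\<close>, the initial energy being at most M A0; it holds for small
  lam.\<close>

lemma J_stage:
 assumes lam: "small lam" and q0: "q 0 \<in> L1" and M: "M > 0" "AE x. \<bar>q 0 x\<bar> \<le> M" and q: "!!i. q (Suc i) = J lam (q i)"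
  and \<kappa>: "0 < \<kappa>0" "\<kappa>0 \<le> \<kappa>" and \<sigma>: "\<sigma> = 1 \<or> \<sigma> = -1" and h: "h > 0" and l: "l > 0"
  and A: "A > 0" "(\<integral>x. pos_part (\<sigma> * q 0 x - \<kappa>)) \<le> A" "A \<le> A0"
  and tiny: "2 * a * \<kappa>0 powr (\<alpha> - 1) * lam * (unit_ball_vol DIM('a) / (2 * A^2)) powr (2 / DIM('a)) * (M * A0) powr (2 / DIM('a)) \<le> 1"
 shows "(\<integral>x. pos_part (\<sigma> * q l x - (\<kappa> + h))) \<le>
  nash_const DIM('a) * A^2 * (real l * lam * (a * \<kappa>0 powr (\<alpha> - 1))) powr (- (DIM('a) / 2)) / (4 * h)"
proof -
 note qi = J_iter[OF lam q0 M q]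
 have lam0: "lam > 0" using lam by (simp add: small_def)
 define E where "E i = (\<integral>x. (pos_part (\<sigma> * q i x - \<kappa>))^2)" for i
 define d where "d = real DIM('a)"
 define \<omega> where "\<omega> = unit_ball_vol d"
 define \<mu> where "\<mu> = a * \<kappa>0 powr (\<alpha> - 1) * lam"
 define B where "B = \<omega> / (2 * A^2)"
 have d: "d > 0" by (simp add: d_def)
 have pos: "\<omega> > 0" "\<mu> > 0" "B > 0" using d a \<kappa> lam0 A by (auto simp: \<omega>_def \<mu>_def B_def)
 have qL: "q i \<in> L1" "q i \<in> Linf" for i using qi(1)[of i] by auto
 have q2: "q i \<in> L2" for i by (rule L1_Linf_L2[OF qL])
 have q_int: "\<L> (q i)" for i using qL(1)[of i] by (simp add: L1_def)
 have [measurable]: "q i \<in> \<M>" for i using q_int by auto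
 have pi: "\<L> (%x. pos_part (\<sigma> * q i x - \<kappa>))" for i by (rule pos_part_integrable[OF q_int _ \<sigma>]) (use \<kappa> in simp)
 have p2: "(%x. pos_part (\<sigma> * q i x - \<kappa>)) \<in> L2" for i
  by (rule L2_dominated[OF q2[of i], of _ 1]) (use \<sigma> \<kappa> in \<open>auto intro!: AE_I2 simp: pos_part_def\<close>)
 have "E l \<le> (real l * (2 * \<mu> * B powr (2 / d)) * ((2 / d) * 2 powr (- (2 / d) - 1))) powr (- (1 / (2 / d)))"
 proof (rule discrete_power_decay[where X="M * A0"])
  show "0 \<le> E i" for i by (simp add: E_def)
  have "E 0 \<le> (\<integral>x. M * pos_part (\<sigma> * q 0 x - \<kappa>))"
   unfolding E_def
  proof (rule integral_mono_AE)
   show "AE x. (pos_part (\<sigma> * q 0 x - \<kappa>))^2 \<le> M * pos_part (\<sigma> * q 0 x - \<kappa>)"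
    using M(2)
   proof eventually_elim
    case (elim x)
    have "pos_part (\<sigma> * q 0 x - \<kappa>) \<le> M" using elim \<sigma> \<kappa> M by (auto simp: pos_part_def)
    then show ?case using pos_part_bounds(1) by (simp add: power2_eq_square mult_right_mono)
   qed
  qed (use pi[of 0] L2_integrable[OF p2[of 0]] in auto)
  also have "\<dots> \<le> M * A0" using A M by simp
  finally show "E 0 \<le> M * A0" .
  show "2 * \<mu> * B powr (2 / d) * (M * A0) powr (2 / d) \<le> 1" using tiny by (simp add: \<mu>_def B_def \<omega>_def d_def mult_ac)
  show "E (Suc i) + 2 * \<mu> * B powr (2 / d) * E (Suc i) powr (1 + 2 / d) \<le> E i" for i
  proof -
   have "(\<integral>x. pos_part (\<sigma> * q i x - \<kappa>)) \<le> A"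
    using J_iter_pos_part[OF lam q0 M q _ \<sigma>, of \<kappa> 0 i] \<kappa> A(2) by simp
   from J_step[OF lam qi(1)[of i] \<kappa> \<sigma> A(1) this] show ?thesis
    by (simp add: E_def q \<mu>_def B_def \<omega>_def d_def mult_ac)
  qed
 qed (use d pos l in auto)
 also have "real l * (2 * \<mu> * B powr (2 / d)) * ((2 / d) * 2 powr (- (2 / d) - 1)) = (2 * decay_exp d) * (real l * \<mu>) * B powr (2 / d)"
  by (simp add: decay_exp_def mult_ac)
 also have "(\<dots>) powr (- (1 / (2 / d))) = (2 * decay_exp d) powr (- (d / 2)) * (real l * \<mu>) powr (- (d / 2)) * B powr (- 1)"
 proof -
  have "decay_exp d > 0" using d by (simp add: decay_exp_def)
  then show ?thesis using pos d l by (simp add: powr_mult powr_powr)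
 qed
 also have "B powr (- 1) = 2 / \<omega> * A^2" using pos by (simp add: powr_minus_divide B_def)
 finally have E: "E l \<le> nash_const d * A^2 * (real l * \<mu>) powr (- (d / 2))" by (simp add: nash_const_def \<omega>_def mult_ac)
 have "(\<integral>x. pos_part (\<sigma> * q l x - (\<kappa> + h))) \<le> (\<integral>x. (pos_part (\<sigma> * q l x - \<kappa>))^2 / (4 * h))"
 proof (rule integral_mono)
  show "\<L> (%x. pos_part (\<sigma> * q l x - (\<kappa> + h)))" by (rule pos_part_integrable[OF q_int _ \<sigma>]) (use \<kappa> h in simp)
  show "pos_part (\<sigma> * q l x - (\<kappa> + h)) \<le> (pos_part (\<sigma> * q l x - \<kappa>))^2 / (4 * h)" for x
   using pos_part_level[OF h, of "\<sigma> * q l x - \<kappa>"] by (simp add: algebra_simps)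
 qed (use L2_integrable[OF p2] in auto)
 also have "\<dots> = E l / (4 * h)" by (simp add: E_def)
 also have "\<dots> \<le> nash_const d * A^2 * (real l * \<mu>) powr (- (d / 2)) / (4 * h)" using E h by (intro divide_right_mono) auto
 finally show ?thesis by (simp add: d_def \<mu>_def mult_ac)
qed

text \<open>De Giorgi iteration: stage \<open>k < K\<close> raises the level from \<open>\<kappa> (2 - 2\<^sup>-\<^sup>k)\<close> to \<open>\<kappa> (2 - 2\<^sup>-\<^sup>k\<^sup>-\<^sup>1)\<close>
 and takes \<open>2\<^sup>K\<^sup>-\<^sup>k\<^sup>-\<^sup>1 l\<close> resolvent steps.\<close>

lemma J_de_giorgi:
 fixes K l :: nat
 assumes lam: "small lam" and q0: "q 0 \<in> L1" and M: "M > 0" "AE x. \<bar>q 0 x\<bar> \<le> M" and q: "!!i. q (Suc i) = J lam (q i)"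
  and \<kappa>: "0 < \<kappa>" and \<sigma>: "\<sigma> = 1 \<or> \<sigma> = -1" and l: "l > 0" and t: "2 ^ K * real l * lam = t"
  and A0: "A0 > 0" "(\<integral>x. pos_part (\<sigma> * q 0 x - \<kappa>)) \<le> A0"
  and start: "nash_const DIM('a) / (4 * \<kappa>) * (t * (a * \<kappa> powr (\<alpha> - 1))) powr (- (DIM('a) / 2)) * A0 * (geo DIM('a))^2 \<le> 1"
  and tiny: "!!k. k < K ==> 2 * a * \<kappa> powr (\<alpha> - 1) * lam * (unit_ball_vol DIM('a) / (2 * (A0 * (1 / geo DIM('a)) ^ k)^2)) powr (2 / DIM('a))
    * (M * A0) powr (2 / DIM('a)) \<le> 1"
 shows "(\<integral>x. pos_part (\<sigma> * q (2 ^ K * l) x - 2 * \<kappa>)) \<le> A0 * (1 / geo DIM('a)) ^ K"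
proof -
 note qi = J_iter[OF lam q0 M q]
 have qL: "q i \<in> L1" for i using qi(1)[of i] by auto
 have q_int: "\<L> (q i)" for i using qL by (simp add: L1_def)
 have lam0: "lam > 0" using lam by (simp add: small_def)
 define d where "d = real DIM('a)"
 define L where "L = geo d"
 have d: "d > 0" by (simp add: d_def)
 have L: "L \<ge> 1" unfolding L_def geo_def using d by (intro ge_one_powr_ge_zero) auto
 have t0: "t > 0" using t[symmetric] lam0 l by simp
 define \<tau> where "\<tau> = t * (a * \<kappa> powr (\<alpha> - 1))"
 have \<tau>: "\<tau> > 0" using t0 a \<kappa> by (simp add: \<tau>_def)
 define Q where "Q = nash_const d / (4 * \<kappa>) * \<tau> powr (- (d / 2))"
 have start': "Q * A0 * L^2 \<le> 1" using start by (simp add: Q_def \<tau>_def L_def d_def)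
 define lev where "lev k = \<kappa> * (2 - (1 / 2) ^ k)" for k :: nat
 have lev: "\<kappa> \<le> lev k" "lev k \<le> 2 * \<kappa>" for k
 proof -
  have "(1 / 2 :: real) ^ k \<le> 1" "(0::real) \<le> (1 / 2) ^ k" by (simp_all add: power_le_one)
  then show "\<kappa> \<le> lev k" "lev k \<le> 2 * \<kappa>" using \<kappa> mult_left_mono[of 1 "2 - (1/2) ^ k" \<kappa>] by (simp_all add: lev_def algebra_simps)
 qed
 \<comment> \<open>The number of steps completed before stage k: the blocks 2^(K-1) l, 2^(K-2) l,
   ... down to 2^(K-k) l.\<close>
 define N where "N k = (2 ^ K - 2 ^ (K - k)) * l" for k
 have claim: "(\<integral>x. pos_part (\<sigma> * q (N k) x - lev k)) \<le> A0 * (1 / L) ^ k" if "k \<le> K" for k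
  using that
 proof (induction k)
  case 0 then show ?case using A0(2) by (simp add: N_def lev_def)
 next
  case (Suc k)
  then have k: "k < K" by simp
  define m where "m = 2 ^ (K - k - 1) * l"
  have pw: "(2::nat) ^ (K - k) = 2 * 2 ^ (K - k - 1)" using k by (simp flip: power_Suc)
  have NS: "N (Suc k) = N k + m"
  proof -
   have "(2::nat) ^ (K - k) \<le> 2 ^ K" by (intro power_increasing) auto
   then have "2 ^ K - 2 ^ (K - Suc k) = (2 ^ K - 2 ^ (K - k)) + (2::nat) ^ (K - k - 1)" using pw by simp
   then show ?thesis by (simp only: N_def m_def add_mult_distrib)
  qed
  define h where "h = \<kappa> * (1 / 2) ^ Suc k"
  have h: "h > 0" "lev (Suc k) = lev k + h" using \<kappa> by (simp_all add: h_def lev_def algebra_simps)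
  define A where "A = A0 * (1 / L) ^ k"
  have A: "A > 0" "A \<le> A0" using A0 L by (simp_all add: A_def power_le_one mult_left_le)
  have "(\<integral>x. pos_part (\<sigma> * q (N k + m) x - (lev k + h))) \<le>
    nash_const DIM('a) * A^2 * (real m * lam * (a * \<kappa> powr (\<alpha> - 1))) powr (- (DIM('a) / 2)) / (4 * h)"
  proof (rule J_stage[OF lam _ M(1) _ _ \<kappa> lev(1) \<sigma> h(1) _ A(1) _ A(2), where q="%i. q (N k + i)"])
   show "(\<integral>x. pos_part (\<sigma> * q (N k + 0) x - lev k)) \<le> A" using Suc by (simp add: A_def)
   show "2 * a * \<kappa> powr (\<alpha> - 1) * lam * (unit_ball_vol DIM('a) / (2 * A^2)) powr (2 / DIM('a)) * (M * A0) powr (2 / DIM('a)) \<le> 1"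
    using tiny[OF k] by (simp add: A_def L_def d_def)
  qed (use qL qi(2) l q in \<open>auto simp: m_def\<close>)
  also have "real m * lam * (a * \<kappa> powr (\<alpha> - 1)) = \<tau> * (1 / 2) ^ Suc k"
  proof -
   have "real m = 2 ^ (K - k - 1) * real l" by (simp add: m_def)
   also have "(2::real) ^ (K - k - 1) = 2 ^ K * (1 / 2) ^ Suc k"
   proof -
    have "K = K - k - 1 + Suc k" using k by simp
    then have "(2::real) ^ K = 2 ^ (K - k - 1) * 2 ^ Suc k" by (metis power_add)
    then show ?thesis by (simp add: power_divide)
   qed
   finally show ?thesis using t[symmetric] by (simp add: \<tau>_def mult_ac)
  qed
  also have "(\<tau> * (1 / 2) ^ Suc k) powr (- (DIM('a) / 2)) = \<tau> powr (- (d / 2)) * (2 powr (d / 2)) ^ Suc k"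
  proof -
   have "((1 / 2) ^ n) powr (- (d / 2)) = (((1 / 2) powr (- (d / 2))) ^ n :: real)" for n
    by (simp add: powr_realpow[symmetric] powr_powr mult.commute)
   moreover have "(1 / 2) powr (- (d / 2)) = (2 powr (d / 2) :: real)" by (simp add: powr_minus_divide powr_divide)
   ultimately show ?thesis using \<tau> by (simp only: powr_mult d_def)
  qed
  also have "nash_const DIM('a) * A^2 * (\<tau> powr (- (d / 2)) * (2 powr (d / 2)) ^ Suc k) / (4 * h) = Q * L ^ Suc k * A^2"
  proof -
   have Lk: "L ^ Suc k = 2 ^ Suc k * (2 powr (d / 2)) ^ Suc k"
    unfolding L_def geo_def powr_add power_mult_distrib by simp
   show ?thesis unfolding Lk Q_def h_def d_def power_divide using \<kappa> by (simp add: field_simps)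
  qed
  \<comment> \<open>With A = A0 L^(-k), the quantity Q L^(k+1) A^2 is Q A0 L^2 times the target A0
    L^(-k-1); this explains the factor \<open>geo\<close> squared in \<open>start\<close>.\<close>
  also have "\<dots> = (Q * A0 * L^2) * (A0 * (1 / L) ^ Suc k)"
   using L by (simp add: A_def power_divide power_mult_distrib field_simps power2_eq_square)
  also have "\<dots> \<le> 1 * (A0 * (1 / L) ^ Suc k)" using start' A0 L by (intro mult_right_mono) auto
  finally show ?case by (simp add: NS h(2))
 qed
 \<comment> \<open>The dyadic blocks add up to (2^K - 1) l; the remaining l steps do not increase
   the mass above a level.\<close>
 have "N K + l = 2 ^ K * l" by (simp add: N_def flip: add_mult_distrib) (simp add: algebra_simps)
 then have "(\<integral>x. pos_part (\<sigma> * q (2 ^ K * l) x - 2 * \<kappa>)) \<le> (\<integral>x. pos_part (\<sigma> * q (N K) x - 2 * \<kappa>))"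
  using J_iter_pos_part[OF lam q0 M q _ \<sigma>, of "2 * \<kappa>" "N K" l] \<kappa> by simp
 also have "\<dots> \<le> (\<integral>x. pos_part (\<sigma> * q (N K) x - lev K))"
  by (rule pos_part_integral_le[OF q_int _ lev(2) \<sigma>]) (use lev(1)[of K] \<kappa> in simp)
 also have "\<dots> \<le> A0 * (1 / L) ^ K" by (rule claim) simp
 finally show ?thesis by (simp add: L_def d_def)
qed

end

section \<open>The generalized solution\<close>


context fpe_resolvents
begin

text \<open>The iteration needs a bounded datum, so u0 is truncated at m, at the cost of its L^1
  distance to the truncation, which the scheme does not amplify. The number of stages is also m;
  with m fixed, the finitely many conditions \<open>tiny\<close> hold once the step is small, and
  the step then tends to 0.\<close>

lemma generalized_solution_level:
 assumes d3: "DIM('a) \<ge> 3" and u0: "u0 \<in> L1" and sol: "generalized_solution \<beta> D b J u0 u" and t: "t > 0"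
  and \<kappa>: "\<kappa> > 0" and A0: "A0 > 0" "(\<integral>x. \<bar>u0 x\<bar>) \<le> A0" and \<sigma>: "\<sigma> = 1 \<or> \<sigma> = -1"
  and start: "nash_const DIM('a) / (4 * \<kappa>) * (t * (a * \<kappa> powr (\<alpha> - 1))) powr (- (DIM('a) / 2)) * A0 * (geo DIM('a))^2 \<le> 1"
 shows "(\<integral>x. pos_part (\<sigma> * u t x - 2 * \<kappa>)) \<le> (\<integral>x. \<bar>truncate u0 m x - u0 x\<bar>) + A0 * (1 / geo DIM('a)) ^ m"
proof -
 obtain v where v: "!!n t. n \<ge> 1 ==> t > 0 ==> (u0, v n t) \<in> resolvent_graph (A_graph \<beta> D b J) (t / real n) ^^ n"
  "!!T. T > 0 ==> uniform_limit {0<..T} (%n t. L1_norm (%x. v n t x - u t x)) (%_. 0) sequentially"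
  using sol unfolding generalized_solution_def by blast
 have uL: "\<L> (u t)" "\<L> u0" using sol t u0 by (simp_all add: generalized_solution_def L1_def)
 have vl: "(%n. L1_norm (%x. v n t x - u t x)) ----> 0"
  using tendsto_uniform_limitI[OF v(2)[OF t], of t] t by simp
 define q0 where "q0 = truncate u0 m"
 have q0L: "q0 \<in> L1" using truncate_mem[OF u0, of m] by (simp add: q0_def)
 then have q0i: "\<L> q0" by (simp add: L1_def)
 define M where "M = real m + 1"
 let ?P = "\<integral>x. pos_part (\<sigma> * u t x - 2 * \<kappa>)"
 let ?A = "A0 * (1 / geo DIM('a)) ^ m"
 let ?I = "\<integral>x. \<bar>q0 x - u0 x\<bar>"
 let ?I1 = "\<integral>x. \<bar>u0 x - q0 x\<bar>"
 have "\<bar>q0 x\<bar> \<le> M" for x using truncate_abs_le(2)[of u0 m x] by (simp add: q0_def M_def)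
 then have M: "M > 0" "AE x. \<bar>q0 x\<bar> \<le> M" by (simp_all add: M_def)
 have "(\<integral>x. pos_part (\<sigma> * q0 x - \<kappa>)) \<le> (\<integral>x. \<bar>u0 x\<bar>)"
 proof (rule integral_mono)
  show "\<L> (%x. pos_part (\<sigma> * q0 x - \<kappa>))" by (rule pos_part_integrable[OF q0i _ \<sigma>]) (use \<kappa> in simp)
  show "pos_part (\<sigma> * q0 x - \<kappa>) \<le> \<bar>u0 x\<bar>" for x
   using truncate_abs_le(1)[of u0 m x] \<sigma> \<kappa> by (auto simp: q0_def pos_part_def)
 qed (use uL in auto)
 then have A: "(\<integral>x. pos_part (\<sigma> * q0 x - \<kappa>)) \<le> A0" using A0 by linarith
 \<comment> \<open>Multiples of 2^m, so that the steps up to time t split into m dyadic stages with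
   base length i + 1.\<close>
 define n where "n i = 2 ^ m * Suc i" for i
 let ?N = "%i. L1_norm (%x. v (n i) t x - u t x)"
 define lam where "lam i = t / real (n i)" for i
 have "n i > 0" for i by (simp add: n_def)
 then have n: "n i \<ge> 1" "real (n i) > 0" for i by (simp_all add: Suc_le_eq)
 have lam_pos: "lam i > 0" for i using t n by (simp add: lam_def)
 have lam_lim: "lam ----> 0"
 proof (rule Lim_null_comparison)
  show "\<forall>\<^sub>F i in sequentially. norm (lam i) \<le> t * inverse (real (Suc i))"
  proof (intro always_eventually allI)
   fix i
   have "1 * Suc i \<le> n i" unfolding n_def by (intro mult_right_mono) auto
   then have "real (Suc i) \<le> real (n i)" by (simp only: mult_1 of_nat_le_iff)
   then show "norm (lam i) \<le> t * inverse (real (Suc i))"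
    using t n[of i] by (simp add: lam_def divide_inverse le_imp_inverse_le del: of_nat_Suc)
  qed
  show "(%i. t * inverse (real (Suc i))) ----> 0" using tendsto_mult_right_zero[OF LIMSEQ_inverse_real_of_nat] .
 qed
 have ev: "\<forall>\<^sub>F i in sequentially. c * lam i < r" if "r > 0" for c r :: real
  by (rule order_tendstoD(2)[OF tendsto_mult_right_zero[OF lam_lim] that])
 have ev1: "\<forall>\<^sub>F i in sequentially. small (lam i)"
 proof -
  have "\<forall>\<^sub>F i in sequentially. m0 * b0 * lam i < 1 / 2" by (rule ev) simp
  then show ?thesis by eventually_elim (use lam_pos in \<open>simp add: small_def mult_ac\<close>)
 qed
 define c where "c k = 2 * a * \<kappa> powr (\<alpha> - 1) * (unit_ball_vol DIM('a) / (2 * (A0 * (1 / geo DIM('a)) ^ k)^2)) powr (2 / DIM('a))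
    * (M * A0) powr (2 / DIM('a))" for k
 have ev2: "\<forall>\<^sub>F i in sequentially. \<forall>k\<in>{..<m}. c k * lam i < 1"
  by (rule eventually_ball_finite) (use ev in auto)
 have main: "?P \<le>
   ?N i + (?I + ?A)"
  if i: "small (lam i)" "!!k. k < m ==> c k * lam i < 1" for i
 proof -
  define q where "q j = (J (lam i) ^^ j) q0" for j
  have q: "q (Suc j) = J (lam i) (q j)" "q 0 = q0" for j by (simp_all add: q_def)
  have q00: "q 0 \<in> L1" "AE x. \<bar>q 0 x\<bar> \<le> M" using q0L M(2) by (simp_all add: q(2))
  have qi: "q j \<in> L1" for j using J_iter(1)[OF i(1) q00(1) M(1) q00(2) q(1), of j] by auto
  have dg: "(\<integral>x. pos_part (\<sigma> * q (2 ^ m * Suc i) x - 2 * \<kappa>)) \<le> ?A"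
  proof (rule J_de_giorgi[OF i(1) q00(1) M(1) q00(2) q(1) \<kappa> \<sigma> _ _ A0(1) _ start])
   have "2 ^ m * real (Suc i) = real (n i)" by (simp only: n_def of_nat_mult of_nat_power of_nat_numeral)
   then show "2 ^ m * real (Suc i) * lam i = t" using n(2)[of i] by (simp add: lam_def)
   show "(\<integral>x. pos_part (\<sigma> * q 0 x - \<kappa>)) \<le> A0" using A by (simp add: q(2))
   show "2 * a * \<kappa> powr (\<alpha> - 1) * lam i * (unit_ball_vol DIM('a) / (2 * (A0 * (1 / geo DIM('a)) ^ k)^2)) powr (2 / DIM('a))
    * (M * A0) powr (2 / DIM('a)) \<le> 1" if "k < m" for k
    using i(2)[OF that] by (simp add: c_def mult_ac)
  qed simp
  obtain f where f: "f 0 = u0" "f (n i) = v (n i) t" "!!j. j < n i ==> (f j, f (Suc j)) \<in> resolvent_graph (A_graph \<beta> D b J) (lam i)"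
   using v(1)[OF n(1) t, of i] unfolding relpow_fun_conv lam_def by blast
  \<comment> \<open>The scheme of A from u0 and the scheme of J from the truncated datum stay within
    their initial L^1 distance; each step of the former is a step of J up to an a.e. change of its
    argument.\<close>
  have chain: "\<L> (f j) \<and> (\<integral>x. \<bar>f j x - q j x\<bar>) \<le> ?I1" if "j \<le> n i" for j
   using that
  proof (induction j)
   case 0 then show ?case using uL by (simp add: f(1) q(2))
  next
   case (Suc j)
   then have IH: "\<L> (f j)" "(\<integral>x. \<bar>f j x - q j x\<bar>) \<le> ?I1" by auto
   have r: "(f j, f (Suc j)) \<in> resolvent_graph (A_graph \<beta> D b J) (lam i)" using f(3) Suc by simp
   obtain g where g: "g \<in> L1" "AE x. f (Suc j) x = J (lam i) g x" "AE x. g x = f j x"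
    by (rule resolvent_graph_J[OF d3 i(1) r]) blast
   have fi: "\<L> (f (Suc j))" using r by (auto simp: resolvent_graph_def A_graph_def A0_graph_def L1_def)
   have gi: "\<L> g" "\<L> (q j)" "\<L> (J (lam i) g)" "\<L> (q (Suc j))"
    using g(1) qi[of j] qi[of "Suc j"] J_L1[OF lam_pos g(1)] by (auto simp: L1_def)
   have [measurable]: "f j \<in> \<M>" "f (Suc j) \<in> \<M>" "g \<in> \<M>" "q j \<in> \<M>"
    "J (lam i) g \<in> \<M>" "q (Suc j) \<in> \<M>" using IH(1) fi gi by auto
   have "(\<integral>x. \<bar>f (Suc j) x - q (Suc j) x\<bar>) = (\<integral>x. \<bar>J (lam i) g x - q (Suc j) x\<bar>)"
    by (rule integral_cong_AE) (use g(2) in auto)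
   also have "\<dots> \<le> (\<integral>x. \<bar>g x - q j x\<bar>)" unfolding q(1) by (rule J_contraction[OF i(1) g(1) qi])
   also have "\<dots> = (\<integral>x. \<bar>f j x - q j x\<bar>)" by (rule integral_cong_AE) (use g(3) in auto)
   finally show ?case using IH(2) fi by simp
  qed
  define N where "N = n i"
  have vi: "\<L> (v N t)" "(\<integral>x. \<bar>v N t x - q N x\<bar>) \<le> ?I1"
   using chain[of "n i"] by (simp_all add: f(2) N_def)
  have qN: "\<L> (q N)" using qi by (simp add: L1_def)
  have pi: "\<L> (%x. pos_part (\<sigma> * h x - 2 * \<kappa>))" if "\<L> h" for h :: "'a => real"
   by (rule pos_part_integrable[OF that _ \<sigma>]) (use \<kappa> in simp)
  have "?P \<le>
    (\<integral>x. \<bar>v N t x - u t x\<bar> + \<bar>v N t x - q N x\<bar> + pos_part (\<sigma> * q N x - 2 * \<kappa>))"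
  proof (rule integral_mono)
   fix x
   have "\<bar>(\<sigma> * u t x - 2 * \<kappa>) - (\<sigma> * q N x - 2 * \<kappa>)\<bar> \<le> \<bar>v N t x - u t x\<bar> + \<bar>v N t x - q N x\<bar>"
    using \<sigma> by auto
   then show "pos_part (\<sigma> * u t x - 2 * \<kappa>) \<le> \<bar>v N t x - u t x\<bar> + \<bar>v N t x - q N x\<bar> + pos_part (\<sigma> * q N x - 2 * \<kappa>)"
    using pos_part_diff_le[of "\<sigma> * u t x - 2 * \<kappa>" "\<sigma> * q N x - 2 * \<kappa>"] by linarith
  qed (use pi uL vi qN in auto)
  also have "\<dots> = L1_norm (%x. v N t x - u t x) + (\<integral>x. \<bar>v N t x - q N x\<bar>) + (\<integral>x. pos_part (\<sigma> * q N x - 2 * \<kappa>))"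
   using pi uL vi qN by (simp add: L1_norm_def)
  also have "\<dots> \<le> L1_norm (%x. v N t x - u t x) + ?I1 + ?A"
   using vi(2) dg by (simp add: N_def n_def)
  finally show ?thesis by (simp add: N_def abs_minus_commute)
 qed
 have "(%i. ?N i) ----> 0"
 proof -
  have "strict_mono n" by (simp add: strict_mono_def n_def)
  from LIMSEQ_subseq_LIMSEQ[OF vl this] show ?thesis by (simp add: o_def)
 qed
 from tendsto_add[OF this tendsto_const]
 have lim: "(%i. ?N i + (?I + ?A)) ---->
  ?I + ?A" by simp
 have "\<forall>\<^sub>F i in sequentially. ?P \<le>
   ?N i + (?I + ?A)"
  using ev1 ev2 by eventually_elim (rule main, auto)
 from tendsto_lowerbound[OF lim this] show ?thesis by (simp add: q0_def)
qed

text \<open>As m grows, both the truncation error and the remaining mass tend to 0, since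
  \<open>geo\<close> is greater than 1.\<close>

lemma generalized_solution_bounded:
 assumes d3: "DIM('a) \<ge> 3" and u0: "u0 \<in> L1" and sol: "generalized_solution \<beta> D b J u0 u" and t: "t > 0"
  and \<kappa>: "\<kappa> > 0" and A0: "A0 > 0" "(\<integral>x. \<bar>u0 x\<bar>) \<le> A0"
  and start: "nash_const DIM('a) / (4 * \<kappa>) * (t * (a * \<kappa> powr (\<alpha> - 1))) powr (- (DIM('a) / 2)) * A0 * (geo DIM('a))^2 \<le> 1"
 shows "AE x. \<bar>u t x\<bar> \<le> 2 * \<kappa>"
proof -
 have ui: "\<L> (u t)" using sol t by (simp add: generalized_solution_def L1_def)
 have g: "1 / geo DIM('a) \<ge> 0" "1 / geo DIM('a) < 1"
  using powr_less_mono[of 0 "1 + DIM('a) / 2" 2] by (simp_all add: geo_def)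
 have lim: "(%m. (\<integral>x. \<bar>truncate u0 m x - u0 x\<bar>) + A0 * (1 / geo DIM('a)) ^ m) ----> 0 + A0 * 0"
  by (intro tendsto_intros truncate_L1_lim[OF u0] LIMSEQ_realpow_zero g)
 have "(\<integral>x. pos_part (\<sigma> * u t x - 2 * \<kappa>)) \<le> 0 + A0 * 0" if "\<sigma> = 1 \<or> \<sigma> = -1" for \<sigma>
  by (rule LIMSEQ_le_const[OF lim]) (use generalized_solution_level[OF d3 u0 sol t \<kappa> A0 that start] in blast)
 then show ?thesis using \<kappa> by (intro AE_abs_le_of_pos_part[OF ui]) auto
qed

text \<open>The level \<kappa> is chosen so that \<open>start\<close> holds with equality. It enters
  \<open>start\<close> with the total power -(1 + (\<alpha>-1) d/2) = -1/p, so \<kappa> is the p-th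
  power of K A0 t^(-d/2), which yields both exponents and the constant C.\<close>

lemma generalized_solution_decay:
 defines "d \<equiv> real DIM('a)"
 defines "p \<equiv> 2 / (2 + d * (\<alpha> - 1))"
 defines "C \<equiv> 2 * (nash_const d / 4 * a powr (- (d / 2)) * (geo d)^2) powr p"
 assumes d3: "DIM('a) \<ge> 3" and u0: "u0 \<in> L1" and sol: "generalized_solution \<beta> D b J u0 u" and t: "t > 0"
 shows "AE x. \<bar>u t x\<bar> \<le> C * t powr (- d / (2 + (\<alpha> - 1) * d)) * L1_norm u0 powr p"
proof -
 define K where "K = nash_const d / 4 * a powr (- (d / 2)) * (geo d)^2"
 have d: "d > 0" using d3 by (simp add: d_def)
 have pos: "2 + d * (\<alpha> - 1) > 0" using d \<alpha> by (simp add: add_pos_nonneg)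
 have K: "K > 0" using d a by (simp add: K_def nash_const_def geo_def decay_exp_def)
 have CK: "C = 2 * K powr p" by (simp only: C_def K_def)
 have p: "p > 0" using pos by (simp add: p_def)
 have bound: "AE x. \<bar>u t x\<bar> \<le> C * t powr (- d / (2 + (\<alpha> - 1) * d)) * A0 powr p" if A0: "A0 > 0" "L1_norm u0 \<le> A0" for A0
 proof -
  define Y where "Y = K * A0 * t powr (- (d / 2))"
  have Y: "Y > 0" using K A0 t by (simp add: Y_def)
  define \<kappa> where "\<kappa> = Y powr p"
  have \<kappa>: "\<kappa> > 0" using Y by (simp add: \<kappa>_def)
  have "(t * (a * \<kappa> powr (\<alpha> - 1))) powr (- (d / 2)) = t powr (- (d / 2)) * (a powr (- (d / 2)) * \<kappa> powr (- ((\<alpha> - 1) * (d / 2))))"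
   using t a \<kappa> by (simp add: powr_mult powr_powr)
  then have "nash_const d / (4 * \<kappa>) * (t * (a * \<kappa> powr (\<alpha> - 1))) powr (- (d / 2)) * A0 * (geo d)^2
   = Y * (\<kappa> powr (- ((\<alpha> - 1) * (d / 2))) * \<kappa> powr (- 1))"
   using \<kappa> by (simp add: Y_def K_def powr_minus_divide mult_ac)
  also have "\<kappa> powr (- ((\<alpha> - 1) * (d / 2))) * \<kappa> powr (- 1) = \<kappa> powr (- (1 / p))"
  proof -
   have "- ((\<alpha> - 1) * (d / 2)) + - 1 = - (1 / p)" by (simp add: p_def field_simps)
   then show ?thesis unfolding powr_add[symmetric] by simp
  qed
  also have "\<dots> = Y powr (- 1)" using p by (simp add: \<kappa>_def powr_powr)
  also have "Y * Y powr (- 1) = 1" using Y by (simp add: powr_minus_divide)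
  finally have "AE x. \<bar>u t x\<bar> \<le> 2 * \<kappa>"
   using A0 by (intro generalized_solution_bounded[OF d3 u0 sol t \<kappa> A0(1)]) (simp_all add: L1_norm_def d_def)
  moreover have "2 * \<kappa> = C * t powr (- d / (2 + (\<alpha> - 1) * d)) * A0 powr p"
  proof -
   have "(t powr (- (d / 2))) powr p = t powr (- d / (2 + (\<alpha> - 1) * d))"
   proof -
    have "- (d / 2) * p = - d / (2 + (\<alpha> - 1) * d)" by (simp add: p_def mult.commute)
    then show ?thesis by (simp only: powr_powr)
   qed
   then show ?thesis using K A0 t by (simp add: \<kappa>_def Y_def CK powr_mult)
  qed
  ultimately show ?thesis by simp
 qed
 have N0: "L1_norm u0 \<ge> 0" by (simp add: L1_norm_def)
 \<comment> \<open>The iteration needs a positive mass bound A0; taking the norm plus 1/(n+1) and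
   letting n grow includes the datum 0.\<close>
 have "AE x. \<forall>n. \<bar>u t x\<bar> \<le> C * t powr (- d / (2 + (\<alpha> - 1) * d)) * (L1_norm u0 + inverse (real (Suc n))) powr p"
  unfolding AE_all_countable by (intro allI bound) (use N0 in \<open>auto intro: add_nonneg_pos\<close>)
 then show ?thesis
 proof eventually_elim
  case (elim x)
  have "(%n. (L1_norm u0 + inverse (real (Suc n))) powr p) ----> (L1_norm u0 + 0) powr p"
  proof (rule tendsto_powr2)
   show "(%n. L1_norm u0 + inverse (real (Suc n))) ----> L1_norm u0 + 0" by (intro tendsto_intros LIMSEQ_inverse_real_of_nat)
   show "\<forall>\<^sub>F n in sequentially. 0 \<le> L1_norm u0 + inverse (real (Suc n))" using N0 by simp
  qed (use p in auto)
  from tendsto_mult_left[OF this, of "C * t powr (- d / (2 + (\<alpha> - 1) * d))"]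
  have "\<bar>u t x\<bar> \<le> C * t powr (- d / (2 + (\<alpha> - 1) * d)) * (L1_norm u0 + 0) powr p"
   by (rule LIMSEQ_le_const) (use elim in blast)
  then show ?case by simp
 qed
qed

end

theorem theorem4p1:
  fixes \<beta> b \<rho> :: "real \<Rightarrow> real"
    and a \<alpha> :: real
    and D :: "real ^ 'd \<Rightarrow> real ^ 'd"
    and divD :: "real ^ 'd \<Rightarrow> real"
    and \<eta> :: "real \<Rightarrow> real ^ 'd \<Rightarrow> real"
    and U :: "real \<Rightarrow> real \<Rightarrow> (real ^ 'd \<Rightarrow> real) \<Rightarrow> real ^ 'd \<Rightarrow> real"
    and e :: "nat \<Rightarrow> real"
    and J :: "real \<Rightarrow> (real ^ 'd \<Rightarrow> real) \<Rightarrow> real ^ 'd \<Rightarrow> real"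
  assumes dim: "CARD('d) \<ge> 3"
    and k: "C_k 2 \<beta>" "\<beta> 0 = 0" "\<alpha> \<ge> 1" "a > 0"
      "\<And>r. deriv \<beta> r \<ge> a * \<bar>r\<bar> powr (\<alpha> - 1)"
    and kk: "D \<in> borel_measurable lborel" "(\<lambda>x. norm (D x)) \<in> Linf"
      "has_weak_div D divD" "divD \<in> L2_plus_Linf" "AE x in lborel. divD x \<ge> 0"
    and kkk: "bounded (range b)" "C_k 1 b" "\<And>r. b r \<ge> 0"
    and approximation: "cutoff_family \<eta>" "standard_mollifier \<rho>"
      "approx_resolvents \<beta> D b \<eta> \<rho> U"
    and resolvents: "limit_resolvents U e J"
  shows "\<exists>C::real. \<forall>u0\<in>L1. \<forall>u. generalized_solution \<beta> D b J u0 u \<longrightarrow>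
    (\<forall>t>0. u t \<in> Linf \<and>
       Linf_norm (u t) \<le> ereal
         (C * t powr (- real CARD('d) / (2 + (\<alpha> - 1) * real CARD('d)))
            * L1_norm u0 powr (2 / (2 + real CARD('d) * (\<alpha> - 1)))))"
proof -
 interpret fpe_resolvents \<beta> b \<rho> a \<alpha> D divD \<eta> U e J
  by standard (fact k kk kkk approximation resolvents)+
 have d3: "DIM(real ^ 'd) \<ge> 3" using dim by simp
 show ?thesis
 proof (intro exI ballI allI impI)
  fix u0 u and t :: real
  assume u0: "u0 \<in> L1" and sol: "generalized_solution \<beta> D b J u0 u" and t: "0 < t"
  have "\<L> (u t)" using sol t by (simp add: generalized_solution_def L1_def)
  then have "u t \<in> \<M>" by auto
  with generalized_solution_decay[OF d3 u0 sol t] show "u t \<in> Linf \<and> Linf_norm (u t) \<le> ereal (2 * (nash_const CARD('d) / 4 * a powr (- (CARD('d) / 2)) * (geo CARD('d))^2) powr (2 / (2 + CARD('d) * (\<alpha> - 1)))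
    * t powr (- real CARD('d) / (2 + (\<alpha> - 1) * real CARD('d))) * L1_norm u0 powr (2 / (2 + real CARD('d) * (\<alpha> - 1))))"
   by (auto simp: Linf_iff intro!: Linf_norm_le)
 qed
qed

end
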